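(* Suppose that the mesh $\mathcal T_h$ satisfies the local symmetry condition: for all interior vertices $z\in\mathcal N_h$, $$\frac1{|\Delta_z^1|}\sum_{T\in\mathcal T_z^1}|T|\,s_T=z,\qquad s_T=\frac1{n+1}\sum_{v\in\mathcal V_T}v.$$ Let $\mathcal C_hv=\sum_{z\in\mathcal N_h\cup\mathcal N_h^\partial}v_z\varphi_z$ with $$v_z=\frac1{\int_{\Delta_z^1}\varphi_z\,dx}\int_{\Delta_z^1}v\varphi_z\,dx\ \text{ if }z\in\mathcal N_h,\qquad v_z=(\mathcal{SZ}_hv)(z)\ \text{ if }z\in\mathcal N_h^\partial.$$ Then for any $T\in\mathcal T_h$ and $0\le s\le1$, $$\|w-\mathcal C_hw\|_{L^2(T)}+h_T\|\nabla(w-\mathcal C_hw)\|_{L^2(T)}\lesssim h_T^{1+s}|w|_{H^{1+s}(\Delta_T)}\quad\text{for all }w\in H^{1+s}(\Delta_T),$$ where $\Delta_T=\bigcup_{z\in\mathcal V_T}\Delta_z^1$.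
   Context: $\Omega\subset\mathbb R^n$ ($n\in\{1,2,3\}$) is an open bounded polygonal/polyhedral domain. $\mathcal T_h$ is a conforming affine simplicial mesh of $\Omega$ with closed elements, $h_T=\operatorname{diam}T$, shape-regular: $h_T/\rho_T\le\sigma$ with $\sigma$ independent of $h$ ($\rho_T$ the radius of the ball inscribed in $T$). $\mathcal N_h$ and $\mathcal N_h^\partial$ are the sets of interior and boundary vertices, $\varphi_z$ the piecewise affine nodal basis function at $z$, $\mathcal V_T$ the vertices of $T$. For a vertex $z$: $\mathcal T_z^1=\{T\in\mathcal T_h:z\in T\}$ and $\Delta_z^1=\operatorname{int}\bigcup_{T\in\mathcal T_z^1}T$. $\mathcal{SZ}_h$ is the Scott–Zhang interpolant: $\mathcal{SZ}_hv=\sum_z\big(\int_{\sigma_z}\theta_zv\,ds\big)\varphi_z$, where for each vertex $z$ a mesh face $\sigma_z\ni z$ of dimension $n-1$ is chosen, with $\sigma_z\subset\partial\Omega$ if $z\in\partial\Omega$, and $\theta_z\in\mathbb P_1(\sigma_z)$ satisfies $\int_{\sigma_z}\theta_z\varphi_{z'}\,ds=\delta_{z,z'}$ for all vertices $z'$ of $\sigma_z$. $a\lesssim b$ means $a\le cb$ with $c$ independent of $h$.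
   Formalization: The polygonal/polyhedral domain Ω is additionally assumed locally connected at every boundary point (no pinching, no slits), which holds for all Lipschitz polyhedral domains; for a domain pinched at a vertex z the estimate fails when σ_z lies on the other side of z from T. *)

theory Defs
  imports "HOL-Analysis.Analysis"
begin

section \<open>Sobolev spaces\<close>

primrec Ck :: "nat \<Rightarrow> ('a::euclidean_space \<Rightarrow> real) \<Rightarrow> bool" where
  "Ck 0 f \<longleftrightarrow> continuous_on UNIV f"
| "Ck (Suc k) f \<longleftrightarrow> (\<forall>x. f differentiable (at x)) \<and>
     (\<forall>b\<in>Basis. Ck k (\<lambda>x. frechet_derivative f (at x) b))"

definition test_function :: "'a::euclidean_space set \<Rightarrow> ('a \<Rightarrow> real) \<Rightarrow> bool" where
  "test_function D \<eta> \<longleftrightarrow> (\<forall>k. Ck k \<eta>) \<and> (\<exists>K. compact K \<and> K \<subseteq> D \<and> (\<forall>x. x \<notin> K \<longrightarrow> \<eta> x = 0))"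

definition square_integrable :: "'a measure \<Rightarrow> ('a \<Rightarrow> real) \<Rightarrow> bool" where
  "square_integrable M u \<longleftrightarrow> u \<in> borel_measurable M \<and> integrable M (\<lambda>x. (u x)\<^sup>2)"

definition l2_norm :: "'a measure \<Rightarrow> ('a \<Rightarrow> real) \<Rightarrow> real" where
  "l2_norm M u = sqrt (LINT x|M. (u x)\<^sup>2)"

definition locally_integrable :: "'a::euclidean_space set \<Rightarrow> ('a \<Rightarrow> real) \<Rightarrow> bool" where
  "locally_integrable D u \<longleftrightarrow> (\<forall>K. compact K \<and> K \<subseteq> D \<longrightarrow> integrable (lebesgue_on K) u)"

definition has_weak_partial ::
  "'a::euclidean_space set \<Rightarrow> 'a \<Rightarrow> ('a \<Rightarrow> real) \<Rightarrow> ('a \<Rightarrow> real) \<Rightarrow> bool" where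
  "has_weak_partial D b u g \<longleftrightarrow> locally_integrable D u \<and> locally_integrable D g \<and>
     (\<forall>\<eta>. test_function D \<eta> \<longrightarrow>
        (LINT x|lebesgue_on D. u x * frechet_derivative \<eta> (at x) b)
          = - (LINT x|lebesgue_on D. g x * \<eta> x))"

text \<open>Unique up to a null set whenever it exists (for open \<open>D\<close>).\<close>

definition weak_partial :: "'a::euclidean_space set \<Rightarrow> 'a \<Rightarrow> ('a \<Rightarrow> real) \<Rightarrow> 'a \<Rightarrow> real" where
  "weak_partial D b u = (SOME g. has_weak_partial D b u g)"

definition h1_seminorm :: "'a::euclidean_space set \<Rightarrow> ('a \<Rightarrow> real) \<Rightarrow> real" where
  "h1_seminorm D u = sqrt (\<Sum>b\<in>Basis. (l2_norm (lebesgue_on D) (weak_partial D b u))\<^sup>2)"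

definition gagliardo :: "real \<Rightarrow> ('a::euclidean_space \<Rightarrow> real) \<Rightarrow> 'a \<times> 'a \<Rightarrow> real" where
  "gagliardo s u = (\<lambda>(x, y). (u x - u y)\<^sup>2 / norm (x - y) powr (real DIM('a) + 2 * s))"

text \<open>The spaces \<open>H\<^sup>s(D)\<close> and \<open>H\<^bsup>1+s\<^esup>(D)\<close> with their seminorms. The parameter is meant to
  range over \<open>0 \<le> s \<le> 1\<close>: \<open>s = 0\<close> is \<open>L\<^sup>2\<close>, \<open>s = 1\<close> is \<open>H\<^sup>1\<close>, and in between these are the
  Sobolev--Slobodeckij spaces.\<close>

definition Hs :: "real \<Rightarrow> 'a::euclidean_space set \<Rightarrow> ('a \<Rightarrow> real) set" where
  "Hs s D = {u. square_integrable (lebesgue_on D) u \<and>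
     (if s = 0 then True
      else if s < 1 then integrable (lebesgue_on D \<Otimes>\<^sub>M lebesgue_on D) (gagliardo s u)
      else (\<forall>b\<in>Basis. \<exists>g. has_weak_partial D b u g \<and> square_integrable (lebesgue_on D) g))}"

definition Hs_seminorm :: "real \<Rightarrow> 'a::euclidean_space set \<Rightarrow> ('a \<Rightarrow> real) \<Rightarrow> real" where
  "Hs_seminorm s D u =
     (if s = 0 then l2_norm (lebesgue_on D) u
      else if s < 1 then sqrt (LINT p|(lebesgue_on D \<Otimes>\<^sub>M lebesgue_on D). gagliardo s u p)
      else h1_seminorm D u)"

definition H1s :: "real \<Rightarrow> 'a::euclidean_space set \<Rightarrow> ('a \<Rightarrow> real) set" where
  "H1s s D = {w. square_integrable (lebesgue_on D) w \<and>
     (\<forall>b\<in>Basis. \<exists>g. has_weak_partial D b w g \<and> g \<in> Hs s D)}"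

definition H1s_seminorm :: "real \<Rightarrow> 'a::euclidean_space set \<Rightarrow> ('a \<Rightarrow> real) \<Rightarrow> real" where
  "H1s_seminorm s D w = sqrt (\<Sum>b\<in>Basis. (Hs_seminorm s D (weak_partial D b w))\<^sup>2)"

section \<open>Domains and simplicial meshes\<close>

text \<open>The last conjunct says that the domain is not pinched and lies on one side of its
  boundary; it holds in particular for every Lipschitz polyhedral domain.\<close>

definition polyhedral_domain :: "'a::euclidean_space set \<Rightarrow> bool" where
  "polyhedral_domain \<Omega> \<longleftrightarrow> \<Omega> \<noteq> {} \<and> open \<Omega> \<and> connected \<Omega> \<and> bounded \<Omega> \<and>
     (\<exists>\<P>. finite \<P> \<and> (\<forall>P\<in>\<P>. polytope P \<and> aff_dim P = int DIM('a) - 1) \<and> frontier \<Omega> = \<Union>\<P>) \<and>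
     (\<forall>x\<in>frontier \<Omega>. \<forall>e>0. \<exists>U. open U \<and> x \<in> U \<and> U \<subseteq> ball x e \<and> connected (U \<inter> \<Omega>))"

definition conforming_mesh :: "'a::euclidean_space set \<Rightarrow> 'a set set \<Rightarrow> bool" where
  "conforming_mesh \<Omega> \<T> \<longleftrightarrow>
     triangulation \<T> \<and> (\<forall>T\<in>\<T>. int DIM('a) simplex T) \<and> \<Union>\<T> = closure \<Omega>"

definition inradius :: "'a::euclidean_space set \<Rightarrow> real" where
  "inradius T = Sup {r. 0 \<le> r \<and> (\<exists>x. cball x r \<subseteq> T)}"

definition shape_regular :: "real \<Rightarrow> 'a::euclidean_space set set \<Rightarrow> bool" where
  "shape_regular \<kappa> \<T> \<longleftrightarrow> (\<forall>T\<in>\<T>. diameter T / inradius T \<le> \<kappa>)"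

definition verts :: "'a::euclidean_space set \<Rightarrow> 'a set" where
  "verts T = {v. v extreme_point_of T}"

definition mesh_verts :: "'a::euclidean_space set set \<Rightarrow> 'a set" where
  "mesh_verts \<T> = (\<Union>T\<in>\<T>. verts T)"

definition interior_verts :: "'a::euclidean_space set \<Rightarrow> 'a set set \<Rightarrow> 'a set" where
  "interior_verts \<Omega> \<T> = mesh_verts \<T> \<inter> \<Omega>"

definition boundary_verts :: "'a::euclidean_space set \<Rightarrow> 'a set set \<Rightarrow> 'a set" where
  "boundary_verts \<Omega> \<T> = mesh_verts \<T> \<inter> frontier \<Omega>"

definition vertex_elements :: "'a::euclidean_space set set \<Rightarrow> 'a \<Rightarrow> 'a set set" where
  "vertex_elements \<T> z = {T\<in>\<T>. z \<in> T}"

definition vertex_patch :: "'a::euclidean_space set set \<Rightarrow> 'a \<Rightarrow> 'a set" where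
  "vertex_patch \<T> z = interior (\<Union>(vertex_elements \<T> z))"

definition element_patch :: "'a::euclidean_space set set \<Rightarrow> 'a set \<Rightarrow> 'a set" where
  "element_patch \<T> T = (\<Union>z\<in>verts T. vertex_patch \<T> z)"

definition barycenter :: "'a::euclidean_space set \<Rightarrow> 'a" where
  "barycenter T = (1 / (real DIM('a) + 1)) *\<^sub>R (\<Sum>v\<in>verts T. v)"

definition locally_symmetric :: "'a::euclidean_space set \<Rightarrow> 'a set set \<Rightarrow> bool" where
  "locally_symmetric \<Omega> \<T> \<longleftrightarrow> (\<forall>z\<in>interior_verts \<Omega> \<T>.
     (1 / measure lebesgue (vertex_patch \<T> z)) *\<^sub>R
       (\<Sum>T\<in>vertex_elements \<T> z. measure lebesgue T *\<^sub>R barycenter T) = z)"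

definition affine_fun_on :: "'a::euclidean_space set \<Rightarrow> ('a \<Rightarrow> real) \<Rightarrow> bool" where
  "affine_fun_on S f \<longleftrightarrow> (\<exists>a c. \<forall>x\<in>S. f x = a \<bullet> x + c)"

text \<open>The values of \<open>\<phi> z\<close> on the mesh are determined by this; continuity there is automatic.\<close>

definition nodal_basis :: "'a::euclidean_space set set \<Rightarrow> ('a \<Rightarrow> 'a \<Rightarrow> real) \<Rightarrow> bool" where
  "nodal_basis \<T> \<phi> \<longleftrightarrow> (\<forall>z\<in>mesh_verts \<T>.
     (\<forall>T\<in>\<T>. affine_fun_on T (\<phi> z)) \<and>
     (\<forall>z'\<in>mesh_verts \<T>. \<phi> z z' = (if z' = z then 1 else 0)))"

section \<open>Surface integrals, traces and interpolation operators\<close>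

text \<open>Surface measure on a subset \<open>F\<close> of a hyperplane: the Lebesgue measure of the slab of
  thickness 1 around \<open>F\<close> (orthogonal to the hyperplane), pushed forward by the orthogonal
  projection. In dimension one this is the unit mass at a point.\<close>

definition face_measure :: "'a::euclidean_space set \<Rightarrow> 'a measure" where
  "face_measure F =
     distr (restrict_space lborel
         {x. closest_point (affine hull F) x \<in> F \<and> dist x (closest_point (affine hull F) x) \<le> 1/2})
       (restrict_space borel F) (closest_point (affine hull F))"

text \<open>\<open>g\<close> is the trace on the face \<open>F\<close> of the element \<open>T\<close> of \<open>v \<in> H\<^sup>1(T)\<close>: the extension by
  continuity of the restriction of \<open>C\<^sup>1\<close> functions to \<open>F\<close>. It is unique up to a null set.\<close>

definition is_face_trace ::
  "'a::euclidean_space set \<Rightarrow> 'a set \<Rightarrow> ('a \<Rightarrow> real) \<Rightarrow> ('a \<Rightarrow> real) \<Rightarrow> bool" where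
  "is_face_trace T F v g \<longleftrightarrow> square_integrable (face_measure F) g \<and>
     (\<exists>u :: nat \<Rightarrow> 'a \<Rightarrow> real. (\<forall>k. Ck 1 (u k)) \<and>
        (\<lambda>k. l2_norm (lebesgue_on (interior T)) (\<lambda>x. u k x - v x)) \<longlonglongrightarrow> 0 \<and>
        (\<lambda>k. h1_seminorm (interior T) (\<lambda>x. u k x - v x)) \<longlonglongrightarrow> 0 \<and>
        (\<lambda>k. l2_norm (face_measure F) (\<lambda>x. u k x - g x)) \<longlonglongrightarrow> 0)"

text \<open>The trace is taken from an element having \<open>F\<close> as a facet. For an interior face there are
  two such elements, and for functions in \<open>H\<^sup>1\<close> of their union both give the same trace.\<close>

definition face_trace :: "'a::euclidean_space set set \<Rightarrow> 'a set \<Rightarrow> ('a \<Rightarrow> real) \<Rightarrow> 'a \<Rightarrow> real" where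
  "face_trace \<T> F v = (SOME g. is_face_trace (SOME T. T \<in> \<T> \<and> F facet_of T) F v g)"

definition scott_zhang_data :: "'a::euclidean_space set \<Rightarrow> 'a set set \<Rightarrow> ('a \<Rightarrow> 'a \<Rightarrow> real) \<Rightarrow>
    ('a \<Rightarrow> 'a set) \<Rightarrow> ('a \<Rightarrow> 'a \<Rightarrow> real) \<Rightarrow> bool" where
  "scott_zhang_data \<Omega> \<T> \<phi> \<sigma> \<theta> \<longleftrightarrow> (\<forall>z\<in>mesh_verts \<T>.
     (\<exists>T\<in>\<T>. \<sigma> z facet_of T) \<and> z \<in> \<sigma> z \<and>
     (z \<in> frontier \<Omega> \<longrightarrow> \<sigma> z \<subseteq> frontier \<Omega>) \<and>
     affine_fun_on (\<sigma> z) (\<theta> z) \<and>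
     (\<forall>z'\<in>verts (\<sigma> z).
        (LINT x|face_measure (\<sigma> z). \<theta> z x * \<phi> z' x) = (if z' = z then 1 else 0)))"

definition scott_zhang :: "'a::euclidean_space set set \<Rightarrow> ('a \<Rightarrow> 'a \<Rightarrow> real) \<Rightarrow>
    ('a \<Rightarrow> 'a set) \<Rightarrow> ('a \<Rightarrow> 'a \<Rightarrow> real) \<Rightarrow> ('a \<Rightarrow> real) \<Rightarrow> 'a \<Rightarrow> real" where
  "scott_zhang \<T> \<phi> \<sigma> \<theta> v x = (\<Sum>z\<in>mesh_verts \<T>.
     (LINT y|face_measure (\<sigma> z). \<theta> z y * face_trace \<T> (\<sigma> z) v y) * \<phi> z x)"

definition clement_coeff :: "'a::euclidean_space set \<Rightarrow> 'a set set \<Rightarrow> ('a \<Rightarrow> 'a \<Rightarrow> real) \<Rightarrow>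
    ('a \<Rightarrow> 'a set) \<Rightarrow> ('a \<Rightarrow> 'a \<Rightarrow> real) \<Rightarrow> ('a \<Rightarrow> real) \<Rightarrow> 'a \<Rightarrow> real" where
  "clement_coeff \<Omega> \<T> \<phi> \<sigma> \<theta> v z =
     (if z \<in> interior_verts \<Omega> \<T>
      then (LINT x|lebesgue_on (vertex_patch \<T> z). v x * \<phi> z x)
             / (LINT x|lebesgue_on (vertex_patch \<T> z). \<phi> z x)
      else scott_zhang \<T> \<phi> \<sigma> \<theta> v z)"

definition clement :: "'a::euclidean_space set \<Rightarrow> 'a set set \<Rightarrow> ('a \<Rightarrow> 'a \<Rightarrow> real) \<Rightarrow>
    ('a \<Rightarrow> 'a set) \<Rightarrow> ('a \<Rightarrow> 'a \<Rightarrow> real) \<Rightarrow> ('a \<Rightarrow> real) \<Rightarrow> 'a \<Rightarrow> real" where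
  "clement \<Omega> \<T> \<phi> \<sigma> \<theta> v x = (\<Sum>z\<in>interior_verts \<Omega> \<T> \<union> boundary_verts \<Omega> \<T>.
     clement_coeff \<Omega> \<T> \<phi> \<sigma> \<theta> v z * \<phi> z x)"

end

theory Submission
  imports Defs
begin

text \<open>
  On the patch \<open>\<Delta>\<^sub>T\<close> there is an affine \<open>P\<close> with
  \<open>\<parallel>w - P\<parallel> + h\<^sub>T \<parallel>\<nabla>(w - P)\<parallel> \<lesssim> h\<^sub>T\<^bsup>1+s\<^esup> |w|\<close>: its gradient is a mean of \<open>\<nabla>w\<close> (for \<open>0 < s < 1\<close> the
  Gagliardo double integral dominates the variance), its constant comes from the Poincare inequality.
  The operator reproduces \<open>P\<close> at all nodes: at interior vertices by local symmetry, at boundary vertices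
  by duality of \<open>\<theta>\<^sub>z\<close>. Hence on \<open>T\<close> the error is \<open>w - P\<close> minus the combination of the \<open>\<phi>\<^sub>z\<close> whose coefficients are
  the nodal functionals of \<open>w - P\<close>, and these are bounded by Cauchy-Schwarz at interior vertices and by
  a scaled trace inequality at boundary vertices.

  The Poincare inequality on \<open>\<Delta>\<^sub>T\<close> is obtained from the one on convex sets by chaining elements
  through common facets; the means over two such elements are compared through a ball centred on the
  facet. Any two elements at a vertex are joined by such a chain because a connected open set stays
  connected after removing finitely many sets of codimension two and because \<open>\<Omega>\<close> is not pinched. This
  also makes the element sizes at a vertex comparable for \<open>n \<ge> 2\<close>; for \<open>n = 1\<close> neighbouring sizes are
  equal by local symmetry.
\<close>

text \<open>No reference element and no compactness argument over patch shapes is used, so the final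
  constant is an explicit function of \<open>\<kappa>\<close> and the dimension. Barycentric
  coordinates do the scaling: shape regularity bounds their gradients by \<open>\<kappa>\<close>
  over the diameter, and edge lengths, balls across facets, facet areas and trace constants all
  follow from this one bound. The substitutions needed on simplices are stretches along one
  direction, obtained from translations, dilations and Tonelli.

  One obstacle looks circular: counting the elements at a vertex seems to need comparable sizes,
  while comparability is obtained along facet chains whose length is bounded by that count. The
  circle is broken by shrinking all elements at the vertex to the smallest diameter before volumes
  are compared.

  A second obstacle is that weak gradients and traces are arbitrary choices of representatives. The
  estimates are therefore proved for any weak gradient and any trace, and the seminorms are shown to
  ignore null sets.\<close>

abbreviation (input) L2 :: "'a::euclidean_space set \<Rightarrow> ('a \<Rightarrow> real) \<Rightarrow> real" where
  "L2 D \<equiv> l2_norm (lebesgue_on D)"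

abbreviation (input) inL2 :: "'a::euclidean_space set \<Rightarrow> ('a \<Rightarrow> real) \<Rightarrow> bool" where
  "inL2 D \<equiv> square_integrable (lebesgue_on D)"

abbreviation (input) vol :: "'a::euclidean_space set \<Rightarrow> real" where
  "vol \<equiv> measure lebesgue"

abbreviation (input) fderiv :: "('a::euclidean_space \<Rightarrow> real) \<Rightarrow> 'a \<Rightarrow> 'a \<Rightarrow> real" where
  "fderiv u x \<equiv> frechet_derivative u (at x)"

abbreviation (input) nn_lborel :: "('a::euclidean_space \<Rightarrow> ennreal) \<Rightarrow> ennreal" (binder \<open>\<integral>\<^sub>+\<close> 10) where
  "nn_lborel f \<equiv> integral\<^sup>N lborel f"

section \<open>Square-integrable functions and their norm\<close>

lemma abs_square_le_power2: "\<bar>a\<bar> \<le> b \<Longrightarrow> a\<^sup>2 \<le> b\<^sup>2" for a b :: real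
  by (metis abs_ge_zero power2_abs power_mono)

lemma square_integrable_mult:
  assumes "square_integrable M u" "square_integrable M v"
  shows "integrable M (\<lambda>x. u x * v x)"
proof (rule Bochner_Integration.integrable_bound)
  show "integrable M (\<lambda>x. (u x)\<^sup>2 + (v x)\<^sup>2)"
    using assms by (auto simp: square_integrable_def)
  show "(\<lambda>x. u x * v x) \<in> borel_measurable M"
    using assms by (auto simp: square_integrable_def)
  have "\<bar>a * b\<bar> \<le> a\<^sup>2 + b\<^sup>2" for a b :: real
    using sum_squares_bound[of "\<bar>a\<bar>" "\<bar>b\<bar>"] abs_ge_zero[of "a * b"] unfolding abs_mult power2_abs by linarith
  then show "AE x in M. norm (u x * v x) \<le> norm ((u x)\<^sup>2 + (v x)\<^sup>2)"
    by simp
qed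

lemma square_integrable_add:
  assumes "square_integrable M u" "square_integrable M v"
  shows "square_integrable M (\<lambda>x. u x + v x)"
  using assms square_integrable_mult[OF assms]
  by (auto simp: square_integrable_def power2_sum mult.assoc)

lemma square_integrable_cmult:
  assumes "square_integrable M u"
  shows "square_integrable M (\<lambda>x. c * u x)"
  using assms by (auto simp: square_integrable_def power_mult_distrib)

lemma square_integrable_diff:
  assumes "square_integrable M u" "square_integrable M v"
  shows "square_integrable M (\<lambda>x. u x - v x)"
  using square_integrable_add[OF assms(1) square_integrable_cmult[OF assms(2), of "-1"]] by simp

lemma square_integrable_sum:
  assumes "\<And>i. i \<in> I \<Longrightarrow> square_integrable M (u i)"
  shows "square_integrable M (\<lambda>x. \<Sum>i\<in>I. u i x)"
  using assms
proof (induction I rule: infinite_finite_induct)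
  case (insert i I)
  then show ?case by (simp add: square_integrable_add)
qed (auto simp: square_integrable_def)

lemma square_integrable_cong_AE:
  assumes "square_integrable M u" "v \<in> borel_measurable M" "AE x in M. u x = v x"
  shows "square_integrable M v"
proof -
  have "integrable M (\<lambda>x. (v x)\<^sup>2)"
    using assms by (subst integrable_cong_AE[where g="\<lambda>x. (u x)\<^sup>2"]) (auto simp: square_integrable_def)
  then show ?thesis using assms by (simp add: square_integrable_def)
qed

lemma l2_norm_cong_AE:
  assumes "u \<in> borel_measurable M" "v \<in> borel_measurable M" "AE x in M. u x = v x"
  shows "l2_norm M u = l2_norm M v"
proof -
  have "(LINT x|M. (u x)\<^sup>2) = (LINT x|M. (v x)\<^sup>2)"
    using assms by (intro integral_cong_AE) auto
  then show ?thesis by (simp add: l2_norm_def)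
qed

lemma l2_norm_nonneg [simp]: "0 \<le> l2_norm M u"
  by (simp add: l2_norm_def)

lemma l2_norm_power2: "(l2_norm M u)\<^sup>2 = (LINT x|M. (u x)\<^sup>2)"
  by (simp add: l2_norm_def)

lemma l2_norm_cmult: "l2_norm M (\<lambda>x. c * u x) = \<bar>c\<bar> * l2_norm M u"
  by (simp add: l2_norm_def power_mult_distrib real_sqrt_mult)

lemma l2_norm_minus_commute: "l2_norm M (\<lambda>x. u x - v x) = l2_norm M (\<lambda>x. v x - u x)"
  by (simp add: l2_norm_def power2_commute)

lemma l2_Cauchy_Schwarz:
  assumes "square_integrable M u" "square_integrable M v"
  shows "\<bar>LINT x|M. u x * v x\<bar> \<le> l2_norm M u * l2_norm M v"
proof -
  have uv: "integrable M (\<lambda>x. u x * v x)" by (rule square_integrable_mult[OF assms])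
  have *: "(\<integral>\<^sup>+x. ennreal \<bar>u x\<bar> * ennreal \<bar>v x\<bar> \<partial>M)\<^sup>2
      \<le> (\<integral>\<^sup>+x. ennreal \<bar>u x\<bar>^2 \<partial>M) * (\<integral>\<^sup>+x. ennreal \<bar>v x\<bar>^2 \<partial>M)"
    using assms by (intro Cauchy_Schwarz_nn_integral) (auto simp: square_integrable_def)
  have 1: "(\<integral>\<^sup>+x. ennreal \<bar>u x\<bar> * ennreal \<bar>v x\<bar> \<partial>M) = ennreal (LINT x|M. \<bar>u x * v x\<bar>)"
    using integrable_abs[OF uv] by (subst nn_integral_eq_integral[symmetric]) (auto simp: ennreal_mult[symmetric] abs_mult)
  have 2: "(\<integral>\<^sup>+x. ennreal \<bar>w x\<bar>^2 \<partial>M) = ennreal (LINT x|M. (w x)\<^sup>2)"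
    if "square_integrable M w" for w
    using that by (subst nn_integral_eq_integral[symmetric]) (auto simp: ennreal_power square_integrable_def)
  have "ennreal ((LINT x|M. \<bar>u x * v x\<bar>)\<^sup>2) \<le> ennreal ((LINT x|M. (u x)\<^sup>2) * (LINT x|M. (v x)\<^sup>2))"
    using * unfolding 1 2[OF assms(1)] 2[OF assms(2)] by (simp add: ennreal_power ennreal_mult)
  then have "(LINT x|M. \<bar>u x * v x\<bar>)\<^sup>2 \<le> (LINT x|M. (u x)\<^sup>2) * (LINT x|M. (v x)\<^sup>2)"
    by (subst (asm) ennreal_le_iff) auto
  then have "(LINT x|M. \<bar>u x * v x\<bar>)\<^sup>2 \<le> (l2_norm M u * l2_norm M v)\<^sup>2"
    by (simp add: power_mult_distrib l2_norm_power2)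
  then have "(LINT x|M. \<bar>u x * v x\<bar>) \<le> l2_norm M u * l2_norm M v"
    by (rule power2_le_imp_le) simp
  moreover have "\<bar>LINT x|M. u x * v x\<bar> \<le> (LINT x|M. \<bar>u x * v x\<bar>)"
    using integral_norm_bound[of M "\<lambda>x. u x * v x"] by simp
  ultimately show ?thesis by linarith
qed

lemma l2_norm_triangle:
  assumes u: "square_integrable M u" and v: "square_integrable M v"
  shows "l2_norm M (\<lambda>x. u x + v x) \<le> l2_norm M u + l2_norm M v"
proof (rule power2_le_imp_le)
  have uv: "integrable M (\<lambda>x. u x * v x)" by (rule square_integrable_mult[OF u v])
  have "(l2_norm M (\<lambda>x. u x + v x))\<^sup>2 = (LINT x|M. (u x)\<^sup>2 + (v x)\<^sup>2 + 2 * (u x * v x))"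
    by (simp add: l2_norm_power2 power2_sum mult.assoc)
  also have "\<dots> = (l2_norm M u)\<^sup>2 + (l2_norm M v)\<^sup>2 + 2 * (LINT x|M. u x * v x)"
    using u v uv by (simp add: l2_norm_power2 square_integrable_def)
  also have "\<dots> \<le> (l2_norm M u + l2_norm M v)\<^sup>2"
    using l2_Cauchy_Schwarz[OF u v] by (simp add: power2_sum)
  finally show "(l2_norm M (\<lambda>x. u x + v x))\<^sup>2 \<le> (l2_norm M u + l2_norm M v)\<^sup>2" .
qed simp

lemma l2_norm_triangle_diff:
  assumes u: "square_integrable M u" and v: "square_integrable M v"
  shows "l2_norm M (\<lambda>x. u x - v x) \<le> l2_norm M u + l2_norm M v"
  using l2_norm_triangle[OF u square_integrable_cmult[OF v, of "-1"]] l2_norm_cmult[of M "-1" v]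
  by simp

lemma l2_norm_triangle_sum:
  assumes "finite I" "\<And>i. i \<in> I \<Longrightarrow> square_integrable M (u i)"
  shows "l2_norm M (\<lambda>x. \<Sum>i\<in>I. u i x) \<le> (\<Sum>i\<in>I. l2_norm M (u i))"
  using assms
proof (induction I rule: finite_induct)
  case (insert i I)
  then have "l2_norm M (\<lambda>x. u i x + (\<Sum>i\<in>I. u i x)) \<le> l2_norm M (u i) + l2_norm M (\<lambda>x. \<Sum>i\<in>I. u i x)"
    by (intro l2_norm_triangle square_integrable_sum) auto
  with insert show ?case by auto
qed (simp add: l2_norm_def)

lemma square_integrable_const:
  assumes "finite_measure M"
  shows "square_integrable M (\<lambda>x. c)"
  using finite_measure.integrable_const[OF assms] by (simp add: square_integrable_def)

lemma l2_norm_const: "l2_norm M (\<lambda>x. c) = \<bar>c\<bar> * sqrt (measure M (space M))"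
  by (simp add: l2_norm_def real_sqrt_mult)

lemma square_integrable_integrable:
  assumes "finite_measure M" "square_integrable M u"
  shows "integrable M u"
  using square_integrable_mult[OF assms(2) square_integrable_const[OF assms(1), of 1]] by simp

lemma square_integrable_bounded:
  assumes "finite_measure M" "u \<in> borel_measurable M" "\<And>x. x \<in> space M \<Longrightarrow> \<bar>u x\<bar> \<le> B"
  shows "square_integrable M u"
proof -
  interpret finite_measure M by fact
  have "integrable M (\<lambda>x. (u x)\<^sup>2)"
    using assms by (intro integrable_const_bound[of _ "B\<^sup>2"] AE_I2) (auto simp: abs_square_le_power2)
  with assms show ?thesis by (simp add: square_integrable_def)
qed

lemma l2_norm_bounded:
  assumes "finite_measure M" "u \<in> borel_measurable M" "\<And>x. x \<in> space M \<Longrightarrow> \<bar>u x\<bar> \<le> B"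
  shows "l2_norm M u \<le> B * sqrt (measure M (space M))"
\<comment> \<open>On an empty space the hypotheses say nothing about the sign of \<open>B\<close>;
  both sides are then zero.\<close>
proof (cases "space M = {}")
  case True
  then have "measure M (space M) = 0" by simp
  have "M = count_space {}" using True by (rule space_empty)
  then show ?thesis by (simp add: l2_norm_def lebesgue_integral_count_space_finite)
next
  case False
  then have B: "0 \<le> B" using assms(3) by fastforce
  interpret finite_measure M by fact
  have "(l2_norm M u)\<^sup>2 \<le> (LINT x|M. B\<^sup>2)"
    unfolding l2_norm_power2 using square_integrable_bounded[OF assms] B assms(3)
    by (intro integral_mono) (auto simp: square_integrable_def abs_square_le_power2)
  also have "\<dots> = (B * sqrt (measure M (space M)))\<^sup>2"
    by (simp add: power_mult_distrib)
  finally show ?thesis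
    by (rule power2_le_imp_le) (simp add: B)
qed

lemma lebesgue_on_integral_eq:
  fixes f :: "'a::euclidean_space \<Rightarrow> real"
  shows "S \<in> sets lebesgue \<Longrightarrow> (LINT x|lebesgue_on S. f x) = (LINT x|lebesgue. indicator S x * f x)"
  by (simp add: integral_restrict_space)

lemma lebesgue_on_integrable_iff:
  fixes f :: "'a::euclidean_space \<Rightarrow> real"
  shows "S \<in> sets lebesgue \<Longrightarrow> integrable (lebesgue_on S) f \<longleftrightarrow> integrable lebesgue (\<lambda>x. indicator S x * f x)"
  by (simp add: integrable_restrict_space)

lemma lebesgue_on_integrable_subset:
  fixes f :: "'a::euclidean_space \<Rightarrow> real"
  assumes "integrable (lebesgue_on S) f" "T \<subseteq> S" "S \<in> sets lebesgue" "T \<in> sets lebesgue"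
  shows "integrable (lebesgue_on T) f"
  using assms set_integrable_subset[of lebesgue S f T]
  by (simp add: integrable_restrict_space set_integrable_def)

lemma square_integrable_subset:
  assumes "inL2 S u" "T \<subseteq> S" "S \<in> sets lebesgue" "T \<in> sets lebesgue"
  shows "inL2 T u"
  using assms unfolding square_integrable_def
  by (meson measurable_restrict_mono lebesgue_on_integrable_subset)

lemma lebesgue_on_integral_mono_set:
  fixes f :: "'a::euclidean_space \<Rightarrow> real"
  assumes "integrable (lebesgue_on S) f" "T \<subseteq> S" "S \<in> sets lebesgue" "T \<in> sets lebesgue" "\<And>x. 0 \<le> f x"
  shows "(LINT x|lebesgue_on T. f x) \<le> (LINT x|lebesgue_on S. f x)"
proof -
  have i: "integrable (lebesgue_on T) f"
    using assms lebesgue_on_integrable_subset by blast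
  have "(LINT x|lebesgue. indicator T x *\<^sub>R f x) \<le> (LINT x|lebesgue. indicator S x *\<^sub>R f x)"
    using i assms by (intro integral_mono) (auto simp: integrable_restrict_space indicator_def)
  then show ?thesis using assms by (simp add: integral_restrict_space)
qed

lemma l2_norm_subset:
  assumes "inL2 S u" "T \<subseteq> S" "S \<in> sets lebesgue" "T \<in> sets lebesgue"
  shows "L2 T u \<le> L2 S u"
  using assms lebesgue_on_integral_mono_set[of S "\<lambda>x. (u x)\<^sup>2" T]
  by (auto simp: l2_norm_def square_integrable_def)

section \<open>Smooth functions\<close>

text \<open>With s = 1/t one has d/dt = - s^2 d/ds, so p(s) exp(-s) differentiates to s^2 (p -
  p')(s) exp(-s); the polynomial \<open>[:0, 0, 1:]\<close> is s^2.\<close>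

primrec exp_inv_poly :: "nat \<Rightarrow> real poly" where
  "exp_inv_poly 0 = 1"
| "exp_inv_poly (Suc k) = [:0, 0, 1:] * (exp_inv_poly k - pderiv (exp_inv_poly k))"

text \<open>The \<open>k\<close>-th derivative of \<open>exp (- 1 / t)\<close>, extended by zero to the left half line.\<close>

definition exp_inv :: "nat \<Rightarrow> real \<Rightarrow> real" where
  "exp_inv k t = (if t > 0 then poly (exp_inv_poly k) (1 / t) * exp (- (1 / t)) else 0)"

lemma poly_exp_tendsto_0: "((\<lambda>s::real. poly p s * exp (- s)) \<longlongrightarrow> 0) at_top"
proof -
  have "((\<lambda>s::real. \<Sum>i\<le>degree p. coeff p i * (s ^ i / exp s)) \<longlongrightarrow> (\<Sum>i\<le>degree p. coeff p i * 0)) at_top"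
    by (intro tendsto_intros tendsto_power_div_exp_0)
  moreover have "poly p s * exp (- s) = (\<Sum>i\<le>degree p. coeff p i * (s ^ i / exp s))" for s :: real
    by (simp add: poly_altdef sum_distrib_right exp_minus divide_inverse mult.assoc)
  ultimately show ?thesis by simp
qed

lemma exp_inv_deriv: "(exp_inv k has_real_derivative exp_inv (Suc k) t) (at t)"
proof (cases t "0::real" rule: linorder_cases)
  case less
  have "((\<lambda>_. 0) has_real_derivative exp_inv (Suc k) t) (at t)"
    using less by (simp add: exp_inv_def)
  then show ?thesis
    by (rule has_field_derivative_transform_within_open[where S="{..<0}"]) (use less in \<open>auto simp: exp_inv_def\<close>)
next
  case greater
  have "((\<lambda>t. poly (exp_inv_poly k) (1 / t) * exp (- (1 / t))) has_real_derivative exp_inv (Suc k) t) (at t)"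
    using greater
    by (auto intro!: derivative_eq_intros DERIV_chain2[OF poly_DERIV] simp: exp_inv_def field_simps power2_eq_square)
  then show ?thesis
    by (rule has_field_derivative_transform_within_open[where S="{0<..}"]) (use greater in \<open>auto simp: exp_inv_def\<close>)
next
  case equal
  have "((\<lambda>h. exp_inv k h / h) \<longlongrightarrow> 0) (at 0)"
  proof (rule filterlim_split_at)
    have "((\<lambda>h::real. 0) \<longlongrightarrow> (0::real)) (at_left 0)" by simp
    then show "((\<lambda>h. exp_inv k h / h) \<longlongrightarrow> 0) (at_left 0)"
      by (rule Lim_transform_eventually) (auto simp: exp_inv_def eventually_at_filter)
    \<comment> \<open>The difference quotient at the origin divides by h, which multiplies the
      polynomial in 1/h by its variable; hence \<open>pCons 0\<close>.\<close>
    have "((\<lambda>h. poly (pCons 0 (exp_inv_poly k)) (inverse h) * exp (- inverse h)) \<longlongrightarrow> 0) (at_right (0::real))"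
      by (rule filterlim_compose[OF poly_exp_tendsto_0 filterlim_inverse_at_top_right])
    then show "((\<lambda>h. exp_inv k h / h) \<longlongrightarrow> 0) (at_right 0)"
      by (rule Lim_transform_eventually) (auto simp: exp_inv_def eventually_at_filter field_simps)
  qed
  then show ?thesis
    using equal by (simp add: has_field_derivative_iff) (simp add: exp_inv_def)
qed

lemma exp_inv_0_bounds: "0 \<le> exp_inv 0 t" "exp_inv 0 t \<le> 1"
  by (auto simp: exp_inv_def)

lemma exp_inv_0_eq_0_iff: "exp_inv 0 t = 0 \<longleftrightarrow> t \<le> 0"
  by (auto simp: exp_inv_def)

lemma Ck_SucD: "Ck (Suc k) f \<Longrightarrow> Ck k f"
  by (induction k arbitrary: f)
    (auto intro!: continuous_at_imp_continuous_on dest: differentiable_imp_continuous_within)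

lemma Ck_continuous: "Ck k f \<Longrightarrow> continuous_on UNIV f"
  by (induction k) (use Ck_SucD in auto)

lemma Ck_const: "Ck k (\<lambda>x. c)"
  by (induction k arbitrary: c) auto

lemma Ck_add: "Ck k f \<Longrightarrow> Ck k g \<Longrightarrow> Ck k (\<lambda>x. f x + g x)"
proof (induction k arbitrary: f g)
  case 0
  then show ?case by (auto intro: continuous_intros)
next
  case (Suc k)
  then have d: "f differentiable at x" "g differentiable at x" for x by auto
  have "fderiv (\<lambda>x. f x + g x) x b = fderiv f x b + fderiv g x b"
    for x b
    using frechet_derivative_at[OF has_derivative_add[OF d(1)[unfolded frechet_derivative_works] d(2)[unfolded frechet_derivative_works]]]
    by (metis (no_types))
  with Suc show ?case by auto
qed

lemma Ck_cmult: "Ck k f \<Longrightarrow> Ck k (\<lambda>x. c * f x)"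
proof (induction k arbitrary: f)
  case 0
  then show ?case by (auto intro: continuous_intros)
next
  case (Suc k)
  then have d: "f differentiable at x" for x by auto
  have "fderiv (\<lambda>x. c * f x) x b = c * fderiv f x b" for x b
    using frechet_derivative_at[OF has_derivative_mult_right[OF d[unfolded frechet_derivative_works], of c]]
    by (metis (no_types))
  with Suc show ?case by auto
qed

lemma Ck_diff: "Ck k f \<Longrightarrow> Ck k g \<Longrightarrow> Ck k (\<lambda>x. f x - g x)"
  using Ck_add[of k f "\<lambda>x. (-1) * g x"] Ck_cmult[of k g "-1"] by simp

lemma Ck_sum: "(\<And>i. i \<in> I \<Longrightarrow> Ck k (f i)) \<Longrightarrow> Ck k (\<lambda>x. \<Sum>i\<in>I. f i x)"
  by (induction I rule: infinite_finite_induct) (auto intro: Ck_add Ck_const)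

lemma Ck_1_iff:
  "Ck 1 f \<longleftrightarrow> (\<forall>x. f differentiable (at x)) \<and> (\<forall>b\<in>Basis. continuous_on UNIV (\<lambda>x. fderiv f x b))"
  by simp

lemma Ck_1_derivative_continuous:
  assumes "Ck 1 f" shows "continuous_on UNIV (\<lambda>x. fderiv f x v)"
proof -
  have lin: "linear (fderiv f x)" for x
    using assms by (auto intro: linear_frechet_derivative)
  have "fderiv f x v = (\<Sum>b\<in>Basis. (v \<bullet> b) * fderiv f x b)" for x
  proof -
    have "fderiv f x v = fderiv f x (\<Sum>b\<in>Basis. (v \<bullet> b) *\<^sub>R b)"
      by (simp add: euclidean_representation)
    also have "\<dots> = (\<Sum>b\<in>Basis. (v \<bullet> b) * fderiv f x b)"
      by (simp add: linear_sum[OF lin] linear_cmul[OF lin])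
    finally show ?thesis .
  qed
  then show ?thesis using assms by (auto intro!: continuous_intros)
qed

text \<open>The induction on \<open>k\<close> needs a class of functions closed under
  differentiation. Products of ridge functions with arbitrary derivative orders \<open>m i\<close>
  form one up to linear combinations: the product rule raises one order at a time.\<close>

lemma Ck_prod_ridge:
  fixes a :: "'i \<Rightarrow> 'a::euclidean_space"
  assumes d: "\<And>k t. (d k has_real_derivative d (Suc k) t) (at t)" and I: "finite I"
  shows "Ck k (\<lambda>x. \<Prod>i\<in>I. d (m i) (a i \<bullet> x + c i))"
proof -
  define F where "F m x = (\<Prod>i\<in>I. d (m i) (a i \<bullet> x + c i))" for m x
  have D: "(F m has_derivative (\<lambda>h. \<Sum>i\<in>I. (a i \<bullet> h) * F (m(i := Suc (m i))) x)) (at x)" for m x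
  proof -
    have 1: "((\<lambda>x. d (m i) (a i \<bullet> x + c i)) has_derivative (\<lambda>h. d (Suc (m i)) (a i \<bullet> x + c i) * (a i \<bullet> h))) (at x)" for i
    proof -
      have "((\<lambda>x. a i \<bullet> x + c i) has_derivative (\<lambda>h. a i \<bullet> h)) (at x)"
        by (auto intro!: derivative_eq_intros)
      moreover have "(d (m i) has_derivative (*) (d (Suc (m i)) (a i \<bullet> x + c i))) (at (a i \<bullet> x + c i))"
        using d has_field_derivative_def by blast
      ultimately show ?thesis
        using diff_chain_at[of "\<lambda>x. a i \<bullet> x + c i" "\<lambda>h. a i \<bullet> h" x "d (m i)"] by (simp add: o_def)
    qed
    have 2: "F (m(i := Suc (m i))) x = d (Suc (m i)) (a i \<bullet> x + c i) * (\<Prod>j\<in>I - {i}. d (m j) (a j \<bullet> x + c j))"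
      if "i \<in> I" for i
      using that I by (simp add: F_def prod.remove[of I i])
    have "((\<lambda>x. \<Prod>i\<in>I. d (m i) (a i \<bullet> x + c i)) has_derivative
        (\<lambda>h. \<Sum>i\<in>I. d (Suc (m i)) (a i \<bullet> x + c i) * (a i \<bullet> h) * (\<Prod>j\<in>I - {i}. d (m j) (a j \<bullet> x + c j)))) (at x)"
      by (rule has_derivative_prod) (rule 1)
    moreover have "(\<lambda>x. \<Prod>i\<in>I. d (m i) (a i \<bullet> x + c i)) = F m" by (simp add: F_def fun_eq_iff)
    ultimately show ?thesis by (simp add: 2 mult_ac)
  qed
  have "Ck k (F m)" for m
  proof (induction k arbitrary: m)
    case 0
    have "F m differentiable at x" for x using D unfolding differentiable_def by blast
    then show ?case
      by (auto intro!: continuous_at_imp_continuous_on dest: differentiable_imp_continuous_within)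
  next
    case (Suc k)
    have "fderiv (F m) x b = (\<Sum>i\<in>I. (a i \<bullet> b) * F (m(i := Suc (m i))) x)" for x b
      using frechet_derivative_at[OF D[of m x]] by (metis (no_types, lifting))
    moreover have "F m differentiable at x" for x using D unfolding differentiable_def by blast
    ultimately show ?case by (auto intro!: Ck_sum Ck_cmult Suc)
  qed
  then show ?thesis by (simp add: F_def[abs_def])
qed

text \<open>The factor \<open>k\<close> serves two purposes: for \<open>k\<close> tending to
  infinity the bump tends to the indicator of the open box, and \<open>k = 1 / r\<close> rescales
  the bump on the unit cube to a cube of half side \<open>r\<close>.\<close>

definition box_bump :: "real \<Rightarrow> 'a::euclidean_space \<Rightarrow> 'a \<Rightarrow> 'a \<Rightarrow> real" where
  "box_bump k a b x = (\<Prod>j\<in>Basis. exp_inv 0 (k * (x \<bullet> j - a \<bullet> j)) * exp_inv 0 (k * (b \<bullet> j - x \<bullet> j)))"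

lemma Ck_box_bump: "Ck m (box_bump k a b)"
proof -
  have "box_bump k a b = (\<lambda>x. \<Prod>i\<in>Basis \<times> {1, -1::real}. exp_inv 0 ((k * snd i) *\<^sub>R fst i \<bullet> x
          + (if snd i = 1 then - k * (a \<bullet> fst i) else k * (b \<bullet> fst i))))"
    (is "_ = (\<lambda>x. \<Prod>i\<in>_. ?f (fst i) (snd i) x)")
  proof
    fix x
    have "(\<Prod>i\<in>Basis \<times> {1, -1::real}. ?f (fst i) (snd i) x) = (\<Prod>j\<in>Basis. \<Prod>s\<in>{1, -1::real}. ?f j s x)"
      by (subst prod.cartesian_product) (simp add: case_prod_unfold)
    also have "\<dots> = box_bump k a b x"
      unfolding box_bump_def by (intro prod.cong) (auto simp: algebra_simps inner_commute)
    finally show "box_bump k a b x = (\<Prod>i\<in>Basis \<times> {1, -1::real}. ?f (fst i) (snd i) x)" by simp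
  qed
  then show ?thesis
    using Ck_prod_ridge[where d=exp_inv, OF exp_inv_deriv, of "Basis \<times> {1, -1::real}" m "\<lambda>_. 0" "\<lambda>i. (k * snd i) *\<^sub>R fst i"
        "\<lambda>i. if snd i = 1 then - k * (a \<bullet> fst i) else k * (b \<bullet> fst i)"] by simp
qed

lemma box_bump_bounds: "0 \<le> box_bump k a b x" "box_bump k a b x \<le> 1"
proof -
  have "\<bar>exp_inv 0 s * exp_inv 0 t\<bar> \<le> 1" for s t
    using exp_inv_0_bounds[of s] exp_inv_0_bounds[of t] by (simp add: abs_mult mult_le_one)
  then show "0 \<le> box_bump k a b x" "box_bump k a b x \<le> 1"
    using exp_inv_0_bounds unfolding box_bump_def by (auto intro!: prod_nonneg prod_le_1 mult_le_one)
qed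

lemma box_bump_eq_0_iff: "k > 0 \<Longrightarrow> box_bump k a b x = 0 \<longleftrightarrow> x \<notin> box a b"
  by (auto simp: box_bump_def mem_box exp_inv_0_eq_0_iff mult_le_0_iff not_less)

lemma box_bump_test: "cbox a b \<subseteq> D \<Longrightarrow> k > 0 \<Longrightarrow> test_function D (box_bump k a b)"
  unfolding test_function_def using box_subset_cbox[of a b]
  by (auto intro!: Ck_box_bump exI[of _ "cbox a b"] simp: box_bump_eq_0_iff)

lemma exp_inv_tendsto_1:
  assumes "t > 0" shows "(\<lambda>k. exp_inv 0 (real (Suc k) * t)) \<longlonglongrightarrow> 1"
proof -
  have "(\<lambda>k. exp (- (inverse (real (Suc k)) * (1 / t)))) \<longlonglongrightarrow> exp (- (0 * (1 / t)))"
    by (intro tendsto_intros LIMSEQ_inverse_real_of_nat)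
  moreover have "exp_inv 0 (real (Suc k) * t) = exp (- (inverse (real (Suc k)) * (1 / t)))" for k
    using assms by (simp add: exp_inv_def divide_inverse del: of_nat_Suc)
  ultimately show ?thesis by simp
qed

lemma box_bump_tendsto: "(\<lambda>k. box_bump (real (Suc k)) a b x) \<longlonglongrightarrow> indicator (box a b) x"
proof (cases "x \<in> box a b")
  case True
  have "(\<lambda>k. box_bump (real (Suc k)) a b x) \<longlonglongrightarrow> (\<Prod>j\<in>(Basis::'a set). 1 * 1)"
    unfolding box_bump_def using True
    by (intro tendsto_prod tendsto_mult exp_inv_tendsto_1) (auto simp: mem_box)
  with True show ?thesis by simp
next
  case False
  then have "box_bump (real (Suc k)) a b x = 0" for k
    using box_bump_eq_0_iff[of "real (Suc k)" a b x] by simp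
  with False show ?thesis by simp
qed

section \<open>Weak derivatives\<close>

text \<open>The sets over which \<open>f\<close> integrates to zero form a Dynkin system, closed
  under complements because of \<open>f0\<close>, and the boxes are an intersection-stable generator
  of the Borel sets.\<close>

lemma AE_zero_of_box_integrals:
  fixes f :: "'a::euclidean_space \<Rightarrow> real"
  assumes f: "integrable lborel f" and f0: "(LINT x|lborel. f x) = 0"
    and box: "\<And>a b. (LINT x|lborel. indicator (box a b) x * f x) = 0"
  shows "AE x in lborel. f x = 0"
proof -
  let ?E = "range (\<lambda>(a, b). box a b::'a set)"
  have E: "sets (lborel::'a measure) = sigma_sets UNIV ?E"
    by (simp add: borel_eq_box)
  have "(LINT x|lborel. indicator A x * f x) = 0" if "A \<in> sigma_sets UNIV ?E" for A
  proof (rule sigma_sets_induct_disjoint[OF _ _ that])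
    show "Int_stable ?E" by (auto simp: Int_stable_def box_Int_box)
  next
    fix A assume "A \<in> ?E"
    then show "(LINT x|lborel. indicator A x * f x) = 0" using box by auto
  next
    fix A :: "'a set" assume A: "A \<in> sigma_sets UNIV ?E" "(LINT x|lborel. indicator A x * f x) = 0"
    have i: "integrable lborel (\<lambda>x. indicator A x * f x)"
      using A(1) E f integrable_mult_indicator[of A lborel f] by auto
    have "(LINT x|lborel. indicator (UNIV - A) x * f x) = (LINT x|lborel. f x - indicator A x * f x)"
      by (intro Bochner_Integration.integral_cong) (auto simp: indicator_def)
    then show "(LINT x|lborel. indicator (UNIV - A) x * f x) = 0"
      using i f f0 A(2) by simp
  next
    fix A :: "nat \<Rightarrow> 'a set"
    assume A: "disjoint_family A" "range A \<subseteq> sigma_sets UNIV ?E"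
      "\<And>i. (LINT x|lborel. indicator (A i) x * f x) = 0"
    have "(LINT x:(\<Union>i. A i)|lborel. f x) = (\<Sum>i. (LINT x:(A i)|lborel. f x))"
    proof (rule lebesgue_integral_countable_add)
      show "\<And>i. A i \<in> sets lborel" using A(2) E by auto
      show "\<And>i j. i \<noteq> j \<Longrightarrow> A i \<inter> A j = {}" using A(1) by (auto simp: disjoint_family_on_def)
      have "(\<Union>i. A i) \<in> sets lborel" using A(2) E by (intro sets.countable_UN) auto
      then show "set_integrable lborel (\<Union>i. A i) f"
        using f integrable_mult_indicator[of "\<Union>i. A i" lborel f] by (simp add: set_integrable_def)
    qed
    then show "(LINT x|lborel. indicator (\<Union>i. A i) x * f x) = 0"
      using A(3) by (simp add: set_lebesgue_integral_def)
  qed auto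
  then have "(LINT x:A|lborel. f x) = (LINT x:A|lborel. 0)" if "A \<in> sets lborel" for A
    using that E by (simp add: set_lebesgue_integral_def)
  then show ?thesis using density_unique_real[OF f integrable_zero] by simp
qed

lemma locally_integrable_mult_support:
  fixes u \<psi> :: "'a::euclidean_space \<Rightarrow> real"
  assumes u: "locally_integrable D u" and D: "D \<in> sets lebesgue" and \<psi>: "continuous_on UNIV \<psi>"
    and K: "compact K" "K \<subseteq> D" "\<And>x. x \<notin> K \<Longrightarrow> \<psi> x = 0"
  shows "integrable (lebesgue_on D) (\<lambda>x. u x * \<psi> x)"
proof -
  have Kl: "K \<in> sets lebesgue" using K by (simp add: lmeasurable_compact fmeasurableD)
  have "bounded (\<psi> ` K)"
    using \<psi> K by (meson compact_continuous_image compact_imp_bounded continuous_on_subset subset_UNIV)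
  then obtain B where B: "\<And>x. x \<in> K \<Longrightarrow> \<bar>\<psi> x\<bar> \<le> B" unfolding bounded_iff by auto
  have uK: "integrable (lebesgue_on K) u" using u K by (auto simp: locally_integrable_def)
  have "\<psi> \<in> borel_measurable (lebesgue_on K)"
    using \<psi> continuous_imp_measurable_on_sets_lebesgue[of K \<psi>] Kl continuous_on_subset by blast
  then have "integrable (lebesgue_on K) (\<lambda>x. u x * \<psi> x)"
  proof (intro Bochner_Integration.integrable_bound[OF integrable_mult_right[OF uK, of B]] AE_I2)
    fix x assume "x \<in> space (lebesgue_on K)"
    then have "\<bar>\<psi> x\<bar> \<le> \<bar>B\<bar>" using B[of x] by simp
    then show "norm (u x * \<psi> x) \<le> norm (B * u x)"
      by (simp add: abs_mult mult.commute[of "\<bar>u _\<bar>"] mult_right_mono)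
  qed (intro borel_measurable_times borel_measurable_integrable[OF uK])
  then have "integrable lebesgue (\<lambda>x. indicator K x *\<^sub>R (u x * \<psi> x))"
    using Kl by (simp add: integrable_restrict_space)
  moreover have "(\<lambda>x. indicator K x *\<^sub>R (u x * \<psi> x)) = (\<lambda>x. indicator D x * (u x * \<psi> x))"
    using K by (fastforce simp: indicator_def fun_eq_iff)
  ultimately show ?thesis using D by (simp only: lebesgue_on_integrable_iff)
qed

lemma locally_integrable_subset: "locally_integrable D u \<Longrightarrow> E \<subseteq> D \<Longrightarrow> locally_integrable E u"
  by (auto simp: locally_integrable_def)

lemma open_eq_countable_Union_cbox:
  fixes D :: "'a::euclidean_space set"
  assumes "open D"
  shows "\<exists>\<D>. countable \<D> \<and> \<D> \<subseteq> Pow D \<and> (\<forall>X\<in>\<D>. \<exists>a b. X = cbox a b) \<and> \<Union>\<D> = D"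
proof (rule open_countable_Union_open_cbox[OF assms])
  fix \<D> assume a: "countable \<D>" "\<D> \<subseteq> Pow D" "\<And>X. X \<in> \<D> \<Longrightarrow> \<exists>a b. X = cbox a b" "\<Union>\<D> = D"
  show ?thesis by (intro exI[of _ \<D>] conjI ballI a)
qed

text \<open>Measurability is a local matter: an open set is a countable union of compact boxes, and
  local integrability gives a measurable restriction to each of them.\<close>

lemma locally_integrable_measurable:
  fixes u :: "'a::euclidean_space \<Rightarrow> real"
  assumes "open D" "locally_integrable D u"
  shows "u \<in> borel_measurable (lebesgue_on D)"
proof -
  obtain \<D> where \<D>: "countable \<D>" "\<D> \<subseteq> Pow D" "\<And>X. X \<in> \<D> \<Longrightarrow> \<exists>a b. X = cbox a b" "\<Union>\<D> = D"
    using open_eq_countable_Union_cbox[OF assms(1)] by blast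
  show ?thesis
  proof (rule measurable_piecewise_restrict[of \<D>])
    show "countable \<D>" by fact
    show "\<And>\<Omega>. \<Omega> \<in> \<D> \<Longrightarrow> \<Omega> \<inter> space (lebesgue_on D) \<in> sets (lebesgue_on D)"
      using \<D> assms(1) by (fastforce simp: sets_restrict_space_iff)
    show "space (lebesgue_on D) \<subseteq> \<Union> \<D>" using \<D> by simp
    fix X assume X: "X \<in> \<D>"
    then have "compact X" "X \<subseteq> D" using \<D>(2) \<D>(3)[OF X] by auto
    moreover from this have "integrable (lebesgue_on X) u" using assms by (auto simp: locally_integrable_def)
    ultimately show "u \<in> borel_measurable (restrict_space (lebesgue_on D) X)"
      by (simp add: restrict_restrict_space Int_absorb1 assms(1) lmeasurable_compact fmeasurableD)
  qed
qed

lemma test_function_zero_outside: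
  assumes "test_function D \<eta>" "x \<notin> D" "open D"
  shows "\<eta> x = 0" "fderiv \<eta> x b = 0"
proof -
  obtain K where K: "compact K" "K \<subseteq> D" "\<And>x. x \<notin> K \<Longrightarrow> \<eta> x = 0" using assms unfolding test_function_def by auto
  then have x: "x \<notin> K" using assms by auto
  with K show "\<eta> x = 0" by auto
  have "(\<eta> has_derivative (\<lambda>_. 0)) (at x)"
    using K x by (intro has_derivative_transform_within_open[OF has_derivative_const[of 0], of "-K"])
      (auto simp: compact_imp_closed open_Compl)
  then show "fderiv \<eta> x b = 0" using frechet_derivative_at by metis
qed

lemma test_function_C1:
  assumes "test_function D \<eta>"
  shows "Ck 1 \<eta>" "continuous_on UNIV \<eta>" "continuous_on UNIV (\<lambda>x. fderiv \<eta> x b)"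
proof -
  have C: "Ck k \<eta>" for k using assms by (auto simp: test_function_def)
  show "Ck 1 \<eta>" by (rule C)
  show "continuous_on UNIV \<eta>" using C[of 0] by simp
  show "continuous_on UNIV (\<lambda>x. fderiv \<eta> x b)" by (rule Ck_1_derivative_continuous[OF C])
qed

lemma test_function_support:
  assumes "test_function D \<eta>"
  shows "\<exists>K. compact K \<and> K \<subseteq> D \<and> (\<forall>x. x \<notin> K \<longrightarrow> \<eta> x = 0) \<and> (\<forall>x. x \<notin> K \<longrightarrow> fderiv \<eta> x b = 0)"
proof -
  obtain K where K: "compact K" "K \<subseteq> D" "\<And>x. x \<notin> K \<Longrightarrow> \<eta> x = 0"
    using assms unfolding test_function_def by auto
  have "fderiv \<eta> x b = 0" if x: "x \<notin> K" for x
  proof -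
    have "(\<eta> has_derivative (\<lambda>_. 0)) (at x)"
      using K x by (intro has_derivative_transform_within_open[OF has_derivative_const[of 0], of "-K"])
        (auto simp: compact_imp_closed open_Compl)
    then show "fderiv \<eta> x b = 0" using frechet_derivative_at by metis
  qed
  with K show ?thesis by blast
qed

lemma test_integral_restrict:
  fixes u \<psi> :: "'a::euclidean_space \<Rightarrow> real"
  assumes "open D" "open E" "E \<subseteq> D" "\<And>x. x \<notin> E \<Longrightarrow> \<psi> x = 0"
  shows "(LINT x|lebesgue_on D. u x * \<psi> x) = (LINT x|lebesgue_on E. u x * \<psi> x)"
proof -
  have "(\<lambda>x. indicator D x * (u x * \<psi> x)) = (\<lambda>x. indicator E x * (u x * \<psi> x))"
    using assms by (fastforce simp: indicator_def fun_eq_iff)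
  moreover have "D \<in> sets lebesgue" "E \<in> sets lebesgue" using assms by auto
  ultimately show ?thesis by (simp only: lebesgue_on_integral_eq)
qed

lemma has_weak_partial_subset:
  assumes "has_weak_partial D b u g" "open D" "open E" "E \<subseteq> D"
  shows "has_weak_partial E b u g"
  unfolding has_weak_partial_def
proof (intro conjI allI impI)
  show "locally_integrable E u" "locally_integrable E g"
    using assms locally_integrable_subset unfolding has_weak_partial_def by blast+
  fix \<eta> assume \<eta>: "test_function E \<eta>"
  then have "test_function D \<eta>" using assms(4) unfolding test_function_def by blast
  then have "(LINT x|lebesgue_on D. u x * fderiv \<eta> x b) = - (LINT x|lebesgue_on D. g x * \<eta> x)"
    using assms unfolding has_weak_partial_def by blast
  moreover have e1: "(LINT x|lebesgue_on D. u x * fderiv \<eta> x b) = (LINT x|lebesgue_on E. u x * fderiv \<eta> x b)"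
    by (rule test_integral_restrict[OF assms(2,3,4)]) (rule test_function_zero_outside(2)[OF \<eta> _ assms(3)])
  moreover have e2: "(LINT x|lebesgue_on D. g x * \<eta> x) = (LINT x|lebesgue_on E. g x * \<eta> x)"
    by (rule test_integral_restrict[OF assms(2,3,4)]) (rule test_function_zero_outside(1)[OF \<eta> _ assms(3)])
  ultimately show "(LINT x|lebesgue_on E. u x * fderiv \<eta> x b) = - (LINT x|lebesgue_on E. g x * \<eta> x)"
    by linarith
qed

lemma has_weak_partial_lincomb:
  assumes ug: "has_weak_partial D b u g" and vh: "has_weak_partial D b v h" and D: "open D"
  shows "has_weak_partial D b (\<lambda>x. u x + c * v x) (\<lambda>x. g x + c * h x)"
proof -
  have Dl: "D \<in> sets lebesgue" using D by simp
  have li: "locally_integrable D u" "locally_integrable D v" "locally_integrable D g" "locally_integrable D h"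
    using assms unfolding has_weak_partial_def by auto
  show ?thesis unfolding has_weak_partial_def
  proof (intro conjI allI impI)
    show "locally_integrable D (\<lambda>x. u x + c * v x)" "locally_integrable D (\<lambda>x. g x + c * h x)"
      using li unfolding locally_integrable_def by auto
    fix \<eta> assume \<eta>: "test_function D \<eta>"
    obtain K where K: "compact K" "K \<subseteq> D" "\<And>x. x \<notin> K \<Longrightarrow> \<eta> x = 0"
      "\<And>x. x \<notin> K \<Longrightarrow> fderiv \<eta> x b = 0"
      using test_function_support[OF \<eta>, of b] by blast
    note i1 = locally_integrable_mult_support[OF _ Dl test_function_C1(3)[OF \<eta>] K(1,2) K(4)]
    note i2 = locally_integrable_mult_support[OF _ Dl test_function_C1(2)[OF \<eta>] K(1,2) K(3)]
    have "(LINT x|lebesgue_on D. (u x + c * v x) * fderiv \<eta> x b) =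
      (LINT x|lebesgue_on D. u x * fderiv \<eta> x b + c * (v x * fderiv \<eta> x b))"
      by (simp add: algebra_simps)
    also have "\<dots> = - ((LINT x|lebesgue_on D. g x * \<eta> x) + c * (LINT x|lebesgue_on D. h x * \<eta> x))"
      using i1 li ug vh \<eta> unfolding has_weak_partial_def by simp
    also have "\<dots> = - (LINT x|lebesgue_on D. g x * \<eta> x + c * (h x * \<eta> x))"
      using i2 li by simp
    also have "\<dots> = - (LINT x|lebesgue_on D. (g x + c * h x) * \<eta> x)"
      by (simp add: algebra_simps)
    finally show "(LINT x|lebesgue_on D. (u x + c * v x) * fderiv \<eta> x b)
      = - (LINT x|lebesgue_on D. (g x + c * h x) * \<eta> x)" .
  qed
qed

lemma has_weak_partial_diff:
  assumes "has_weak_partial D b u g" "has_weak_partial D b v h" "open D"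
  shows "has_weak_partial D b (\<lambda>x. u x - v x) (\<lambda>x. g x - h x)"
  using has_weak_partial_lincomb[OF assms, of "-1"] by simp

text \<open>The bumps on the box are test functions because the closed box lies in \<open>D\<close>.
  They converge to the indicator of the open box, dominated by \<open>g\<close> on the closed
  box.\<close>

lemma integral_zero_on_box:
  fixes g :: "'a::euclidean_space \<Rightarrow> real"
  assumes D: "open D" and g: "locally_integrable D g"
    and z: "\<And>\<eta>. test_function D \<eta> \<Longrightarrow> (LINT x|lebesgue_on D. g x * \<eta> x) = 0"
    and ab: "cbox a b \<subseteq> D"
  shows "(LINT x|lebesgue. indicator (box a b) x * g x) = 0"
proof -
  have i: "integrable lebesgue (\<lambda>x. indicator (cbox a b) x * g x)"
    using g ab by (simp add: locally_integrable_def lebesgue_on_integrable_iff[symmetric])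
  have m: "(\<lambda>x. indicator (cbox a b) x * g x) \<in> borel_measurable lebesgue"
    using i by (rule borel_measurable_integrable)
  have lim: "(\<lambda>k. LINT x|lebesgue. indicator (cbox a b) x * g x * box_bump (real (Suc k)) a b x) \<longlonglongrightarrow>
      (LINT x|lebesgue. indicator (cbox a b) x * g x * indicator (box a b) x)"
  proof (rule integral_dominated_convergence[where w="\<lambda>x. \<bar>indicator (cbox a b) x * g x\<bar>"])
    have "box_bump k a b \<in> borel_measurable borel" for k
      using Ck_continuous[OF Ck_box_bump] by (rule borel_measurable_continuous_onI)
    then have bm: "box_bump k a b \<in> borel_measurable lebesgue" for k
      by (intro measurable_completion) simp
    show "(\<lambda>x. indicator (cbox a b) x * g x * box_bump (real (Suc k)) a b x) \<in> borel_measurable lebesgue" for k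
      using m bm by (rule borel_measurable_times)
    show "(\<lambda>x. indicator (cbox a b) x * g x * indicator (box a b) x) \<in> borel_measurable lebesgue"
      using m by (rule borel_measurable_times) (rule borel_measurable_indicator, simp)
    show "AE x in lebesgue. (\<lambda>k. indicator (cbox a b) x * g x * box_bump (real (Suc k)) a b x)
       \<longlonglongrightarrow> indicator (cbox a b) x * g x * indicator (box a b) x"
      by (intro AE_I2 tendsto_mult tendsto_const box_bump_tendsto)
    show "AE x in lebesgue. norm (indicator (cbox a b) x * g x * box_bump (real (Suc k)) a b x) \<le> \<bar>indicator (cbox a b) x * g x\<bar>" for k
      using box_bump_bounds[of "real (Suc k)" a b] by (intro AE_I2) (auto simp: abs_mult intro!: mult_left_le)
  qed (use i in simp)
  have zero: "(LINT x|lebesgue. indicator (cbox a b) x * g x * box_bump (real (Suc k)) a b x) = 0" for k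
  proof -
    have "(LINT x|lebesgue_on D. g x * box_bump (real (Suc k)) a b x) = 0"
      by (intro z box_bump_test ab) simp
    moreover have "(\<lambda>x. indicator D x * (g x * box_bump (real (Suc k)) a b x))
        = (\<lambda>x. indicator (cbox a b) x * g x * box_bump (real (Suc k)) a b x)"
    proof
      fix x
      show "indicator D x * (g x * box_bump (real (Suc k)) a b x) = indicator (cbox a b) x * g x * box_bump (real (Suc k)) a b x"
      proof (cases "x \<in> cbox a b")
        case False
        then have "box_bump (real (Suc k)) a b x = 0"
          using box_subset_cbox[of a b] by (subst box_bump_eq_0_iff) auto
        then show ?thesis by simp
      qed (use ab in auto)
    qed
    moreover have "D \<in> sets lebesgue" using D by simp
    ultimately show ?thesis by (simp only: lebesgue_on_integral_eq)
  qed
  from lim have "(LINT x|lebesgue. indicator (cbox a b) x * g x * indicator (box a b) x) = 0"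
    by (simp only: zero LIMSEQ_const_iff)
  moreover have "indicator (cbox a b) x * g x * indicator (box a b) x = indicator (box a b) x * g x" for x
    using box_subset_cbox[of a b] by (auto simp: indicator_def)
  ultimately show ?thesis by simp
qed

text \<open>Fundamental lemma of the calculus of variations. Since \<open>g\<close> is only locally
  integrable, the criterion on box integrals is applied inside one box at a time, and countably many
  boxes cover \<open>D\<close>.\<close>

lemma AE_zero_of_test_integrals:
  fixes g :: "'a::euclidean_space \<Rightarrow> real"
  assumes D: "open D" and g: "locally_integrable D g"
    and z: "\<And>\<eta>. test_function D \<eta> \<Longrightarrow> (LINT x|lebesgue_on D. g x * \<eta> x) = 0"
  shows "AE x in lebesgue_on D. g x = 0"
proof -
  have local: "AE x in lebesgue. x \<in> box c d \<longrightarrow> g x = 0" if cd: "cbox c d \<subseteq> D" for c d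
  proof -
    define h where "h x = indicator (box c d) x * g x" for x
    have i: "integrable (lebesgue_on (cbox c d)) g"
      using g cd unfolding locally_integrable_def by auto
    then have i: "integrable lebesgue h"
      using lebesgue_on_integrable_subset[OF i box_subset_cbox] by (auto simp: integrable_restrict_space h_def[abs_def])
    \<comment> \<open>The criterion on box integrals concerns Borel functions, whereas
      \<open>h\<close> is only Lebesgue measurable.\<close>
    obtain h' where h': "h' \<in> borel_measurable lborel" "AE x in lborel. h x = h' x"
      using completion_ex_borel_measurable_real[OF borel_measurable_integrable[OF i]] by blast
    have ae: "AE x in lebesgue. h x = h' x" using h'(2) by (rule AE_completion)
    have h'l: "h' \<in> borel_measurable lebesgue" using h'(1) by (rule measurable_completion)
    have ib: "integrable lborel h'"
      using i integrable_cong_AE[OF borel_measurable_integrable[OF i] h'l ae] integrable_completion[OF h'(1)] by simp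
    have boxi: "(LINT x|lebesgue. indicator (box a b) x * h x) = 0" for a b
    proof -
      obtain p q where pq: "box a b \<inter> box c d = box p q" using box_Int_box by blast
      have e: "indicator (box a b) x * h x = indicator (box p q) x * g x" for x
        using pq by (auto simp: h_def indicator_def)
      show ?thesis
      proof (cases "box p q = {}")
        case False
        then have "cbox p q = closure (box p q)" by (simp add: closure_box)
        also have "\<dots> \<subseteq> cbox c d" using pq by (intro closure_minimal) (use box_subset_cbox[of c d] in auto)
        finally show ?thesis using integral_zero_on_box[OF D g z, of p q] cd e by auto
      qed (simp add: e)
    qed
    have eqb: "(LINT x|lborel. indicator (box a b) x * h' x) = 0" for a b
    proof -
      have "(LINT x|lborel. indicator (box a b) x * h' x) = (LINT x|lebesgue. indicator (box a b) x * h' x)"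
        using h'(1) by (intro integral_completion[symmetric]) auto
      also have "\<dots> = (LINT x|lebesgue. indicator (box a b) x * h x)"
        using h'l borel_measurable_integrable[OF i] ae
        by (intro integral_cong_AE borel_measurable_times borel_measurable_indicator) auto
      finally show ?thesis using boxi by simp
    qed
    have "(LINT x|lborel. h' x) = (LINT x|lborel. indicator (box c d) x * h' x)"
      using h' by (intro integral_cong_AE) (auto simp: h_def indicator_def)
    then have "AE x in lborel. h' x = 0"
      using eqb by (intro AE_zero_of_box_integrals ib) auto
    then have "AE x in lebesgue. h' x = 0" by (rule AE_completion)
    with ae show ?thesis by eventually_elim (auto simp: h_def indicator_def)
  qed
  obtain \<D> where \<D>: "countable \<D>" "\<D> \<subseteq> Pow D" "\<And>X. X \<in> \<D> \<Longrightarrow> \<exists>a b. X = cbox a b" "\<Union>\<D> = D"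
    using open_eq_countable_Union_cbox[OF D] by blast
  have "AE x in lebesgue. x \<in> X \<longrightarrow> g x = 0" if "X \<in> \<D>" for X
  proof -
    obtain a b where ab: "X = cbox a b" using \<D> \<open>X \<in> \<D>\<close> by blast
    have "cbox a b \<subseteq> D" using \<D>(2) that ab by blast
    moreover have "AE x in lebesgue. x \<notin> cbox a b - box a b"
      using negligible_frontier_interval[of a b] by (simp only: negligible_iff_null_sets AE_not_in)
    ultimately show ?thesis using local[of a b] ab by (auto elim!: eventually_elim2)
  qed
  then have "AE x in lebesgue. \<forall>X\<in>\<D>. x \<in> X \<longrightarrow> g x = 0"
    using \<D>(1) by (subst AE_ball_countable) auto
  then have "AE x in lebesgue. x \<in> D \<longrightarrow> g x = 0"
    by eventually_elim (use \<D>(4) in auto)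
  then show ?thesis using D by (simp add: AE_restrict_space_iff)
qed

lemma has_weak_partial_unique:
  assumes D: "open D" and "has_weak_partial D b u g" "has_weak_partial D b u h"
  shows "AE x in lebesgue_on D. g x = h x"
proof -
  have d: "has_weak_partial D b (\<lambda>x. u x - u x) (\<lambda>x. g x - h x)"
    by (rule has_weak_partial_diff[OF assms(2,3,1)])
  have "AE x in lebesgue_on D. g x - h x = 0"
    using d by (intro AE_zero_of_test_integrals[OF D]) (auto simp: has_weak_partial_def)
  then show ?thesis by simp
qed

lemma weak_partial_works:
  assumes "has_weak_partial D b u g"
  shows "has_weak_partial D b u (weak_partial D b u)"
  unfolding weak_partial_def by (rule someI[of "has_weak_partial D b u", OF assms])

lemma weak_partial_AE:
  assumes "open D" "has_weak_partial D b u g"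
  shows "AE x in lebesgue_on D. weak_partial D b u x = g x"
  by (rule has_weak_partial_unique[OF assms(1) weak_partial_works[OF assms(2)] assms(2)])

lemma l2_norm_weak_partial:
  assumes "open D" "has_weak_partial D b u g"
  shows "L2 D (weak_partial D b u) = L2 D g"
proof (rule l2_norm_cong_AE)
  show "weak_partial D b u \<in> borel_measurable (lebesgue_on D)" "g \<in> borel_measurable (lebesgue_on D)"
    using weak_partial_works[OF assms(2)] assms locally_integrable_measurable
    unfolding has_weak_partial_def by blast+
qed (rule weak_partial_AE[OF assms])

lemma h1_seminorm_eq:
  assumes "open D" "\<And>b. b \<in> Basis \<Longrightarrow> has_weak_partial D b u (g b)"
  shows "h1_seminorm D u = sqrt (\<Sum>b\<in>Basis. (L2 D (g b))\<^sup>2)"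
  unfolding h1_seminorm_def using l2_norm_weak_partial[OF assms(1) assms(2)] by simp

lemma has_weak_partial_cong_AE:
  assumes ug: "has_weak_partial D b u g" and D: "open D"
    and u: "u' \<in> borel_measurable (lebesgue_on D)" "AE x in lebesgue_on D. u x = u' x"
    and g: "g' \<in> borel_measurable (lebesgue_on D)" "AE x in lebesgue_on D. g x = g' x"
  shows "has_weak_partial D b u' g'"
proof -
  have loc: "locally_integrable D f'" if f: "locally_integrable D f"
    "f' \<in> borel_measurable (lebesgue_on D)" "AE x in lebesgue_on D. f x = f' x" for f f'
    unfolding locally_integrable_def
  proof (intro allI impI)
    fix K assume K: "compact K \<and> K \<subseteq> D"
    then have Kl: "K \<in> sets lebesgue" by (simp add: lmeasurable_compact fmeasurableD)
    have i: "integrable (lebesgue_on K) f" using f K by (auto simp: locally_integrable_def)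
    have "AE x in lebesgue_on K. f x = f' x"
      using f(3) K Kl D by (auto simp: AE_restrict_space_iff elim!: eventually_mono)
    moreover have "f' \<in> borel_measurable (lebesgue_on K)"
      using f(2) K measurable_restrict_mono by blast
    ultimately show "integrable (lebesgue_on K) f'"
      using i by (subst integrable_cong_AE[where g=f]) (auto intro: borel_measurable_integrable)
  qed
  have m: "u \<in> borel_measurable (lebesgue_on D)" "g \<in> borel_measurable (lebesgue_on D)"
    using ug D locally_integrable_measurable unfolding has_weak_partial_def by blast+
  show ?thesis unfolding has_weak_partial_def
  proof (intro conjI allI impI)
    show "locally_integrable D u'" "locally_integrable D g'"
      using loc u g ug unfolding has_weak_partial_def by blast+
    fix \<eta> assume \<eta>: "test_function D \<eta>"
    note K = test_function_C1(2,3)[OF \<eta>]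
    have meas: "\<psi> \<in> borel_measurable (lebesgue_on D)" if "continuous_on UNIV \<psi>" for \<psi> :: "'a \<Rightarrow> real"
      by (rule continuous_imp_measurable_on_sets_lebesgue[OF continuous_on_subset[OF that]]) (use D in auto)
    have "(LINT x|lebesgue_on D. u' x * fderiv \<eta> x b) = (LINT x|lebesgue_on D. u x * fderiv \<eta> x b)"
    proof (rule integral_cong_AE)
      show "AE x in lebesgue_on D. u' x * fderiv \<eta> x b = u x * fderiv \<eta> x b"
        using u(2) by eventually_elim simp
    qed (intro borel_measurable_times u(1) m meas[OF K(2)])+
    also have "\<dots> = - (LINT x|lebesgue_on D. g x * \<eta> x)" using ug \<eta> unfolding has_weak_partial_def by blast
    also have "\<dots> = - (LINT x|lebesgue_on D. g' x * \<eta> x)"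
    proof -
      have "(LINT x|lebesgue_on D. g x * \<eta> x) = (LINT x|lebesgue_on D. g' x * \<eta> x)"
      proof (rule integral_cong_AE)
        show "AE x in lebesgue_on D. g x * \<eta> x = g' x * \<eta> x"
          using g(2) by eventually_elim simp
      qed (intro borel_measurable_times g(1) m meas[OF K(1)])+
      then show ?thesis by simp
    qed
    finally show "(LINT x|lebesgue_on D. u' x * fderiv \<eta> x b) = - (LINT x|lebesgue_on D. g' x * \<eta> x)" .
  qed
qed

text \<open>A forward difference quotient integrates to zero by translation invariance. The
  quotients converge to the derivative; by the mean value theorem they are bounded by
  \<open>B\<close>, and since the steps are at most one they vanish outside a fixed ball.\<close>

lemma integral_derivative_compact_support:
  fixes \<psi> :: "'a::euclidean_space \<Rightarrow> real"
  assumes C: "Ck 1 \<psi>" and K: "compact K" "\<And>x. x \<notin> K \<Longrightarrow> \<psi> x = 0"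
  shows "(LINT x|lborel. fderiv \<psi> x b) = 0"
proof -
  let ?D = "\<lambda>x. fderiv \<psi> x b"
  have der: "(\<psi> has_derivative fderiv \<psi> x) (at x)" for x
    using C unfolding Ck_1_iff by (simp add: frechet_derivative_works[symmetric])
  have cont: "continuous_on UNIV \<psi>" using C by (rule Ck_continuous)
  have cD: "continuous_on UNIV ?D" by (rule Ck_1_derivative_continuous[OF C])
  have D0: "?D x = 0" if "x \<notin> K" for x
  proof -
    have "(\<psi> has_derivative (\<lambda>_. 0)) (at x)"
      using K that by (intro has_derivative_transform_within_open[OF has_derivative_const[of 0], of "-K"])
        (auto simp: compact_imp_closed open_Compl)
    then show ?thesis using frechet_derivative_at by metis
  qed
  have "bounded (?D ` K)"
    using cD K by (meson compact_continuous_image compact_imp_bounded continuous_on_subset subset_UNIV)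
  then obtain B where B: "\<And>x. x \<in> K \<Longrightarrow> \<bar>?D x\<bar> \<le> B" "B > 0" unfolding bounded_pos by auto
  have B: "\<bar>?D x\<bar> \<le> B" for x using B D0[of x] by (cases "x \<in> K") auto
  obtain R where R: "R > 0" "K \<subseteq> cball 0 R"
    using compact_imp_bounded[OF K(1)] by (auto simp: bounded_pos subset_iff)
  define q where "q k x = real (Suc k) * (\<psi> (x + (1 / real (Suc k)) *\<^sub>R b) - \<psi> x)" for k x
  have qB: "\<bar>q k x\<bar> \<le> B * indicator (cball 0 (R + norm b)) x" for k x
  proof (cases "x \<in> cball 0 (R + norm b)")
    case True
    have line: "((\<lambda>t. \<psi> (x + t *\<^sub>R b)) has_real_derivative ?D (x + t *\<^sub>R b)) (at t)" for t
    proof -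
      have "((\<lambda>t. \<psi> (x + t *\<^sub>R b)) has_derivative (\<lambda>s. fderiv \<psi> (x + t *\<^sub>R b) (s *\<^sub>R b))) (at t)"
        by (rule has_derivative_compose[of "\<lambda>t. x + t *\<^sub>R b" "\<lambda>s. s *\<^sub>R b", OF _ der]) (auto intro!: derivative_eq_intros)
      then show ?thesis
        by (simp add: has_field_derivative_def linear_cmul[OF has_derivative_linear[OF der]] mult_commute_abs)
    qed
    obtain z where "\<psi> (x + (1 / real (Suc k)) *\<^sub>R b) - \<psi> (x + 0 *\<^sub>R b) = (1 / real (Suc k) - 0) * ?D (x + z *\<^sub>R b)"
      using MVT2[of 0 "1 / real (Suc k)" "\<lambda>t. \<psi> (x + t *\<^sub>R b)" "\<lambda>t. ?D (x + t *\<^sub>R b)"] line by auto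
    then have "q k x = ?D (x + z *\<^sub>R b)" by (simp add: q_def field_simps)
    with B True show ?thesis by simp
  next
    case False
    then have nx: "norm x > R + norm b" by simp
    have "norm ((1 / real (Suc k)) *\<^sub>R b) \<le> 1 * norm b"
      unfolding norm_scaleR by (intro mult_right_mono) auto
    then have "norm (x + (1 / real (Suc k)) *\<^sub>R b) > R"
      using norm_diff_ineq[of x "(1 / real (Suc k)) *\<^sub>R b"] nx by linarith
    then have "x + (1 / real (Suc k)) *\<^sub>R b \<notin> K" using R by auto
    moreover have "norm x > R" using nx norm_ge_zero[of b] by linarith
    then have "x \<notin> K" using R by auto
    ultimately show ?thesis using False K by (simp add: q_def)
  qed
  have intpsi: "integrable lborel \<psi>"
  proof -
    have "integrable lborel (\<lambda>x. indicator K x *\<^sub>R \<psi> x)"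
      using K(1) cont by (intro borel_integrable_compact continuous_on_subset[OF cont]) auto
    moreover have "(\<lambda>x. indicator K x *\<^sub>R \<psi> x) = \<psi>" using K by (fastforce simp: indicator_def fun_eq_iff)
    ultimately show ?thesis by (simp only:)
  qed
  have tr: "integrable lborel (\<lambda>x. \<psi> (x + c))" "(LINT x|lborel. \<psi> (x + c)) = (LINT x|lborel. \<psi> x)" for c
  proof -
    have d: "distr lborel borel (\<lambda>x. x + c) = (lborel :: 'a measure)"
    proof -
      have "(\<lambda>x. x + c) = (+) c" by (auto simp: add.commute)
      then show ?thesis using lborel_distr_plus[of c] by simp
    qed
    have m: "\<psi> \<in> borel_measurable borel" using cont by (rule borel_measurable_continuous_onI)
    show "integrable lborel (\<lambda>x. \<psi> (x + c))"
      using intpsi m by (subst (asm) d[symmetric]) (simp add: integrable_distr_eq)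
    show "(LINT x|lborel. \<psi> (x + c)) = (LINT x|lborel. \<psi> x)"
      using m by (subst (2) d[symmetric]) (simp add: integral_distr)
  qed
  have "(\<lambda>k. LINT x|lborel. q k x) \<longlonglongrightarrow> (LINT x|lborel. ?D x)"
  proof (rule integral_dominated_convergence[where w="\<lambda>x. B * indicator (cball 0 (R + norm b)) x"])
    show "?D \<in> borel_measurable lborel" using cD by (simp add: borel_measurable_continuous_onI)
    have "continuous_on UNIV (q k)" for k
      unfolding q_def by (intro continuous_intros continuous_on_compose2[OF cont]) auto
    then show "\<And>k. q k \<in> borel_measurable lborel" by (simp add: borel_measurable_continuous_onI)
    show "integrable lborel (\<lambda>x. B * indicator (cball 0 (R + norm b)) x :: real)"
      using emeasure_lborel_cball_finite[of 0 "R + norm b"]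
      by (intro integrable_mult_right integrable_real_indicator) auto
    show "AE x in lborel. norm (q k x) \<le> B * indicator (cball 0 (R + norm b)) x" for k
      using qB by (intro AE_I2) simp
    show "AE x in lborel. (\<lambda>k. q k x) \<longlonglongrightarrow> ?D x"
    proof (rule AE_I2)
      fix x
      have "((\<lambda>t. \<psi> (x + t *\<^sub>R b)) has_derivative (\<lambda>s. fderiv \<psi> (x + 0 *\<^sub>R b) (s *\<^sub>R b))) (at 0)"
        by (rule has_derivative_compose[of "\<lambda>t. x + t *\<^sub>R b" "\<lambda>s. s *\<^sub>R b", OF _ der]) (auto intro!: derivative_eq_intros)
      then have "((\<lambda>t. \<psi> (x + t *\<^sub>R b)) has_real_derivative ?D x) (at 0)"
        by (simp add: has_field_derivative_def linear_cmul[OF has_derivative_linear[OF der]] mult_commute_abs)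
      then have "((\<lambda>h. (\<psi> (x + h *\<^sub>R b) - \<psi> x) / h) \<longlongrightarrow> ?D x) (at 0)"
        by (simp add: has_field_derivative_iff)
      moreover have "filterlim (\<lambda>k. 1 / real (Suc k)) (at 0) sequentially"
        using LIMSEQ_inverse_real_of_nat by (auto simp: filterlim_at inverse_eq_divide)
      ultimately have "(\<lambda>k. (\<psi> (x + (1 / real (Suc k)) *\<^sub>R b) - \<psi> x) / (1 / real (Suc k))) \<longlonglongrightarrow> ?D x"
        by (rule filterlim_compose)
      then show "(\<lambda>k. q k x) \<longlonglongrightarrow> ?D x" by (simp add: q_def mult.commute)
    qed
  qed
  moreover have q0: "(LINT x|lborel. q k x) = 0" for k
    using tr intpsi by (simp add: q_def)
  ultimately show ?thesis by (simp only: q0 LIMSEQ_const_iff)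
qed

text \<open>Integration by parts: the product of \<open>u\<close> with a test function has compact
  support, so its derivative integrates to zero, and the product rule splits that integral.\<close>

lemma Ck_1_has_weak_partial:
  fixes u :: "'a::euclidean_space \<Rightarrow> real"
  assumes C: "Ck 1 u" and D: "open D"
  shows "has_weak_partial D b u (\<lambda>x. fderiv u x b)"
  unfolding has_weak_partial_def
proof (intro conjI allI impI)
  have loc: "locally_integrable D f" if "continuous_on UNIV f" for f :: "'a \<Rightarrow> real"
    unfolding locally_integrable_def
  proof (intro allI impI)
    fix K assume K: "compact K \<and> K \<subseteq> D"
    then have "integrable lborel (\<lambda>x. indicator K x *\<^sub>R f x)"
      using borel_integrable_compact[of K f] continuous_on_subset[OF that] by auto
    then have "integrable lebesgue (\<lambda>x. indicator K x *\<^sub>R f x)"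
      using integrable_completion[OF borel_measurable_integrable] by blast
    then show "integrable (lebesgue_on K) f" using K by (simp add: integrable_restrict_space lmeasurable_compact fmeasurableD)
  qed
  have cu: "continuous_on UNIV u" using C by (rule Ck_continuous)
  have cD: "continuous_on UNIV (\<lambda>x. fderiv u x b)" for b by (rule Ck_1_derivative_continuous[OF C])
  show lu: "locally_integrable D u" and lD: "locally_integrable D (\<lambda>x. fderiv u x b)"
    using loc cu cD by auto
  fix \<eta> assume \<eta>: "test_function D \<eta>"
  obtain K' where K': "compact K'" "K' \<subseteq> D" "\<And>x. x \<notin> K' \<Longrightarrow> \<eta> x = 0"
      "\<And>x. x \<notin> K' \<Longrightarrow> fderiv \<eta> x b = 0"
    using test_function_support[OF \<eta>, of b] by blast
  note K = K' test_function_C1(2,3)[OF \<eta>] test_function_C1(1)[OF \<eta>]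
  have der: "(f has_derivative fderiv f x) (at x)" if "Ck 1 f" for f :: "'a \<Rightarrow> real" and x
    using that unfolding Ck_1_iff by (simp add: frechet_derivative_works[symmetric])
  have pd: "((\<lambda>x. u x * \<eta> x) has_derivative (\<lambda>h. u x * fderiv \<eta> x h + fderiv u x h * \<eta> x)) (at x)" for x
    by (rule has_derivative_mult[OF der[OF C] der[OF K(7)]])
  have fd: "fderiv (\<lambda>x. u x * \<eta> x) x h = u x * fderiv \<eta> x h + fderiv u x h * \<eta> x" for x h
    using frechet_derivative_at[OF pd] by metis
  have "Ck 1 (\<lambda>x. u x * \<eta> x)"
    unfolding Ck_1_iff fd using pd Ck_1_derivative_continuous[OF K(7)] cu cD K(5)
    by (auto simp: differentiable_def intro!: continuous_intros)
  then have "(LINT x|lborel. fderiv (\<lambda>x. u x * \<eta> x) x b) = 0"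
    by (rule integral_derivative_compact_support[OF _ K(1)]) (use K in auto)
  then have z: "(LINT x|lebesgue. u x * fderiv \<eta> x b + fderiv u x b * \<eta> x) = 0"
    unfolding fd using cu K(5,6) cD
    by (subst integral_completion) (auto intro!: borel_measurable_continuous_onI continuous_intros)
  note i1 = locally_integrable_mult_support[OF lu _ K(6) K(1,2) K(4)]
  note i2 = locally_integrable_mult_support[OF lD _ K(5) K(1,2) K(3)]
  have "(LINT x|lebesgue_on D. u x * fderiv \<eta> x b + fderiv u x b * \<eta> x) = 0"
  proof -
    have "(\<lambda>x. indicator D x * (u x * fderiv \<eta> x b + fderiv u x b * \<eta> x))
      = (\<lambda>x. u x * fderiv \<eta> x b + fderiv u x b * \<eta> x)"
    proof
      fix x
      show "indicator D x * (u x * fderiv \<eta> x b + fderiv u x b * \<eta> x)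
        = u x * fderiv \<eta> x b + fderiv u x b * \<eta> x"
      proof (cases "x \<in> D")
        case False
        then have "x \<notin> K'" using K(2) by auto
        then show ?thesis using K(3,4) False by simp
      qed simp
    qed
    moreover have "D \<in> sets lebesgue" using D by simp
    ultimately show ?thesis using z by (simp only: lebesgue_on_integral_eq)
  qed
  then show "(LINT x|lebesgue_on D. u x * fderiv \<eta> x b) = - (LINT x|lebesgue_on D. fderiv u x b * \<eta> x)"
    using i1 i2 D by simp
qed

section \<open>Density of continuously differentiable functions\<close>

lemma finite_measure_bounded_lebesgue_on:
  assumes "bounded D" "D \<in> sets lebesgue"
  shows "finite_measure (lebesgue_on D)"
  using assms by (intro finite_measure_lebesgue_on bounded_set_imp_lmeasurable)

lemma nn_integral_lborel_affine:
  fixes f :: "'a::euclidean_space \<Rightarrow> ennreal"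
  assumes c: "c \<noteq> 0" and [measurable]: "f \<in> borel_measurable borel"
  shows "(\<integral>\<^sub>+x. f (t + c *\<^sub>R x)) * ennreal (\<bar>c\<bar> ^ DIM('a)) = (\<integral>\<^sub>+x. f x)"
proof -
  have "(\<integral>\<^sub>+x. f x) = (\<integral>\<^sub>+x. ennreal (\<bar>c\<bar> ^ DIM('a)) * f (t + c *\<^sub>R x))"
    using c by (subst lborel_affine[OF c, of t]) (simp add: nn_integral_density nn_integral_distr)
  then show ?thesis by (simp add: nn_integral_cmult mult.commute)
qed

lemma nn_integral_lborel_translate:
  fixes f :: "'a::euclidean_space \<Rightarrow> ennreal"
  assumes "f \<in> borel_measurable borel"
  shows "(\<integral>\<^sub>+x. f (x + t)) = (\<integral>\<^sub>+x. f x)"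
  using nn_integral_lborel_affine[of 1 f t] assms by (simp add: add.commute)

lemma integral_lborel_affine:
  fixes f :: "'a::euclidean_space \<Rightarrow> real"
  assumes c: "c \<noteq> 0" and f: "integrable lborel f"
  shows "integrable lborel (\<lambda>x. f (t + c *\<^sub>R x))"
    "(LINT x|lborel. f (t + c *\<^sub>R x)) * \<bar>c\<bar> ^ DIM('a) = (LINT x|lborel. f x)"
proof -
  have m: "f \<in> borel_measurable borel" using borel_measurable_integrable[OF f] by simp
  have m': "(\<lambda>x. f (t + c *\<^sub>R x)) \<in> borel_measurable borel" using m by measurable
  have "integrable (density (distr lborel borel (\<lambda>x. t + c *\<^sub>R x)) (\<lambda>_. ennreal (\<bar>c\<bar> ^ DIM('a)))) f"
    using f by (subst (asm) lborel_affine[OF c, of t])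
  then have "integrable (distr lborel borel (\<lambda>x. t + c *\<^sub>R x)) (\<lambda>x. \<bar>c\<bar> ^ DIM('a) * f x)"
    using m by (subst (asm) integrable_density) auto
  then have i: "integrable lborel (\<lambda>x. \<bar>c\<bar> ^ DIM('a) * f (t + c *\<^sub>R x))"
    using m by (subst (asm) integrable_distr_eq) auto
  then show "integrable lborel (\<lambda>x. f (t + c *\<^sub>R x))"
    using c by simp
  have "(LINT x|lborel. f x) = (LINT x|density (distr lborel borel (\<lambda>x. t + c *\<^sub>R x)) (\<lambda>_. ennreal (\<bar>c\<bar> ^ DIM('a))). f x)"
    by (subst lborel_affine[OF c, of t]) simp
  also have "\<dots> = (LINT x|distr lborel borel (\<lambda>x. t + c *\<^sub>R x). \<bar>c\<bar> ^ DIM('a) * f x)"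
    using m by (subst integral_density) auto
  also have "\<dots> = (LINT x|lborel. \<bar>c\<bar> ^ DIM('a) * f (t + c *\<^sub>R x))"
    using m by (subst integral_distr) auto
  finally show "(LINT x|lborel. f (t + c *\<^sub>R x)) * \<bar>c\<bar> ^ DIM('a) = (LINT x|lborel. f x)"
    by (simp add: mult.commute)
qed

lemma l2_dominated_convergence:
  assumes M: "f \<in> borel_measurable M" "\<And>n. g n \<in> borel_measurable M"
    and lim: "AE x in M. (\<lambda>n. g n x) \<longlonglongrightarrow> f x"
    and b: "integrable M B" "\<And>n x. x \<in> space M \<Longrightarrow> (f x - g n x)\<^sup>2 \<le> B x"
  shows "(\<lambda>n. l2_norm M (\<lambda>x. f x - g n x)) \<longlonglongrightarrow> 0"
proof -
  have "(\<lambda>n. LINT x|M. (f x - g n x)\<^sup>2) \<longlonglongrightarrow> (LINT x|M. 0)"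
  proof (rule integral_dominated_convergence[where w=B])
    show "AE x in M. (\<lambda>n. (f x - g n x)\<^sup>2) \<longlonglongrightarrow> 0"
      using lim
    proof eventually_elim
      case (elim x)
      then have "(\<lambda>n. (f x - g n x)\<^sup>2) \<longlonglongrightarrow> (f x - f x)\<^sup>2" by (intro tendsto_intros)
      then show ?case by simp
    qed
  qed (use M b in \<open>auto intro!: AE_I2\<close>)
  then have "(\<lambda>n. sqrt (LINT x|M. (f x - g n x)\<^sup>2)) \<longlonglongrightarrow> sqrt 0"
    by (intro tendsto_real_sqrt) simp
  then show ?thesis by (simp add: l2_norm_def)
qed

lemma l2_truncation:
  assumes "square_integrable M f"
  shows "(\<lambda>n. l2_norm M (\<lambda>x. f x - max (- real n) (min (real n) (f x)))) \<longlonglongrightarrow> 0"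
proof (rule l2_dominated_convergence[where B="\<lambda>x. (f x)\<^sup>2"])
  show "AE x in M. (\<lambda>n. max (- real n) (min (real n) (f x))) \<longlonglongrightarrow> f x"
  proof (rule AE_I2)
    fix x
    have "\<forall>\<^sub>F n in sequentially. real n \<ge> \<bar>f x\<bar>"
      using filterlim_real_sequentially by (simp add: filterlim_at_top)
    then have "\<forall>\<^sub>F n in sequentially. f x = max (- real n) (min (real n) (f x))"
      by eventually_elim auto
    then show "(\<lambda>n. max (- real n) (min (real n) (f x))) \<longlonglongrightarrow> f x"
      by (rule Lim_transform_eventually[OF tendsto_const])
  qed
  show "(f x - max (- real n) (min (real n) (f x)))\<^sup>2 \<le> (f x)\<^sup>2" for n x
  proof -
    have "\<bar>f x - max (- real n) (min (real n) (f x))\<bar> \<le> \<bar>f x\<bar>" by (auto simp: max_def min_def)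
    then show ?thesis by (simp add: abs_le_square_iff)
  qed
qed (use assms in \<open>auto simp: square_integrable_def\<close>)

text \<open>Continuous functions converging a.e. to a measurable function come without an integrable
  bound. Hence \<open>f\<close> is truncated at a level \<open>m\<close> first, and the approximants
  are clamped at the same level, which makes dominated convergence available.\<close>

lemma l2_dense_continuous:
  fixes f :: "'a::euclidean_space \<Rightarrow> real"
  assumes D: "D \<in> sets lebesgue" "bounded D" and f: "inL2 D f" and e: "e > 0"
  shows "\<exists>c. continuous_on UNIV c \<and> bounded (range c) \<and> inL2 D c \<and> L2 D (\<lambda>x. f x - c x) < e"
proof -
  have fin: "finite_measure (lebesgue_on D)" by (rule finite_measure_bounded_lebesgue_on[OF D(2,1)])
  let ?cl = "\<lambda>m x. max (- real m) (min (real m) x)"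
  have "\<forall>\<^sub>F n in sequentially. L2 D (\<lambda>x. f x - ?cl n (f x)) < e / 2"
    using l2_truncation[OF f] e by (intro order_tendstoD) auto
  then obtain m where m: "L2 D (\<lambda>x. f x - ?cl m (f x)) < e / 2"
    by (auto simp: eventually_sequentially)
  have fm: "f \<in> borel_measurable (lebesgue_on D)" using f by (simp add: square_integrable_def)
  have "(\<lambda>x. if x \<in> D then f x else 0) \<in> borel_measurable lebesgue"
    using fm D by (simp add: borel_measurable_if)
  then have "(\<lambda>x. if x \<in> D then f x else 0) measurable_on UNIV"
    by (intro lebesgue_measurable_imp_measurable_on_real) auto
  then obtain N g where N: "negligible N" and g: "\<And>n. continuous_on UNIV (g n)"
    "\<And>x. x \<notin> N \<Longrightarrow> (\<lambda>n. g n x) \<longlonglongrightarrow> (if x \<in> D then f x else 0)"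
    unfolding measurable_on_def by auto
  have gc: "continuous_on UNIV (\<lambda>x. ?cl m (g n x))" for n
    by (intro continuous_intros g)
  have meas: "c \<in> borel_measurable (lebesgue_on D)" if "continuous_on UNIV c" for c :: "'a \<Rightarrow> real"
    by (rule continuous_imp_measurable_on_sets_lebesgue[OF continuous_on_subset[OF that]]) (use D in auto)
  have sqc: "inL2 D (\<lambda>x. ?cl m (g n x))" for n
    by (rule square_integrable_bounded[OF fin meas[OF gc], of _ m]) auto
  have sqf: "inL2 D (\<lambda>x. ?cl m (f x))"
    by (rule square_integrable_bounded[OF fin, of _ m]) (use fm in auto)
  have "(\<lambda>n. L2 D (\<lambda>x. ?cl m (f x) - ?cl m (g n x))) \<longlonglongrightarrow> 0"
  proof (rule l2_dominated_convergence[where B="\<lambda>x. (2 * real m)\<^sup>2"])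
    have "AE x in lebesgue. x \<notin> N" using N by (simp only: negligible_iff_null_sets AE_not_in)
    then have "AE x in lebesgue_on D. x \<notin> N" using D by (auto simp: AE_restrict_space_iff elim: eventually_mono)
    then show "AE x in lebesgue_on D. (\<lambda>n. ?cl m (g n x)) \<longlonglongrightarrow> ?cl m (f x)"
      using AE_space[of "lebesgue_on D"]
    proof eventually_elim
      case (elim x)
      then have "(\<lambda>n. g n x) \<longlonglongrightarrow> f x" using g(2)[of x] by simp
      then show ?case by (intro tendsto_intros)
    qed
    show "integrable (lebesgue_on D) (\<lambda>x. (2 * real m)\<^sup>2)"
      by (rule finite_measure.integrable_const[OF fin])
    show "(?cl m (f x) - ?cl m (g n x))\<^sup>2 \<le> (2 * real m)\<^sup>2" for n x
      by (rule abs_square_le_power2) (auto simp: max_def min_def)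
  qed (use sqc sqf in \<open>auto simp: square_integrable_def\<close>)
  then have "\<forall>\<^sub>F n in sequentially. L2 D (\<lambda>x. ?cl m (f x) - ?cl m (g n x)) < e / 2"
    using e by (intro order_tendstoD) auto
  then obtain n where n: "L2 D (\<lambda>x. ?cl m (f x) - ?cl m (g n x)) < e / 2"
    by (auto simp: eventually_sequentially)
  have "L2 D (\<lambda>x. (f x - ?cl m (f x)) + (?cl m (f x) - ?cl m (g n x)))
     \<le> L2 D (\<lambda>x. f x - ?cl m (f x)) + L2 D (\<lambda>x. ?cl m (f x) - ?cl m (g n x))"
    by (intro l2_norm_triangle square_integrable_diff f sqf sqc)
  with m n have "L2 D (\<lambda>x. f x - ?cl m (g n x)) < e" by simp
  moreover have "bounded (range (\<lambda>x. ?cl m (g n x)))"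
    by (rule boundedI[of _ "real m"]) auto
  ultimately show ?thesis using gc sqc by blast
qed

lemma uniformly_continuous_compact_support:
  fixes f :: "'a::euclidean_space \<Rightarrow> real"
  assumes f: "continuous_on UNIV f" and K: "compact K" "\<And>x. x \<notin> K \<Longrightarrow> f x = 0" and e: "e > 0"
  shows "\<exists>d>0. \<forall>x y. dist x y < d \<longrightarrow> \<bar>f x - f y\<bar> < e"
proof -
  obtain R where R: "R > 0" "K \<subseteq> cball 0 R"
    using compact_imp_bounded[OF K(1)] by (auto simp: bounded_pos subset_iff)
  have "uniformly_continuous_on (cball 0 (R + 1)) f"
    using f by (intro compact_uniformly_continuous continuous_on_subset[OF f]) auto
  then obtain d where d: "d > 0" "\<And>x y. x \<in> cball 0 (R + 1) \<Longrightarrow> y \<in> cball 0 (R + 1) \<Longrightarrow> dist y x < d \<Longrightarrow> dist (f y) (f x) < e"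
    unfolding uniformly_continuous_on_def using e by metis
  have "\<bar>f x - f y\<bar> < e" if xy: "dist x y < min d 1" for x y
  proof (cases "x \<in> cball 0 (R + 1) \<and> y \<in> cball 0 (R + 1)")
    case True
    then show ?thesis using d(2)[of y x] xy by (simp add: dist_real_def)
  next
    case False
    then have "norm x > R" "norm y > R"
      using xy norm_triangle_ineq2[of x y] norm_triangle_ineq3[of x y] by (auto simp: dist_norm)
    then have "x \<notin> K" "y \<notin> K" using R by auto
    then show ?thesis using K e by simp
  qed
  then show ?thesis using d(1) by (intro exI[of _ "min d 1"]) auto
qed

text \<open>The factor \<open>a\<close> is present because the mollifier below moves its kernel with
  (1 - \<delta>) x. Differentiation under the integral rests on the uniform continuity of the
  derivatives of the compactly supported kernel.\<close>

lemma convolution_C1: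
  fixes H f :: "'a::euclidean_space \<Rightarrow> real" and a :: real
  assumes H: "Ck 1 H" and K: "compact K" "\<And>x. x \<notin> K \<Longrightarrow> H x = 0" and f: "integrable lborel f"
  defines "\<Psi> \<equiv> \<lambda>x. LINT z|lborel. H (z - a *\<^sub>R x) * f z"
  shows "Ck 1 \<Psi>" "fderiv \<Psi> x v = - a * (LINT z|lborel. fderiv H (z - a *\<^sub>R x) v * f z)"
proof -
  let ?D = "\<lambda>v x. fderiv H x v"
  have fm [measurable]: "f \<in> borel_measurable borel" using borel_measurable_integrable[OF f] by simp
  have der: "(H has_derivative fderiv H x) (at x)" for x
    using H unfolding Ck_1_iff by (simp add: frechet_derivative_works[symmetric])
  have lin: "linear (fderiv H x)" for x by (rule has_derivative_linear[OF der])
  have D0: "?D v x = 0" if "x \<notin> K" for x v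
  proof -
    have "(H has_derivative (\<lambda>_. 0)) (at x)"
      using K that by (intro has_derivative_transform_within_open[OF has_derivative_const[of 0], of "-K"])
        (auto simp: compact_imp_closed open_Compl)
    then show ?thesis using frechet_derivative_at by metis
  qed
  have cH: "continuous_on UNIV H" using H by (rule Ck_continuous)
  have cD: "continuous_on UNIV (?D v)" for v by (rule Ck_1_derivative_continuous[OF H])
  have int: "integrable lborel (\<lambda>z. F (z - c) * f z)"
    if F: "continuous_on UNIV F" "\<And>x. x \<notin> K \<Longrightarrow> F x = 0" for F :: "'a \<Rightarrow> real" and c
  proof -
    have "bounded (F ` K)"
      using F K by (meson compact_continuous_image compact_imp_bounded continuous_on_subset subset_UNIV)
    then obtain B where B: "B > 0" "\<And>x. x \<in> K \<Longrightarrow> \<bar>F x\<bar> \<le> B" unfolding bounded_pos by auto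
    have B': "\<bar>F x\<bar> \<le> B" for x using B F(2)[of x] by (cases "x \<in> K") auto
    have [measurable]: "F \<in> borel_measurable borel" using F(1) by (rule borel_measurable_continuous_onI)
    show ?thesis
      by (rule Bochner_Integration.integrable_bound[OF integrable_mult_right[OF f, of B]])
        (use B' B(1) in \<open>auto intro!: AE_I2 simp: abs_mult mult_right_mono\<close>)
  qed
  let ?L = "\<lambda>x v. - a * (LINT z|lborel. ?D v (z - a *\<^sub>R x) * f z)"
  have derP: "(\<Psi> has_derivative ?L x) (at x)" for x
    unfolding has_derivative_at_alt
  proof (intro conjI allI impI)
    have "linear (?L x)"
    proof (rule linearI)
      fix v w
      have "(LINT z|lborel. ?D (v + w) (z - a *\<^sub>R x) * f z) = (LINT z|lborel. ?D v (z - a *\<^sub>R x) * f z + ?D w (z - a *\<^sub>R x) * f z)"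
        by (simp add: linear_add[OF lin] algebra_simps)
      also have "\<dots> = (LINT z|lborel. ?D v (z - a *\<^sub>R x) * f z) + (LINT z|lborel. ?D w (z - a *\<^sub>R x) * f z)"
        by (intro Bochner_Integration.integral_add int cD D0)
      finally show "?L x (v + w) = ?L x v + ?L x w" by (simp add: algebra_simps)
    next
      fix r v
      have "(LINT z|lborel. ?D (r *\<^sub>R v) (z - a *\<^sub>R x) * f z) = r * (LINT z|lborel. ?D v (z - a *\<^sub>R x) * f z)"
        by (simp add: linear_cmul[OF lin] mult.assoc)
      then show "?L x (r *\<^sub>R v) = r *\<^sub>R ?L x v" by simp
    qed
    then show "bounded_linear (?L x)" by (rule linear_conv_bounded_linear[THEN iffD1])
    fix e :: real assume e: "e > 0"
    define I where "I = (LINT z|lborel. \<bar>f z\<bar>)"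
    have I: "I \<ge> 0" by (simp add: I_def)
    \<comment> \<open>Chosen so that the sum over the basis, the factor \<open>\<bar>a\<bar>\<close>
      hidden in \<open>q\<close> and the mass \<open>I\<close> of \<open>f\<close> together give at
      most \<open>e\<close>.\<close>
    define e' where "e' = e / (real DIM('a) * (\<bar>a\<bar> + 1) * (I + 1))"
    have e': "e' > 0" using e I by (simp add: e'_def)
    have "\<forall>b\<in>Basis. \<exists>d>0. \<forall>x y. dist x y < d \<longrightarrow> \<bar>?D b x - ?D b y\<bar> < e'"
      using uniformly_continuous_compact_support[OF cD K(1) D0 e'] by blast
    then obtain d where d: "\<And>b. b \<in> Basis \<Longrightarrow> d b > 0"
      "\<And>b x y. b \<in> Basis \<Longrightarrow> dist x y < d b \<Longrightarrow> \<bar>?D b x - ?D b y\<bar> < e'" by metis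
    define d0 where "d0 = Min (d ` Basis)"
    have d0: "d0 > 0" using d by (simp add: d0_def)
    have d0': "d0 \<le> d b" if "b \<in> Basis" for b using that by (simp add: d0_def)
    have pw: "\<bar>H (p + q) - H p - ?D q p\<bar> \<le> real DIM('a) * e' * norm q" if q: "norm q < d0" for p q
    proof -
      have line: "((\<lambda>t. H (p + t *\<^sub>R q)) has_real_derivative ?D q (p + t *\<^sub>R q)) (at t)" for t
      proof -
        have "((\<lambda>t. H (p + t *\<^sub>R q)) has_derivative (\<lambda>s. fderiv H (p + t *\<^sub>R q) (s *\<^sub>R q))) (at t)"
          by (rule has_derivative_compose[of "\<lambda>t. p + t *\<^sub>R q" "\<lambda>s. s *\<^sub>R q", OF _ der]) (auto intro!: derivative_eq_intros)
        then show ?thesis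
          by (simp add: has_field_derivative_def linear_cmul[OF lin] mult_commute_abs)
      qed
      obtain t where t: "0 < t" "t < 1" and "H (p + 1 *\<^sub>R q) - H (p + 0 *\<^sub>R q) = (1 - 0) * ?D q (p + t *\<^sub>R q)"
        using MVT2[of 0 1 "\<lambda>t. H (p + t *\<^sub>R q)" "\<lambda>t. ?D q (p + t *\<^sub>R q)"] line by auto
      then have eq: "H (p + q) - H p - ?D q p = ?D q (p + t *\<^sub>R q) - ?D q p" by simp
      have rep: "?D q x = (\<Sum>b\<in>Basis. (q \<bullet> b) * ?D b x)" for x
      proof -
        have "?D q x = fderiv H x (\<Sum>b\<in>Basis. (q \<bullet> b) *\<^sub>R b)" by (simp add: euclidean_representation)
        also have "\<dots> = (\<Sum>b\<in>Basis. (q \<bullet> b) * ?D b x)" by (simp add: linear_sum[OF lin] linear_cmul[OF lin])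
        finally show ?thesis .
      qed
      have "dist (p + t *\<^sub>R q) p < d0"
        using t q mult_left_le_one_le[of "norm q" t] by (simp add: dist_norm)
      then have b: "\<bar>?D b (p + t *\<^sub>R q) - ?D b p\<bar> \<le> e'" if "b \<in> Basis" for b
        using d(2)[OF that, of "p + t *\<^sub>R q" p] d0'[OF that] by linarith
      have "\<bar>?D q (p + t *\<^sub>R q) - ?D q p\<bar> = \<bar>\<Sum>b\<in>Basis. (q \<bullet> b) * (?D b (p + t *\<^sub>R q) - ?D b p)\<bar>"
        unfolding rep by (simp add: sum_subtractf right_diff_distrib)
      also have "\<dots> \<le> (\<Sum>b\<in>(Basis::'a set). norm q * e')"
        by (rule order_trans[OF sum_abs], rule sum_mono) (auto simp: abs_mult intro!: mult_mono b Basis_le_norm)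
      finally show ?thesis unfolding eq by (simp add: mult_ac)
    qed
    show "\<exists>d>0. \<forall>y. norm (y - x) < d \<longrightarrow> norm (\<Psi> y - \<Psi> x - ?L x (y - x)) \<le> e * norm (y - x)"
    proof (intro exI[of _ "d0 / (\<bar>a\<bar> + 1)"] conjI allI impI)
      show "d0 / (\<bar>a\<bar> + 1) > 0" using d0 by simp
      fix y assume y: "norm (y - x) < d0 / (\<bar>a\<bar> + 1)"
      define q where "q = - a *\<^sub>R (y - x)"
      have "(\<bar>a\<bar> + 1) * norm (y - x) < d0" using y by (simp add: field_simps)
      then have "\<bar>a\<bar> * norm (y - x) + norm (y - x) < d0" by (simp add: algebra_simps)
      then have "\<bar>a\<bar> * norm (y - x) < d0" using norm_ge_zero[of "y - x"] by linarith
      then have nq: "norm q < d0" unfolding q_def norm_scaleR by simp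
      have "\<Psi> y - \<Psi> x - ?L x (y - x) =
        (LINT z|lborel. H (z - a *\<^sub>R y) * f z - H (z - a *\<^sub>R x) * f z - ?D q (z - a *\<^sub>R x) * f z)"
      proof -
        have "?L x (y - x) = (LINT z|lborel. - a * (?D (y - x) (z - a *\<^sub>R x) * f z))" by simp
        also have "\<dots> = (LINT z|lborel. ?D q (z - a *\<^sub>R x) * f z)"
          unfolding q_def by (simp add: linear_cmul[OF lin] linear_neg[OF lin] mult.assoc)
        finally have L: "?L x (y - x) = (LINT z|lborel. ?D q (z - a *\<^sub>R x) * f z)" .
        have i: "integrable lborel (\<lambda>z. H (z - c) * f z)" "integrable lborel (\<lambda>z. ?D q (z - c) * f z)" for c
          by (intro int cH K cD D0; assumption)+
        show ?thesis
          unfolding L \<Psi>_def by (simp add: i)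
      qed
      also have "\<dots> = (LINT z|lborel. (H ((z - a *\<^sub>R x) + q) - H (z - a *\<^sub>R x) - ?D q (z - a *\<^sub>R x)) * f z)"
        by (simp add: q_def algebra_simps)
      finally have "norm (\<Psi> y - \<Psi> x - ?L x (y - x)) \<le> (LINT z|lborel. \<bar>(H ((z - a *\<^sub>R x) + q) - H (z - a *\<^sub>R x) - ?D q (z - a *\<^sub>R x)) * f z\<bar>)"
        using integral_norm_bound[of lborel "\<lambda>z. (H ((z - a *\<^sub>R x) + q) - H (z - a *\<^sub>R x) - ?D q (z - a *\<^sub>R x)) * f z"] by simp
      also have "\<dots> \<le> (LINT z|lborel. real DIM('a) * e' * norm q * \<bar>f z\<bar>)"
      proof (rule integral_mono)
        have "integrable lborel (\<lambda>z. H (z - (a *\<^sub>R x - q)) * f z - H (z - a *\<^sub>R x) * f z - ?D q (z - a *\<^sub>R x) * f z)"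
          by (intro Bochner_Integration.integrable_diff int cH K cD D0)
        then have "integrable lborel (\<lambda>z. (H ((z - a *\<^sub>R x) + q) - H (z - a *\<^sub>R x) - ?D q (z - a *\<^sub>R x)) * f z)"
          by (simp add: algebra_simps)
        then show "integrable lborel (\<lambda>z. \<bar>(H ((z - a *\<^sub>R x) + q) - H (z - a *\<^sub>R x) - ?D q (z - a *\<^sub>R x)) * f z\<bar>)"
          by (rule integrable_abs)
        show "integrable lborel (\<lambda>z. real DIM('a) * e' * norm q * \<bar>f z\<bar>)" using f by simp
      qed (use pw[OF nq] in \<open>auto simp: abs_mult intro!: mult_right_mono\<close>)
      also have "\<dots> = real DIM('a) * e' * norm q * I" by (simp add: I_def)
      also have "\<dots> = e * norm (y - x) * (\<bar>a\<bar> / (\<bar>a\<bar> + 1)) * (I / (I + 1))"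
      proof -
        have "norm q = \<bar>a\<bar> * norm (y - x)" unfolding q_def norm_scaleR by simp
        then show ?thesis using I by (simp add: e'_def)
      qed
      also have "\<dots> \<le> e * norm (y - x) * 1 * 1"
        using I e by (intro mult_mono) (auto simp: field_simps)
      finally show "norm (\<Psi> y - \<Psi> x - ?L x (y - x)) \<le> e * norm (y - x)" by simp
    qed
  qed
  have fd: "fderiv \<Psi> x v = ?L x v" for x v
    by (rule fun_cong[OF frechet_derivative_at[OF derP, symmetric]])
  then show "fderiv \<Psi> x v = ?L x v" by simp
  have "continuous_on UNIV (\<lambda>x. ?L x v)" for v
  proof -
    have "continuous_on UNIV (\<lambda>x. LINT z|lborel. ?D v (z - a *\<^sub>R x) * f z)"
      unfolding continuous_on_iff
    proof (intro ballI allI impI)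
      fix x :: 'a and e :: real assume e: "e > 0"
      define I where "I = (LINT z|lborel. \<bar>f z\<bar>)"
      have I: "I \<ge> 0" by (simp add: I_def)
      obtain d where d: "d > 0" "\<And>x y. dist x y < d \<Longrightarrow> \<bar>?D v x - ?D v y\<bar> < e / (I + 1)"
        using uniformly_continuous_compact_support[OF cD K(1) D0, of "e / (I + 1)" v] e I by auto
      show "\<exists>d>0. \<forall>x'\<in>UNIV. dist x' x < d \<longrightarrow>
          dist (LINT z|lborel. ?D v (z - a *\<^sub>R x') * f z) (LINT z|lborel. ?D v (z - a *\<^sub>R x) * f z) < e"
      proof (intro exI[of _ "d / (\<bar>a\<bar> + 1)"] conjI ballI impI)
        show "d / (\<bar>a\<bar> + 1) > 0" using d by simp
        fix y assume y: "dist y x < d / (\<bar>a\<bar> + 1)"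
        have "(\<bar>a\<bar> + 1) * norm (y - x) < d" using y by (simp add: field_simps dist_norm)
        then have nq: "\<bar>a\<bar> * norm (y - x) < d" by (simp add: algebra_simps) (smt (verit) norm_ge_zero)
        have dd: "dist (z - a *\<^sub>R y) (z - a *\<^sub>R x) < d" for z
        proof -
          have "dist (z - a *\<^sub>R y) (z - a *\<^sub>R x) = norm (a *\<^sub>R (x - y))" by (simp add: dist_norm algebra_simps)
          then show ?thesis using nq by (simp add: norm_minus_commute)
        qed
        have "dist (LINT z|lborel. ?D v (z - a *\<^sub>R y) * f z) (LINT z|lborel. ?D v (z - a *\<^sub>R x) * f z)
          = \<bar>LINT z|lborel. (?D v (z - a *\<^sub>R y) * f z - ?D v (z - a *\<^sub>R x) * f z)\<bar>"
        proof -
          have i: "integrable lborel (\<lambda>z. ?D v (z - c) * f z)" for c by (intro int cD D0; assumption)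
          show ?thesis by (simp add: dist_real_def i)
        qed
        also have "\<dots> \<le> (LINT z|lborel. \<bar>?D v (z - a *\<^sub>R y) * f z - ?D v (z - a *\<^sub>R x) * f z\<bar>)"
          using integral_norm_bound[of lborel "\<lambda>z. ?D v (z - a *\<^sub>R y) * f z - ?D v (z - a *\<^sub>R x) * f z"] by simp
        also have "\<dots> \<le> (LINT z|lborel. e / (I + 1) * \<bar>f z\<bar>)"
        proof (rule integral_mono)
          show "integrable lborel (\<lambda>z. \<bar>?D v (z - a *\<^sub>R y) * f z - ?D v (z - a *\<^sub>R x) * f z\<bar>)"
            by (intro integrable_abs Bochner_Integration.integrable_diff int cD D0)
          show "integrable lborel (\<lambda>z. e / (I + 1) * \<bar>f z\<bar>)" using f by simp
          show "\<bar>?D v (z - a *\<^sub>R y) * f z - ?D v (z - a *\<^sub>R x) * f z\<bar> \<le> e / (I + 1) * \<bar>f z\<bar>" for z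
            using mult_right_mono[OF less_imp_le[OF d(2)[OF dd[of z]]] abs_ge_zero[of "f z"]]
            by (simp only: left_diff_distrib[symmetric] abs_mult)
        qed
        also have "\<dots> = e * (I / (I + 1))" by (simp add: I_def)
        also have "\<dots> < e" using e I by (simp add: field_simps)
        finally show "dist (LINT z|lborel. ?D v (z - a *\<^sub>R y) * f z) (LINT z|lborel. ?D v (z - a *\<^sub>R x) * f z) < e" .
      qed
    qed
    then show ?thesis by (intro continuous_intros)
  qed
  then show "Ck 1 \<Psi>" unfolding Ck_1_iff fd using derP by (auto simp: differentiable_def)
qed

text \<open>The bridge to nonnegative integrals over \<open>lborel\<close>, where the Tonelli
  arguments take place. Such integrals agree for a measure and its completion.\<close>

lemma l2_norm_nn_integral:
  fixes u :: "'a::euclidean_space \<Rightarrow> real"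
  assumes u: "inL2 S u" and S: "S \<in> sets lebesgue"
  shows "ennreal ((L2 S u)\<^sup>2) = (\<integral>\<^sub>+x. indicator S x * ennreal ((u x)\<^sup>2))"
proof -
  have i: "integrable (lebesgue_on S) (\<lambda>x. (u x)\<^sup>2)" using u by (simp add: square_integrable_def)
  have "ennreal ((L2 S u)\<^sup>2) = (\<integral>\<^sup>+x. ennreal ((u x)\<^sup>2) \<partial>lebesgue_on S)"
    unfolding l2_norm_power2 by (rule nn_integral_eq_integral[symmetric, OF i]) simp
  also have "\<dots> = (\<integral>\<^sup>+x. ennreal ((u x)\<^sup>2) * indicator S x \<partial>lebesgue)"
    using S by (simp add: nn_integral_restrict_space)
  also have "\<dots> = (\<integral>\<^sub>+x. indicator S x * ennreal ((u x)\<^sup>2))"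
    by (simp add: nn_integral_completion mult.commute)
  finally show ?thesis .
qed

lemma continuous_square_integrable:
  fixes c :: "'a::euclidean_space \<Rightarrow> real"
  assumes c: "continuous_on UNIV c" and D: "bounded D" "D \<in> sets lebesgue"
  shows "inL2 D c"
proof -
  have "compact (closure D)" using D by (simp add: compact_closure)
  then have "bounded (c ` closure D)"
    using c by (meson compact_continuous_image compact_imp_bounded continuous_on_subset subset_UNIV)
  then obtain B where B: "\<And>x. x \<in> closure D \<Longrightarrow> \<bar>c x\<bar> \<le> B" unfolding bounded_iff by auto
  have m: "c \<in> borel_measurable (lebesgue_on D)"
    by (rule continuous_imp_measurable_on_sets_lebesgue[OF continuous_on_subset[OF c]]) (use D in auto)
  show ?thesis
    by (rule square_integrable_bounded[OF finite_measure_bounded_lebesgue_on[OF D] m, of B])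
      (use B closure_subset in auto)
qed

text \<open>The mollifier integrates against \<open>lborel\<close>, so a Borel version is wanted; it
  vanishes off \<open>D\<close> so that integrals over \<open>D\<close> become integrals over the
  whole space.\<close>

lemma borel_representative:
  fixes f :: "'a::euclidean_space \<Rightarrow> real"
  assumes D: "open D" and f: "f \<in> borel_measurable (lebesgue_on D)"
  shows "\<exists>f'. f' \<in> borel_measurable borel \<and> (\<forall>x. x \<notin> D \<longrightarrow> f' x = 0) \<and> (AE x in lebesgue_on D. f x = f' x)"
proof -
  have "(\<lambda>x. if x \<in> D then f x else 0) \<in> borel_measurable lebesgue"
    using f D by (simp add: borel_measurable_if)
  then obtain g where g: "g \<in> borel_measurable lborel" "AE x in lborel. (if x \<in> D then f x else 0) = g x"
    using completion_ex_borel_measurable_real by blast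
  have "AE x in lebesgue. (if x \<in> D then f x else 0) = g x" using g(2) by (rule AE_completion)
  then have "AE x in lebesgue_on D. f x = indicator D x * g x"
    using D by (auto simp: AE_restrict_space_iff elim!: eventually_mono)
  moreover have "(\<lambda>x. indicator D x * g x) \<in> borel_measurable borel" using g(1) D by simp
  ultimately show ?thesis by (intro exI[of _ "\<lambda>x. indicator D x * g x"]) auto
qed

lemma borel_square_integrable:
  fixes f :: "'a::euclidean_space \<Rightarrow> real"
  assumes f: "f \<in> borel_measurable borel" "\<And>x. x \<notin> D \<Longrightarrow> f x = 0"
    and D: "open D" "bounded D" and sq: "inL2 D f"
  shows "integrable lborel f" "integrable lborel (\<lambda>x. (f x)\<^sup>2)"
proof -
  have Dl: "D \<in> sets lebesgue" using D by simp
  have "integrable (lebesgue_on D) f"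
    by (rule square_integrable_integrable[OF finite_measure_bounded_lebesgue_on[OF D(2) Dl] sq])
  moreover have "(\<lambda>x. indicator D x * f x) = f" "(\<lambda>x. indicator D x * (f x)\<^sup>2) = (\<lambda>x. (f x)\<^sup>2)"
    using f(2) by (auto simp: fun_eq_iff indicator_def)
  ultimately have "integrable lebesgue f" "integrable lebesgue (\<lambda>x. (f x)\<^sup>2)"
    using sq by (simp_all only: square_integrable_def lebesgue_on_integrable_iff[OF Dl])
  then show "integrable lborel f" "integrable lborel (\<lambda>x. (f x)\<^sup>2)"
    using integrable_completion[of f lborel] integrable_completion[of "\<lambda>x. (f x)\<^sup>2" lborel] f(1) by auto
qed

section \<open>Mollification by contraction into a convex set\<close>

abbreviation unit_bump :: "'a::euclidean_space \<Rightarrow> real" where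
  "unit_bump \<equiv> box_bump 1 (- One) One"

definition bump_mass :: "'a::euclidean_space itself \<Rightarrow> real" where
  "bump_mass _ = (LINT y|lborel. unit_bump (y::'a))"

lemma unit_bump_measurable [measurable]: "unit_bump \<in> borel_measurable borel"
  using Ck_continuous[OF Ck_box_bump] by (rule borel_measurable_continuous_onI)

lemma unit_bump_zero: "y \<notin> cbox (- One) One \<Longrightarrow> unit_bump y = 0"
  using box_subset_cbox[of "- One" One] by (auto simp: box_bump_eq_0_iff)

lemma unit_bump_integrable: "integrable lborel (unit_bump :: 'a::euclidean_space \<Rightarrow> real)"
proof (rule Bochner_Integration.integrable_bound[where f="indicator (cbox (- One) (One::'a))"])
  show "integrable lborel (indicator (cbox (- One) (One::'a)) :: 'a \<Rightarrow> real)"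
    by (intro integrable_real_indicator) (auto simp: emeasure_lborel_cbox_eq)
  have "norm (unit_bump (y::'a)) \<le> norm (indicator (cbox (- One) One) y :: real)" for y
    using unit_bump_zero[of y] box_bump_bounds[of 1 "- One" One y] by (cases "y \<in> cbox (- One) One") auto
  then show "AE y in lborel. norm (unit_bump (y::'a)) \<le> norm (indicator (cbox (- One) One) y :: real)" by simp
qed simp

lemma bump_mass_pos: "bump_mass TYPE('a::euclidean_space) > 0"
proof -
  have "bump_mass TYPE('a) \<ge> 0" unfolding bump_mass_def by (simp add: box_bump_bounds)
  moreover have "bump_mass TYPE('a) \<noteq> 0"
  proof
    assume "bump_mass TYPE('a) = 0"
    then have "AE y in lborel. unit_bump (y::'a) = 0"
      using integral_nonneg_eq_0_iff_AE[OF unit_bump_integrable[where 'a='a] AE_I2[OF box_bump_bounds(1)]]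
      by (simp add: bump_mass_def)
    then have "AE y in lborel. (y::'a) \<notin> box (- One) One" by (simp add: box_bump_eq_0_iff)
    then have "emeasure lborel (box (- One) (One::'a)) = 0"
      using AE_iff_measurable[of "box (- One) (One::'a)" lborel "\<lambda>y. y \<notin> box (- One) One"] by simp
    then have "(2::real) ^ DIM('a) \<le> 0" by (simp add: emeasure_lborel_box_eq prod_ennreal ennreal_eq_0_iff inner_simps)
    then show False by (metis not_le zero_less_numeral zero_less_power)
  qed
  ultimately show ?thesis by linarith
qed

text \<open>By substitution this is the bump-weighted mean of \<open>f\<close> over the points (1 -
  \<delta>) x + \<delta> (x0 + \<rho> y) with y in the cube of half side one. If the cube around
  \<open>x0\<close> lies in a convex set, these points stay in the set for every x of the set, so
  approximation works up to the boundary without extending \<open>f\<close>.\<close>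

definition mollify :: "'a::euclidean_space \<Rightarrow> real \<Rightarrow> real \<Rightarrow> ('a \<Rightarrow> real) \<Rightarrow> 'a \<Rightarrow> real" where
  "mollify x0 \<rho> \<delta> f x = (LINT z|lborel. unit_bump ((1 / (\<delta> * \<rho>)) *\<^sub>R (z - (1 - \<delta>) *\<^sub>R x - \<delta> *\<^sub>R x0)) * f z)
      / (bump_mass TYPE('a) * (\<delta> * \<rho>) ^ DIM('a))"

lemma unit_bump_scaled:
  assumes "r > 0"
  shows "unit_bump ((1 / r) *\<^sub>R (z - p)) = box_bump (1 / r) (p - r *\<^sub>R One) (p + r *\<^sub>R One) z"
  unfolding box_bump_def using assms by (intro prod.cong) (auto simp: inner_simps field_simps)

lemma bump_mult_integrable:
  fixes f :: "'a::euclidean_space \<Rightarrow> real"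
  assumes "integrable lborel f"
  shows "integrable lborel (\<lambda>z. unit_bump ((1 / r) *\<^sub>R (z - p)) * f z)"
  by (rule Bochner_Integration.integrable_bound[OF assms])
    (use box_bump_bounds[of 1 "- One" "One::'a"] borel_measurable_integrable[OF assms]
      in \<open>auto intro!: AE_I2 simp: abs_mult mult_left_le_one_le\<close>)

context
  fixes x0 :: "'a::euclidean_space" and \<rho> \<delta> :: real
  assumes \<rho>: "\<rho> > 0" and \<delta>: "0 < \<delta>" "\<delta> < 1"
begin

lemma mollify_C1:
  assumes f: "integrable lborel f"
  shows "Ck 1 (mollify x0 \<rho> \<delta> f)"
    "fderiv (mollify x0 \<rho> \<delta> f) x b = - (1 - \<delta>) *
       (LINT z|lborel. fderiv (\<lambda>z. unit_bump ((1 / (\<delta> * \<rho>)) *\<^sub>R (z - (1 - \<delta>) *\<^sub>R x - \<delta> *\<^sub>R x0))) z b * f z)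
      / (bump_mass TYPE('a) * (\<delta> * \<rho>) ^ DIM('a))"
proof -
  define r where "r = \<delta> * \<rho>"
  have r: "r > 0" using \<rho> \<delta> by (simp add: r_def)
  define H :: "'a \<Rightarrow> real" where "H = box_bump (1 / r) (\<delta> *\<^sub>R x0 - r *\<^sub>R One) (\<delta> *\<^sub>R x0 + r *\<^sub>R One)"
  define c where "c = inverse (bump_mass TYPE('a) * r ^ DIM('a))"
  have H: "H z = unit_bump ((1 / r) *\<^sub>R (z - \<delta> *\<^sub>R x0))" for z
    unfolding H_def by (rule unit_bump_scaled[OF r, symmetric])
  have Hx: "H (z - (1 - \<delta>) *\<^sub>R x) = unit_bump ((1 / r) *\<^sub>R (z - (1 - \<delta>) *\<^sub>R x - \<delta> *\<^sub>R x0))" for x z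
    by (simp add: H)
  have CH: "Ck 1 H" unfolding H_def by (rule Ck_box_bump)
  have H0: "H z = 0" if "z \<notin> cbox (\<delta> *\<^sub>R x0 - r *\<^sub>R One) (\<delta> *\<^sub>R x0 + r *\<^sub>R One)" for z
    unfolding H_def using that r box_subset_cbox by (subst box_bump_eq_0_iff) auto
  have m: "mollify x0 \<rho> \<delta> f = (\<lambda>x. c * (LINT z|lborel. H (z - (1 - \<delta>) *\<^sub>R x) * f z))"
    unfolding mollify_def Hx r_def[symmetric] c_def by (simp add: divide_inverse mult.commute)
  note C = convolution_C1[where a="1 - \<delta>" and K="cbox (\<delta> *\<^sub>R x0 - r *\<^sub>R One) (\<delta> *\<^sub>R x0 + r *\<^sub>R One)", OF CH compact_cbox H0 f]
  show "Ck 1 (mollify x0 \<rho> \<delta> f)" unfolding m by (rule Ck_cmult[OF C(1)])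
  have d: "(\<lambda>x. LINT z|lborel. H (z - (1 - \<delta>) *\<^sub>R x) * f z) differentiable (at x)"
    using C(1) unfolding Ck_1_iff by blast
  have "fderiv (mollify x0 \<rho> \<delta> f) x b = c * fderiv (\<lambda>x. LINT z|lborel. H (z - (1 - \<delta>) *\<^sub>R x) * f z) x b"
    unfolding m using frechet_derivative_at[OF has_derivative_mult_right[OF d[unfolded frechet_derivative_works], of c]]
    by (metis (no_types))
  also have "\<dots> = c * (- (1 - \<delta>) * (LINT z|lborel. fderiv H (z - (1 - \<delta>) *\<^sub>R x) b * f z))"
    using C(2)[of x b] by simp
  also have "(\<lambda>z. fderiv H (z - (1 - \<delta>) *\<^sub>R x) b * f z) =
     (\<lambda>z. fderiv (\<lambda>z. unit_bump ((1 / r) *\<^sub>R (z - (1 - \<delta>) *\<^sub>R x - \<delta> *\<^sub>R x0))) z b * f z)"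
  proof
    fix z
    have "(H has_derivative fderiv H (z - (1 - \<delta>) *\<^sub>R x)) (at (z - (1 - \<delta>) *\<^sub>R x))"
      using CH unfolding Ck_1_iff by (simp add: frechet_derivative_works[symmetric])
    moreover have "((\<lambda>z. z - (1 - \<delta>) *\<^sub>R x) has_derivative (\<lambda>h. h)) (at z)" by (auto intro!: derivative_eq_intros)
    ultimately have "((\<lambda>z. H (z - (1 - \<delta>) *\<^sub>R x)) has_derivative fderiv H (z - (1 - \<delta>) *\<^sub>R x)) (at z)"
      using has_derivative_compose[of "\<lambda>z. z - (1 - \<delta>) *\<^sub>R x" "\<lambda>h. h" z UNIV H] by blast
    then have "fderiv (\<lambda>z. H (z - (1 - \<delta>) *\<^sub>R x)) z = fderiv H (z - (1 - \<delta>) *\<^sub>R x)"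
      using frechet_derivative_at by metis
    then show "fderiv H (z - (1 - \<delta>) *\<^sub>R x) b * f z =
      fderiv (\<lambda>z. unit_bump ((1 / r) *\<^sub>R (z - (1 - \<delta>) *\<^sub>R x - \<delta> *\<^sub>R x0))) z b * f z"
      unfolding Hx by simp
  qed
  finally show "fderiv (mollify x0 \<rho> \<delta> f) x b = - (1 - \<delta>) *
       (LINT z|lborel. fderiv (\<lambda>z. unit_bump ((1 / (\<delta> * \<rho>)) *\<^sub>R (z - (1 - \<delta>) *\<^sub>R x - \<delta> *\<^sub>R x0))) z b * f z)
      / (bump_mass TYPE('a) * (\<delta> * \<rho>) ^ DIM('a))"
    by (simp add: c_def divide_inverse r_def mult.commute)
qed

lemma mollify_average:
  assumes f: "integrable lborel f"
  shows "integrable lborel (\<lambda>y. unit_bump y * f ((1 - \<delta>) *\<^sub>R x + \<delta> *\<^sub>R x0 + (\<delta> * \<rho>) *\<^sub>R y))"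
    "mollify x0 \<rho> \<delta> f x = (LINT y|lborel. unit_bump y * f ((1 - \<delta>) *\<^sub>R x + \<delta> *\<^sub>R x0 + (\<delta> * \<rho>) *\<^sub>R y)) / bump_mass TYPE('a)"
proof -
  define r where "r = \<delta> * \<rho>"
  have r: "r > 0" using \<rho> \<delta> by (simp add: r_def)
  define p where "p = (1 - \<delta>) *\<^sub>R x + \<delta> *\<^sub>R x0"
  have e: "unit_bump ((1 / r) *\<^sub>R ((p + r *\<^sub>R y) - p)) * f (p + r *\<^sub>R y) = unit_bump y * f (p + r *\<^sub>R y)" for y
    using r by simp
  note A = integral_lborel_affine[of r, OF _ bump_mult_integrable[OF f, of r p], of p, unfolded e]
  show "integrable lborel (\<lambda>y. unit_bump y * f ((1 - \<delta>) *\<^sub>R x + \<delta> *\<^sub>R x0 + (\<delta> * \<rho>) *\<^sub>R y))"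
    using A(1) r \<rho> \<delta> by (simp add: p_def r_def)
  have "mollify x0 \<rho> \<delta> f x = (LINT z|lborel. unit_bump ((1 / r) *\<^sub>R (z - p)) * f z) / (bump_mass TYPE('a) * r ^ DIM('a))"
    by (simp add: mollify_def r_def p_def algebra_simps)
  also have "\<dots> = (LINT y|lborel. unit_bump y * f (p + r *\<^sub>R y)) / bump_mass TYPE('a)"
    using A(2) r bump_mass_pos[where 'a='a] by (simp add: field_simps)
  finally show "mollify x0 \<rho> \<delta> f x = (LINT y|lborel. unit_bump y * f ((1 - \<delta>) *\<^sub>R x + \<delta> *\<^sub>R x0 + (\<delta> * \<rho>) *\<^sub>R y)) / bump_mass TYPE('a)"
    by (simp add: p_def r_def)
qed

lemma mollify_Jensen:
  assumes f: "integrable lborel f" "integrable lborel (\<lambda>x. (f x)\<^sup>2)"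
  shows "(mollify x0 \<rho> \<delta> f x)\<^sup>2 \<le> (LINT y|lborel. unit_bump y * (f ((1 - \<delta>) *\<^sub>R x + \<delta> *\<^sub>R x0 + (\<delta> * \<rho>) *\<^sub>R y))\<^sup>2) / bump_mass TYPE('a)"
proof -
  let ?f = "\<lambda>y. f ((1 - \<delta>) *\<^sub>R x + \<delta> *\<^sub>R x0 + (\<delta> * \<rho>) *\<^sub>R y)"
  let ?Z = "bump_mass TYPE('a)"
  define m where "m = mollify x0 \<rho> \<delta> f x"
  have Z: "?Z > 0" by (rule bump_mass_pos)
  have m: "(LINT y|lborel. unit_bump y * ?f y) = m * ?Z"
    unfolding m_def using mollify_average(2)[OF f(1), of x] Z by simp
  have i1: "integrable lborel (\<lambda>y. unit_bump y * ?f y)" by (rule mollify_average(1)[OF f(1)])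
  have i2: "integrable lborel (\<lambda>y. unit_bump y * (?f y)\<^sup>2)" by (rule mollify_average(1)[OF f(2)])
  \<comment> \<open>The weighted variance about \<open>m\<close> is nonnegative; expanding the
    square yields Jensen's inequality.\<close>
  have "0 \<le> (LINT y|lborel. unit_bump y * (?f y - m)\<^sup>2)"
    by (intro Bochner_Integration.integral_nonneg) (auto simp: box_bump_bounds)
  also have "\<dots> = (LINT y|lborel. unit_bump y * (?f y)\<^sup>2 - (2 * m) * (unit_bump y * ?f y) + m\<^sup>2 * unit_bump y)"
    by (intro Bochner_Integration.integral_cong) (auto simp: power2_eq_square algebra_simps)
  also have "\<dots> = (LINT y|lborel. unit_bump y * (?f y)\<^sup>2) - (2 * m) * (m * ?Z) + m\<^sup>2 * ?Z"
    using i1 i2 unit_bump_integrable[where 'a='a] by (simp add: m bump_mass_def[symmetric] bump_mass_def[of "TYPE('a)", symmetric])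
  finally have "m\<^sup>2 * ?Z \<le> (LINT y|lborel. unit_bump y * (?f y)\<^sup>2)" by (simp add: power2_eq_square)
  then show ?thesis using Z by (simp add: m_def field_simps)
qed

text \<open>For a fixed kernel variable y the argument of \<open>f\<close> is a dilation of x by 1 -
  \<delta>; its Jacobian is the extra factor on the left. Jensen and Tonelli reduce the claim to
  this.\<close>

lemma mollify_L2:
  assumes f: "integrable lborel f" "integrable lborel (\<lambda>x. (f x)\<^sup>2)"
  shows "(\<integral>\<^sub>+x. ennreal ((mollify x0 \<rho> \<delta> f x)\<^sup>2)) * ennreal ((1 - \<delta>) ^ DIM('a)) \<le> (\<integral>\<^sub>+x. ennreal ((f x)\<^sup>2))"
proof -
  let ?f = "\<lambda>x y. f ((1 - \<delta>) *\<^sub>R x + \<delta> *\<^sub>R x0 + (\<delta> * \<rho>) *\<^sub>R y)"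
  let ?Z = "bump_mass TYPE('a)"
  have Z: "?Z > 0" by (rule bump_mass_pos)
  have fm [measurable]: "f \<in> borel_measurable borel" using borel_measurable_integrable[OF f(1)] by simp
  have "ennreal ((mollify x0 \<rho> \<delta> f x)\<^sup>2) \<le> (\<integral>\<^sub>+y. ennreal (unit_bump y / ?Z) * ennreal ((?f x y)\<^sup>2))" for x
  proof -
    have "ennreal ((mollify x0 \<rho> \<delta> f x)\<^sup>2) \<le> ennreal ((LINT y|lborel. unit_bump y * (?f x y)\<^sup>2) / ?Z)"
      using mollify_Jensen[OF f] by (rule ennreal_leI)
    also have "\<dots> = ennreal (LINT y|lborel. unit_bump y * (?f x y)\<^sup>2 / ?Z)" by simp
    also have "\<dots> = (\<integral>\<^sub>+y. ennreal (unit_bump y * (?f x y)\<^sup>2 / ?Z))"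
      using Z by (intro nn_integral_eq_integral[symmetric] integrable_divide mollify_average(1)[OF f(2)]) (auto simp: box_bump_bounds)
    also have "\<dots> = (\<integral>\<^sub>+y. ennreal (unit_bump y / ?Z) * ennreal ((?f x y)\<^sup>2))"
      using Z by (intro nn_integral_cong) (auto simp: ennreal_mult[symmetric] box_bump_bounds)
    finally show ?thesis .
  qed
  then have "(\<integral>\<^sub>+x. ennreal ((mollify x0 \<rho> \<delta> f x)\<^sup>2)) \<le> (\<integral>\<^sub>+x. (\<integral>\<^sub>+y. ennreal (unit_bump y / ?Z) * ennreal ((?f x y)\<^sup>2)))"
    by (rule nn_integral_mono)
  also have "\<dots> = (\<integral>\<^sub>+y. (\<integral>\<^sub>+x. ennreal (unit_bump y / ?Z) * ennreal ((?f x y)\<^sup>2)))"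
    by (rule lborel_pair.Fubini') simp
  also have "\<dots> = (\<integral>\<^sub>+y. ennreal (unit_bump y / ?Z) * (\<integral>\<^sub>+x. ennreal ((?f x y)\<^sup>2)))"
    by (intro nn_integral_cong nn_integral_cmult) simp
  finally have "(\<integral>\<^sub>+x. ennreal ((mollify x0 \<rho> \<delta> f x)\<^sup>2)) * ennreal ((1 - \<delta>) ^ DIM('a)) \<le>
     (\<integral>\<^sub>+y. ennreal (unit_bump y / ?Z) * (\<integral>\<^sub>+x. ennreal ((?f x y)\<^sup>2))) * ennreal ((1 - \<delta>) ^ DIM('a))"
    by (rule mult_right_mono) simp
  also have "\<dots> = (\<integral>\<^sub>+y. ennreal (unit_bump y / ?Z) * ((\<integral>\<^sub>+x. ennreal ((?f x y)\<^sup>2)) * ennreal ((1 - \<delta>) ^ DIM('a))))"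
    by (subst nn_integral_multc[symmetric]) (auto simp: mult.assoc)
  also have "\<dots> = (\<integral>\<^sub>+y. ennreal (unit_bump (y::'a) / ?Z) * (\<integral>\<^sub>+x. ennreal ((f x)\<^sup>2)))"
  proof -
    have "(\<integral>\<^sub>+x. ennreal ((?f x y)\<^sup>2)) * ennreal ((1 - \<delta>) ^ DIM('a)) = (\<integral>\<^sub>+x. ennreal ((f x)\<^sup>2))" for y
      using nn_integral_lborel_affine[of "1 - \<delta>" "\<lambda>x. ennreal ((f x)\<^sup>2)" "\<delta> *\<^sub>R x0 + (\<delta> * \<rho>) *\<^sub>R y"] \<delta>
      by (simp add: algebra_simps)
    then show ?thesis by simp
  qed
  also have "\<dots> = (\<integral>\<^sub>+y. ennreal (unit_bump (y::'a) / ?Z)) * (\<integral>\<^sub>+x. ennreal ((f x)\<^sup>2))"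
    by (rule nn_integral_multc) simp
  also have "(\<integral>\<^sub>+y. ennreal (unit_bump (y::'a) / ?Z)) = ennreal (LINT y|lborel. unit_bump (y::'a) / ?Z)"
    using Z by (intro nn_integral_eq_integral integrable_divide unit_bump_integrable) (auto simp: box_bump_bounds)
  also have "\<dots> = 1" using Z unfolding bump_mass_def by simp
  finally show ?thesis by simp
qed

end

lemma mollify_linear:
  assumes "\<rho> > 0" "0 < \<delta>" "\<delta> < 1" "integrable lborel f" "integrable lborel g"
  shows "mollify x0 \<rho> \<delta> (\<lambda>x. f x + g x) x = mollify x0 \<rho> \<delta> f x + mollify x0 \<rho> \<delta> g x"
  using bump_mult_integrable[OF assms(4), of "\<delta> * \<rho>" "(1 - \<delta>) *\<^sub>R x + \<delta> *\<^sub>R x0"]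
    bump_mult_integrable[OF assms(5), of "\<delta> * \<rho>" "(1 - \<delta>) *\<^sub>R x + \<delta> *\<^sub>R x0"]
  by (simp add: mollify_def distrib_left add_divide_distrib diff_diff_add)

lemma in_convex_mollify:
  assumes "convex D" "x \<in> D" "\<And>y. y \<in> cbox (- One) One \<Longrightarrow> x0 + \<rho> *\<^sub>R y \<in> D" "y \<in> cbox (- One) One" "0 < \<delta>" "\<delta> < 1"
  shows "(1 - \<delta>) *\<^sub>R x + \<delta> *\<^sub>R x0 + (\<delta> * \<rho>) *\<^sub>R y \<in> D"
proof -
  have "(1 - \<delta>) *\<^sub>R x + \<delta> *\<^sub>R (x0 + \<rho> *\<^sub>R y) \<in> D"
    using assms by (intro convexD) auto
  then show ?thesis by (simp add: algebra_simps)
qed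

context
  fixes D :: "'a::euclidean_space set" and x0 :: 'a and \<rho> :: real
  assumes D: "open D" "bounded D" "convex D"
    and \<rho>: "\<rho> > 0" and cube: "\<And>y. y \<in> cbox (- One) One \<Longrightarrow> x0 + \<rho> *\<^sub>R y \<in> D"
begin

lemma mollify_continuous_uniform:
  assumes c: "continuous_on UNIV c" and e: "e > 0"
  shows "\<exists>d>0. \<forall>\<delta>. 0 < \<delta> \<and> \<delta> < 1 \<and> \<delta> < d \<longrightarrow> (\<forall>x\<in>D. \<bar>mollify x0 \<rho> \<delta> (\<lambda>x. indicator D x * c x) x - c x\<bar> \<le> e)"
proof -
  let ?Z = "bump_mass TYPE('a)"
  have Z: "?Z > 0" by (rule bump_mass_pos)
  have "compact (closure D)" using D by (simp add: compact_closure)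
  then have "uniformly_continuous_on (closure D) c"
    by (intro compact_uniformly_continuous continuous_on_subset[OF c]) auto
  then obtain d where d: "d > 0" "\<And>x y. x \<in> closure D \<Longrightarrow> y \<in> closure D \<Longrightarrow> dist y x < d \<Longrightarrow> dist (c y) (c x) < e"
    unfolding uniformly_continuous_on_def using e by metis
  obtain R where R: "R > 0" "\<And>x y. x \<in> D \<Longrightarrow> y \<in> D \<Longrightarrow> dist x y \<le> R"
  proof -
    have "dist x y \<le> diameter D + 1" if "x \<in> D" "y \<in> D" for x y
      using diameter_bounded_bound[OF D(2) that] by simp
    moreover have "diameter D + 1 > 0" using diameter_ge_0[OF D(2)] by simp
    ultimately show ?thesis using that by blast
  qed
  have sq: "inL2 D (\<lambda>x. indicator D x * c x)"
  proof (rule square_integrable_cong_AE[OF continuous_square_integrable[OF c D(2)]])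
    show "(\<lambda>x. indicator D x * c x) \<in> borel_measurable (lebesgue_on D)"
      using continuous_square_integrable[OF c D(2)] D(1)
      by (subst measurable_cong[where g=c]) (auto simp: square_integrable_def)
  qed (use D in \<open>auto intro!: AE_I2\<close>)
  have cm: "c \<in> borel_measurable borel" using c by (rule borel_measurable_continuous_onI)
  have int: "integrable lborel (\<lambda>x. indicator D x * c x)"
    by (rule borel_square_integrable(1)[OF _ _ D(1,2) sq]) (use cm D in auto)
  show ?thesis
  \<comment> \<open>The argument of \<open>c\<close> is displaced from \<open>x\<close> by \<delta>
    (x0 + \<rho> y - x), a vector of length at most \<delta> R.\<close>
  proof (intro exI[of _ "d / R"] conjI allI impI ballI)
    show "d / R > 0" using d R by simp
    fix \<delta> x assume \<delta>: "0 < \<delta> \<and> \<delta> < 1 \<and> \<delta> < d / R" and x: "x \<in> D"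
    let ?T = "\<lambda>y. (1 - \<delta>) *\<^sub>R x + \<delta> *\<^sub>R x0 + (\<delta> * \<rho>) *\<^sub>R y"
    have i: "integrable lborel (\<lambda>y. unit_bump y * (indicator D (?T y) * c (?T y)))"
      by (rule mollify_average(1)[OF \<rho> _ _ int]) (use \<delta> in auto)
    have pw: "\<bar>unit_bump y * (indicator D (?T y) * c (?T y)) - unit_bump y * c x\<bar> \<le> e * unit_bump y" for y
    proof (cases "y \<in> cbox (- One) One")
      case True
      have T: "?T y \<in> D" by (rule in_convex_mollify[OF D(3) x cube True]) (use \<delta> in auto)
      have "dist (?T y) x = norm (\<delta> *\<^sub>R ((x0 + \<rho> *\<^sub>R y) - x))" by (simp add: dist_norm algebra_simps)
      also have "\<dots> \<le> \<delta> * R" using R(2)[OF cube[OF True] x] \<delta> by (simp add: dist_norm)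
      also have "\<dots> < d" using \<delta> R by (simp add: field_simps)
      finally have "\<bar>c (?T y) - c x\<bar> \<le> e"
        using d(2)[of x "?T y"] subsetD[OF closure_subset T] subsetD[OF closure_subset x] by (simp add: dist_real_def)
      then have "\<bar>unit_bump y * (c (?T y) - c x)\<bar> \<le> unit_bump y * e"
        using box_bump_bounds(1)[of 1 "- One" One y] by (simp add: abs_mult mult_left_mono)
      then show ?thesis using T by (simp add: right_diff_distrib mult.commute)
    qed (simp add: unit_bump_zero)
    have i2: "integrable lborel (\<lambda>y. unit_bump (y::'a) * c x)" "integrable lborel (\<lambda>y. e * unit_bump (y::'a))"
      by (intro integrable_mult_left integrable_mult_right unit_bump_integrable)+
    have "mollify x0 \<rho> \<delta> (\<lambda>x. indicator D x * c x) x - c x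
       = ((LINT y|lborel. unit_bump y * (indicator D (?T y) * c (?T y))) - (LINT y|lborel. unit_bump (y::'a) * c x)) / ?Z"
      using Z \<delta> by (subst mollify_average(2)[OF \<rho> _ _ int]) (auto simp: bump_mass_def[symmetric] field_simps)
    also have "\<dots> = (LINT y|lborel. unit_bump y * (indicator D (?T y) * c (?T y)) - unit_bump (y::'a) * c x) / ?Z"
      using i i2 by simp
    finally have "\<bar>mollify x0 \<rho> \<delta> (\<lambda>x. indicator D x * c x) x - c x\<bar>
       = \<bar>LINT y|lborel. unit_bump y * (indicator D (?T y) * c (?T y)) - unit_bump (y::'a) * c x\<bar> / ?Z"
      using Z by simp
    also have "\<dots> \<le> (LINT y|lborel. \<bar>unit_bump y * (indicator D (?T y) * c (?T y)) - unit_bump (y::'a) * c x\<bar>) / ?Z"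
      using Z integral_norm_bound[of lborel "\<lambda>y. unit_bump y * (indicator D (?T y) * c (?T y)) - unit_bump (y::'a) * c x"]
      by (intro divide_right_mono) auto
    also have "\<dots> \<le> (LINT y|lborel. e * unit_bump (y::'a)) / ?Z"
      using Z pw i i2 by (intro divide_right_mono integral_mono integrable_abs Bochner_Integration.integrable_diff) auto
    also have "\<dots> = e" using Z unfolding bump_mass_def by simp
    finally show "\<bar>mollify x0 \<rho> \<delta> (\<lambda>x. indicator D x * c x) x - c x\<bar> \<le> e" .
  qed
qed

lemma mollify_tendsto:
  assumes f: "f \<in> borel_measurable borel" "\<And>x. x \<notin> D \<Longrightarrow> f x = 0" "inL2 D f"
  shows "(\<lambda>k. L2 D (\<lambda>x. mollify x0 \<rho> (1 / (real k + 2)) f x - f x)) \<longlonglongrightarrow> 0"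
proof (rule LIMSEQ_I)
  fix e :: real assume e: "e > 0"
  have Dl: "D \<in> sets lebesgue" using D by simp
  \<comment> \<open>For \<delta> at most 1/2 the mollifier has operator norm at most
    \<open>sqrt (2 ^ DIM('a))\<close>; the added 1 accounts for the remainder \<open>h\<close>
    itself. In \<open>V\<close> the added 1 only ensures positivity.\<close>
  define A where "A = sqrt (2 ^ DIM('a)) + 1"
  have A: "A > 0" by (simp add: A_def add_nonneg_pos)
  define V where "V = sqrt (vol D) + 1"
  have V: "V > 0" by (simp add: V_def add_nonneg_pos)
  obtain c where c: "continuous_on UNIV c" "inL2 D c"
      "L2 D (\<lambda>x. f x - c x) < e / (2 * A)"
    using l2_dense_continuous[OF Dl D(2) f(3), of "e / (2 * A)"] e A by auto
  obtain d where d: "d > 0" "\<And>\<delta> x. 0 < \<delta> \<Longrightarrow> \<delta> < 1 \<Longrightarrow> \<delta> < d \<Longrightarrow> x \<in> D \<Longrightarrow> \<bar>mollify x0 \<rho> \<delta> (\<lambda>x. indicator D x * c x) x - c x\<bar> \<le> e / (2 * V)"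
    using mollify_continuous_uniform[OF c(1), of "e / (2 * V)"] e V by auto
  define c0 where "c0 x = indicator D x * c x" for x
  define h where "h x = f x - c0 x" for x
  have cm: "c \<in> borel_measurable borel" using c(1) by (rule borel_measurable_continuous_onI)
  have c0m: "c0 \<in> borel_measurable borel" unfolding c0_def[abs_def] using cm D by simp
  have on_D: "AE x in lebesgue_on D. c x = c0 x" by (intro AE_I2) (auto simp: c0_def)
  have restrm: "g \<in> borel_measurable (lebesgue_on D)" if "g \<in> borel_measurable borel" for g :: "'a \<Rightarrow> real"
    using that by (intro measurable_restrict_space1 measurable_completion) simp
  have c0sq: "inL2 D c0"
    by (rule square_integrable_cong_AE[OF c(2) restrm[OF c0m] on_D])
  have hm: "h \<in> borel_measurable borel" unfolding h_def[abs_def] using f(1) c0m by simp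
  have hsq: "inL2 D h"
    unfolding h_def[abs_def] by (rule square_integrable_diff[OF f(3) c0sq])
  have h0: "x \<notin> D \<Longrightarrow> h x = 0" for x using f(2) by (simp add: h_def c0_def)
  have hint: "integrable lborel h" "integrable lborel (\<lambda>x. (h x)\<^sup>2)"
    by (rule borel_square_integrable[OF hm h0 D(1,2) hsq]; assumption)+
  have c0int: "integrable lborel c0"
    by (rule borel_square_integrable(1)[OF c0m _ D(1,2) c0sq]) (simp add: c0_def)
  have hn: "L2 D h < e / (2 * A)"
  proof -
    have "L2 D h = L2 D (\<lambda>x. f x - c x)"
      using hsq square_integrable_diff[OF f(3) c(2)]
      by (intro l2_norm_cong_AE AE_I2) (auto simp: square_integrable_def h_def c0_def)
    then show ?thesis using c(3) by simp
  qed
  obtain k0 :: nat where k0: "real k0 > 1 / d" using reals_Archimedean2 by blast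
  show "\<exists>no. \<forall>k\<ge>no. norm (L2 D (\<lambda>x. mollify x0 \<rho> (1 / (real k + 2)) f x - f x) - 0) < e"
  proof (intro exI[of _ k0] allI impI)
    fix k assume k: "k \<ge> k0"
    define \<delta> where "\<delta> = 1 / (real k + 2)"
    have \<delta>: "0 < \<delta>" "\<delta> < 1" "\<delta> \<le> 1 / 2" by (auto simp: \<delta>_def field_simps)
    have "1 / d < real k + 2" using k k0 by linarith
    then have \<delta>d: "\<delta> < d" using d(1) by (simp add: \<delta>_def field_simps)
    let ?m = "mollify x0 \<rho> \<delta>"
    have mh: "inL2 D (?m h)" and mc: "inL2 D (?m c0)"
      using Ck_continuous[OF mollify_C1(1)[OF \<rho> \<delta>(1,2)]] hint c0int D Dl
      by (auto intro!: continuous_square_integrable)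
    have eq: "?m f x - f x = ?m h x + ((?m c0 x - c0 x) - h x)" for x
    proof -
      have "?m f x = ?m (\<lambda>x. h x + c0 x) x" by (simp add: h_def)
      then show ?thesis using mollify_linear[OF \<rho> \<delta>(1,2) hint(1) c0int, of x0 x] by (simp add: h_def)
    qed
    have n1: "L2 D (?m h) \<le> sqrt (2 ^ DIM('a)) * L2 D h"
    proof -
      have "ennreal ((L2 D (?m h))\<^sup>2) \<le> (\<integral>\<^sub>+x. ennreal ((?m h x)\<^sup>2))"
        unfolding l2_norm_nn_integral[OF mh Dl] by (intro nn_integral_mono) (auto simp: indicator_def)
      then have "ennreal ((L2 D (?m h))\<^sup>2) * ennreal ((1 - \<delta>) ^ DIM('a))
        \<le> (\<integral>\<^sub>+x. ennreal ((?m h x)\<^sup>2)) * ennreal ((1 - \<delta>) ^ DIM('a))"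
        by (rule mult_right_mono) simp
      also have "\<dots> \<le> (\<integral>\<^sub>+x. ennreal ((h x)\<^sup>2))"
        by (rule mollify_L2[OF \<rho> \<delta>(1,2) hint])
      also have "\<dots> = ennreal ((L2 D h)\<^sup>2)"
        unfolding l2_norm_nn_integral[OF hsq Dl] using h0 by (intro nn_integral_cong) (auto simp: indicator_def)
      finally have "(L2 D (?m h))\<^sup>2 * (1 - \<delta>) ^ DIM('a) \<le> (L2 D h)\<^sup>2"
        using \<delta> by (simp add: ennreal_mult[symmetric])
      moreover have "(L2 D (?m h))\<^sup>2 * (1 / 2) ^ DIM('a) \<le> (L2 D (?m h))\<^sup>2 * (1 - \<delta>) ^ DIM('a)"
        using \<delta> by (intro mult_left_mono power_mono) auto
      ultimately have "(L2 D (?m h))\<^sup>2 * (1 / 2) ^ DIM('a) \<le> (L2 D h)\<^sup>2"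
        by linarith
      then have "(L2 D (?m h))\<^sup>2 \<le> (sqrt (2 ^ DIM('a)) * L2 D h)\<^sup>2"
        by (simp add: power_mult_distrib power_divide field_simps)
      then show ?thesis by (rule power2_le_imp_le) simp
    qed
    have n2: "L2 D (\<lambda>x. ?m c0 x - c0 x) \<le> e / (2 * V) * sqrt (vol D)"
    proof -
      have "L2 D (\<lambda>x. ?m c0 x - c0 x) \<le> e / (2 * V) * sqrt (measure (lebesgue_on D) (space (lebesgue_on D)))"
      proof (rule l2_norm_bounded)
        show "finite_measure (lebesgue_on D)" by (rule finite_measure_bounded_lebesgue_on[OF D(2) Dl])
        show "(\<lambda>x. ?m c0 x - c0 x) \<in> borel_measurable (lebesgue_on D)"
          using square_integrable_diff[OF mc c0sq] by (simp add: square_integrable_def)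
        fix x assume "x \<in> space (lebesgue_on D)"
        then have x: "x \<in> D" by simp
        have "\<bar>?m (\<lambda>x. indicator D x * c x) x - c x\<bar> \<le> e / (2 * V)" by (rule d(2)[OF \<delta>(1,2) \<delta>d x])
        then show "\<bar>?m c0 x - c0 x\<bar> \<le> e / (2 * V)" using x by (simp add: c0_def[abs_def])
      qed
      then show ?thesis using Dl by (simp add: measure_restrict_space)
    qed
    have "L2 D (\<lambda>x. ?m f x - f x) \<le> L2 D (?m h) + L2 D (\<lambda>x. (?m c0 x - c0 x) - h x)"
      unfolding eq by (intro l2_norm_triangle mh square_integrable_diff mc c0sq hsq)
    also have "L2 D (\<lambda>x. (?m c0 x - c0 x) - h x) \<le> L2 D (\<lambda>x. ?m c0 x - c0 x) + L2 D h"
      by (intro l2_norm_triangle_diff square_integrable_diff mc c0sq hsq)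
    finally have "L2 D (\<lambda>x. ?m f x - f x) \<le> A * L2 D h + e / (2 * V) * sqrt (vol D)"
      using n1 n2 by (simp add: A_def algebra_simps)
    also have "\<dots> < A * (e / (2 * A)) + e / (2 * V) * V"
      using hn A V e by (intro add_less_le_mono mult_strict_left_mono mult_left_mono) (auto simp: V_def)
    also have "\<dots> = e" using A V by simp
    finally show "norm (L2 D (\<lambda>x. mollify x0 \<rho> (1 / (real k + 2)) f x - f x) - 0) < e"
      by (simp add: \<delta>_def)
  qed
qed

text \<open>For \<open>x\<close> in \<open>D\<close> the kernel is, as a function of the integration
  variable, a test function of \<open>D\<close>; its derivative can therefore be moved onto
  \<open>g\<close>. The factor 1 - \<delta> is the chain rule for the moving centre (1 - \<delta>)
  x.\<close>

lemma mollify_derivative: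
  assumes w: "w \<in> borel_measurable borel" "\<And>x. x \<notin> D \<Longrightarrow> w x = 0" "inL2 D w"
    and g: "g \<in> borel_measurable borel" "\<And>x. x \<notin> D \<Longrightarrow> g x = 0"
    and wg: "has_weak_partial D b w g" and \<delta>: "0 < \<delta>" "\<delta> < 1" and x: "x \<in> D"
  shows "fderiv (mollify x0 \<rho> \<delta> w) x b = (1 - \<delta>) * mollify x0 \<rho> \<delta> g x"
proof -
  define r where "r = \<delta> * \<rho>"
  have r: "r > 0" using \<rho> \<delta> by (simp add: r_def)
  define p where "p = (1 - \<delta>) *\<^sub>R x + \<delta> *\<^sub>R x0"
  let ?\<eta> = "\<lambda>z. unit_bump ((1 / r) *\<^sub>R (z - p))"
  have \<eta>: "?\<eta> = box_bump (1 / r) (p - r *\<^sub>R One) (p + r *\<^sub>R One)"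
    using unit_bump_scaled[OF r, of _ p] by (simp add: fun_eq_iff)
  have sub: "cbox (p - r *\<^sub>R One) (p + r *\<^sub>R One) \<subseteq> D"
  proof
    fix z assume z: "z \<in> cbox (p - r *\<^sub>R One) (p + r *\<^sub>R One)"
    define y where "y = (1 / r) *\<^sub>R (z - p)"
    have "y \<in> cbox (- One) One"
      unfolding y_def mem_box
    proof (intro ballI conjI)
      fix i :: 'a assume i: "i \<in> Basis"
      then have zi: "p \<bullet> i - r \<le> z \<bullet> i" "z \<bullet> i \<le> p \<bullet> i + r" using z by (auto simp: mem_box inner_simps)
      show "- One \<bullet> i \<le> (1 / r) *\<^sub>R (z - p) \<bullet> i" "(1 / r) *\<^sub>R (z - p) \<bullet> i \<le> One \<bullet> i"
        using zi r i by (auto simp: inner_simps field_simps)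
    qed
    then have "(1 - \<delta>) *\<^sub>R x + \<delta> *\<^sub>R x0 + (\<delta> * \<rho>) *\<^sub>R y \<in> D"
      by (intro in_convex_mollify[OF D(3) x cube _ \<delta>])
    moreover have "(1 - \<delta>) *\<^sub>R x + \<delta> *\<^sub>R x0 + (\<delta> * \<rho>) *\<^sub>R y = z"
      using r by (simp add: y_def p_def[symmetric] r_def[symmetric])
    ultimately show "z \<in> D" by simp
  qed
  have test: "test_function D ?\<eta>" unfolding \<eta> by (rule box_bump_test[OF sub]) (use r in simp)
  have wp: "(LINT z|lebesgue_on D. w z * fderiv ?\<eta> z b) = - (LINT z|lebesgue_on D. g z * ?\<eta> z)"
    using wg test unfolding has_weak_partial_def by blast
  have conv: "(LINT z|lebesgue_on D. v z * \<psi> z) = (LINT z|lborel. \<psi> z * v z)"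
    if v: "v \<in> borel_measurable borel" "\<And>x. x \<notin> D \<Longrightarrow> v x = 0" and \<psi>: "continuous_on UNIV \<psi>" for v \<psi> :: "'a \<Rightarrow> real"
  proof -
    have "(LINT z|lebesgue_on D. v z * \<psi> z) = (LINT z|lebesgue. indicator D z * (v z * \<psi> z))"
      using D by (intro lebesgue_on_integral_eq) simp
    also have "(\<lambda>z. indicator D z * (v z * \<psi> z)) = (\<lambda>z. \<psi> z * v z)" using v(2) by (auto simp: fun_eq_iff indicator_def)
    also have "(LINT z|lebesgue. \<psi> z * v z) = (LINT z|lborel. \<psi> z * v z)"
      using v \<psi> borel_measurable_continuous_onI[OF \<psi>] by (intro integral_completion) simp
    finally show ?thesis .
  qed
  have e1: "(LINT z|lborel. fderiv ?\<eta> z b * w z) = - (LINT z|lborel. ?\<eta> z * g z)"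
    using wp conv[OF w(1,2) test_function_C1(3)[OF test]] conv[OF g test_function_C1(2)[OF test]] by simp
  have wi: "integrable lborel w" by (rule borel_square_integrable(1)[OF w(1,2) D(1,2) w(3)])
  have pe: "z - (1 - \<delta>) *\<^sub>R x - \<delta> *\<^sub>R x0 = z - p" for z by (simp add: p_def)
  show ?thesis
    unfolding mollify_C1(2)[OF \<rho> \<delta> wi] mollify_def[of _ _ _ g] pe r_def[symmetric] e1
    by (simp add: left_diff_distrib diff_divide_distrib)
qed

end

text \<open>The approximants are continuously differentiable on the whole space, not only inside
  \<open>D\<close>; this is what traces on the boundary need.\<close>

theorem H1_density:
  fixes w :: "'a::euclidean_space \<Rightarrow> real"
  assumes D: "open D" "bounded D" "convex D" "D \<noteq> {}"
    and w: "inL2 D w"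
    and g: "\<And>b. b \<in> Basis \<Longrightarrow> has_weak_partial D b w (g b)" "\<And>b. b \<in> Basis \<Longrightarrow> inL2 D (g b)"
  shows "\<exists>u. (\<forall>k. Ck 1 (u k)) \<and> (\<lambda>k. L2 D (\<lambda>x. u k x - w x)) \<longlonglongrightarrow> 0 \<and>
    (\<forall>b\<in>Basis. (\<lambda>k. L2 D (\<lambda>x. fderiv (u k) x b - g b x)) \<longlonglongrightarrow> 0)"
proof -
  have Dl: "D \<in> sets lebesgue" using D by simp
  obtain x0 where x0: "x0 \<in> D" using D(4) by auto
  obtain e where e: "e > 0" "cball x0 e \<subseteq> D" using D(1) x0 open_contains_cball by blast
  \<comment> \<open>The Euclidean norm is at most the sum of the coordinates, so the cube of half
    side \<open>\<rho>\<close> about \<open>x0\<close> lies in the ball of radius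
    \<open>e\<close>.\<close>
  define \<rho> where "\<rho> = e / real DIM('a)"
  have \<rho>: "\<rho> > 0" using e by (simp add: \<rho>_def)
  have cube: "x0 + \<rho> *\<^sub>R y \<in> D" if y: "y \<in> cbox (- One) One" for y
  proof -
    have "norm y \<le> (\<Sum>b\<in>Basis. \<bar>y \<bullet> b\<bar>)" by (rule norm_le_l1)
    also have "\<dots> \<le> (\<Sum>b\<in>(Basis::'a set). 1)" using y by (intro sum_mono) (auto simp: mem_box abs_le_iff)
    finally have "norm y \<le> real DIM('a)" by simp
    then have "\<rho> * norm y \<le> e" using e mult_left_mono[of "norm y" "real DIM('a)" \<rho>] \<rho> by (simp add: \<rho>_def)
    then show ?thesis using e(2) \<rho> by (auto simp: subset_iff dist_norm)
  qed
  have meas: "f \<in> borel_measurable (lebesgue_on D)" if "f \<in> borel_measurable borel" for f :: "'a \<Rightarrow> real"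
    using that by (intro measurable_restrict_space1 measurable_completion) simp
  have "\<exists>f'. f' \<in> borel_measurable borel \<and> (\<forall>x. x \<notin> D \<longrightarrow> f' x = 0) \<and> (AE x in lebesgue_on D. f x = f' x)"
    if "inL2 D f" for f
    using borel_representative[OF D(1)] that by (auto simp: square_integrable_def)
  then obtain rep where rep: "\<And>f. inL2 D f \<Longrightarrow> rep f \<in> borel_measurable borel"
    "\<And>f x. inL2 D f \<Longrightarrow> x \<notin> D \<Longrightarrow> rep f x = 0"
    "\<And>f. inL2 D f \<Longrightarrow> AE x in lebesgue_on D. f x = rep f x"
    by metis
  have repsq: "inL2 D (rep f)" if "inL2 D f" for f
    by (rule square_integrable_cong_AE[OF that meas[OF rep(1)[OF that]] rep(3)[OF that]])
  have repwp: "has_weak_partial D b (rep w) (rep (g b))" if b: "b \<in> Basis" for b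
    by (rule has_weak_partial_cong_AE[OF g(1)[OF b] D(1) meas[OF rep(1)[OF w]] rep(3)[OF w] meas[OF rep(1)[OF g(2)[OF b]]] rep(3)[OF g(2)[OF b]]])
  define u where "u k = mollify x0 \<rho> (1 / (real k + 2)) (rep w)" for k :: nat
  have \<delta>: "0 < 1 / (real k + 2)" "1 / (real k + 2) < 1" for k by (auto simp: field_simps)
  have wi: "integrable lborel (rep f)" if "inL2 D f" for f
    by (rule borel_square_integrable(1)[OF rep(1)[OF that] rep(2)[OF that] D(1,2) repsq[OF that]])
  have C: "Ck 1 (u k)" for k unfolding u_def by (rule mollify_C1(1)[OF \<rho> \<delta> wi[OF w]])
  have sqC: "inL2 D f" if "continuous_on UNIV f" for f
    by (rule continuous_square_integrable[OF that D(2) Dl])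
  have replace: "L2 D (\<lambda>x. v x - rep f x) = L2 D (\<lambda>x. v x - f x)"
    if f: "inL2 D f" and v: "continuous_on UNIV v" for f v
  proof (rule l2_norm_cong_AE)
    show "(\<lambda>x. v x - rep f x) \<in> borel_measurable (lebesgue_on D)" "(\<lambda>x. v x - f x) \<in> borel_measurable (lebesgue_on D)"
      using square_integrable_diff[OF sqC[OF v] repsq[OF f]] square_integrable_diff[OF sqC[OF v] f]
      by (auto simp: square_integrable_def)
    show "AE x in lebesgue_on D. v x - rep f x = v x - f x" using rep(3)[OF f] by eventually_elim simp
  qed
  have lim: "(\<lambda>k. L2 D (\<lambda>x. mollify x0 \<rho> (1 / (real k + 2)) (rep f) x - rep f x)) \<longlonglongrightarrow> 0"
    if f: "inL2 D f" for f
    by (rule mollify_tendsto[OF D(1-3) \<rho> cube rep(1)[OF f] rep(2)[OF f] repsq[OF f]])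
  have "(\<lambda>k. L2 D (\<lambda>x. u k x - w x)) \<longlonglongrightarrow> 0"
    using lim[OF w] unfolding u_def[symmetric] replace[OF w Ck_continuous[OF C]] .
  moreover have "(\<lambda>k. L2 D (\<lambda>x. fderiv (u k) x b - g b x)) \<longlonglongrightarrow> 0" if b: "b \<in> Basis" for b
  proof -
    let ?G = "rep (g b)" and ?m = "\<lambda>k. mollify x0 \<rho> (1 / (real k + 2)) (rep (g b))"
    note gb = g(2)[OF b]
    have Gsq: "inL2 D ?G" by (rule repsq[OF gb])
    have msq: "inL2 D (?m k)" for k
      by (rule sqC[OF Ck_continuous[OF mollify_C1(1)[OF \<rho> \<delta> wi[OF gb]]]])
    \<comment> \<open>The derivative of the mollified function is (1 - \<delta>) times the mollified
      derivative, so its error is (1 - \<delta>) times the mollification error minus \<delta> times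
      the derivative.\<close>
    have bound: "L2 D (\<lambda>x. fderiv (u k) x b - g b x)
      \<le> 2 * L2 D (\<lambda>x. ?m k x - ?G x) + 1 / (real k + 2) * L2 D ?G" for k
    proof -
      let ?\<delta> = "1 / (real k + 2)"
      have "L2 D (\<lambda>x. fderiv (u k) x b - g b x) = L2 D (\<lambda>x. fderiv (u k) x b - ?G x)"
        by (rule replace[OF gb Ck_1_derivative_continuous[OF C], symmetric])
      also have "\<dots> = L2 D (\<lambda>x. (1 - ?\<delta>) * (?m k x - ?G x) - ?\<delta> * ?G x)"
      proof (rule l2_norm_cong_AE)
        show "(\<lambda>x. fderiv (u k) x b - ?G x) \<in> borel_measurable (lebesgue_on D)"
          using square_integrable_diff[OF sqC[OF Ck_1_derivative_continuous[OF C]] Gsq] by (simp add: square_integrable_def)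
        show "(\<lambda>x. (1 - ?\<delta>) * (?m k x - ?G x) - ?\<delta> * ?G x) \<in> borel_measurable (lebesgue_on D)"
          using square_integrable_diff[OF square_integrable_cmult[OF square_integrable_diff[OF msq Gsq]] square_integrable_cmult[OF Gsq]]
          unfolding square_integrable_def by blast
        show "AE x in lebesgue_on D. fderiv (u k) x b - ?G x = (1 - ?\<delta>) * (?m k x - ?G x) - ?\<delta> * ?G x"
        proof (rule AE_I2)
          fix x assume "x \<in> space (lebesgue_on D)"
          then have xD: "x \<in> D" by simp
          have "fderiv (u k) x b = (1 - ?\<delta>) * ?m k x"
            unfolding u_def
          proof (rule mollify_derivative[where D=D])
            show "\<And>y. y \<in> cbox (- One) One \<Longrightarrow> x0 + \<rho> *\<^sub>R y \<in> D" by (rule cube)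
            show "\<And>x. x \<notin> D \<Longrightarrow> rep w x = 0" "\<And>x. x \<notin> D \<Longrightarrow> rep (g b) x = 0"
              using rep(2)[OF w] rep(2)[OF gb] by blast+
          qed (fact D \<rho> rep(1)[OF w] repsq[OF w] rep(1)[OF gb] repwp[OF b] \<delta> xD)+
          then show "fderiv (u k) x b - ?G x = (1 - ?\<delta>) * (?m k x - ?G x) - ?\<delta> * ?G x"
            by (simp add: algebra_simps)
        qed
      qed
      also have "\<dots> \<le> L2 D (\<lambda>x. (1 - ?\<delta>) * (?m k x - ?G x)) + L2 D (\<lambda>x. ?\<delta> * ?G x)"
        by (intro l2_norm_triangle_diff square_integrable_cmult square_integrable_diff msq Gsq)
      also have "\<dots> = \<bar>1 - ?\<delta>\<bar> * L2 D (\<lambda>x. ?m k x - ?G x) + \<bar>?\<delta>\<bar> * L2 D ?G"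
        by (simp only: l2_norm_cmult)
      also have "\<dots> \<le> 2 * L2 D (\<lambda>x. ?m k x - ?G x) + ?\<delta> * L2 D ?G"
      proof -
        have "\<bar>1 - d\<bar> * A + \<bar>d\<bar> * B \<le> 2 * A + d * B" if "0 < d" "d < 1" "A \<ge> 0" for d A B :: real
          using that by (simp add: mult_right_mono)
        from this[OF \<delta>[of k] l2_norm_nonneg] show ?thesis .
      qed
      finally show ?thesis .
    qed
    have t: "(\<lambda>k. 1 / (real k + 2)) \<longlonglongrightarrow> 0"
      using LIMSEQ_ignore_initial_segment[OF lim_1_over_n[where 'a=real], of 2] by (simp add: add.commute)
    have "(\<lambda>k. 2 * L2 D (\<lambda>x. ?m k x - ?G x) + 1 / (real k + 2) * L2 D ?G) \<longlonglongrightarrow> 2 * 0 + 0 * L2 D ?G"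
      by (rule tendsto_add[OF tendsto_mult[OF tendsto_const lim[OF gb]] tendsto_mult[OF t tendsto_const]])
    then show ?thesis
      by (intro tendsto_sandwich[OF always_eventually[OF allI[OF l2_norm_nonneg]] always_eventually[OF allI[OF bound]] tendsto_const]) simp
  qed
  ultimately show ?thesis using C by blast
qed

section \<open>The Poincare inequality on convex sets\<close>

lemma Ck_1_line_deriv:
  assumes "Ck 1 u"
  shows "((\<lambda>t. u (y + t *\<^sub>R v)) has_real_derivative fderiv u (y + t *\<^sub>R v) v) (at t)"
proof -
  have der: "(u has_derivative fderiv u x) (at x)" for x
    using assms unfolding Ck_1_iff by (simp add: frechet_derivative_works[symmetric])
  have "((\<lambda>t. u (y + t *\<^sub>R v)) has_derivative (\<lambda>s. fderiv u (y + t *\<^sub>R v) (s *\<^sub>R v))) (at t)"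
    by (rule has_derivative_compose[of "\<lambda>t. y + t *\<^sub>R v" "\<lambda>s. s *\<^sub>R v", OF _ der]) (auto intro!: derivative_eq_intros)
  then show ?thesis
    by (simp add: has_field_derivative_def linear_cmul[OF has_derivative_linear[OF der]] mult_commute_abs)
qed

text \<open>The fundamental theorem of calculus along the ray, followed by Cauchy-Schwarz against
  the indicator of \<open>{0..t}\<close>, which produces the factor \<open>t\<close>.\<close>

lemma Ck_1_line_estimate:
  fixes u :: "'a::euclidean_space \<Rightarrow> real"
  assumes u: "Ck 1 u" and t: "0 \<le> t"
  shows "ennreal ((u (y + t *\<^sub>R v) - u y)\<^sup>2) \<le>
    ennreal t * (\<integral>\<^sub>+s. indicator {0..t} s * ennreal ((fderiv u (y + s *\<^sub>R v) v)\<^sup>2))"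
proof -
  let ?f = "\<lambda>s. fderiv u (y + s *\<^sub>R v) v"
  have cont: "continuous_on UNIV ?f"
    by (rule continuous_on_compose2[OF Ck_1_derivative_continuous[OF u]]) (auto intro!: continuous_intros)
  have ftc: "(LINT s|lborel. ?f s * indicator {0..t} s) = u (y + t *\<^sub>R v) - u (y + 0 *\<^sub>R v)"
    by (rule integral_FTC_Icc_real[OF t])
      (use Ck_1_line_deriv[OF u] cont in \<open>auto simp: continuous_on_eq_continuous_at\<close>)
  have ind: "square_integrable lborel (indicator {0..t} :: real \<Rightarrow> real)"
    unfolding square_integrable_def by (auto simp: power2_eq_square indicator_inter_arith[symmetric] emeasure_lborel_Icc_eq)
  have i2: "integrable lborel (\<lambda>s. indicator {0..t} s *\<^sub>R (?f s)\<^sup>2)"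
    by (rule borel_integrable_compact) (auto intro!: continuous_intros continuous_on_subset[OF cont])
  have fm [measurable]: "?f \<in> borel_measurable borel" using cont by (rule borel_measurable_continuous_onI)
  have e: "(?f s * indicator {0..t} s)\<^sup>2 = indicator {0..t} s *\<^sub>R (?f s)\<^sup>2" for s
    by (auto simp: indicator_def)
  have fi: "square_integrable lborel (\<lambda>s. ?f s * indicator {0..t} s)"
    unfolding square_integrable_def e using i2 by simp
  have l1: "(l2_norm lborel (indicator {0..t} :: real \<Rightarrow> real))\<^sup>2 = t"
    using t unfolding l2_norm_power2 by (simp add: power2_eq_square indicator_inter_arith[symmetric])
  have "\<bar>LINT s|lborel. indicator {0..t} s * (?f s * indicator {0..t} s)\<bar>
      \<le> l2_norm lborel (indicator {0..t} :: real \<Rightarrow> real) * l2_norm lborel (\<lambda>s. ?f s * indicator {0..t} s)"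
    by (rule l2_Cauchy_Schwarz[OF ind fi])
  moreover have "(LINT s|lborel. indicator {0..t} s * (?f s * indicator {0..t} s)) = u (y + t *\<^sub>R v) - u y"
  proof -
    have "(\<lambda>s. indicator {0..t} s * (?f s * indicator {0..t} s)) = (\<lambda>s. ?f s * indicator {0..t} s)"
      by (auto simp: fun_eq_iff indicator_def)
    then show ?thesis using ftc by simp
  qed
  ultimately have "(u (y + t *\<^sub>R v) - u y)\<^sup>2 \<le> (l2_norm lborel (indicator {0..t} :: real \<Rightarrow> real) * l2_norm lborel (\<lambda>s. ?f s * indicator {0..t} s))\<^sup>2"
    by (intro abs_square_le_power2) simp
  also have "\<dots> = t * (LINT s|lborel. indicator {0..t} s *\<^sub>R (?f s)\<^sup>2)"
    unfolding power_mult_distrib l1 by (simp only: l2_norm_power2 e)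
  finally have "ennreal ((u (y + t *\<^sub>R v) - u y)\<^sup>2) \<le> ennreal (t * (LINT s|lborel. indicator {0..t} s *\<^sub>R (?f s)\<^sup>2))"
    by (rule ennreal_leI)
  also have "\<dots> = ennreal t * ennreal (LINT s|lborel. indicator {0..t} s *\<^sub>R (?f s)\<^sup>2)"
    using t by (rule ennreal_mult) simp
  also have "ennreal (LINT s|lborel. indicator {0..t} s *\<^sub>R (?f s)\<^sup>2) = (\<integral>\<^sub>+s. ennreal (indicator {0..t} s *\<^sub>R (?f s)\<^sup>2))"
    by (rule nn_integral_eq_integral[OF i2, symmetric]) simp
  also have "\<dots> = (\<integral>\<^sub>+s. indicator {0..t} s * ennreal ((?f s)\<^sup>2))"
    by (intro nn_integral_cong) (auto simp: indicator_def)
  finally show ?thesis .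
qed

definition grad_sq :: "('a::euclidean_space \<Rightarrow> real) \<Rightarrow> 'a \<Rightarrow> real" where
  "grad_sq u x = (\<Sum>b\<in>Basis. (fderiv u x b)\<^sup>2)"

lemma grad_sq_nonneg: "0 \<le> grad_sq u x"
  by (simp add: grad_sq_def sum_nonneg)

lemma grad_sq_measurable:
  assumes "Ck 1 u" shows "grad_sq u \<in> borel_measurable borel"
proof -
  have "continuous_on UNIV (grad_sq u)"
    unfolding grad_sq_def[abs_def] by (intro continuous_intros Ck_1_derivative_continuous[OF assms])
  then show ?thesis by (rule borel_measurable_continuous_onI)
qed

lemma derivative_le_grad_sq:
  assumes "Ck 1 u"
  shows "(fderiv u x v)\<^sup>2 \<le> (norm v)\<^sup>2 * grad_sq u x"
proof -
  have lin: "linear (fderiv u x)"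
    using assms by (auto intro: linear_frechet_derivative)
  have "fderiv u x v = fderiv u x (\<Sum>b\<in>Basis. (v \<bullet> b) *\<^sub>R b)"
    by (simp add: euclidean_representation)
  also have "\<dots> = (\<Sum>b\<in>Basis. (v \<bullet> b) * fderiv u x b)"
    by (simp add: linear_sum[OF lin] linear_cmul[OF lin])
  finally have "(fderiv u x v)\<^sup>2 = (\<Sum>b\<in>Basis. (v \<bullet> b) * fderiv u x b)\<^sup>2" by simp
  also have "\<dots> \<le> (\<Sum>b\<in>Basis. (v \<bullet> b)\<^sup>2) * (\<Sum>b\<in>Basis. (fderiv u x b)\<^sup>2)"
    by (rule Cauchy_Schwarz_ineq_sum)
  also have "(\<Sum>b\<in>Basis. (v \<bullet> b)\<^sup>2) = (norm v)\<^sup>2"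
    unfolding power2_norm_eq_inner using euclidean_inner[of v v] by (simp add: power2_eq_square)
  finally show ?thesis by (simp add: grad_sq_def)
qed

text \<open>For s at least 1/2 the integration in y is a dilation with Jacobian at least 2^(-n). For
  s below 1/2 the two variables exchange roles, which avoids the degenerate Jacobian at s =
  0.\<close>

lemma nn_integral_convex_combination_le:
  fixes g :: "'a::euclidean_space \<Rightarrow> ennreal"
  assumes [measurable]: "g \<in> borel_measurable borel" "K \<in> sets borel" and s: "0 \<le> s" "s \<le> 1"
  shows "(\<integral>\<^sub>+x. \<integral>\<^sub>+y. indicator K x * indicator K y * g ((1 - s) *\<^sub>R x + s *\<^sub>R y))
     \<le> 2 ^ DIM('a) * emeasure lborel K * (\<integral>\<^sub>+x. g x)"
proof -
  have A: "(\<integral>\<^sub>+x. \<integral>\<^sub>+y. indicator K x * indicator K y * g (r *\<^sub>R x + s *\<^sub>R y))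
     \<le> 2 ^ DIM('a) * emeasure lborel K * (\<integral>\<^sub>+x. g x)" if s: "s \<ge> 1 / 2" for r s :: real
  proof -
    have "(\<integral>\<^sub>+y. g (r *\<^sub>R x + s *\<^sub>R y)) \<le> 2 ^ DIM('a) * (\<integral>\<^sub>+x. g x)" for x
    proof -
      have "(\<integral>\<^sub>+y. g (r *\<^sub>R x + s *\<^sub>R y)) = (\<integral>\<^sub>+y. g (r *\<^sub>R x + s *\<^sub>R y)) * ennreal ((1/2) ^ DIM('a)) * ennreal (2 ^ DIM('a))"
        by (simp add: mult.assoc ennreal_mult[symmetric] power_mult_distrib[symmetric])
      also have "\<dots> \<le> (\<integral>\<^sub>+y. g (r *\<^sub>R x + s *\<^sub>R y)) * ennreal (\<bar>s\<bar> ^ DIM('a)) * ennreal (2 ^ DIM('a))"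
        using s by (intro mult_mono ennreal_leI power_mono) auto
      also have "\<dots> = (\<integral>\<^sub>+x. g x) * ennreal (2 ^ DIM('a))"
        using s by (subst nn_integral_lborel_affine) auto
      also have "ennreal (2 ^ DIM('a)) = 2 ^ DIM('a)" by (simp add: ennreal_power[symmetric])
      finally show ?thesis by (simp add: mult.commute)
    qed
    then have "(\<integral>\<^sub>+y. indicator K x * indicator K y * g (r *\<^sub>R x + s *\<^sub>R y)) \<le> indicator K x * (2 ^ DIM('a) * (\<integral>\<^sub>+x. g x))" for x
    proof -
      have "(\<integral>\<^sub>+y. indicator K x * indicator K y * g (r *\<^sub>R x + s *\<^sub>R y)) \<le> (\<integral>\<^sub>+y. indicator K x * g (r *\<^sub>R x + s *\<^sub>R y))"
        by (intro nn_integral_mono) (auto simp: indicator_def)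
      also have "\<dots> = indicator K x * (\<integral>\<^sub>+y. g (r *\<^sub>R x + s *\<^sub>R y))" by (rule nn_integral_cmult) simp
      also have "\<dots> \<le> indicator K x * (2 ^ DIM('a) * (\<integral>\<^sub>+x. g x))"
        using \<open>\<And>x. (\<integral>\<^sub>+y. g (r *\<^sub>R x + s *\<^sub>R y)) \<le> 2 ^ DIM('a) * (\<integral>\<^sub>+x. g x)\<close> by (intro mult_left_mono) auto
      finally show ?thesis .
    qed
    then have "(\<integral>\<^sub>+x. \<integral>\<^sub>+y. indicator K x * indicator K y * g (r *\<^sub>R x + s *\<^sub>R y))
      \<le> (\<integral>\<^sub>+x. indicator K x * (2 ^ DIM('a) * (\<integral>\<^sub>+x. g x)))"
      by (intro nn_integral_mono) simp
    also have "\<dots> = emeasure lborel K * (2 ^ DIM('a) * (\<integral>\<^sub>+x. g x))"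
      by (subst nn_integral_multc) auto
    finally show ?thesis by (simp add: mult_ac)
  qed
  show ?thesis
  proof (cases "s \<ge> 1 / 2")
    case True
    then show ?thesis by (rule A)
  next
    case False
    have "(\<integral>\<^sub>+x. \<integral>\<^sub>+y. indicator K x * indicator K y * g ((1 - s) *\<^sub>R x + s *\<^sub>R y))
      = (\<integral>\<^sub>+y. \<integral>\<^sub>+x. indicator K x * indicator K y * g ((1 - s) *\<^sub>R x + s *\<^sub>R y))"
      by (rule lborel_pair.Fubini') simp
    also have "\<dots> = (\<integral>\<^sub>+x. \<integral>\<^sub>+y. indicator K x * indicator K y * g (s *\<^sub>R x + (1 - s) *\<^sub>R y))"
      by (simp add: ac_simps)
    also have "\<dots> \<le> 2 ^ DIM('a) * emeasure lborel K * (\<integral>\<^sub>+x. g x)"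
      by (rule A) (use False in simp)
    finally show ?thesis .
  qed
qed

text \<open>The line estimate is used on the segment from x to y, which convexity keeps in
  \<open>K\<close>. Tonelli then moves the segment parameter outside, where the preceding bound is
  uniform in it.\<close>

lemma difference_double_integral_le:
  fixes u :: "'a::euclidean_space \<Rightarrow> real"
  assumes u: "Ck 1 u" and K: "open K" "convex K" "bounded K"
  shows "(\<integral>\<^sub>+x. \<integral>\<^sub>+y. indicator K x * indicator K y * ennreal ((u y - u x)\<^sup>2))
    \<le> ennreal ((diameter K)\<^sup>2) * (2 ^ DIM('a) * emeasure lborel K * (\<integral>\<^sub>+x. indicator K x * ennreal (grad_sq u x)))"
proof -
  define g where "g x = indicator K x * ennreal (grad_sq u x)" for x
  have Kb [measurable]: "K \<in> sets borel" using K by simp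
  have [measurable]: "grad_sq u \<in> borel_measurable borel" by (rule grad_sq_measurable[OF u])
  have gm [measurable]: "g \<in> borel_measurable borel" unfolding g_def[abs_def] by measurable
  let ?d = "ennreal ((diameter K)\<^sup>2)"
  have pw: "indicator K x * indicator K y * ennreal ((u y - u x)\<^sup>2) \<le>
     (\<integral>\<^sub>+s. indicator {0..1::real} s * (?d * (indicator K x * indicator K y * g ((1 - s) *\<^sub>R x + s *\<^sub>R y))))" for x y
  proof (cases "x \<in> K \<and> y \<in> K")
    case True
    have "ennreal ((u (x + 1 *\<^sub>R (y - x)) - u x)\<^sup>2) \<le>
      ennreal 1 * (\<integral>\<^sub>+s. indicator {0..1::real} s * ennreal ((fderiv u (x + s *\<^sub>R (y - x)) (y - x))\<^sup>2))"
      by (rule Ck_1_line_estimate[OF u]) simp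
    also have "\<dots> \<le> ennreal 1 * (\<integral>\<^sub>+s. indicator {0..1::real} s * (?d * g ((1 - s) *\<^sub>R x + s *\<^sub>R y)))"
    proof (rule mult_left_mono[OF nn_integral_mono])
      fix s :: real
      have e: "x + s *\<^sub>R (y - x) = (1 - s) *\<^sub>R x + s *\<^sub>R y" by (simp add: algebra_simps)
      show "indicator {0..1::real} s * ennreal ((fderiv u (x + s *\<^sub>R (y - x)) (y - x))\<^sup>2) \<le> indicator {0..1::real} s * (?d * g ((1 - s) *\<^sub>R x + s *\<^sub>R y))"
      proof (cases "s \<in> {0..1}")
        case s: True
        then have inK: "(1 - s) *\<^sub>R x + s *\<^sub>R y \<in> K" using True K(2) by (intro convexD) auto
        have "(fderiv u (x + s *\<^sub>R (y - x)) (y - x))\<^sup>2 \<le> (norm (y - x))\<^sup>2 * grad_sq u (x + s *\<^sub>R (y - x))"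
          by (rule derivative_le_grad_sq[OF u])
        also have "\<dots> \<le> (diameter K)\<^sup>2 * grad_sq u (x + s *\<^sub>R (y - x))"
          using diameter_bounded_bound[OF K(3)] True grad_sq_nonneg
          by (intro mult_right_mono power_mono) (auto simp: dist_norm)
        finally show ?thesis using s inK
          by (simp add: g_def e ennreal_mult[symmetric] grad_sq_nonneg ennreal_leI)
      qed simp
    qed simp
    finally show ?thesis using True by simp
  qed auto
  have "(\<integral>\<^sub>+x. \<integral>\<^sub>+y. indicator K x * indicator K y * ennreal ((u y - u x)\<^sup>2)) \<le>
    (\<integral>\<^sub>+x. \<integral>\<^sub>+y. (\<integral>\<^sub>+s. indicator {0..1::real} s * (?d * (indicator K x * indicator K y * g ((1 - s) *\<^sub>R x + s *\<^sub>R y)))))"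
    by (intro nn_integral_mono pw)
  also have "\<dots> = (\<integral>\<^sub>+x. (\<integral>\<^sub>+s. \<integral>\<^sub>+y. indicator {0..1::real} s * (?d * (indicator K x * indicator K y * g ((1 - s) *\<^sub>R x + s *\<^sub>R y)))))"
    by (intro nn_integral_cong lborel_pair.Fubini') simp
  also have "\<dots> = (\<integral>\<^sub>+s. (\<integral>\<^sub>+x. \<integral>\<^sub>+y. indicator {0..1::real} s * (?d * (indicator K x * indicator K y * g ((1 - s) *\<^sub>R x + s *\<^sub>R y)))))"
    by (rule lborel_pair.Fubini') simp
  also have "\<dots> = (\<integral>\<^sub>+s. indicator {0..1::real} s * (?d * (\<integral>\<^sub>+x. \<integral>\<^sub>+y. (indicator K x * indicator K y * g ((1 - s) *\<^sub>R x + s *\<^sub>R y)))))"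
    by (simp add: nn_integral_cmult)
  also have "\<dots> \<le> (\<integral>\<^sub>+s. indicator {0..1::real} s * (?d * (2 ^ DIM('a) * emeasure lborel K * (\<integral>\<^sub>+x. g x))))"
  proof (intro nn_integral_mono)
    fix s :: real
    show "indicator {0..1::real} s * (?d * (\<integral>\<^sub>+x. \<integral>\<^sub>+y. (indicator K x * indicator K y * g ((1 - s) *\<^sub>R x + s *\<^sub>R y))))
      \<le> indicator {0..1::real} s * (?d * (2 ^ DIM('a) * emeasure lborel K * (\<integral>\<^sub>+x. g x)))"
    proof (cases "s \<in> {0..1}")
      case True
      then show ?thesis using nn_integral_convex_combination_le[OF gm Kb, of s] by (simp add: mult_left_mono)
    qed simp
  qed
  also have "\<dots> = ?d * (2 ^ DIM('a) * emeasure lborel K * (\<integral>\<^sub>+x. g x))"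
    by (subst nn_integral_multc) auto
  finally show ?thesis by (simp add: g_def)
qed

definition avg :: "'a::euclidean_space set \<Rightarrow> ('a \<Rightarrow> real) \<Rightarrow> real" where
  "avg K u = (LINT x|lebesgue_on K. u x) / vol K"

text \<open>The mean is the best constant in the mean square: replacing it by \<open>c\<close> adds
  (c - mean)^2 times the volume to the squared norm.\<close>

lemma l2_norm_avg_le:
  fixes u :: "'a::euclidean_space \<Rightarrow> real"
  assumes K: "bounded K" "K \<in> sets lebesgue" and u: "inL2 K u" and pos: "vol K > 0"
  shows "L2 K (\<lambda>x. u x - avg K u) \<le> L2 K (\<lambda>x. u x - c)"
proof (rule power2_le_imp_le)
  have fin: "finite_measure (lebesgue_on K)" by (rule finite_measure_bounded_lebesgue_on[OF K])
  interpret finite_measure "lebesgue_on K" by fact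
  have m: "measure (lebesgue_on K) (space (lebesgue_on K)) = vol K"
    using K by (simp add: measure_restrict_space)
  let ?m = "vol K"
  have i: "integrable (lebesgue_on K) u" by (rule square_integrable_integrable[OF fin u])
  have i2: "integrable (lebesgue_on K) (\<lambda>x. (u x)\<^sup>2)" using u by (simp add: square_integrable_def)
  have f: "(L2 K (\<lambda>x. u x - c))\<^sup>2 = (LINT x|lebesgue_on K. (u x)\<^sup>2) - 2 * c * (LINT x|lebesgue_on K. u x) + c\<^sup>2 * ?m" for c
  proof -
    have "(L2 K (\<lambda>x. u x - c))\<^sup>2 = (LINT x|lebesgue_on K. (u x)\<^sup>2 - (2 * c) * u x + c\<^sup>2)"
      unfolding l2_norm_power2 by (intro Bochner_Integration.integral_cong) (auto simp: power2_eq_square algebra_simps)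
    also have "\<dots> = (LINT x|lebesgue_on K. (u x)\<^sup>2) - (2 * c) * (LINT x|lebesgue_on K. u x) + c\<^sup>2 * ?m"
      using i i2 m by simp
    finally show ?thesis .
  qed
  have a: "(LINT x|lebesgue_on K. u x) = avg K u * ?m" using pos by (simp add: avg_def)
  have "0 \<le> (c - avg K u)\<^sup>2 * ?m" using pos by simp
  then show "(L2 K (\<lambda>x. u x - avg K u))\<^sup>2 \<le> (L2 K (\<lambda>x. u x - c))\<^sup>2"
    unfolding f a by (simp add: power2_eq_square algebra_simps)
qed simp

text \<open>The argument is a family of partial derivatives rather than a function, so that the same
  norm serves classical gradients, any chosen weak gradient, and gradients minus a constant
  vector.\<close>

definition grad_norm :: "'a::euclidean_space set \<Rightarrow> ('a \<Rightarrow> 'a \<Rightarrow> real) \<Rightarrow> real" where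
  "grad_norm K g = sqrt (\<Sum>b\<in>Basis. (L2 K (g b))\<^sup>2)"

lemma grad_norm_nonneg: "0 \<le> grad_norm K g"
  by (simp add: grad_norm_def sum_nonneg)

lemma open_measure_pos:
  fixes K :: "'a::euclidean_space set"
  assumes "open K" "bounded K" "K \<noteq> {}"
  shows "vol K > 0"
proof -
  have "\<not> negligible K" using open_not_negligible assms by blast
  moreover have "K \<in> lmeasurable" using assms by (intro lmeasurable_open)
  ultimately have "vol K \<noteq> 0" by (simp add: negligible_iff_measure)
  then show ?thesis by (simp add: zero_less_measure_iff)
qed

text \<open>For every x the variance of \<open>u\<close> is at most the squared distance of
  \<open>u\<close> to the constant \<open>u x\<close>. Integrating over x gives the double integral
  of squared differences, and one factor of the volume cancels.\<close>

lemma Poincare_C1: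
  fixes u :: "'a::euclidean_space \<Rightarrow> real"
  assumes u: "Ck 1 u" and K: "open K" "convex K" "bounded K" "K \<noteq> {}"
  shows "L2 K (\<lambda>x. u x - avg K u) \<le> sqrt (2 ^ DIM('a)) * diameter K * grad_norm K (\<lambda>b x. fderiv u x b)"
proof -
  have Kl: "K \<in> sets lebesgue" using K by simp
  have usq: "inL2 K (\<lambda>x. u x - c)" for c
    using Ck_continuous[OF u] by (intro continuous_square_integrable K Kl continuous_intros)
  have dsq: "inL2 K (\<lambda>x. fderiv u x b)" for b
    by (rule continuous_square_integrable[OF Ck_1_derivative_continuous[OF u] K(3) Kl])
  have usq0: "inL2 K u" using usq[of 0] by simp
  have pos: "vol K > 0" by (rule open_measure_pos) (use K in auto)
  have em: "emeasure lborel K = ennreal (vol K)"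
  proof -
    have "emeasure lebesgue K = ennreal (vol K)"
      using lmeasurable_open[OF K(3,1)] by (rule emeasure_eq_measure2)
    moreover have "emeasure lebesgue K = emeasure lborel K" using K(1) by simp
    ultimately show ?thesis by simp
  qed
  let ?A = "(L2 K (\<lambda>x. u x - avg K u))\<^sup>2"
  let ?G = "grad_norm K (\<lambda>b x. fderiv u x b)"
  have [measurable]: "u \<in> borel_measurable borel" using Ck_continuous[OF u] by (rule borel_measurable_continuous_onI)
  have [measurable]: "K \<in> sets borel" using K by simp
  have G: "(\<integral>\<^sub>+x. indicator K x * ennreal (grad_sq u x)) = ennreal (?G\<^sup>2)"
  proof -
    have "(\<integral>\<^sub>+x. indicator K x * ennreal (grad_sq u x)) = (\<integral>\<^sub>+x. (\<Sum>b\<in>Basis. indicator K x * ennreal ((fderiv u x b)\<^sup>2)))"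
    proof -
      have "indicator K x * ennreal (grad_sq u x) = (\<Sum>b\<in>Basis. indicator K x * ennreal ((fderiv u x b)\<^sup>2))" for x
        by (cases "x \<in> K") (auto simp: grad_sq_def sum_ennreal)
      then show ?thesis by simp
    qed
    also have "\<dots> = (\<Sum>b\<in>Basis. \<integral>\<^sub>+x. indicator K x * ennreal ((fderiv u x b)\<^sup>2))"
      using Ck_1_derivative_continuous[OF u, THEN borel_measurable_continuous_onI] by (intro nn_integral_sum) simp
    also have "\<dots> = (\<Sum>b\<in>Basis. ennreal ((L2 K (\<lambda>x. fderiv u x b))\<^sup>2))"
      by (simp add: l2_norm_nn_integral[OF dsq Kl])
    also have "\<dots> = ennreal (?G\<^sup>2)" by (simp add: grad_norm_def sum_nonneg)
    finally show ?thesis .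
  qed
  have "ennreal (vol K) * ennreal ?A = (\<integral>\<^sub>+x. indicator K x * ennreal ?A)"
    by (subst nn_integral_multc) (auto simp: em)
  also have "\<dots> \<le> (\<integral>\<^sub>+x. \<integral>\<^sub>+y. indicator K x * indicator K y * ennreal ((u y - u x)\<^sup>2))"
  proof (rule nn_integral_mono)
    fix x
    have "?A \<le> (L2 K (\<lambda>y. u y - u x))\<^sup>2"
      by (intro power_mono l2_norm_avg_le K Kl usq0 pos) simp
    then have "ennreal ?A \<le> (\<integral>\<^sub>+y. indicator K y * ennreal ((u y - u x)\<^sup>2))"
      unfolding l2_norm_nn_integral[OF usq Kl, symmetric] by (rule ennreal_leI)
    then have "indicator K x * ennreal ?A \<le> indicator K x * (\<integral>\<^sub>+y. indicator K y * ennreal ((u y - u x)\<^sup>2))"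
      by (rule mult_left_mono) simp
    also have "\<dots> = (\<integral>\<^sub>+y. indicator K x * (indicator K y * ennreal ((u y - u x)\<^sup>2)))"
      by (rule nn_integral_cmult[symmetric]) simp
    finally show "indicator K x * ennreal ?A \<le> (\<integral>\<^sub>+y. indicator K x * indicator K y * ennreal ((u y - u x)\<^sup>2))"
      by (simp add: mult.assoc)
  qed
  also have "\<dots> \<le> ennreal ((diameter K)\<^sup>2) * (2 ^ DIM('a) * emeasure lborel K * (\<integral>\<^sub>+x. indicator K x * ennreal (grad_sq u x)))"
    by (rule difference_double_integral_le[OF u K(1-3)])
  also have "\<dots> = ennreal ((diameter K)\<^sup>2 * (2 ^ DIM('a) * vol K * ?G\<^sup>2))"
  proof -
    have "(2::ennreal) ^ DIM('a) = ennreal (2 ^ DIM('a))" by (simp add: ennreal_power[symmetric])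
    then show ?thesis unfolding G em by (simp add: ennreal_mult)
  qed
  finally have "vol K * ?A \<le> (diameter K)\<^sup>2 * (2 ^ DIM('a) * vol K * ?G\<^sup>2)"
    by (simp add: ennreal_mult[symmetric])
  then have "vol K * ?A \<le> vol K * (sqrt (2 ^ DIM('a)) * diameter K * ?G)\<^sup>2"
    by (simp add: power_mult_distrib mult_ac)
  then have "?A \<le> (sqrt (2 ^ DIM('a)) * diameter K * ?G)\<^sup>2" using pos by simp
  then show ?thesis
    by (rule power2_le_imp_le) (simp add: grad_norm_nonneg diameter_ge_0 K)
qed

text \<open>A limit of the smooth case. The means of the approximants need not be followed to the
  limit: the mean of \<open>w\<close> is a better constant for \<open>w\<close> than any of
  them.\<close>

theorem Poincare_convex:
  fixes w :: "'a::euclidean_space \<Rightarrow> real"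
  assumes K: "open K" "convex K" "bounded K" "K \<noteq> {}"
    and w: "inL2 K w"
    and g: "\<And>b. b \<in> Basis \<Longrightarrow> has_weak_partial K b w (g b)" "\<And>b. b \<in> Basis \<Longrightarrow> inL2 K (g b)"
  shows "L2 K (\<lambda>x. w x - avg K w) \<le> sqrt (2 ^ DIM('a)) * diameter K * grad_norm K g"
proof -
  have Kl: "K \<in> sets lebesgue" using K by simp
  have fin: "finite_measure (lebesgue_on K)" by (rule finite_measure_bounded_lebesgue_on[OF K(3) Kl])
  have pos: "vol K > 0" by (rule open_measure_pos) (use K in auto)
  obtain u where u: "\<And>k. Ck 1 (u k)" "(\<lambda>k. L2 K (\<lambda>x. u k x - w x)) \<longlonglongrightarrow> 0"
    "\<And>b. b \<in> Basis \<Longrightarrow> (\<lambda>k. L2 K (\<lambda>x. fderiv (u k) x b - g b x)) \<longlonglongrightarrow> 0"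
    using H1_density[OF K(1,3,2,4) w g] by blast
  have usq: "inL2 K (u k)" for k
    by (rule continuous_square_integrable[OF Ck_continuous[OF u(1)] K(3) Kl])
  have dsq: "inL2 K (\<lambda>x. fderiv (u k) x b)" for k b
    by (rule continuous_square_integrable[OF Ck_1_derivative_continuous[OF u(1)] K(3) Kl])
  let ?C = "sqrt (2 ^ DIM('a)) * diameter K"
  have C: "?C \<ge> 0" using diameter_ge_0[OF K(3)] by simp
  let ?e = "\<lambda>k b. L2 K (\<lambda>x. fderiv (u k) x b - g b x)"
  have b: "L2 K (\<lambda>x. w x - avg K w) \<le> L2 K (\<lambda>x. u k x - w x)
     + ?C * sqrt (\<Sum>b\<in>Basis. (?e k b + L2 K (g b))\<^sup>2)" for k
  proof -
    have "L2 K (\<lambda>x. w x - avg K w) \<le> L2 K (\<lambda>x. w x - avg K (u k))"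
      by (rule l2_norm_avg_le[OF K(3) Kl w pos])
    also have "\<dots> = L2 K (\<lambda>x. (u k x - avg K (u k)) - (u k x - w x))" by simp
    also have "\<dots> \<le> L2 K (\<lambda>x. u k x - avg K (u k)) + L2 K (\<lambda>x. u k x - w x)"
      by (intro l2_norm_triangle_diff square_integrable_diff usq w square_integrable_const fin)
    also have "L2 K (\<lambda>x. u k x - avg K (u k)) \<le> ?C * grad_norm K (\<lambda>b x. fderiv (u k) x b)"
      by (rule Poincare_C1[OF u(1) K])
    also have "\<dots> \<le> ?C * sqrt (\<Sum>b\<in>Basis. (?e k b + L2 K (g b))\<^sup>2)"
    proof -
      have "L2 K (\<lambda>x. fderiv (u k) x b) \<le> ?e k b + L2 K (g b)" if "b \<in> Basis" for b
        using l2_norm_triangle[OF square_integrable_diff[OF dsq g(2)[OF that]] g(2)[OF that], of k b] by simp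
      then show ?thesis unfolding grad_norm_def using C
        by (intro mult_left_mono real_sqrt_le_mono sum_mono power_mono) auto
    qed
    finally show ?thesis by simp
  qed
  have "(\<lambda>k. L2 K (\<lambda>x. u k x - w x) + ?C * sqrt (\<Sum>b\<in>Basis. (?e k b + L2 K (g b))\<^sup>2))
     \<longlonglongrightarrow> 0 + ?C * sqrt (\<Sum>b\<in>Basis. (0 + L2 K (g b))\<^sup>2)"
    by (intro tendsto_add tendsto_mult tendsto_const tendsto_real_sqrt tendsto_sum tendsto_power u)
  then show ?thesis
    using b by (intro LIMSEQ_le_const[of _ "?C * grad_norm K g"]) (auto simp: grad_norm_def)
qed

section \<open>Traces on hyperplane faces\<close>

text \<open>Lebesgue measure in coordinates \<open>(y, t)\<close> with \<open>y\<close> in the hyperplane and \<open>t\<close> along \<open>v\<close>; only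
  translation invariance and Tonelli's theorem are needed.\<close>

lemma slab_fubini:
  fixes f :: "'a::euclidean_space \<Rightarrow> ennreal"
  assumes f [measurable]: "f \<in> borel_measurable borel" and I [measurable]: "I \<in> sets borel"
    and \<nu>: "norm \<nu> = 1" and d: "\<nu> \<bullet> v = d" "d \<noteq> 0"
  shows "(\<integral>\<^sub>+x. \<integral>\<^sub>+t. indicator I (\<nu> \<bullet> x - c) * f (x - (\<nu> \<bullet> x - c) *\<^sub>R \<nu> + t *\<^sub>R v)) * ennreal \<bar>d\<bar>
    = emeasure lborel I * (\<integral>\<^sub>+x. f x)"
proof -
  \<comment> \<open>The tangential part of \<open>v\<close>: a shift by a multiple of
    \<open>m\<close> leaves the coordinate along \<open>\<nu>\<close> unchanged, so for fixed t
    translation invariance replaces \<open>v\<close> by \<open>d *\<^sub>R \<nu>\<close>.\<close>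
  define m where "m = v - d *\<^sub>R \<nu>"
  have nn: "\<nu> \<bullet> \<nu> = 1" using \<nu> by (simp add: power2_norm_eq_inner[symmetric])
  have m: "\<nu> \<bullet> m = 0" using d nn by (simp add: m_def inner_diff_right)
  have v: "v = d *\<^sub>R \<nu> + m" by (simp add: m_def)
  have "(\<integral>\<^sub>+x. \<integral>\<^sub>+t. indicator I (\<nu> \<bullet> x - c) * f (x - (\<nu> \<bullet> x - c) *\<^sub>R \<nu> + t *\<^sub>R v))
    = (\<integral>\<^sub>+t. \<integral>\<^sub>+x. indicator I (\<nu> \<bullet> x - c) * f (x - (\<nu> \<bullet> x - c) *\<^sub>R \<nu> + t *\<^sub>R v))"
    by (rule lborel_pair.Fubini') measurable
  also have "\<dots> = (\<integral>\<^sub>+t. \<integral>\<^sub>+x. indicator I (\<nu> \<bullet> x - c) * f (x - (\<nu> \<bullet> x - c) *\<^sub>R \<nu> + (t * d) *\<^sub>R \<nu>))"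
  proof (rule nn_integral_cong)
    fix t :: real
    have "(\<integral>\<^sub>+x. indicator I (\<nu> \<bullet> (x + (- t) *\<^sub>R m) - c) * f ((x + (- t) *\<^sub>R m) - (\<nu> \<bullet> (x + (- t) *\<^sub>R m) - c) *\<^sub>R \<nu> + t *\<^sub>R v))
      = (\<integral>\<^sub>+x. indicator I (\<nu> \<bullet> x - c) * f (x - (\<nu> \<bullet> x - c) *\<^sub>R \<nu> + t *\<^sub>R v))"
      by (rule nn_integral_lborel_translate) measurable
    moreover have "\<nu> \<bullet> (x + (- t) *\<^sub>R m) = \<nu> \<bullet> x" for x by (simp add: inner_add_right inner_diff_right m)
    moreover have "x + (- t) *\<^sub>R m - (\<nu> \<bullet> x - c) *\<^sub>R \<nu> + t *\<^sub>R v = x - (\<nu> \<bullet> x - c) *\<^sub>R \<nu> + (t * d) *\<^sub>R \<nu>" for x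
      by (simp add: v algebra_simps)
    ultimately show "(\<integral>\<^sub>+x. indicator I (\<nu> \<bullet> x - c) * f (x - (\<nu> \<bullet> x - c) *\<^sub>R \<nu> + t *\<^sub>R v))
      = (\<integral>\<^sub>+x. indicator I (\<nu> \<bullet> x - c) * f (x - (\<nu> \<bullet> x - c) *\<^sub>R \<nu> + (t * d) *\<^sub>R \<nu>))"
      by (simp only:)
  qed
  also have "\<dots> = (\<integral>\<^sub>+x. \<integral>\<^sub>+t. indicator I (\<nu> \<bullet> x - c) * f (x - (\<nu> \<bullet> x - c) *\<^sub>R \<nu> + (t * d) *\<^sub>R \<nu>))"
    by (rule lborel_pair.Fubini'[symmetric]) measurable
  finally have 1: "(\<integral>\<^sub>+x. \<integral>\<^sub>+t. indicator I (\<nu> \<bullet> x - c) * f (x - (\<nu> \<bullet> x - c) *\<^sub>R \<nu> + t *\<^sub>R v))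
    = (\<integral>\<^sub>+x. \<integral>\<^sub>+t. indicator I (\<nu> \<bullet> x - c) * f (x - (\<nu> \<bullet> x - c) *\<^sub>R \<nu> + (t * d) *\<^sub>R \<nu>))" .
  have "(\<integral>\<^sub>+x. \<integral>\<^sub>+t. indicator I (\<nu> \<bullet> x - c) * f (x - (\<nu> \<bullet> x - c) *\<^sub>R \<nu> + (t * d) *\<^sub>R \<nu>)) * ennreal \<bar>d\<bar>
    = (\<integral>\<^sub>+x. (\<integral>\<^sub>+t. indicator I (\<nu> \<bullet> x - c) * f (x - (\<nu> \<bullet> x - c) *\<^sub>R \<nu> + (t * d) *\<^sub>R \<nu>)) * ennreal \<bar>d\<bar>)"
    by (rule nn_integral_multc[symmetric]) measurable
  also have "\<dots> = (\<integral>\<^sub>+x. \<integral>\<^sub>+t. indicator I (\<nu> \<bullet> x - c) * f (x + t *\<^sub>R \<nu>))"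
  proof (rule nn_integral_cong)
    fix x :: 'a
    have "(\<integral>\<^sub>+t. indicator I (\<nu> \<bullet> x - c) * f (x - (\<nu> \<bullet> x - c) *\<^sub>R \<nu> + (t * d) *\<^sub>R \<nu>)) * ennreal \<bar>d\<bar>
       = (\<integral>\<^sub>+t. indicator I (\<nu> \<bullet> x - c) * f (x + ((- (\<nu> \<bullet> x - c)) + d *\<^sub>R t) *\<^sub>R \<nu>)) * ennreal (\<bar>d\<bar> ^ DIM(real))"
      by (simp add: algebra_simps)
    also have "\<dots> = (\<integral>\<^sub>+t. indicator I (\<nu> \<bullet> x - c) * f (x + t *\<^sub>R \<nu>))"
      using d(2) by (rule nn_integral_lborel_affine) measurable
    finally show "(\<integral>\<^sub>+t. indicator I (\<nu> \<bullet> x - c) * f (x - (\<nu> \<bullet> x - c) *\<^sub>R \<nu> + (t * d) *\<^sub>R \<nu>)) * ennreal \<bar>d\<bar>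
       = (\<integral>\<^sub>+t. indicator I (\<nu> \<bullet> x - c) * f (x + t *\<^sub>R \<nu>))" .
  qed
  also have "\<dots> = (\<integral>\<^sub>+t. \<integral>\<^sub>+x. indicator I (\<nu> \<bullet> x - c) * f (x + t *\<^sub>R \<nu>))"
    by (rule lborel_pair.Fubini') measurable
  \<comment> \<open>Translating x by t \<nu> moves the dependence on t from \<open>f\<close> into
    the indicator, whose integral over t is the length of \<open>I\<close>.\<close>
  also have "\<dots> = (\<integral>\<^sub>+t. \<integral>\<^sub>+x. indicator I (\<nu> \<bullet> x - c - t) * f x)"
  proof (rule nn_integral_cong)
    fix t :: real
    have "(\<integral>\<^sub>+x. indicator I (\<nu> \<bullet> (x + t *\<^sub>R \<nu>) - c - t) * f (x + t *\<^sub>R \<nu>)) = (\<integral>\<^sub>+x. indicator I (\<nu> \<bullet> x - c - t) * f x)"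
      by (rule nn_integral_lborel_translate) measurable
    moreover have "\<nu> \<bullet> (x + t *\<^sub>R \<nu>) - c - t = \<nu> \<bullet> x - c" for x by (simp add: inner_add_right nn)
    ultimately show "(\<integral>\<^sub>+x. indicator I (\<nu> \<bullet> x - c) * f (x + t *\<^sub>R \<nu>)) = (\<integral>\<^sub>+x. indicator I (\<nu> \<bullet> x - c - t) * f x)"
      by (simp only:)
  qed
  also have "\<dots> = (\<integral>\<^sub>+x. \<integral>\<^sub>+t. indicator I (\<nu> \<bullet> x - c - t) * f x)"
    by (rule lborel_pair.Fubini'[symmetric]) measurable
  also have "\<dots> = (\<integral>\<^sub>+x. emeasure lborel I * f x)"
  proof (rule nn_integral_cong)
    fix x :: 'a
    have "(\<integral>\<^sub>+t. indicator I (\<nu> \<bullet> x - c - t) * f x) = (\<integral>\<^sub>+t. indicator I ((\<nu> \<bullet> x - c) + (-1) *\<^sub>R t)) * ennreal (\<bar>-1\<bar> ^ DIM(real)) * f x"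
      by (subst nn_integral_multc) (auto simp: algebra_simps)
    also have "(\<integral>\<^sub>+t. indicator I ((\<nu> \<bullet> x - c) + (-1) *\<^sub>R t)) * ennreal (\<bar>-1\<bar> ^ DIM(real)) = (\<integral>\<^sub>+t. indicator I t)"
      by (rule nn_integral_lborel_affine) measurable
    finally show "(\<integral>\<^sub>+t. indicator I (\<nu> \<bullet> x - c - t) * f x) = emeasure lborel I * f x" by simp
  qed
  also have "\<dots> = emeasure lborel I * (\<integral>\<^sub>+x. f x)" by (rule nn_integral_cmult) measurable
  finally show ?thesis unfolding 1 .
qed

lemma closest_point_hyperplane:
  fixes \<nu> :: "'a::euclidean_space"
  assumes \<nu>: "norm \<nu> = 1"
  shows "closest_point {x. \<nu> \<bullet> x = c} x = x - (\<nu> \<bullet> x - c) *\<^sub>R \<nu>"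
proof -
  have nn: "\<nu> \<bullet> \<nu> = 1" using \<nu> by (simp add: power2_norm_eq_inner[symmetric])
  have "x - (\<nu> \<bullet> x - c) *\<^sub>R \<nu> = closest_point {x. \<nu> \<bullet> x = c} x"
  proof (rule closest_point_unique)
    show "convex {x. \<nu> \<bullet> x = c}" "closed {x. \<nu> \<bullet> x = c}" by (simp_all add: convex_hyperplane closed_hyperplane)
    show "x - (\<nu> \<bullet> x - c) *\<^sub>R \<nu> \<in> {x. \<nu> \<bullet> x = c}" by (simp add: inner_diff_right nn)
    show "\<forall>z\<in>{x. \<nu> \<bullet> x = c}. dist x (x - (\<nu> \<bullet> x - c) *\<^sub>R \<nu>) \<le> dist x z"
    proof
      fix z assume "z \<in> {x. \<nu> \<bullet> x = c}"
      then have "\<bar>\<nu> \<bullet> x - c\<bar> = \<bar>\<nu> \<bullet> (x - z)\<bar>" by (simp add: inner_diff_right)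
      also have "\<dots> \<le> norm \<nu> * norm (x - z)" by (rule Cauchy_Schwarz_ineq2)
      finally show "dist x (x - (\<nu> \<bullet> x - c) *\<^sub>R \<nu>) \<le> dist x z" using \<nu> by (simp add: dist_norm)
    qed
  qed
  then show ?thesis by simp
qed

locale hyperplane_face =
  fixes F :: "'a::euclidean_space set" and \<nu> :: 'a and c :: real
  assumes F: "compact F" and \<nu>: "norm \<nu> = 1" and hull: "affine hull F = {x. \<nu> \<bullet> x = c}"
begin

definition P :: "'a \<Rightarrow> 'a" where "P x = x - (\<nu> \<bullet> x - c) *\<^sub>R \<nu>"

lemma F_sub: "y \<in> F \<Longrightarrow> \<nu> \<bullet> y = c"
  using hull hull_subset[of F affine] by auto

lemma P_measurable [measurable]: "P \<in> borel \<rightarrow>\<^sub>M borel"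
  unfolding P_def[abs_def] by measurable

lemma F_borel [measurable]: "F \<in> sets borel"
  using F by (simp add: borel_closed compact_imp_closed)

lemma face_measure_eq:
  "face_measure F = distr (restrict_space lborel {x. P x \<in> F \<and> \<bar>\<nu> \<bullet> x - c\<bar> \<le> 1/2}) (restrict_space borel F) P"
proof -
  have "closest_point (affine hull F) = P"
    unfolding hull using closest_point_hyperplane[OF \<nu>] by (auto simp: P_def fun_eq_iff)
  moreover have "dist x (P x) = \<bar>\<nu> \<bullet> x - c\<bar>" for x
    using \<nu> by (simp add: P_def dist_norm)
  ultimately show ?thesis unfolding face_measure_def by simp
qed

lemma slab_iff: "r \<in> {-1/2..1/2} \<longleftrightarrow> \<bar>r\<bar> \<le> 1/2" for r :: real
  by auto

lemma slab_borel: "{x. P x \<in> F \<and> \<bar>\<nu> \<bullet> x - c\<bar> \<le> 1/2} \<in> sets borel"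
  by measurable

lemma P_measurable_slab:
  "P \<in> restrict_space lborel {x. P x \<in> F \<and> \<bar>\<nu> \<bullet> x - c\<bar> \<le> 1/2} \<rightarrow>\<^sub>M restrict_space borel F"
  by (rule measurable_restrict_space3) (auto simp: Pi_def)

lemma space_face_measure [simp]: "space (face_measure F) = F"
  by (simp add: face_measure_eq space_restrict_space)

lemma face_measurable: "f \<in> borel_measurable borel \<Longrightarrow> f \<in> borel_measurable (face_measure F)"
  by (simp add: face_measure_eq measurable_restrict_space1)

lemma nn_integral_face_measure:
  fixes f :: "'a \<Rightarrow> ennreal"
  assumes [measurable]: "f \<in> borel_measurable borel"
  shows "(\<integral>\<^sup>+y. f y \<partial>face_measure F) = (\<integral>\<^sub>+x. indicator {-1/2..1/2} (\<nu> \<bullet> x - c) * (indicator F (P x) * f (P x)))"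
proof -
  have "(\<integral>\<^sup>+y. f y \<partial>face_measure F) = (\<integral>\<^sup>+x. f (P x) \<partial>restrict_space lborel {x. P x \<in> F \<and> \<bar>\<nu> \<bullet> x - c\<bar> \<le> 1/2})"
    unfolding face_measure_eq by (rule nn_integral_distr[OF P_measurable_slab]) (simp add: measurable_restrict_space1)
  also have "\<dots> = (\<integral>\<^sub>+x. f (P x) * indicator {x. P x \<in> F \<and> \<bar>\<nu> \<bullet> x - c\<bar> \<le> 1/2} x)"
    using slab_borel by (simp add: nn_integral_restrict_space)
  also have "\<dots> = (\<integral>\<^sub>+x. indicator {-1/2..1/2} (\<nu> \<bullet> x - c) * (indicator F (P x) * f (P x)))"
    unfolding slab_iff[symmetric] by (intro nn_integral_cong) (auto simp: indicator_def)
  finally show ?thesis .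
qed

lemma finite_face_measure: "finite_measure (face_measure F)"
proof (rule finite_measureI)
  let ?S = "{x. P x \<in> F \<and> \<bar>\<nu> \<bullet> x - c\<bar> \<le> 1/2}"
  obtain R where R: "\<And>y. y \<in> F \<Longrightarrow> norm y \<le> R" using compact_imp_bounded[OF F] by (auto simp: bounded_iff)
  have "?S \<subseteq> cball 0 (R + 1)"
  proof
    fix x assume x: "x \<in> ?S"
    have "x = P x + (\<nu> \<bullet> x - c) *\<^sub>R \<nu>" by (simp add: P_def)
    then have "norm x \<le> norm (P x) + norm ((\<nu> \<bullet> x - c) *\<^sub>R \<nu>)" by (metis norm_triangle_ineq)
    also have "\<dots> \<le> R + 1" using x R[of "P x"] \<nu> by simp
    finally show "x \<in> cball 0 (R + 1)" by simp
  qed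
  then have "emeasure lborel ?S \<le> emeasure lborel (cball (0::'a) (R + 1))" by (rule emeasure_mono) simp
  also have "\<dots> < \<infinity>" by (rule emeasure_lborel_cball_finite)
  finally have S: "emeasure lborel ?S < \<infinity>" .
  have "emeasure (face_measure F) F = (\<integral>\<^sup>+y. 1 \<partial>face_measure F)" by simp
  also have "\<dots> = (\<integral>\<^sub>+x. indicator {-1/2..1/2} (\<nu> \<bullet> x - c) * (indicator F (P x) * 1))"
    by (rule nn_integral_face_measure) simp
  also have "\<dots> = (\<integral>\<^sub>+x. indicator ?S x)"
    unfolding slab_iff[symmetric] by (intro nn_integral_cong) (auto simp: indicator_def)
  also have "\<dots> = emeasure lborel ?S" using slab_borel by simp
  finally show "emeasure (face_measure F) (space (face_measure F)) \<noteq> \<infinity>" using S by simp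
qed

lemma square_integrable_face:
  assumes f: "continuous_on UNIV f"
  shows "square_integrable (face_measure F) f"
proof -
  have "bounded (f ` F)" using f F by (meson compact_continuous_image compact_imp_bounded continuous_on_subset subset_UNIV)
  then obtain B where "\<And>x. x \<in> F \<Longrightarrow> \<bar>f x\<bar> \<le> B" unfolding bounded_iff by auto
  then show ?thesis
    by (intro square_integrable_bounded[OF finite_face_measure, of f B] face_measurable borel_measurable_continuous_onI f) auto
qed

text \<open>Segments that start in the face with direction \<open>v\<close> sweep out a part of
  \<open>T\<close>. In slab coordinates the volume element is \<open>d\<close> times face measure
  times dt; the slab has thickness one, so no further factor appears.\<close>

lemma slab_face_le:
  fixes f :: "'a \<Rightarrow> ennreal"
  assumes f [measurable]: "f \<in> borel_measurable borel" and v: "\<nu> \<bullet> v = d" "d > 0" and E [measurable]: "E \<in> sets borel"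
    and T: "T \<in> sets borel" "\<And>y t. y \<in> E \<Longrightarrow> y \<in> F \<Longrightarrow> 0 \<le> t \<Longrightarrow> t \<le> \<delta> \<Longrightarrow> y + t *\<^sub>R v \<in> T"
  shows "ennreal d * (\<integral>\<^sup>+y. indicator E y * (\<integral>\<^sub>+t. indicator {0..\<delta>} t * f (y + t *\<^sub>R v)) \<partial>face_measure F)
    \<le> (\<integral>\<^sub>+x. indicator T x * f x)"
proof -
  have [measurable]: "T \<in> sets borel" by fact
  have "(\<integral>\<^sup>+y. indicator E y * (\<integral>\<^sub>+t. indicator {0..\<delta>} t * f (y + t *\<^sub>R v)) \<partial>face_measure F)
    = (\<integral>\<^sub>+x. indicator {-1/2..1/2} (\<nu> \<bullet> x - c) * (indicator F (P x) * (indicator E (P x) * (\<integral>\<^sub>+t. indicator {0..\<delta>} t * f (P x + t *\<^sub>R v)))))"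
    by (rule nn_integral_face_measure) measurable
  also have "\<dots> \<le> (\<integral>\<^sub>+x. \<integral>\<^sub>+t. indicator {-1/2..1/2} (\<nu> \<bullet> x - c) * (indicator T (P x + t *\<^sub>R v) * f (P x + t *\<^sub>R v)))"
  proof (rule nn_integral_mono)
    fix x :: 'a
    show "indicator {-1/2..1/2} (\<nu> \<bullet> x - c) * (indicator F (P x) * (indicator E (P x) * (\<integral>\<^sub>+t. indicator {0..\<delta>} t * f (P x + t *\<^sub>R v))))
       \<le> (\<integral>\<^sub>+t. indicator {-1/2..1/2} (\<nu> \<bullet> x - c) * (indicator T (P x + t *\<^sub>R v) * f (P x + t *\<^sub>R v)))"
    proof (cases "\<nu> \<bullet> x - c \<in> {-1/2..1/2} \<and> P x \<in> F \<and> P x \<in> E")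
      case True
      have "(\<integral>\<^sub>+t. indicator {0..\<delta>} t * f (P x + t *\<^sub>R v)) \<le> (\<integral>\<^sub>+t. indicator T (P x + t *\<^sub>R v) * f (P x + t *\<^sub>R v))"
        using T(2)[of "P x"] True by (intro nn_integral_mono) (auto simp: indicator_def)
      then show ?thesis using True by simp
    qed (auto simp: indicator_def)
  qed
  also have "\<dots> = (\<integral>\<^sub>+x. \<integral>\<^sub>+t. indicator {-1/2..1/2} (\<nu> \<bullet> x - c) * (\<lambda>x. indicator T x * f x) (x - (\<nu> \<bullet> x - c) *\<^sub>R \<nu> + t *\<^sub>R v))"
    by (simp add: P_def)
  finally have "(\<integral>\<^sup>+y. indicator E y * (\<integral>\<^sub>+t. indicator {0..\<delta>} t * f (y + t *\<^sub>R v)) \<partial>face_measure F) * ennreal \<bar>d\<bar> \<le>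
     (\<integral>\<^sub>+x. \<integral>\<^sub>+t. indicator {-1/2..1/2} (\<nu> \<bullet> x - c) * (\<lambda>x. indicator T x * f x) (x - (\<nu> \<bullet> x - c) *\<^sub>R \<nu> + t *\<^sub>R v)) * ennreal \<bar>d\<bar>"
    by (rule mult_right_mono) simp
  also have "\<dots> = emeasure lborel {-1/2..1/2::real} * (\<integral>\<^sub>+x. indicator T x * f x)"
    by (rule slab_fubini[OF _ _ \<nu> v(1)]) (use v in auto)
  finally show ?thesis using v by (simp add: mult.commute)
qed

text \<open>On each segment (u y)^2 is at most twice the square at the point with parameter t plus
  twice the squared increment, and the increment is controlled by the gradient. Averaging over t in
  \<open>{0..\<delta>}\<close> turns the face integral into volume integrals.\<close>

lemma trace_C1_piece:
  assumes u: "Ck 1 u" and v: "\<nu> \<bullet> v = d" "d > 0" "norm v \<le> h" and E [measurable]: "E \<in> sets borel" and \<delta>: "\<delta> > 0"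
    and T: "T \<in> sets borel" "\<And>y t. y \<in> E \<Longrightarrow> y \<in> F \<Longrightarrow> 0 \<le> t \<Longrightarrow> t \<le> \<delta> \<Longrightarrow> y + t *\<^sub>R v \<in> T"
  shows "ennreal (d * \<delta>) * (\<integral>\<^sup>+y. indicator E y * ennreal ((u y)\<^sup>2) \<partial>face_measure F)
    \<le> 2 * (\<integral>\<^sub>+x. indicator T x * ennreal ((u x)\<^sup>2)) + ennreal (2 * (\<delta> * h)\<^sup>2) * (\<integral>\<^sub>+x. indicator T x * ennreal (grad_sq u x))"
proof -
  have um [measurable]: "u \<in> borel_measurable borel" using Ck_continuous[OF u] by (rule borel_measurable_continuous_onI)
  have gm [measurable]: "grad_sq u \<in> borel_measurable borel" by (rule grad_sq_measurable[OF u])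
  have [measurable]: "E \<inter> F \<in> sets (face_measure F)"
    unfolding face_measure_eq by (simp add: sets_restrict_space_iff E)
  let ?J1 = "\<lambda>y. \<integral>\<^sub>+t. indicator {0..\<delta>} t * ennreal ((u (y + t *\<^sub>R v))\<^sup>2)"
  let ?J2 = "\<lambda>y. \<integral>\<^sub>+t. indicator {0..\<delta>} t * ennreal (grad_sq u (y + t *\<^sub>R v))"
  have h: "h \<ge> 0" using v(3) norm_ge_zero[of v] by linarith
  have pw: "ennreal \<delta> * ennreal ((u y)\<^sup>2) \<le> 2 * ?J1 y + ennreal (2 * \<delta>\<^sup>2 * h\<^sup>2) * ?J2 y" for y
  proof -
    have "ennreal ((u y)\<^sup>2) \<le> 2 * ennreal ((u (y + t *\<^sub>R v))\<^sup>2) + ennreal (2 * \<delta> * h\<^sup>2) * ?J2 y" if t: "0 \<le> t" "t \<le> \<delta>" for t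
    proof -
      have ab: "a\<^sup>2 \<le> 2 * b\<^sup>2 + 2 * (b - a)\<^sup>2" for a b :: real
        using zero_le_power2[of "2 * b - a"] by (simp add: power2_eq_square algebra_simps)
      have "ennreal ((u y)\<^sup>2) \<le> ennreal (2 * (u (y + t *\<^sub>R v))\<^sup>2 + 2 * (u (y + t *\<^sub>R v) - u y)\<^sup>2)"
        by (rule ennreal_leI[OF ab])
      also have "\<dots> = 2 * ennreal ((u (y + t *\<^sub>R v))\<^sup>2) + 2 * ennreal ((u (y + t *\<^sub>R v) - u y)\<^sup>2)"
        by (simp add: ennreal_mult)
      also have "ennreal ((u (y + t *\<^sub>R v) - u y)\<^sup>2) \<le> ennreal t * (\<integral>\<^sub>+s. indicator {0..t} s * ennreal ((fderiv u (y + s *\<^sub>R v) v)\<^sup>2))"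
        by (rule Ck_1_line_estimate[OF u t(1)])
      also have "\<dots> \<le> ennreal \<delta> * (\<integral>\<^sub>+s. ennreal (h\<^sup>2) * (indicator {0..\<delta>} s * ennreal (grad_sq u (y + s *\<^sub>R v))))"
      proof (rule mult_mono[OF ennreal_leI[OF t(2)] nn_integral_mono])
        fix s :: real
        have "(fderiv u (y + s *\<^sub>R v) v)\<^sup>2 \<le> (norm v)\<^sup>2 * grad_sq u (y + s *\<^sub>R v)"
          by (rule derivative_le_grad_sq[OF u])
        also have "\<dots> \<le> h\<^sup>2 * grad_sq u (y + s *\<^sub>R v)"
          using v(3) by (intro mult_right_mono power_mono grad_sq_nonneg) auto
        finally have "ennreal ((fderiv u (y + s *\<^sub>R v) v)\<^sup>2) \<le> ennreal (h\<^sup>2) * ennreal (grad_sq u (y + s *\<^sub>R v))"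
          by (simp add: ennreal_mult[symmetric] grad_sq_nonneg ennreal_leI)
        then show "indicator {0..t} s * ennreal ((fderiv u (y + s *\<^sub>R v) v)\<^sup>2) \<le> ennreal (h\<^sup>2) * (indicator {0..\<delta>} s * ennreal (grad_sq u (y + s *\<^sub>R v)))"
          using t by (auto simp: indicator_def)
      qed auto
      also have "\<dots> = ennreal \<delta> * (ennreal (h\<^sup>2) * ?J2 y)" by (subst nn_integral_cmult) auto
      finally have "ennreal ((u y)\<^sup>2) \<le> 2 * ennreal ((u (y + t *\<^sub>R v))\<^sup>2) + 2 * (ennreal \<delta> * (ennreal (h\<^sup>2) * ?J2 y))"
        by (simp add: mult_left_mono add_left_mono)
      then show ?thesis using \<delta> by (simp add: ennreal_mult mult.assoc)
    qed
    then have "(\<integral>\<^sub>+t. indicator {0..\<delta>} t * ennreal ((u y)\<^sup>2)) \<le>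
      (\<integral>\<^sub>+t. 2 * (indicator {0..\<delta>} t * ennreal ((u (y + t *\<^sub>R v))\<^sup>2)) + indicator {0..\<delta>} t * (ennreal (2 * \<delta> * h\<^sup>2) * ?J2 y))"
      by (intro nn_integral_mono) (auto simp: indicator_def)
    also have "\<dots> = 2 * ?J1 y + ennreal \<delta> * (ennreal (2 * \<delta> * h\<^sup>2) * ?J2 y)"
      using \<delta> by (simp add: nn_integral_add nn_integral_cmult nn_integral_multc)
    also have "(\<integral>\<^sub>+t. indicator {0..\<delta>} t * ennreal ((u y)\<^sup>2)) = ennreal \<delta> * ennreal ((u y)\<^sup>2)"
      using \<delta> by (simp add: nn_integral_multc)
    also have "ennreal \<delta> * (ennreal (2 * \<delta> * h\<^sup>2) * ?J2 y) = ennreal (2 * \<delta>\<^sup>2 * h\<^sup>2) * ?J2 y"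
      using \<delta> by (simp add: mult.assoc[symmetric] ennreal_mult[symmetric]) (simp add: power2_eq_square mult_ac)
    finally show ?thesis .
  qed
  have "ennreal (d * \<delta>) * (\<integral>\<^sup>+y. indicator E y * ennreal ((u y)\<^sup>2) \<partial>face_measure F)
     = ennreal d * (\<integral>\<^sup>+y. indicator E y * (ennreal \<delta> * ennreal ((u y)\<^sup>2)) \<partial>face_measure F)"
  proof -
    have "(\<integral>\<^sup>+y. indicator E y * (ennreal \<delta> * ennreal ((u y)\<^sup>2)) \<partial>face_measure F) = (\<integral>\<^sup>+y. ennreal \<delta> * (indicator E y * ennreal ((u y)\<^sup>2)) \<partial>face_measure F)"
      by (simp add: mult_ac)
    also have "\<dots> = ennreal \<delta> * (\<integral>\<^sup>+y. indicator E y * ennreal ((u y)\<^sup>2) \<partial>face_measure F)"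
      by (rule nn_integral_cmult, rule face_measurable) measurable
    finally show ?thesis using v \<delta> by (simp add: ennreal_mult mult.assoc)
  qed
  also have "\<dots> \<le> ennreal d * (\<integral>\<^sup>+y. 2 * (indicator E y * ?J1 y) + ennreal (2 * \<delta>\<^sup>2 * h\<^sup>2) * (indicator E y * ?J2 y) \<partial>face_measure F)"
    using pw by (intro mult_left_mono nn_integral_mono) (auto simp: indicator_def)
  also have "(\<integral>\<^sup>+y. 2 * (indicator E y * ?J1 y) + ennreal (2 * \<delta>\<^sup>2 * h\<^sup>2) * (indicator E y * ?J2 y) \<partial>face_measure F)
     = 2 * (\<integral>\<^sup>+y. indicator E y * ?J1 y \<partial>face_measure F) + ennreal (2 * \<delta>\<^sup>2 * h\<^sup>2) * (\<integral>\<^sup>+y. indicator E y * ?J2 y \<partial>face_measure F)"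
  proof -
    have m1: "(\<lambda>y. indicator E y * ?J1 y) \<in> borel_measurable (face_measure F)"
      by (rule face_measurable) measurable
    have m2: "(\<lambda>y. indicator E y * ?J2 y) \<in> borel_measurable (face_measure F)"
      by (rule face_measurable) measurable
    show ?thesis
      using m1 m2 by (simp add: nn_integral_add nn_integral_cmult)
  qed
  also have "ennreal d * \<dots> = 2 * (ennreal d * (\<integral>\<^sup>+y. indicator E y * ?J1 y \<partial>face_measure F)) + ennreal (2 * \<delta>\<^sup>2 * h\<^sup>2) * (ennreal d * (\<integral>\<^sup>+y. indicator E y * ?J2 y \<partial>face_measure F))"
    by (simp add: distrib_left mult_ac)
  also have "\<dots> \<le> 2 * (\<integral>\<^sub>+x. indicator T x * ennreal ((u x)\<^sup>2)) + ennreal (2 * \<delta>\<^sup>2 * h\<^sup>2) * (\<integral>\<^sub>+x. indicator T x * ennreal (grad_sq u x))"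
    by (intro add_mono mult_left_mono slab_face_le[OF _ v(1,2) E T]) auto
  finally show ?thesis by (simp add: power_mult_distrib mult.assoc)
qed

text \<open>In dimension at least two no single direction leads from every point of a facet of a
  simplex into the simplex. The face is therefore covered by pieces \<open>E i\<close>, each with
  its own direction \<open>v i\<close> of the same normal component \<open>d\<close>.\<close>

lemma trace_C1:
  assumes u: "Ck 1 u" and J: "finite J" and v: "\<And>i. i \<in> J \<Longrightarrow> \<nu> \<bullet> v i = d" "d > 0" "\<And>i. i \<in> J \<Longrightarrow> norm (v i) \<le> h"
    and h: "h \<ge> 0" and E: "\<And>i. i \<in> J \<Longrightarrow> closed (E i)" "F \<subseteq> (\<Union>i\<in>J. E i)" and \<delta>: "\<delta> > 0"
    and T: "bounded T" "open K" "K \<subseteq> T" "negligible (T - K)" "T \<in> sets borel"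
      "\<And>i y t. i \<in> J \<Longrightarrow> y \<in> E i \<Longrightarrow> y \<in> F \<Longrightarrow> 0 \<le> t \<Longrightarrow> t \<le> \<delta> \<Longrightarrow> y + t *\<^sub>R v i \<in> T"
  shows "l2_norm (face_measure F) u \<le> sqrt (2 * real (card J) / (d * \<delta>)) *
     (L2 K u + \<delta> * h * grad_norm K (\<lambda>b x. fderiv u x b))"
proof -
  let ?G = "grad_norm K (\<lambda>b x. fderiv u x b)" and ?L = "L2 K u"
  have Kl: "K \<in> sets lebesgue" and Kb: "bounded K" using T bounded_subset by auto
  have usq: "inL2 K u"
    by (rule continuous_square_integrable[OF Ck_continuous[OF u] Kb Kl])
  have dsq: "inL2 K (\<lambda>x. fderiv u x b)" for b
    by (rule continuous_square_integrable[OF Ck_1_derivative_continuous[OF u] Kb Kl])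
  have TK: "(\<integral>\<^sub>+x. indicator T x * f x) = (\<integral>\<^sub>+x. indicator K x * f x)" for f :: "'a \<Rightarrow> ennreal"
  proof -
    have "AE x in lebesgue. x \<notin> T - K" using T(4) by (simp only: negligible_iff_null_sets AE_not_in)
    then have "AE x in lebesgue. indicator T x * f x = indicator K x * f x"
      by eventually_elim (use T(3) in \<open>auto simp: indicator_def\<close>)
    then have "(\<integral>\<^sup>+x. indicator T x * f x \<partial>lebesgue) = (\<integral>\<^sup>+x. indicator K x * f x \<partial>lebesgue)"
      by (rule nn_integral_cong_AE)
    then show ?thesis by (simp add: nn_integral_completion)
  qed
  have 1: "(\<integral>\<^sub>+x. indicator T x * ennreal ((u x)\<^sup>2)) = ennreal (?L\<^sup>2)"
    unfolding TK by (rule l2_norm_nn_integral[OF usq Kl, symmetric])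
  have 2: "(\<integral>\<^sub>+x. indicator T x * ennreal (grad_sq u x)) = ennreal (?G\<^sup>2)"
  proof -
    have "(\<integral>\<^sub>+x. indicator K x * ennreal (grad_sq u x)) = (\<integral>\<^sub>+x. (\<Sum>b\<in>Basis. indicator K x * ennreal ((fderiv u x b)\<^sup>2)))"
    proof -
      have "indicator K x * ennreal (grad_sq u x) = (\<Sum>b\<in>Basis. indicator K x * ennreal ((fderiv u x b)\<^sup>2))" for x
        by (cases "x \<in> K") (auto simp: grad_sq_def sum_ennreal)
      then show ?thesis by simp
    qed
    also have "\<dots> = (\<Sum>b\<in>Basis. \<integral>\<^sub>+x. indicator K x * ennreal ((fderiv u x b)\<^sup>2))"
      using Ck_1_derivative_continuous[OF u, THEN borel_measurable_continuous_onI] T(2) by (intro nn_integral_sum) simp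
    also have "\<dots> = (\<Sum>b\<in>Basis. ennreal ((L2 K (\<lambda>x. fderiv u x b))\<^sup>2))"
      by (simp add: l2_norm_nn_integral[OF dsq Kl])
    also have "\<dots> = ennreal (?G\<^sup>2)" by (simp add: grad_norm_def sum_nonneg)
    finally show ?thesis unfolding TK .
  qed
  have sq: "square_integrable (face_measure F) u" by (rule square_integrable_face[OF Ck_continuous[OF u]])
  have um: "u \<in> borel_measurable borel" using Ck_continuous[OF u] by (rule borel_measurable_continuous_onI)
  let ?N = "l2_norm (face_measure F) u"
  have "ennreal (?N\<^sup>2) = (\<integral>\<^sup>+y. ennreal ((u y)\<^sup>2) \<partial>face_measure F)"
    unfolding l2_norm_power2 using sq by (intro nn_integral_eq_integral[symmetric]) (auto simp: square_integrable_def)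
  also have "\<dots> \<le> (\<integral>\<^sup>+y. (\<Sum>i\<in>J. indicator (E i) y * ennreal ((u y)\<^sup>2)) \<partial>face_measure F)"
  proof (rule nn_integral_mono)
    fix y assume "y \<in> space (face_measure F)"
    then obtain i where i: "i \<in> J" "y \<in> E i" using E(2) by auto
    have "ennreal ((u y)\<^sup>2) = indicator (E i) y * ennreal ((u y)\<^sup>2)" using i by simp
    also have "\<dots> \<le> (\<Sum>i\<in>J. indicator (E i) y * ennreal ((u y)\<^sup>2))"
      by (rule member_le_sum[OF i(1)]) (use J in auto)
    finally show "ennreal ((u y)\<^sup>2) \<le> (\<Sum>i\<in>J. indicator (E i) y * ennreal ((u y)\<^sup>2))" .
  qed
  also have "\<dots> = (\<Sum>i\<in>J. \<integral>\<^sup>+y. indicator (E i) y * ennreal ((u y)\<^sup>2) \<partial>face_measure F)"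
    using E(1) um by (intro nn_integral_sum face_measurable) (simp add: borel_closed)
  finally have "ennreal (d * \<delta>) * ennreal (?N\<^sup>2) \<le> ennreal (d * \<delta>) * (\<Sum>i\<in>J. \<integral>\<^sup>+y. indicator (E i) y * ennreal ((u y)\<^sup>2) \<partial>face_measure F)"
    by (rule mult_left_mono) simp
  also have "\<dots> = (\<Sum>i\<in>J. ennreal (d * \<delta>) * (\<integral>\<^sup>+y. indicator (E i) y * ennreal ((u y)\<^sup>2) \<partial>face_measure F))"
    by (rule sum_distrib_left)
  also have "\<dots> \<le> (\<Sum>i\<in>J. 2 * (\<integral>\<^sub>+x. indicator T x * ennreal ((u x)\<^sup>2)) + ennreal (2 * (\<delta> * h)\<^sup>2) * (\<integral>\<^sub>+x. indicator T x * ennreal (grad_sq u x)))"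
    by (intro sum_mono trace_C1_piece[OF u v(1,2,3) _ \<delta> T(5,6)]) (auto intro: borel_closed E(1))
  also have "\<dots> = (\<Sum>i\<in>J. ennreal (2 * ?L\<^sup>2 + 2 * (\<delta> * h)\<^sup>2 * ?G\<^sup>2))"
    unfolding 1 2 by (simp add: ennreal_mult)
  also have "\<dots> = ennreal (real (card J) * (2 * ?L\<^sup>2 + 2 * (\<delta> * h)\<^sup>2 * ?G\<^sup>2))"
    by (simp add: ennreal_of_nat_eq_real_of_nat ennreal_mult)
  finally have "d * \<delta> * ?N\<^sup>2 \<le> real (card J) * (2 * ?L\<^sup>2 + 2 * (\<delta> * h)\<^sup>2 * ?G\<^sup>2)"
    using v(2) \<delta> by (simp add: ennreal_mult[symmetric])
  also have "\<dots> \<le> real (card J) * (2 * (?L + \<delta> * h * ?G)\<^sup>2)"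
  proof -
    have "0 \<le> ?L * (\<delta> * h * ?G)" using h \<delta> grad_norm_nonneg by (intro mult_nonneg_nonneg) auto
    then have "2 * ?L\<^sup>2 + 2 * (\<delta> * h)\<^sup>2 * ?G\<^sup>2 \<le> 2 * (?L + \<delta> * h * ?G)\<^sup>2"
      by (simp add: power2_sum power_mult_distrib)
    then show ?thesis by (rule mult_left_mono) simp
  qed
  finally have "?N\<^sup>2 \<le> (2 * real (card J) / (d * \<delta>)) * (?L + \<delta> * h * ?G)\<^sup>2"
    using v(2) \<delta> by (simp add: field_simps)
  also have "\<dots> = (sqrt (2 * real (card J) / (d * \<delta>)) * (?L + \<delta> * h * ?G))\<^sup>2"
    using v(2) \<delta> by (simp add: power_mult_distrib)
  finally show ?thesis
    by (rule power2_le_imp_le) (use v(2) \<delta> h grad_norm_nonneg in \<open>auto intro!: mult_nonneg_nonneg add_nonneg_nonneg divide_nonneg_nonneg\<close>)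
qed

end

section \<open>Completeness of the square-integrable functions and existence of traces\<close>

text \<open>Riesz-Fischer: a fast subsequence converges a.e., and Fatou's lemma carries the Cauchy
  estimate over to its limit.\<close>

lemma l2_complete:
  fixes u :: "nat \<Rightarrow> 'a \<Rightarrow> real"
  assumes u: "\<And>k. square_integrable M (u k)"
    and Cauchy: "\<And>e. e > 0 \<Longrightarrow> \<exists>N. \<forall>j\<ge>N. \<forall>k\<ge>N. l2_norm M (\<lambda>x. u j x - u k x) < e"
  shows "\<exists>g. square_integrable M g \<and> (\<lambda>k. l2_norm M (\<lambda>x. u k x - g x)) \<longlonglongrightarrow> 0"
proof -
  have um [measurable]: "u k \<in> borel_measurable M" for k using u by (simp add: square_integrable_def)
  have nn: "(\<integral>\<^sup>+x. ennreal ((f x)\<^sup>2) \<partial>M) = ennreal ((l2_norm M f)\<^sup>2)" if "square_integrable M f" for f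
    unfolding l2_norm_power2 using that by (intro nn_integral_eq_integral) (auto simp: square_integrable_def)
  define N where "N m = (SOME N. \<forall>j\<ge>N. \<forall>k\<ge>N. l2_norm M (\<lambda>x. u j x - u k x) < (1/2) ^ m)" for m :: nat
  have N0: "\<forall>j\<ge>N m. \<forall>k\<ge>N m. l2_norm M (\<lambda>x. u j x - u k x) < (1/2) ^ m" for m
    unfolding N_def by (rule someI_ex) (rule Cauchy, simp)
  have N: "l2_norm M (\<lambda>x. u j x - u k x) < (1/2) ^ m" if "j \<ge> N m" "k \<ge> N m" for m j k
    using N0[of m] that by simp
  \<comment> \<open>The partial sums make the index sequence monotone and at least
    \<open>N m\<close>; the added \<open>m\<close> makes it unbounded.\<close>
  define r where "r m = (\<Sum>i\<le>m. N i) + m" for m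
  have rN: "r m \<ge> N m" for m unfolding r_def by (rule trans_le_add1) (rule member_le_sum, auto)
  have rmono: "r m \<le> r (Suc m)" for m unfolding r_def by simp
  have rm: "r m \<ge> m" for m by (simp add: r_def)
  let ?v = "\<lambda>m. u (r m)"
  \<comment> \<open>The squared distances are at most 4^(-m). The weight 2^m leaves a summable bound
    and still forces pointwise differences of order \<open>sqrt (1/2) ^ m\<close>, hence pointwise
    convergence.\<close>
  have small: "(\<integral>\<^sup>+x. ennreal (2 ^ m * (?v (Suc m) x - ?v m x)\<^sup>2) \<partial>M) \<le> ennreal ((1/2) ^ m)" for m
  proof -
    have "l2_norm M (\<lambda>x. ?v (Suc m) x - ?v m x) \<le> (1/2) ^ m"
      using N[of m "r (Suc m)" "r m"] rN[of m] rmono[of m] by simp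
    then have "(l2_norm M (\<lambda>x. ?v (Suc m) x - ?v m x))\<^sup>2 \<le> ((1/2) ^ m)\<^sup>2" by (rule power_mono) simp
    then have "2 ^ m * (l2_norm M (\<lambda>x. ?v (Suc m) x - ?v m x))\<^sup>2 \<le> 2 ^ m * ((1/2) ^ m)\<^sup>2" by (rule mult_left_mono) simp
    also have "\<dots> = (1/2 :: real) ^ m" by (simp add: power2_eq_square power_mult_distrib[symmetric] mult.assoc[symmetric])
    finally have b: "2 ^ m * (l2_norm M (\<lambda>x. ?v (Suc m) x - ?v m x))\<^sup>2 \<le> (1/2) ^ m" .
    have "(\<integral>\<^sup>+x. ennreal (2 ^ m * (?v (Suc m) x - ?v m x)\<^sup>2) \<partial>M) = ennreal (2 ^ m) * (\<integral>\<^sup>+x. ennreal ((?v (Suc m) x - ?v m x)\<^sup>2) \<partial>M)"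
      by (subst nn_integral_cmult[symmetric]) (auto simp: ennreal_mult)
    also have "\<dots> = ennreal (2 ^ m * (l2_norm M (\<lambda>x. ?v (Suc m) x - ?v m x))\<^sup>2)"
      by (subst nn[OF square_integrable_diff[OF u u]]) (simp add: ennreal_mult)
    also have "\<dots> \<le> ennreal ((1/2) ^ m)" by (rule ennreal_leI[OF b])
    finally show ?thesis .
  qed
  have "(\<integral>\<^sup>+x. (\<Sum>m. ennreal (2 ^ m * (?v (Suc m) x - ?v m x)\<^sup>2)) \<partial>M) = (\<Sum>m. \<integral>\<^sup>+x. ennreal (2 ^ m * (?v (Suc m) x - ?v m x)\<^sup>2) \<partial>M)"
    by (rule nn_integral_suminf) measurable
  also have "\<dots> \<le> (\<Sum>m. ennreal ((1/2) ^ m))" by (intro suminf_le small) auto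
  also have "\<dots> = ennreal (\<Sum>m. (1/2) ^ m)" by (rule suminf_ennreal2) (auto simp: summable_geometric)
  also have "\<dots> < \<infinity>" by simp
  finally have "AE x in M. (\<Sum>m. ennreal (2 ^ m * (?v (Suc m) x - ?v m x)\<^sup>2)) \<noteq> \<infinity>"
    by (intro nn_integral_PInf_AE) auto
  then have AEconv: "AE x in M. convergent (\<lambda>m. ?v m x)"
  proof eventually_elim
    case (elim x)
    let ?S = "\<Sum>m. ennreal (2 ^ m * (?v (Suc m) x - ?v m x)\<^sup>2)"
    have fin: "\<exists>B. s = ennreal B \<and> B \<ge> 0" if "s \<noteq> \<infinity>" for s :: ennreal using that by (cases s) auto
    obtain B where B: "?S = ennreal B" "B \<ge> 0" using fin[OF elim] by blast
    have "2 ^ m * (?v (Suc m) x - ?v m x)\<^sup>2 \<le> B" for m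
    proof -
      have "(\<Sum>i\<in>{m}. ennreal (2 ^ i * (?v (Suc i) x - ?v i x)\<^sup>2)) \<le> ?S"
        by (rule sum_le_suminf) auto
      then show ?thesis using B by simp
    qed
    then have d: "\<bar>?v (Suc m) x - ?v m x\<bar> \<le> sqrt B * (sqrt (1/2)) ^ m" for m
    proof -
      have "(?v (Suc m) x - ?v m x)\<^sup>2 \<le> B * (1/2) ^ m"
        using \<open>\<And>m. 2 ^ m * (?v (Suc m) x - ?v m x)\<^sup>2 \<le> B\<close>[of m] by (simp add: power_divide field_simps)
      then have "sqrt ((?v (Suc m) x - ?v m x)\<^sup>2) \<le> sqrt (B * (1/2) ^ m)" by (rule real_sqrt_le_mono)
      then show ?thesis unfolding real_sqrt_abs by (simp only: real_sqrt_mult real_sqrt_power)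
    qed
    have "summable (\<lambda>m. sqrt B * (sqrt (1/2)) ^ m)"
      by (intro summable_mult summable_geometric) (simp add: real_sqrt_divide)
    then have "summable (\<lambda>m. ?v (Suc m) x - ?v m x)"
      by (rule summable_comparison_test'[where N=0]) (use d in simp)
    then have "convergent (\<lambda>n. \<Sum>m<n. ?v (Suc m) x - ?v m x)" by (simp add: summable_iff_convergent)
    moreover have "(\<Sum>m<n. ?v (Suc m) x - ?v m x) = ?v n x - ?v 0 x" for n by (rule sum_lessThan_telescope)
    ultimately have "convergent (\<lambda>n. ?v n x - ?v 0 x)" by simp
    from convergent_add[OF this convergent_const[of "?v 0 x"]] show ?case by simp
  qed
  define g where "g x = lim (\<lambda>m. ?v m x)" for x
  have gm [measurable]: "g \<in> borel_measurable M" unfolding g_def[abs_def] by measurable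
  have glim: "AE x in M. (\<lambda>m. ?v m x) \<longlonglongrightarrow> g x"
    using AEconv by eventually_elim (simp add: g_def convergent_LIMSEQ_iff)
  have fat: "(\<integral>\<^sup>+x. ennreal ((u k x - g x)\<^sup>2) \<partial>M) \<le> ennreal ((e)\<^sup>2)"
    if e: "e > 0" and k: "\<And>j. j \<ge> K \<Longrightarrow> l2_norm M (\<lambda>x. u k x - u j x) < e" for k K e
  proof -
    have "(\<integral>\<^sup>+x. ennreal ((u k x - g x)\<^sup>2) \<partial>M) = (\<integral>\<^sup>+x. liminf (\<lambda>m. ennreal ((u k x - ?v m x)\<^sup>2)) \<partial>M)"
    proof (rule nn_integral_cong_AE)
      show "AE x in M. ennreal ((u k x - g x)\<^sup>2) = liminf (\<lambda>m. ennreal ((u k x - ?v m x)\<^sup>2))"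
        using glim
      proof eventually_elim
        case (elim x)
        then have "(\<lambda>m. ennreal ((u k x - ?v m x)\<^sup>2)) \<longlonglongrightarrow> ennreal ((u k x - g x)\<^sup>2)"
          by (intro tendsto_ennrealI tendsto_intros)
        then show ?case by (rule lim_imp_Liminf[OF sequentially_bot, symmetric])
      qed
    qed
    also have "\<dots> \<le> liminf (\<lambda>m. \<integral>\<^sup>+x. ennreal ((u k x - ?v m x)\<^sup>2) \<partial>M)"
      by (rule nn_integral_liminf) measurable
    also have "\<dots> \<le> ennreal (e\<^sup>2)"
    proof (rule Liminf_le)
      show "sequentially \<noteq> bot" by simp
      show "\<forall>\<^sub>F m in sequentially. (\<integral>\<^sup>+x. ennreal ((u k x - ?v m x)\<^sup>2) \<partial>M) \<le> ennreal (e\<^sup>2)"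
        unfolding eventually_sequentially
      proof (intro exI[of _ K] allI impI)
        fix m assume "m \<ge> K"
        then have "l2_norm M (\<lambda>x. u k x - ?v m x) \<le> e" using k[of "r m"] rm[of m] by simp
        then show "(\<integral>\<^sup>+x. ennreal ((u k x - ?v m x)\<^sup>2) \<partial>M) \<le> ennreal (e\<^sup>2)"
          unfolding nn[OF square_integrable_diff[OF u u]] by (intro ennreal_leI power_mono) auto
      qed
    qed
    finally show ?thesis .
  qed
  have sqd: "square_integrable M (\<lambda>x. u (N 0) x - g x)"
  proof -
    have "(\<integral>\<^sup>+x. ennreal ((u (N 0) x - g x)\<^sup>2) \<partial>M) \<le> ennreal (1\<^sup>2)"
      by (rule fat[where K="N 0"]) (use N[of 0 "N 0"] in auto)
    also have "\<dots> < \<infinity>" by simp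
    finally have "integrable M (\<lambda>x. (u (N 0) x - g x)\<^sup>2)"
      by (intro integrableI_nonneg) auto
    then show ?thesis by (simp add: square_integrable_def)
  qed
  have gsq: "square_integrable M g" using square_integrable_diff[OF u sqd, of "N 0"] by simp
  moreover have "(\<lambda>k. l2_norm M (\<lambda>x. u k x - g x)) \<longlonglongrightarrow> 0"
  proof (rule LIMSEQ_I)
    fix e :: real assume e: "e > 0"
    obtain K where K: "\<And>j k. j \<ge> K \<Longrightarrow> k \<ge> K \<Longrightarrow> l2_norm M (\<lambda>x. u j x - u k x) < e / 2"
      using Cauchy[of "e / 2"] e by auto
    have "l2_norm M (\<lambda>x. u k x - g x) < e" if k: "k \<ge> K" for k
    proof -
      have "(\<integral>\<^sup>+x. ennreal ((u k x - g x)\<^sup>2) \<partial>M) \<le> ennreal ((e / 2)\<^sup>2)"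
        by (rule fat[where K=K]) (use e K k in auto)
      then have "(l2_norm M (\<lambda>x. u k x - g x))\<^sup>2 \<le> (e / 2)\<^sup>2"
        unfolding nn[OF square_integrable_diff[OF u gsq]] by simp
      then have "l2_norm M (\<lambda>x. u k x - g x) \<le> e / 2" by (rule power2_le_imp_le) (use e in simp)
      then show ?thesis using e by simp
    qed
    then show "\<exists>no. \<forall>k\<ge>no. norm (l2_norm M (\<lambda>x. u k x - g x) - 0) < e" by auto
  qed
  ultimately show ?thesis by blast
qed

lemma grad_norm_triangle:
  assumes "\<And>b. b \<in> Basis \<Longrightarrow> inL2 K (g b)" "\<And>b. b \<in> Basis \<Longrightarrow> inL2 K (h b)"
  shows "grad_norm K (\<lambda>b x. g b x + h b x) \<le> grad_norm K g + grad_norm K h"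
proof -
  have "grad_norm K (\<lambda>b x. g b x + h b x) = L2_set (\<lambda>b. L2 K (\<lambda>x. g b x + h b x)) Basis"
    by (simp add: grad_norm_def L2_set_def)
  also have "\<dots> \<le> L2_set (\<lambda>b. L2 K (g b) + L2 K (h b)) Basis"
    by (intro L2_set_mono l2_norm_triangle assms) auto
  also have "\<dots> \<le> L2_set (\<lambda>b. L2 K (g b)) Basis + L2_set (\<lambda>b. L2 K (h b)) Basis"
    by (rule L2_set_triangle_ineq)
  finally show ?thesis by (simp add: grad_norm_def L2_set_def)
qed

lemma grad_norm_minus_commute: "grad_norm K (\<lambda>b x. g b x - h b x) = grad_norm K (\<lambda>b x. h b x - g b x)"
  unfolding grad_norm_def by (subst l2_norm_minus_commute) (rule refl)

lemma grad_norm_tendsto_0: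
  assumes "\<And>b. b \<in> Basis \<Longrightarrow> (\<lambda>k. L2 K (g k b)) \<longlonglongrightarrow> 0"
  shows "(\<lambda>k. grad_norm K (g k)) \<longlonglongrightarrow> 0"
proof -
  have "(\<lambda>k. sqrt (\<Sum>b\<in>Basis. (L2 K (g k b))\<^sup>2)) \<longlonglongrightarrow> sqrt (\<Sum>b\<in>(Basis::'a set). 0\<^sup>2)"
    by (intro tendsto_real_sqrt tendsto_sum tendsto_power assms)
  then show ?thesis by (simp add: grad_norm_def)
qed

context hyperplane_face
begin

context
  fixes T :: "'a set" and w :: "'a \<Rightarrow> real" and g :: "'a \<Rightarrow> 'a \<Rightarrow> real" and A B :: real
  assumes T: "convex T" "bounded T" "interior T \<noteq> {}"
    and tr: "\<And>u. Ck 1 u \<Longrightarrow> l2_norm (face_measure F) u \<le>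
      A * L2 (interior T) u + B * grad_norm (interior T) (\<lambda>b x. fderiv u x b)"
    and AB: "A \<ge> 0" "B \<ge> 0"
    and w: "inL2 (interior T) w"
    and g: "\<And>b. b \<in> Basis \<Longrightarrow> has_weak_partial (interior T) b w (g b)"
      "\<And>b. b \<in> Basis \<Longrightarrow> inL2 (interior T) (g b)"
begin

lemma interior_facts: "open (interior T)" "bounded (interior T)" "convex (interior T)" "interior T \<in> sets lebesgue"
  using T by (auto intro: convex_interior bounded_subset[OF _ interior_subset])

lemma C1_square_integrable:
  assumes "Ck 1 u"
  shows "inL2 (interior T) u"
    "inL2 (interior T) (\<lambda>x. fderiv u x b)"
  using interior_facts Ck_continuous[OF assms] Ck_1_derivative_continuous[OF assms]
  by (auto intro!: continuous_square_integrable)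

lemma frechet_derivative_diff_C1:
  assumes "Ck 1 u" "Ck 1 v"
  shows "fderiv (\<lambda>x. u x - v x) x b = fderiv u x b - fderiv v x b"
proof -
  have "(u has_derivative fderiv u x) (at x)" "(v has_derivative fderiv v x) (at x)"
    using assms unfolding Ck_1_iff by (auto simp: frechet_derivative_works[symmetric])
  from frechet_derivative_at[OF has_derivative_diff[OF this]] show ?thesis by metis
qed

lemma trace_C1_diff:
  assumes "Ck 1 u" "Ck 1 v"
  shows "l2_norm (face_measure F) (\<lambda>x. u x - v x) \<le> A * (L2 (interior T) (\<lambda>x. u x - w x) + L2 (interior T) (\<lambda>x. w x - v x))
    + B * (grad_norm (interior T) (\<lambda>b x. fderiv u x b - g b x) + grad_norm (interior T) (\<lambda>b x. g b x - fderiv v x b))"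
proof -
  have "l2_norm (face_measure F) (\<lambda>x. u x - v x) \<le> A * L2 (interior T) (\<lambda>x. u x - v x)
     + B * grad_norm (interior T) (\<lambda>b x. fderiv u x b - fderiv v x b)"
    using tr[OF Ck_diff[OF assms]] unfolding frechet_derivative_diff_C1[OF assms] .
  also have "\<dots> \<le> A * (L2 (interior T) (\<lambda>x. u x - w x) + L2 (interior T) (\<lambda>x. w x - v x))
    + B * (grad_norm (interior T) (\<lambda>b x. fderiv u x b - g b x) + grad_norm (interior T) (\<lambda>b x. g b x - fderiv v x b))"
  proof (intro add_mono mult_left_mono AB)
    show "L2 (interior T) (\<lambda>x. u x - v x) \<le> L2 (interior T) (\<lambda>x. u x - w x) + L2 (interior T) (\<lambda>x. w x - v x)"
      using l2_norm_triangle[OF square_integrable_diff[OF C1_square_integrable(1)[OF assms(1)] w] square_integrable_diff[OF w C1_square_integrable(1)[OF assms(2)]]] by simp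
    show "grad_norm (interior T) (\<lambda>b x. fderiv u x b - fderiv v x b)
       \<le> grad_norm (interior T) (\<lambda>b x. fderiv u x b - g b x) + grad_norm (interior T) (\<lambda>b x. g b x - fderiv v x b)"
      using grad_norm_triangle[of "interior T" "\<lambda>b x. fderiv u x b - g b x" "\<lambda>b x. g b x - fderiv v x b"]
        C1_square_integrable(2)[OF assms(1)] C1_square_integrable(2)[OF assms(2)] g(2) by (simp add: square_integrable_diff)
  qed
  finally show ?thesis .
qed

lemma h1_seminorm_C1_diff:
  assumes "Ck 1 u"
  shows "h1_seminorm (interior T) (\<lambda>x. u x - w x) = grad_norm (interior T) (\<lambda>b x. fderiv u x b - g b x)"
  unfolding grad_norm_def
  by (rule h1_seminorm_eq[OF interior_facts(1)])
    (rule has_weak_partial_diff[OF Ck_1_has_weak_partial[OF assms interior_facts(1)] g(1) interior_facts(1)])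

text \<open>By the trace inequality for smooth functions, any smooth sequence converging to
  \<open>w\<close> is Cauchy on the face. Existence matters because \<open>face_trace\<close> is a
  Hilbert choice, which has the wanted property only if some trace exists.\<close>

theorem face_trace_exists: "\<exists>t. is_face_trace T F w t"
proof -
  obtain u where u: "\<And>k. Ck 1 (u k)" "(\<lambda>k. L2 (interior T) (\<lambda>x. u k x - w x)) \<longlonglongrightarrow> 0"
    "\<And>b. b \<in> Basis \<Longrightarrow> (\<lambda>k. L2 (interior T) (\<lambda>x. fderiv (u k) x b - g b x)) \<longlonglongrightarrow> 0"
    using H1_density[OF interior_facts(1-3) T(3) w g] by blast
  let ?a = "\<lambda>k. L2 (interior T) (\<lambda>x. u k x - w x)"
  let ?b = "\<lambda>k. grad_norm (interior T) (\<lambda>b x. fderiv (u k) x b - g b x)"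
  have b0: "?b \<longlonglongrightarrow> 0" by (rule grad_norm_tendsto_0) (rule u(3))
  have usq: "square_integrable (face_measure F) (u k)" for k
    by (rule square_integrable_face[OF Ck_continuous[OF u(1)]])
  have "\<exists>t. square_integrable (face_measure F) t \<and> (\<lambda>k. l2_norm (face_measure F) (\<lambda>x. u k x - t x)) \<longlonglongrightarrow> 0"
  proof (rule l2_complete[OF usq])
    fix e :: real assume e: "e > 0"
    have "(\<lambda>k. A * ?a k + B * ?b k) \<longlonglongrightarrow> A * 0 + B * 0"
      by (intro tendsto_add tendsto_mult tendsto_const u(2) b0)
    then have "\<forall>\<^sub>F k in sequentially. A * ?a k + B * ?b k < e / 2"
      using e by (intro order_tendstoD) auto
    then obtain N where N: "\<And>k. k \<ge> N \<Longrightarrow> A * ?a k + B * ?b k < e / 2" by (auto simp: eventually_sequentially)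
    have "l2_norm (face_measure F) (\<lambda>x. u j x - u k x) < e" if "j \<ge> N" "k \<ge> N" for j k
    proof -
      have "l2_norm (face_measure F) (\<lambda>x. u j x - u k x) \<le> A * (?a j + ?a k) + B * (?b j + ?b k)"
        using trace_C1_diff[OF u(1) u(1), of j k]
        by (simp add: l2_norm_minus_commute[of _ w] grad_norm_minus_commute[of _ g])
      also have "\<dots> < e" using N[OF that(1)] N[OF that(2)] by (simp add: algebra_simps)
      finally show ?thesis .
    qed
    then show "\<exists>N. \<forall>j\<ge>N. \<forall>k\<ge>N. l2_norm (face_measure F) (\<lambda>x. u j x - u k x) < e" by blast
  qed
  then obtain t where t: "square_integrable (face_measure F) t" "(\<lambda>k. l2_norm (face_measure F) (\<lambda>x. u k x - t x)) \<longlonglongrightarrow> 0" by blast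
  have "is_face_trace T F w t"
    unfolding is_face_trace_def using t u b0 h1_seminorm_C1_diff[OF u(1)] by (auto intro!: exI[of _ u])
  then show ?thesis by blast
qed

text \<open>Formulated for an arbitrary trace \<open>t\<close>, because nothing is known about the
  representative picked by \<open>face_trace\<close>. Subtracting a smooth \<open>p\<close> prepares
  for the affine approximant.\<close>

theorem face_trace_bound:
  assumes t: "is_face_trace T F w t" and p: "Ck 1 p"
  shows "l2_norm (face_measure F) (\<lambda>x. t x - p x) \<le> A * L2 (interior T) (\<lambda>x. w x - p x)
    + B * grad_norm (interior T) (\<lambda>b x. g b x - fderiv p x b)"
proof -
  obtain u where u: "\<And>k. Ck 1 (u k)" "(\<lambda>k. L2 (interior T) (\<lambda>x. u k x - w x)) \<longlonglongrightarrow> 0"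
    "(\<lambda>k. h1_seminorm (interior T) (\<lambda>x. u k x - w x)) \<longlonglongrightarrow> 0" "(\<lambda>k. l2_norm (face_measure F) (\<lambda>x. u k x - t x)) \<longlonglongrightarrow> 0"
    and tsq: "square_integrable (face_measure F) t"
    using t unfolding is_face_trace_def by blast
  let ?a = "\<lambda>k. L2 (interior T) (\<lambda>x. u k x - w x)"
  let ?b = "\<lambda>k. grad_norm (interior T) (\<lambda>b x. fderiv (u k) x b - g b x)"
  let ?c = "\<lambda>k. l2_norm (face_measure F) (\<lambda>x. u k x - t x)"
  let ?R1 = "L2 (interior T) (\<lambda>x. w x - p x)"
  let ?R2 = "grad_norm (interior T) (\<lambda>b x. g b x - fderiv p x b)"
  have b0: "?b \<longlonglongrightarrow> 0" using u(3) unfolding h1_seminorm_C1_diff[OF u(1)] .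
  have psq: "square_integrable (face_measure F) p" by (rule square_integrable_face[OF Ck_continuous[OF p]])
  have usq: "square_integrable (face_measure F) (u k)" for k
    by (rule square_integrable_face[OF Ck_continuous[OF u(1)]])
  have "l2_norm (face_measure F) (\<lambda>x. t x - p x) \<le> ?c k + (A * (?a k + ?R1) + B * (?b k + ?R2))" for k
  proof -
    have "l2_norm (face_measure F) (\<lambda>x. t x - p x) = l2_norm (face_measure F) (\<lambda>x. (u k x - p x) - (u k x - t x))" by simp
    also have "\<dots> \<le> l2_norm (face_measure F) (\<lambda>x. u k x - p x) + ?c k"
      by (intro l2_norm_triangle_diff square_integrable_diff usq psq tsq)
    finally show ?thesis using trace_C1_diff[OF u(1) p, of k] by simp
  qed
  moreover have "(\<lambda>k. ?c k + (A * (?a k + ?R1) + B * (?b k + ?R2))) \<longlonglongrightarrow> 0 + (A * (0 + ?R1) + B * (0 + ?R2))"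
    by (intro tendsto_add tendsto_mult tendsto_const u(2,4) b0)
  ultimately show ?thesis by (intro LIMSEQ_le_const[where X="\<lambda>k. ?c k + (A * (?a k + ?R1) + B * (?b k + ?R2))"]) auto
qed

end

end

section \<open>Simplices in barycentric coordinates\<close>

text \<open>The map fixes the hyperplane \<open>a \<bullet> x + c = 0\<close> and stretches by
  \<open>1 + \<beta> * s\<close> along \<open>v\<close>. In slab coordinates over that hyperplane it
  is a dilation of the variable t, so the determinant can be read off.\<close>

lemma nn_integral_affine_stretch:
  fixes f :: "'a::euclidean_space \<Rightarrow> ennreal"
  assumes f [measurable]: "f \<in> borel_measurable borel" and s: "a \<bullet> v = s" "s \<noteq> 0" and \<beta>: "1 + \<beta> * s \<noteq> 0"
  shows "(\<integral>\<^sub>+x. f (x + (\<beta> * (a \<bullet> x + c)) *\<^sub>R v)) * ennreal \<bar>1 + \<beta> * s\<bar> = (\<integral>\<^sub>+x. f x)"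
proof -
  have a: "a \<noteq> 0" using s by auto
  define \<nu> where "\<nu> = (1 / norm a) *\<^sub>R a"
  define c' where "c' = - c / norm a"
  have \<nu>: "norm \<nu> = 1" using a by (simp add: \<nu>_def)
  have nn: "\<nu> \<bullet> \<nu> = 1" using \<nu> by (simp add: power2_norm_eq_inner[symmetric])
  have an: "a = norm a *\<^sub>R \<nu>" using a by (simp add: \<nu>_def)
  have d: "\<nu> \<bullet> v = s / norm a" using s by (simp add: \<nu>_def)
  have d0: "s / norm a \<noteq> 0" using s a by simp
  let ?I = "{0..1::real}"
  let ?L = "\<lambda>x. x + (\<beta> * (a \<bullet> x + c)) *\<^sub>R v"
  let ?P = "\<lambda>x. x - (\<nu> \<bullet> x - c') *\<^sub>R \<nu>"
  have Lm: "(\<lambda>x. f (?L x)) \<in> borel_measurable borel" by measurable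
  have L: "?L (?P x + t *\<^sub>R v) = ?P x + ((1 + \<beta> * s) * t) *\<^sub>R v" for x t
  proof -
    have "\<nu> \<bullet> ?P x = c'" by (simp add: inner_diff_right nn)
    then have "a \<bullet> ?P x = norm a * c'" by (subst an) simp
    then have "a \<bullet> ?P x + c = 0" using a by (simp add: c'_def)
    then have "a \<bullet> (?P x + t *\<^sub>R v) + c = t * s" using s by (simp only: inner_add_right inner_scaleR_right)
    then show ?thesis by (simp add: algebra_simps)
  qed
  have e1: "(\<integral>\<^sub>+t. indicator ?I (\<nu> \<bullet> x - c') * f (?L (?P x + t *\<^sub>R v))) * ennreal \<bar>1 + \<beta> * s\<bar>
      = (\<integral>\<^sub>+t. indicator ?I (\<nu> \<bullet> x - c') * f (?P x + t *\<^sub>R v))" for x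
    using nn_integral_lborel_affine[OF \<beta>, of "\<lambda>t. indicator ?I (\<nu> \<bullet> x - c') * f (?P x + t *\<^sub>R v)" 0]
    unfolding L by simp
  have "(\<integral>\<^sub>+x. f (?L x)) * ennreal \<bar>1 + \<beta> * s\<bar>
     = emeasure lborel ?I * (\<integral>\<^sub>+x. f (?L x)) * ennreal \<bar>1 + \<beta> * s\<bar>" by simp
  also have "\<dots> = (\<integral>\<^sub>+x. \<integral>\<^sub>+t. indicator ?I (\<nu> \<bullet> x - c') * f (?L (?P x + t *\<^sub>R v))) * ennreal \<bar>s / norm a\<bar> * ennreal \<bar>1 + \<beta> * s\<bar>"
    using slab_fubini[OF Lm _ \<nu> d d0, of ?I c'] by simp
  also have "\<dots> = (\<integral>\<^sub>+x. (\<integral>\<^sub>+t. indicator ?I (\<nu> \<bullet> x - c') * f (?L (?P x + t *\<^sub>R v))) * ennreal \<bar>1 + \<beta> * s\<bar>) * ennreal \<bar>s / norm a\<bar>"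
    by (subst nn_integral_multc) (auto simp: mult_ac)
  also have "\<dots> = (\<integral>\<^sub>+x. \<integral>\<^sub>+t. indicator ?I (\<nu> \<bullet> x - c') * f (?P x + t *\<^sub>R v)) * ennreal \<bar>s / norm a\<bar>"
    unfolding e1 ..
  also have "\<dots> = emeasure lborel ?I * (\<integral>\<^sub>+x. f x)"
    by (rule slab_fubini[OF f _ \<nu> d d0]) simp
  finally show ?thesis by simp
qed

lemma integral_affine_stretch:
  fixes f :: "'a::euclidean_space \<Rightarrow> real"
  assumes f [measurable]: "f \<in> borel_measurable borel" and f0: "\<And>x. 0 \<le> f x"
    and s: "a \<bullet> v = s" "s \<noteq> 0" and \<beta>: "1 + \<beta> * s \<noteq> 0"
  shows "(LINT x|lborel. f (x + (\<beta> * (a \<bullet> x + c)) *\<^sub>R v)) * \<bar>1 + \<beta> * s\<bar> = (LINT x|lborel. f x)"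
proof -
  have "(LINT x|lborel. f (x + (\<beta> * (a \<bullet> x + c)) *\<^sub>R v)) = enn2real (\<integral>\<^sub>+x. ennreal (f (x + (\<beta> * (a \<bullet> x + c)) *\<^sub>R v)))"
    by (rule integral_eq_nn_integral) (auto simp: f0)
  moreover have "(LINT x|lborel. f x) = enn2real (\<integral>\<^sub>+x. ennreal (f x))"
    by (rule integral_eq_nn_integral) (auto simp: f0)
  moreover have "(\<integral>\<^sub>+x. ennreal (f (x + (\<beta> * (a \<bullet> x + c)) *\<^sub>R v))) * ennreal \<bar>1 + \<beta> * s\<bar> = (\<integral>\<^sub>+x. ennreal (f x))"
    by (rule nn_integral_affine_stretch[OF _ s \<beta>]) measurable
  ultimately show ?thesis by (metis enn2real_mult enn2real_ennreal abs_ge_zero)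
qed

text \<open>\<open>a v\<close> and \<open>c v\<close> are the gradient and the constant term of the
  barycentric coordinate of \<open>v\<close>. They are characterized by duality instead of being
  constructed, so that the pieces of a nodal basis can be inserted directly.\<close>

locale bary_simplex =
  fixes C :: "'a::euclidean_space set" and a :: "'a \<Rightarrow> 'a" and c :: "'a \<Rightarrow> real"
  assumes card_C: "card C = Suc DIM('a)" and indep: "\<not> affine_dependent C"
    and dual: "\<And>v v'. v \<in> C \<Longrightarrow> v' \<in> C \<Longrightarrow> a v \<bullet> v' + c v = (if v' = v then 1 else 0)"
begin

definition T where "T = convex hull C"

definition lam :: "'a \<Rightarrow> 'a \<Rightarrow> real" where "lam v x = a v \<bullet> x + c v"

lemma fin_C [simp]: "finite C" by (rule aff_independent_finite[OF indep])

lemma lam_vertex: "v \<in> C \<Longrightarrow> v' \<in> C \<Longrightarrow> lam v v' = (if v' = v then 1 else 0)"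
  by (simp add: lam_def dual)

lemma affine_combination:
  assumes "sum u C = 1"
  shows "p \<bullet> (\<Sum>v\<in>C. u v *\<^sub>R v) + q = (\<Sum>v\<in>C. u v * (p \<bullet> v + q))"
  using assms by (simp add: inner_sum_right distrib_left sum.distrib sum_distrib_right[symmetric])

lemma lam_sum_exists: "\<exists>u. sum u C = 1 \<and> x = (\<Sum>v\<in>C. u v *\<^sub>R v) \<and> (\<forall>v\<in>C. lam v x = u v)"
proof -
  have "affine hull C = UNIV"
    using card_C by (intro affine_independent_span_eq[OF indep]) simp
  then have "x \<in> affine hull C" by simp
  then obtain u where u: "sum u C = 1" "(\<Sum>v\<in>C. u v *\<^sub>R v) = x" by (auto simp: affine_hull_finite)
  have "lam v x = u v" if v: "v \<in> C" for v
  proof -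
    have "lam v x = (\<Sum>w\<in>C. if w = v then u w else 0)"
      unfolding lam_def u(2)[symmetric] affine_combination[OF u(1)] using dual[OF v] by (intro sum.cong) auto
    also have "\<dots> = u v" using v by simp
    finally show ?thesis .
  qed
  then show ?thesis using u by blast
qed

lemma lam_sum: "(\<Sum>v\<in>C. lam v x) = 1"
  using lam_sum_exists[of x] by auto

lemma lam_repr: "(\<Sum>v\<in>C. lam v x *\<^sub>R v) = x"
  using lam_sum_exists[of x] by auto

lemma lam_unique: "sum u C = 1 \<Longrightarrow> v \<in> C \<Longrightarrow> lam v (\<Sum>w\<in>C. u w *\<^sub>R w) = u v"
proof -
  assume u: "sum u C = 1" and v: "v \<in> C"
  have "lam v (\<Sum>w\<in>C. u w *\<^sub>R w) = (\<Sum>w\<in>C. if w = v then u w else 0)"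
    unfolding lam_def affine_combination[OF u] using dual[OF v] by (intro sum.cong) auto
  then show ?thesis using v by simp
qed

lemma affine_repr: "p \<bullet> x + q = (\<Sum>v\<in>C. lam v x * (p \<bullet> v + q))"
  using affine_combination[OF lam_sum, of p x q] lam_repr[of x] by simp

lemma T_eq: "T = {x. \<forall>v\<in>C. 0 \<le> lam v x}"
proof (intro set_eqI iffI)
  fix x assume "x \<in> T"
  then obtain u where u: "\<forall>v\<in>C. 0 \<le> u v" "sum u C = 1" "(\<Sum>v\<in>C. u v *\<^sub>R v) = x"
    unfolding T_def by (auto simp: convex_hull_finite)
  then show "x \<in> {x. \<forall>v\<in>C. 0 \<le> lam v x}" using lam_unique[OF u(2)] by auto
next
  fix x assume "x \<in> {x. \<forall>v\<in>C. 0 \<le> lam v x}"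
  then show "x \<in> T" unfolding T_def convex_hull_finite[OF fin_C]
    using lam_sum[of x] lam_repr[of x] by (auto intro!: exI[of _ "\<lambda>v. lam v x"])
qed

lemma lam_le_1: "x \<in> T \<Longrightarrow> v \<in> C \<Longrightarrow> lam v x \<le> 1"
  using member_le_sum[of v C "\<lambda>v. lam v x"] lam_sum[of x] by (auto simp: T_eq)

lemma lam_add: "lam v (x + y) = lam v x + a v \<bullet> y"
  by (simp add: lam_def inner_add_right)

lemma a_diff: "v \<in> C \<Longrightarrow> p \<in> C \<Longrightarrow> q \<in> C \<Longrightarrow> a v \<bullet> (p - q) = lam v p - lam v q"
  by (simp add: lam_def inner_diff_right)

lemma other_vertex: "\<exists>w\<in>C. w \<noteq> v"
proof (rule ccontr)
  assume "\<not> (\<exists>w\<in>C. w \<noteq> v)"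
  then have "C \<subseteq> {v}" by auto
  then have "card C \<le> 1" using card_mono[of "{v}" C] by simp
  then show False using card_C by simp
qed

lemma a_nz: assumes v: "v \<in> C" shows "a v \<noteq> 0"
proof
  assume "a v = 0"
  moreover obtain w where "w \<in> C" "w \<noteq> v" using other_vertex by blast
  ultimately show False using dual[OF v v] dual[OF v, of w] by simp
qed

lemma lam_continuous: "continuous_on S (lam v)"
  unfolding lam_def by (intro continuous_intros)

lemma lam_measurable [measurable]: "lam v \<in> borel_measurable borel"
  using lam_continuous by (rule borel_measurable_continuous_onI)

lemma T_compact: "compact T"
  unfolding T_def by (intro finite_imp_compact_convex_hull fin_C)

lemma T_borel [measurable]: "T \<in> sets borel"
  using T_compact by (simp add: borel_closed compact_imp_closed)

lemma T_convex: "convex T"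
  by (simp add: T_def)

lemma interior_T: "interior T = {x. \<forall>v\<in>C. 0 < lam v x}"
proof (intro equalityI subsetI)
  fix x assume x: "x \<in> interior T"
  show "x \<in> {x. \<forall>v\<in>C. 0 < lam v x}"
  proof (intro CollectI ballI)
    fix v assume v: "v \<in> C"
    obtain e where e: "e > 0" "cball x e \<subseteq> T" using x by (auto simp: mem_interior_cball)
    define y where "y = x - (e / norm (a v)) *\<^sub>R a v"
    have "y \<in> cball x e" using e a_nz[OF v] by (simp add: y_def dist_norm)
    then have "0 \<le> lam v y" using e v by (auto simp: T_eq)
    moreover have "lam v y = lam v x - e * norm (a v)"
      using a_nz[OF v] by (simp add: y_def lam_def inner_diff_right dot_square_norm power2_eq_square)
    moreover have "e * norm (a v) > 0" using e a_nz[OF v] by simp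
    ultimately show "0 < lam v x" by linarith
  qed
next
  fix x assume x: "x \<in> {x. \<forall>v\<in>C. 0 < lam v x}"
  have "{x. \<forall>v\<in>C. 0 < lam v x} = (\<Inter>v\<in>C. {x. 0 < lam v x})" by auto
  moreover have "open (\<Inter>v\<in>C. {x. 0 < lam v x})"
    by (intro open_INT fin_C ballI open_Collect_less continuous_on_const lam_continuous)
  ultimately have "open {x. \<forall>v\<in>C. 0 < lam v x}" by simp
  moreover have "{x. \<forall>v\<in>C. 0 < lam v x} \<subseteq> T" by (auto simp: T_eq less_imp_le)
  ultimately show "x \<in> interior T" using x by (rule_tac interiorI)
qed

lemma interior_T_nonempty: "interior T \<noteq> {}"
proof -
  let ?n = "real (card C)"
  have n: "?n > 0" by (simp add: card_C)
  have "C \<noteq> {}" using card_C by auto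
  then have "sum (\<lambda>_. 1 / ?n) C = 1" by simp
  from lam_unique[OF this] have "(\<Sum>w\<in>C. (1 / ?n) *\<^sub>R w) \<in> interior T"
    using n by (simp add: interior_T)
  then show ?thesis by blast
qed

lemma bounded_T: "bounded T" using T_compact by (rule compact_imp_bounded)

lemma negligible_frontier_T: "negligible (T - interior T)"
  using negligible_convex_frontier[OF T_convex] closure_subset[of T]
  by (auto simp: frontier_def intro: negligible_subset)

lemma diff_norm_le: "x \<in> T \<Longrightarrow> y \<in> T \<Longrightarrow> norm (x - y) \<le> diameter T"
  using diameter_bounded_bound[OF bounded_T] by (simp add: dist_norm)

lemma vertex_in_T: "v \<in> C \<Longrightarrow> v \<in> T"
  unfolding T_def by (rule hull_inc)

text \<open>Along the diameter of the ball in direction \<open>a v\<close> the coordinate of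
  \<open>v\<close> grows by \<open>2 * \<rho> * norm (a v)\<close>, and it stays between 0 and 1 on
  the simplex.\<close>

lemma grad_le:
  assumes "cball x \<rho> \<subseteq> T" "\<rho> > 0" "v \<in> C"
  shows "2 * \<rho> * norm (a v) \<le> 1"
proof -
  let ?y = "\<lambda>s. x + (s * \<rho> / norm (a v)) *\<^sub>R a v"
  have na: "norm (a v) > 0" using a_nz[OF assms(3)] by simp
  have "?y 1 \<in> T" "?y (-1) \<in> T" using assms na by (auto intro!: subsetD[OF assms(1)] simp: dist_norm)
  then have "lam v (?y 1) \<le> 1" "0 \<le> lam v (?y (-1))" using lam_le_1 assms(3) by (auto simp: T_eq)
  moreover have "lam v (x + (s * \<rho> / norm (a v)) *\<^sub>R a v) = lam v x + s * \<rho> * norm (a v)" for s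
    using na by (simp add: lam_def inner_add_right dot_square_norm power2_eq_square)
  from this[of 1] this[of "-1"] calculation show ?thesis by linarith
qed

subsection \<open>Moments\<close>

definition mom :: "('a \<Rightarrow> real) \<Rightarrow> real" where "mom f = (LINT x|lborel. indicator T x * f x)"

lemma mom_integrable: "continuous_on UNIV (f :: 'a \<Rightarrow> real) \<Longrightarrow> integrable lborel (\<lambda>x. indicator T x * f x)"
  using borel_integrable_compact[OF T_compact, of f] continuous_on_subset by auto

text \<open>With \<open>\<beta>\<close> = 1 the stretch along \<open>j - i\<close> has determinant 1
  - 2 = -1: it is the affine reflection that exchanges the vertices \<open>i\<close> and
  \<open>j\<close> and fixes the other ones.\<close>

lemma swap_moment:
  fixes f :: "'a \<Rightarrow> real"
  assumes i: "i \<in> C" and j: "j \<in> C" "i \<noteq> j" and f: "f \<in> borel_measurable borel" "\<And>x. 0 \<le> f x"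
  shows "(LINT x|lborel. f (x + (lam i x - lam j x) *\<^sub>R (j - i))) = (LINT x|lborel. f x)"
proof -
  have s: "(a i - a j) \<bullet> (j - i) = -2"
    using a_diff[OF i j(1) i] a_diff[OF j(1) j(1) i] lam_vertex i j by (simp add: inner_diff_left)
  show ?thesis
    using integral_affine_stretch[OF f s, of 1 "c i - c j"] by (simp add: lam_def inner_diff_left algebra_simps)
qed

lemma swap_lam:
  assumes i: "i \<in> C" and j: "j \<in> C" "i \<noteq> j" and v: "v \<in> C"
  shows "lam v (x + (lam i x - lam j x) *\<^sub>R (j - i)) = (if v = i then lam j x else if v = j then lam i x else lam v x)"
  using a_diff[OF v j(1) i] lam_vertex v i j by (auto simp: lam_add)

lemma swap_T:
  assumes i: "i \<in> C" and j: "j \<in> C" "i \<noteq> j"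
  shows "x + (lam i x - lam j x) *\<^sub>R (j - i) \<in> T \<longleftrightarrow> x \<in> T"
  unfolding T_eq mem_Collect_eq using swap_lam[OF assms] assms by metis

lemma mom_swap:
  assumes i: "i \<in> C" and j: "j \<in> C" "i \<noteq> j" and f: "f \<in> borel_measurable borel" "\<And>x. x \<in> T \<Longrightarrow> 0 \<le> f x"
  shows "mom (\<lambda>x. f (x + (lam i x - lam j x) *\<^sub>R (j - i))) = mom f"
proof -
  have "(LINT x|lborel. indicator T (x + (lam i x - lam j x) *\<^sub>R (j - i)) * f (x + (lam i x - lam j x) *\<^sub>R (j - i))) = (LINT x|lborel. indicator T x * f x)"
    by (rule swap_moment[OF i j, of "\<lambda>x. indicator T x * f x"]) (use f in \<open>auto simp: indicator_def\<close>)
  then show ?thesis by (simp add: mom_def indicator_def swap_T[OF i j])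
qed

lemma mom_sum: "finite I \<Longrightarrow> (\<And>i. i \<in> I \<Longrightarrow> continuous_on UNIV (f i)) \<Longrightarrow> mom (\<lambda>x. \<Sum>i\<in>I. f i x) = (\<Sum>i\<in>I. mom (f i))"
  unfolding mom_def sum_distrib_left by (rule Bochner_Integration.integral_sum) (rule mom_integrable)

lemma mom_cmult: "mom (\<lambda>x. r * f x) = r * mom f"
  unfolding mom_def by (simp add: mult.left_commute)

text \<open>By the vertex exchanges all n + 1 coordinates have the same integral, and they sum to
  one.\<close>

lemma mom_lam:
  assumes i: "i \<in> C"
  shows "mom (lam i) = vol T / (real DIM('a) + 1)"
proof -
  have "mom (lam j) = mom (lam i)" if j: "j \<in> C" for j
  proof (cases "i = j")
    case False
    have "mom (\<lambda>x. lam i (x + (lam i x - lam j x) *\<^sub>R (j - i))) = mom (lam i)"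
      by (rule mom_swap[OF i j False]) (use i in \<open>auto simp: T_eq\<close>)
    then show ?thesis using swap_lam[OF i j False i] by simp
  qed simp
  then have "(\<Sum>j\<in>C. mom (lam j)) = real (card C) * mom (lam i)" by simp
  moreover have "(\<Sum>j\<in>C. mom (lam j)) = mom (\<lambda>x. 1)"
    using mom_sum[of C lam] lam_continuous lam_sum by simp
  moreover have "mom (\<lambda>x. 1) = vol T"
    by (simp add: mom_def)
  ultimately show ?thesis using card_C by (simp add: field_simps)
qed

text \<open>The simplex is bisected at the midpoint of the edge between \<open>i\<close> and
  \<open>j\<close>. The half nearer to \<open>i\<close> carries half of the mixed moment, and it is
  the image of the whole simplex under the stretch that moves \<open>j\<close> to the midpoint;
  pulling back expresses that half through mixed and pure moments.\<close>

lemma mom_bisect: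
  assumes i: "i \<in> C" and j: "j \<in> C" "i \<noteq> j"
  shows "mom (\<lambda>x. lam i x * lam j x) = mom (\<lambda>x. lam j x * lam j x) / 2"
proof -
  let ?M = "mom (\<lambda>x. lam i x * lam j x)"
  let ?H = "\<lambda>x. indicator {x. lam j x \<le> lam i x} x :: real"
  let ?H' = "\<lambda>x. indicator {x. lam i x \<le> lam j x} x :: real"
  have Hm: "{x. lam j x \<le> lam i x} \<in> sets borel" "{x. lam i x \<le> lam j x} \<in> sets borel" by measurable
  have T0: "x \<in> T \<Longrightarrow> 0 \<le> lam i x" "x \<in> T \<Longrightarrow> 0 \<le> lam j x" for x using i j by (auto simp: T_eq)
  have int: "integrable lborel (\<lambda>x. indicator T x * (lam i x * lam j x))"
    by (intro mom_integrable continuous_intros lam_continuous)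
  have intH: "integrable lborel (\<lambda>x. indicator A x * (indicator T x * (lam i x * lam j x)))" if "A \<in> sets borel" for A
    using integrable_mult_indicator[OF _ int, of A] that by simp
  \<comment> \<open>The exchange of \<open>i\<close> and \<open>j\<close> maps one half to the other
    and preserves the integrand; the separating hyperplane is a null set.\<close>
  have half: "mom (\<lambda>x. ?H x * (lam i x * lam j x)) = ?M / 2"
  proof -
    have "AE x in lborel. indicator T x * (lam i x * lam j x) = indicator T x * (?H x * (lam i x * lam j x)) + indicator T x * (?H' x * (lam i x * lam j x))"
    proof -
      have "a i \<noteq> a j"
      proof
        assume "a i = a j"
        then have "a i \<bullet> (j - i) = a j \<bullet> (j - i)" by simp
        then show False using a_diff[OF i j(1) i] a_diff[OF j(1) j(1) i] lam_vertex i j by simp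
      qed
      then have "negligible {x. (a i - a j) \<bullet> x = c j - c i}" by (intro negligible_hyperplane) auto
      then have "AE x in lebesgue. x \<notin> {x. (a i - a j) \<bullet> x = c j - c i}" by (simp only: negligible_iff_null_sets AE_not_in)
      then have "AE x in lborel. x \<notin> {x. (a i - a j) \<bullet> x = c j - c i}" by (simp add: AE_completion_iff)
      then show ?thesis
      proof eventually_elim
        case (elim x)
        then have "lam i x \<noteq> lam j x" by (auto simp: lam_def inner_diff_left)
        then show ?case by (auto simp: indicator_def)
      qed
    qed
    then have "?M = (LINT x|lborel. indicator T x * (?H x * (lam i x * lam j x)) + indicator T x * (?H' x * (lam i x * lam j x)))"
      unfolding mom_def by (intro integral_cong_AE) (use Hm in auto)
    also have "\<dots> = mom (\<lambda>x. ?H x * (lam i x * lam j x)) + mom (\<lambda>x. ?H' x * (lam i x * lam j x))"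
      unfolding mom_def using intH[OF Hm(1)] intH[OF Hm(2)] by (subst Bochner_Integration.integral_add) (auto simp: mult.left_commute)
    also have "mom (\<lambda>x. ?H' x * (lam i x * lam j x)) = mom (\<lambda>x. ?H x * (lam i x * lam j x))"
    proof -
      have "mom (\<lambda>x. (\<lambda>x. ?H' x * (lam i x * lam j x)) (x + (lam i x - lam j x) *\<^sub>R (j - i))) = mom (\<lambda>x. ?H' x * (lam i x * lam j x))"
        by (rule mom_swap[OF i j]) (use T0 Hm in \<open>auto simp: indicator_def\<close>)
      then show ?thesis using swap_lam[OF i j i] swap_lam[OF i j j(1)] j(2) by (simp add: indicator_def mult.commute)
    qed
    finally show ?thesis by simp
  qed
  let ?L = "\<lambda>x. x + (1/2 * (a j \<bullet> x + c j)) *\<^sub>R (i - j)"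
  have s: "a j \<bullet> (i - j) = -1" using a_diff[OF j(1) i j(1)] lam_vertex i j by simp
  have Lv: "lam v (?L x) = lam v x + 1/2 * lam j x * (lam v i - lam v j)" if "v \<in> C" for v x
    using a_diff[OF that i j(1)] by (simp add: lam_add) (simp add: lam_def)
  have Li: "lam i (?L x) = lam i x + lam j x / 2" and Lj: "lam j (?L x) = lam j x / 2" for x
    using Lv[OF i] Lv[OF j(1)] lam_vertex i j by auto
  have Lo: "lam v (?L x) = lam v x" if "v \<in> C" "v \<noteq> i" "v \<noteq> j" for v x
    using Lv[OF that(1)] lam_vertex i j that by auto
  have LT: "?L x \<in> T \<and> lam j (?L x) \<le> lam i (?L x) \<longleftrightarrow> x \<in> T" for x
  proof
    assume L: "?L x \<in> T \<and> lam j (?L x) \<le> lam i (?L x)"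
    then have "0 \<le> lam v x" if "v \<in> C" for v
      using Li[of x] Lj[of x] Lo[of v x] that by (cases "v = i \<or> v = j") (auto simp: T_eq)
    then show "x \<in> T" by (simp add: T_eq)
  next
    assume x: "x \<in> T"
    then have "0 \<le> lam v (?L x)" if "v \<in> C" for v
      using Li[of x] Lj[of x] Lo[of v x] that T0[of x] by (cases "v = i \<or> v = j") (auto simp: T_eq)
    then have "?L x \<in> T" unfolding T_eq by blast
    moreover have "lam j (?L x) \<le> lam i (?L x)" unfolding Li Lj using T0[OF x] by simp
    ultimately show "?L x \<in> T \<and> lam j (?L x) \<le> lam i (?L x)" ..
  qed
  let ?f = "\<lambda>x. indicator T x * (?H x * (lam i x * lam j x))"
  \<comment> \<open>The determinant is 1/2. With mixed moment M and pure moment A this reads (M/2 +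
    A/4) / 2 = M/2, that is M = A/2.\<close>
  have "(LINT x|lborel. ?f (?L x)) * \<bar>1 + 1/2 * (-1)\<bar> = (LINT x|lborel. ?f x)"
    by (rule integral_affine_stretch[OF _ _ s]) (use T0 Hm in \<open>auto simp: indicator_def\<close>)
  moreover have "(LINT x|lborel. ?f (?L x)) = mom (\<lambda>x. 1/2 * (lam i x * lam j x) + 1/4 * (lam j x * lam j x))"
    unfolding mom_def
  proof (rule Bochner_Integration.integral_cong[OF refl])
    fix x
    have "?f (?L x) = indicator T x * (lam i (?L x) * lam j (?L x))"
      using LT[of x] by (auto simp: indicator_def)
    then show "?f (?L x) = indicator T x * (1/2 * (lam i x * lam j x) + 1/4 * (lam j x * lam j x))"
      unfolding Li Lj by (simp add: algebra_simps)
  qed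
  moreover have "mom (\<lambda>x. 1/2 * (lam i x * lam j x) + 1/4 * (lam j x * lam j x)) = 1/2 * ?M + 1/4 * mom (\<lambda>x. lam j x * lam j x)"
  proof -
    have "integrable lborel (\<lambda>x. indicator T x * (1/2 * (lam i x * lam j x)))" "integrable lborel (\<lambda>x. indicator T x * (1/4 * (lam j x * lam j x)))"
      by (intro mom_integrable continuous_intros lam_continuous)+
    then have "mom (\<lambda>x. 1/2 * (lam i x * lam j x) + 1/4 * (lam j x * lam j x)) = mom (\<lambda>x. 1/2 * (lam i x * lam j x)) + mom (\<lambda>x. 1/4 * (lam j x * lam j x))"
      unfolding mom_def distrib_left by (rule Bochner_Integration.integral_add)
    then show ?thesis by (simp only: mom_cmult)
  qed
  ultimately show ?thesis using half by (simp add: mom_def)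
qed

text \<open>Since the coordinates sum to one, the n mixed moments and the pure moment of
  \<open>i\<close> add up to the first moment: A (1 + n/2) = |T| / (n + 1).\<close>

lemma mom_lam_lam:
  assumes i: "i \<in> C" and j: "j \<in> C"
  shows "mom (\<lambda>x. lam i x * lam j x) = vol T * (if i = j then 2 else 1) / ((real DIM('a) + 1) * (real DIM('a) + 2))"
proof -
  let ?A = "mom (\<lambda>x. lam i x * lam i x)"
  have off: "mom (\<lambda>x. lam i x * lam v x) = ?A / 2" if v: "v \<in> C" "v \<noteq> i" for v
    using mom_bisect[OF v(1) i v(2)] by (simp add: mult.commute)
  have "mom (\<lambda>x. \<Sum>v\<in>C. lam i x * lam v x) = (\<Sum>v\<in>C. mom (\<lambda>x. lam i x * lam v x))"
    by (rule mom_sum) (auto intro!: continuous_intros lam_continuous)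
  also have "\<dots> = ?A + (\<Sum>v\<in>C - {i}. ?A / 2)"
  proof -
    have "(\<Sum>v\<in>C - {i}. mom (\<lambda>x. lam i x * lam v x)) = (\<Sum>v\<in>C - {i}. ?A / 2)"
      by (rule sum.cong[OF refl]) (rule off, auto)
    then show ?thesis using sum.remove[OF fin_C i, of "\<lambda>v. mom (\<lambda>x. lam i x * lam v x)"] by simp
  qed
  also have "\<dots> = ?A * (1 + real DIM('a) / 2)" using i card_C by (simp add: field_simps)
  also have "mom (\<lambda>x. \<Sum>v\<in>C. lam i x * lam v x) = mom (lam i)"
    by (simp add: sum_distrib_left[symmetric] lam_sum)
  finally have "?A * (1 + real DIM('a) / 2) = vol T / (real DIM('a) + 1)" using mom_lam[OF i] by simp
  moreover have "1 + real DIM('a) / 2 = (real DIM('a) + 2) / 2" by (simp add: field_simps)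
  ultimately have h: "?A * ((real DIM('a) + 2) / 2) = vol T / (real DIM('a) + 1)" by (simp only:)
  have "?A = vol T / (real DIM('a) + 1) / ((real DIM('a) + 2) / 2)"
    by (rule eq_divide_imp[OF _ h]) simp
  then have A: "?A = vol T * 2 / ((real DIM('a) + 1) * (real DIM('a) + 2))" by simp
  show ?thesis using A off[of j] j by auto
qed

text \<open>Vertex \<open>i\<close> enters once more than the others because a pure second moment is
  twice a mixed one. The sum over all vertices is the barycenter term on which local symmetry will
  act.\<close>

lemma mom_lam_affine:
  assumes i: "i \<in> C"
  shows "mom (\<lambda>x. (p \<bullet> x + q) * lam i x) = vol T / ((real DIM('a) + 1) * (real DIM('a) + 2)) * ((p \<bullet> i + q) + (\<Sum>v\<in>C. p \<bullet> v + q))"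
proof -
  let ?K = "vol T / ((real DIM('a) + 1) * (real DIM('a) + 2))"
  have "mom (\<lambda>x. (p \<bullet> x + q) * lam i x) = mom (\<lambda>x. \<Sum>v\<in>C. (p \<bullet> v + q) * (lam i x * lam v x))"
  proof -
    have "(p \<bullet> x + q) * lam i x = (\<Sum>v\<in>C. (p \<bullet> v + q) * (lam i x * lam v x))" for x
      by (subst affine_repr[of p x q], subst sum_distrib_right, intro sum.cong) (auto simp: mult_ac)
    then show ?thesis by simp
  qed
  also have "\<dots> = (\<Sum>v\<in>C. (p \<bullet> v + q) * mom (\<lambda>x. lam i x * lam v x))"
    by (subst mom_sum) (auto simp: mom_cmult intro!: continuous_intros lam_continuous)
  also have "\<dots> = (\<Sum>v\<in>C. ?K * (p \<bullet> v + q) + (if v = i then ?K * (p \<bullet> v + q) else 0))"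
    by (intro sum.cong) (auto simp: mom_lam_lam[OF i])
  also have "\<dots> = ?K * ((p \<bullet> i + q) + (\<Sum>v\<in>C. p \<bullet> v + q))"
    using i by (simp add: sum.distrib sum_distrib_left distrib_left)
  finally show ?thesis .
qed

subsection \<open>Facets\<close>

text \<open>Facets are indexed by the opposite vertex \<open>v\<close>, whose coordinate vanishes on
  them; \<open>normal v\<close> is the unit normal pointing towards \<open>v\<close>.\<close>

definition facet :: "'a \<Rightarrow> 'a set" where "facet v = convex hull (C - {v})"
definition normal :: "'a \<Rightarrow> 'a" where "normal v = (1 / norm (a v)) *\<^sub>R a v"
definition offset :: "'a \<Rightarrow> real" where "offset v = - c v / norm (a v)"

lemma lam_normal: "v \<in> C \<Longrightarrow> lam v x = norm (a v) * (normal v \<bullet> x - offset v)"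
  using a_nz[of v] by (simp add: lam_def normal_def offset_def field_simps)

lemma lam_remove:
  assumes v: "v \<in> C" and x: "lam v x = 0"
  shows "(\<Sum>w\<in>C - {v}. lam w x) = 1" "(\<Sum>w\<in>C - {v}. lam w x *\<^sub>R w) = x"
  using lam_sum[of x] lam_repr[of x] x
  by (simp_all add: sum.remove[OF fin_C v])

lemma lam_extend:
  assumes v: "v \<in> C" and u: "sum u (C - {v}) = 1" "(\<Sum>w\<in>C - {v}. u w *\<^sub>R w) = x"
  shows "lam v x = 0" "\<And>w. w \<in> C \<Longrightarrow> w \<noteq> v \<Longrightarrow> lam w x = u w"
proof -
  let ?u = "\<lambda>w. if w = v then 0 else u w"
  have "sum ?u (C - {v}) = sum u (C - {v})" "(\<Sum>w\<in>C - {v}. ?u w *\<^sub>R w) = (\<Sum>w\<in>C - {v}. u w *\<^sub>R w)"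
    by (intro sum.cong; auto)+
  then have s: "sum ?u C = 1" "(\<Sum>w\<in>C. ?u w *\<^sub>R w) = x"
    using u by (simp_all add: sum.remove[OF fin_C v])
  show "lam v x = 0" using lam_unique[OF s(1) v] unfolding s(2) by simp
  show "lam w x = u w" if "w \<in> C" "w \<noteq> v" for w using lam_unique[OF s(1) that(1)] that unfolding s(2) by simp
qed

lemma facet_eq:
  assumes v: "v \<in> C"
  shows "facet v = {x \<in> T. lam v x = 0}"
proof (intro equalityI subsetI)
  fix x assume "x \<in> facet v"
  then obtain u where u: "\<forall>w\<in>C - {v}. 0 \<le> u w" "sum u (C - {v}) = 1" "(\<Sum>w\<in>C - {v}. u w *\<^sub>R w) = x"
    unfolding facet_def by (auto simp: convex_hull_finite)
  have "0 \<le> lam w x" if w: "w \<in> C" for w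
  proof (cases "w = v")
    case True
    then show ?thesis using lam_extend(1)[OF v u(2,3)] by simp
  next
    case False
    then show ?thesis using lam_extend(2)[OF v u(2,3) w] u(1) w by auto
  qed
  then show "x \<in> {x \<in> T. lam v x = 0}" using lam_extend(1)[OF v u(2,3)] by (auto simp: T_eq)
next
  fix x assume "x \<in> {x \<in> T. lam v x = 0}"
  then have x: "lam v x = 0" "\<forall>w\<in>C. 0 \<le> lam w x" by (auto simp: T_eq)
  have fin: "finite (C - {v})" by simp
  show "x \<in> facet v" unfolding facet_def convex_hull_finite[OF fin]
    using lam_remove[OF v x(1)] x(2) by (auto intro!: exI[of _ "\<lambda>w. lam w x"])
qed

lemma affine_hull_facet:
  assumes v: "v \<in> C"
  shows "affine hull (facet v) = {x. lam v x = 0}"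
proof -
  have "affine hull (facet v) = affine hull (C - {v})" by (simp add: facet_def affine_hull_convex_hull)
  also have "\<dots> = {x. lam v x = 0}"
  proof (intro equalityI subsetI)
    fix x assume "x \<in> affine hull (C - {v})"
    then obtain u where "sum u (C - {v}) = 1" "(\<Sum>w\<in>C - {v}. u w *\<^sub>R w) = x" by (auto simp: affine_hull_finite)
    then show "x \<in> {x. lam v x = 0}" using lam_extend(1)[OF v] by blast
  next
    fix x assume x: "x \<in> {x. lam v x = 0}"
    have fin: "finite (C - {v})" by simp
    show "x \<in> affine hull (C - {v})" unfolding affine_hull_finite[OF fin]
      using lam_remove[OF v, of x] x by (auto intro!: exI[of _ "\<lambda>w. lam w x"])
  qed
  finally show ?thesis .
qed

lemma hyperplane_face_facet:
  assumes v: "v \<in> C"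
  shows "hyperplane_face (facet v) (normal v) (offset v)"
proof
  show "compact (facet v)" unfolding facet_def by (intro finite_imp_compact_convex_hull) simp
  show "norm (normal v) = 1" using a_nz[OF v] by (simp add: normal_def)
  show "affine hull facet v = {x. normal v \<bullet> x = offset v}"
    unfolding affine_hull_facet[OF v] using a_nz[OF v] by (auto simp: lam_normal[OF v])
qed

lemma card_facet_verts: "v \<in> C \<Longrightarrow> card (C - {v}) = DIM('a)"
  using card_C by simp

text \<open>The n remaining coordinates sum to one. The large one selects the direction in which a
  point of the facet is moved in the trace inequality.\<close>

lemma facet_large_coordinate:
  assumes v: "v \<in> C" and x: "lam v x = 0"
  shows "\<exists>w\<in>C - {v}. lam w x \<ge> 1 / real DIM('a)"
proof (rule ccontr)
  assume "\<not> (\<exists>w\<in>C - {v}. lam w x \<ge> 1 / real DIM('a))"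
  then have "(\<Sum>w\<in>C - {v}. lam w x) < (\<Sum>w\<in>C - {v}. 1 / real DIM('a))"
  proof (intro sum_strict_mono)
    show "C - {v} \<noteq> {}" using card_facet_verts[OF v] DIM_positive[where 'a='a] by force
  qed (auto simp: not_le)
  then show False using lam_remove(1)[OF v x] card_facet_verts[OF v] by simp
qed

text \<open>From a facet point with \<open>lam w\<close> at least 1/n one may move along
  \<open>v - w\<close> up to parameter 1/n, since only the coordinate of \<open>w\<close> decreases.
  All these edges have the same normal component \<open>1 / norm (a v)\<close>, the height over the
  facet; n pieces then give \<open>2 * n / ((1 / norm (a v)) * (1 / n))\<close> under the
  root.\<close>

lemma facet_trace_C1:
  assumes v: "v \<in> C" and u: "Ck 1 u"
  defines "A \<equiv> sqrt (2 * (real DIM('a))\<^sup>2 * norm (a v))"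
  shows "l2_norm (face_measure (facet v)) u \<le> A * L2 (interior T) u
    + A * diameter T * grad_norm (interior T) (\<lambda>b x. fderiv u x b)"
proof -
  interpret hyperplane_face "facet v" "normal v" "offset v" by (rule hyperplane_face_facet[OF v])
  let ?n = "real DIM('a)" and ?L = "L2 (interior T) u"
    and ?G = "grad_norm (interior T) (\<lambda>b x. fderiv u x b)"
  have na: "norm (a v) > 0" using a_nz[OF v] by simp
  have n: "?n \<ge> 1" using DIM_positive[where 'a='a] by linarith
  have A: "sqrt (2 * real (card (C - {v})) / (1 / norm (a v) * (1 / ?n))) = A"
    unfolding A_def card_facet_verts[OF v] using n by (simp add: power2_eq_square field_simps)
  have "l2_norm (face_measure (facet v)) u \<le> sqrt (2 * real (card (C - {v})) / (1 / norm (a v) * (1 / ?n))) * (?L + 1 / ?n * diameter T * ?G)"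
  proof (rule trace_C1[OF u, where v="\<lambda>w. v - w" and E="\<lambda>w. {y. 1 / ?n \<le> lam w y}" and T=T])
    show "normal v \<bullet> (v - w) = 1 / norm (a v)" if "w \<in> C - {v}" for w
      using a_diff[OF v v, of w] that lam_vertex v by (auto simp: normal_def)
    show "norm (v - w) \<le> diameter T" if "w \<in> C - {v}" for w
      using that v by (intro diff_norm_le vertex_in_T) auto
    show "0 \<le> diameter T" by (rule diameter_ge_0[OF bounded_T])
    show "closed {y. 1 / ?n \<le> lam w y}" for w
      by (intro closed_Collect_le continuous_on_const lam_continuous)
    show "facet v \<subseteq> (\<Union>w\<in>C - {v}. {y. 1 / ?n \<le> lam w y})"
      using facet_large_coordinate[OF v] by (auto simp: facet_eq[OF v])
    show "y + t *\<^sub>R (v - w) \<in> T" if w: "w \<in> C - {v}" and y: "y \<in> {y. 1 / ?n \<le> lam w y}" "y \<in> facet v" and t: "0 \<le> t" "t \<le> 1 / ?n" for w y t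
      unfolding T_eq
    proof (intro CollectI ballI)
      fix x assume x: "x \<in> C"
      have "lam x (y + t *\<^sub>R (v - w)) = lam x y + t * (lam x v - lam x w)"
        using a_diff[OF x v, of w] w by (simp add: lam_add)
      moreover have "0 \<le> lam x y" using y x by (auto simp: facet_eq[OF v] T_eq)
      ultimately show "0 \<le> lam x (y + t *\<^sub>R (v - w))"
        using lam_vertex[OF x v] lam_vertex[OF x, of w] w t y by auto
    qed
  qed (use na n bounded_T interior_subset negligible_frontier_T in auto)
  also have "\<dots> \<le> A * (?L + diameter T * ?G)"
  proof -
    have "1 / ?n * (diameter T * ?G) \<le> 1 * (diameter T * ?G)"
      using n by (intro mult_right_mono mult_nonneg_nonneg diameter_ge_0 bounded_T grad_norm_nonneg) auto
    then show ?thesis unfolding A by (intro mult_left_mono) (auto simp: A_def)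
  qed
  finally show ?thesis by (simp add: distrib_left mult.assoc)
qed

definition facet_center :: "'a \<Rightarrow> 'a" where "facet_center v = (\<Sum>w\<in>C - {v}. (1 / real DIM('a)) *\<^sub>R w)"

lemma lam_facet_center:
  assumes v: "v \<in> C"
  shows "lam v (facet_center v) = 0" "\<And>w. w \<in> C \<Longrightarrow> w \<noteq> v \<Longrightarrow> lam w (facet_center v) = 1 / real DIM('a)"
proof -
  have "sum (\<lambda>_. 1 / real DIM('a)) (C - {v}) = 1" using card_facet_verts[OF v] by simp
  from lam_extend[OF v this] show "lam v (facet_center v) = 0" "\<And>w. w \<in> C \<Longrightarrow> w \<noteq> v \<Longrightarrow> lam w (facet_center v) = 1 / real DIM('a)"
    by (auto simp: facet_center_def)
qed

lemma lam_near_facet_center: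
  assumes v: "v \<in> C" and w: "w \<in> C" "w \<noteq> v" and x: "norm (x - facet_center v) < r" "r * norm (a w) \<le> 1 / real DIM('a)"
  shows "lam w x > 0"
proof -
  have "lam w x = lam w (facet_center v) + a w \<bullet> (x - facet_center v)"
    by (simp add: lam_def inner_diff_right)
  moreover have "\<bar>a w \<bullet> (x - facet_center v)\<bar> \<le> norm (a w) * norm (x - facet_center v)" by (rule Cauchy_Schwarz_ineq2)
  moreover have "norm (a w) * norm (x - facet_center v) < norm (a w) * r" using x a_nz[OF w(1)] by simp
  ultimately show ?thesis using lam_facet_center(2)[OF v w] x(2) by (simp add: mult.commute)
qed

text \<open>The inner half of the ball contains a ball of half the radius, centred half a radius
  along the normal; there the coordinate of \<open>v\<close> is positive as well.\<close>

lemma inward_half_ball: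
  assumes v: "v \<in> C" and b: "lam v b = 0" and r: "r > 0" and pos: "\<And>w x. w \<in> C \<Longrightarrow> w \<noteq> v \<Longrightarrow> x \<in> ball b r \<Longrightarrow> lam w x > 0"
  shows "ball (b + (r/2) *\<^sub>R normal v) (r/2) \<subseteq> ball b r \<inter> interior T"
proof
  fix x assume x: "x \<in> ball (b + (r/2) *\<^sub>R normal v) (r/2)"
  interpret H: hyperplane_face "facet v" "normal v" "offset v" by (rule hyperplane_face_facet[OF v])
  let ?\<nu> = "normal v"
  have nn: "?\<nu> \<bullet> ?\<nu> = 1" using H.\<nu> by (simp add: power2_norm_eq_inner[symmetric])
  have "dist b x \<le> dist b (b + (r/2) *\<^sub>R ?\<nu>) + dist (b + (r/2) *\<^sub>R ?\<nu>) x" by (rule dist_triangle)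
  also have "\<dots> < r/2 + r/2" using x r H.\<nu> by (intro add_le_less_mono) (auto simp: dist_norm)
  finally have xb: "x \<in> ball b r" by simp
  have "\<bar>?\<nu> \<bullet> (x - (b + (r/2) *\<^sub>R ?\<nu>))\<bar> \<le> norm ?\<nu> * norm (x - (b + (r/2) *\<^sub>R ?\<nu>))" by (rule Cauchy_Schwarz_ineq2)
  also have "\<dots> < r/2" using x H.\<nu> by (simp add: dist_norm norm_minus_commute)
  finally have "?\<nu> \<bullet> x - ?\<nu> \<bullet> b > 0" unfolding inner_diff_right inner_add_right inner_scaleR_right nn abs_less_iff by linarith
  moreover have "?\<nu> \<bullet> b = offset v" using b a_nz[OF v] by (simp add: lam_normal[OF v])
  ultimately have "lam v x > 0" using a_nz[OF v] by (simp add: lam_normal[OF v])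
  then show "x \<in> ball b r \<inter> interior T" unfolding interior_T using pos[OF _ _ xb] xb by auto
qed

text \<open>A lower bound for the facet area. The condition on \<open>r\<close> keeps the other
  coordinates positive near the facet centre, so the ball projects into the facet and lies in a
  cylinder of height \<open>2 * r\<close> over it.\<close>

lemma facet_measure_ge:
  assumes v: "v \<in> C" and r: "r > 0" "\<And>w. w \<in> C \<Longrightarrow> r * norm (a w) \<le> 1 / real DIM('a)"
  shows "measure lborel (ball (facet_center v) r) \<le> 2 * r * measure (face_measure (facet v)) (facet v)"
proof -
  interpret hyperplane_face "facet v" "normal v" "offset v" by (rule hyperplane_face_facet[OF v])
  interpret fm: finite_measure "face_measure (facet v)" by (rule finite_face_measure)
  let ?b = "facet_center v" and ?\<nu> = "normal v" and ?c = "offset v"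
  have b: "?\<nu> \<bullet> ?b = ?c" using lam_facet_center(1)[OF v] a_nz[OF v] by (simp add: lam_normal[OF v])
  have nn: "?\<nu> \<bullet> ?\<nu> = 1" using \<nu> by (simp add: power2_norm_eq_inner[symmetric])
  have "emeasure lborel (ball ?b r) = emeasure lborel {-1/2..1/2::real} * (\<integral>\<^sub>+x. indicator (ball ?b r) x)" by simp
  also have "\<dots> = (\<integral>\<^sub>+x. \<integral>\<^sub>+t. indicator {-1/2..1/2} (?\<nu> \<bullet> x - ?c) * indicator (ball ?b r) (x - (?\<nu> \<bullet> x - ?c) *\<^sub>R ?\<nu> + t *\<^sub>R ?\<nu>)) * ennreal \<bar>1\<bar>"
    by (rule slab_fubini[symmetric]) (use \<nu> nn in \<open>auto intro: borel_measurable_indicator\<close>)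
  also have "\<dots> = (\<integral>\<^sub>+x. \<integral>\<^sub>+t. indicator {-1/2..1/2} (?\<nu> \<bullet> x - ?c) * indicator (ball ?b r) (P x + t *\<^sub>R ?\<nu>))"
    by (simp add: P_def)
  also have "\<dots> \<le> (\<integral>\<^sub>+x. \<integral>\<^sub>+t. indicator {-1/2..1/2} (?\<nu> \<bullet> x - ?c) * (indicator (facet v) (P x) * 1) * indicator {-r..r} t)"
  proof (intro nn_integral_mono)
    fix x :: 'a and t :: real
    have Pb: "?\<nu> \<bullet> (P x - ?b) = 0" using b nn by (simp add: P_def inner_diff_right)
    have sq: "(norm (P x + t *\<^sub>R ?\<nu> - ?b))\<^sup>2 = (norm (P x - ?b))\<^sup>2 + t\<^sup>2"
    proof -
      have "P x + t *\<^sub>R ?\<nu> - ?b = (P x - ?b) + t *\<^sub>R ?\<nu>" by simp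
      also have "(norm \<dots>)\<^sup>2 = (norm (P x - ?b))\<^sup>2 + (norm (t *\<^sub>R ?\<nu>))\<^sup>2"
        by (rule norm_add_Pythagorean) (simp add: orthogonal_def inner_commute[of "P x - ?b"] Pb)
      finally show ?thesis using \<nu> by simp
    qed
    show "indicator {-1/2..1/2} (?\<nu> \<bullet> x - ?c) * indicator (ball ?b r) (P x + t *\<^sub>R ?\<nu>)
      \<le> indicator {-1/2..1/2} (?\<nu> \<bullet> x - ?c) * (indicator (facet v) (P x) * (1::ennreal)) * indicator {-r..r} t"
    proof (cases "P x + t *\<^sub>R ?\<nu> \<in> ball ?b r")
      case True
      then have "(norm (P x + t *\<^sub>R ?\<nu> - ?b))\<^sup>2 < r\<^sup>2" using r(1) by (intro power_strict_mono) (auto simp: dist_norm norm_minus_commute)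
      then have "(norm (P x - ?b))\<^sup>2 < r\<^sup>2" "t\<^sup>2 \<le> r\<^sup>2" using sq zero_le_power2[of t] zero_le_power2[of "norm (P x - ?b)"] by linarith+
      then have nb: "norm (P x - ?b) < r" and t: "\<bar>t\<bar> \<le> r" using r(1)
        by (auto intro: power2_less_imp_less simp: abs_le_square_iff[symmetric])
      have l0: "lam v (P x) = 0" using Pb b by (simp add: lam_normal[OF v] inner_diff_right)
      have "0 \<le> lam w (P x)" if "w \<in> C" for w
        using lam_near_facet_center[OF v that _ nb r(2)[OF that]] l0 by (cases "w = v") auto
      then have "P x \<in> facet v" using l0 by (simp add: facet_eq[OF v] T_eq)
      then show ?thesis using t by (auto simp: indicator_def)
    qed simp
  qed
  also have "\<dots> = (\<integral>\<^sub>+x. indicator {-1/2..1/2} (?\<nu> \<bullet> x - ?c) * (indicator (facet v) (P x) * 1) * ennreal (2 * r))"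
    using r(1) by (simp add: nn_integral_cmult)
  also have "\<dots> = (\<integral>\<^sub>+x. indicator {-1/2..1/2} (?\<nu> \<bullet> x - ?c) * (indicator (facet v) (P x) * 1)) * ennreal (2 * r)"
    by (rule nn_integral_multc) measurable
  also have "\<dots> = (\<integral>\<^sup>+y. 1 \<partial>face_measure (facet v)) * ennreal (2 * r)"
    by (subst nn_integral_face_measure) auto
  also have "\<dots> = ennreal (measure (face_measure (facet v)) (facet v)) * ennreal (2 * r)"
    using fm.emeasure_eq_measure[of "facet v"] by simp
  also have "\<dots> = ennreal (2 * r * measure (face_measure (facet v)) (facet v))"
    using r(1) by (simp add: ennreal_mult mult.commute)
  finally have "emeasure lborel (ball ?b r) \<le> ennreal (2 * r * measure (face_measure (facet v)) (facet v))" .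
  then show ?thesis
    using r(1) emeasure_lborel_ball_finite[of ?b r] by (simp add: emeasure_eq_ennreal_measure)
qed

text \<open>An affine f satisfies f(z) = 2 f((z + y)/2) - f(y), and the homothety y to (z + y)/2
  maps the facet into itself. It also halves the slab in which face integrals are computed, so its
  Jacobian is taken in full dimension, which gives 2^n.\<close>

lemma facet_point_value:
  assumes v: "v \<in> C" and z: "z \<in> C" "z \<noteq> v"
  shows "(p \<bullet> z + q)\<^sup>2 * measure (face_measure (facet v)) (facet v) \<le> (8 * 2 ^ DIM('a) + 2) * (l2_norm (face_measure (facet v)) (\<lambda>y. p \<bullet> y + q))\<^sup>2"
proof -
  interpret hyperplane_face "facet v" "normal v" "offset v" by (rule hyperplane_face_facet[OF v])
  interpret fm: finite_measure "face_measure (facet v)" by (rule finite_face_measure)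
  let ?\<nu> = "normal v" and ?c = "offset v" and ?f = "\<lambda>y. p \<bullet> y + q"
  have zF: "z \<in> facet v" unfolding facet_def by (rule hull_inc) (use z in auto)
  have zc: "?\<nu> \<bullet> z = ?c" by (rule F_sub[OF zF])
  have sq: "square_integrable (face_measure (facet v)) ?f"
    by (rule square_integrable_face) (intro continuous_intros)
  let ?Q = "\<integral>\<^sup>+y. ennreal ((?f y)\<^sup>2) \<partial>face_measure (facet v)"
  have Q: "?Q = ennreal ((l2_norm (face_measure (facet v)) ?f)\<^sup>2)"
    unfolding l2_norm_power2 using sq by (intro nn_integral_eq_integral) (auto simp: square_integrable_def)
  let ?h = "\<lambda>y. (1/2) *\<^sub>R z + (1/2) *\<^sub>R y"
  let ?H = "\<lambda>x. indicator {-1/2..1/2} (?\<nu> \<bullet> x - ?c) * (indicator (facet v) (P x) * ennreal ((?f (P x))\<^sup>2))"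
  have "(\<integral>\<^sup>+y. ennreal ((?f (?h y))\<^sup>2) \<partial>face_measure (facet v))
    = (\<integral>\<^sub>+x. indicator {-1/2..1/2} (?\<nu> \<bullet> x - ?c) * (indicator (facet v) (P x) * ennreal ((?f (?h (P x)))\<^sup>2)))"
    by (rule nn_integral_face_measure) measurable
  also have "\<dots> \<le> (\<integral>\<^sub>+x. ?H (?h x))"
  proof (rule nn_integral_mono)
    fix x
    have t: "?\<nu> \<bullet> ?h x - ?c = (1/2) * (?\<nu> \<bullet> x - ?c)" by (simp add: inner_add_right zc field_simps)
    have Ph: "P (?h x) = ?h (P x)"
      unfolding P_def t by (simp add: algebra_simps)
    have "?h (P x) \<in> facet v" if "P x \<in> facet v"
      using that zF convex_convex_hull[of "C - {v}"] unfolding facet_def by (intro convexD) auto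
    then show "indicator {-1/2..1/2} (?\<nu> \<bullet> x - ?c) * (indicator (facet v) (P x) * ennreal ((?f (?h (P x)))\<^sup>2)) \<le> ?H (?h x)"
      unfolding Ph t by (auto simp: indicator_def)
  qed
  also have "\<dots> = (\<integral>\<^sub>+x. ?H (?h x)) * ennreal (\<bar>1/2\<bar> ^ DIM('a)) * ennreal (2 ^ DIM('a))"
    by (simp add: mult.assoc ennreal_mult[symmetric] power_mult_distrib[symmetric])
  also have "(\<integral>\<^sub>+x. ?H (?h x)) * ennreal (\<bar>1/2\<bar> ^ DIM('a)) = (\<integral>\<^sub>+x. ?H x)"
    by (rule nn_integral_lborel_affine) (simp, measurable)
  also have "\<dots> = ?Q" by (rule nn_integral_face_measure[symmetric]) measurable
  finally have half: "(\<integral>\<^sup>+y. ennreal ((?f (?h y))\<^sup>2) \<partial>face_measure (facet v)) \<le> ennreal (2 ^ DIM('a)) * ?Q" by (simp add: mult.commute)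
  have "ennreal ((?f z)\<^sup>2) * ennreal (measure (face_measure (facet v)) (facet v)) = (\<integral>\<^sup>+y. ennreal ((?f z)\<^sup>2) \<partial>face_measure (facet v))"
    using fm.emeasure_eq_measure[of "facet v"] by simp
  also have "\<dots> \<le> (\<integral>\<^sup>+y. 8 * ennreal ((?f (?h y))\<^sup>2) + 2 * ennreal ((?f y)\<^sup>2) \<partial>face_measure (facet v))"
  proof (rule nn_integral_mono)
    fix y
    have "?f z = 2 * ?f (?h y) - ?f y" by (simp add: inner_add_right algebra_simps)
    moreover have "(2 * s - t)\<^sup>2 \<le> 8 * s\<^sup>2 + 2 * t\<^sup>2" for s t :: real
      using zero_le_power2[of "2 * s + t"] by (simp add: power2_eq_square algebra_simps)
    ultimately have "(?f z)\<^sup>2 \<le> 8 * (?f (?h y))\<^sup>2 + 2 * (?f y)\<^sup>2" by metis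
    then have "ennreal ((?f z)\<^sup>2) \<le> ennreal (8 * (?f (?h y))\<^sup>2 + 2 * (?f y)\<^sup>2)" by (rule ennreal_leI)
    then show "ennreal ((?f z)\<^sup>2) \<le> 8 * ennreal ((?f (?h y))\<^sup>2) + 2 * ennreal ((?f y)\<^sup>2)"
      by (simp add: ennreal_mult)
  qed
  also have "\<dots> = 8 * (\<integral>\<^sup>+y. ennreal ((?f (?h y))\<^sup>2) \<partial>face_measure (facet v)) + 2 * ?Q"
  proof -
    have m: "(\<lambda>y. ennreal ((?f (?h y))\<^sup>2)) \<in> borel_measurable (face_measure (facet v))" "(\<lambda>y. ennreal ((?f y)\<^sup>2)) \<in> borel_measurable (face_measure (facet v))"
      by (rule face_measurable, measurable)+
    show ?thesis using m by (simp add: nn_integral_add nn_integral_cmult)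
  qed
  also have "\<dots> \<le> 8 * (ennreal (2 ^ DIM('a)) * ?Q) + 2 * ?Q" by (intro add_right_mono mult_left_mono half) simp
  also have "\<dots> = ennreal ((8 * 2 ^ DIM('a) + 2) * (l2_norm (face_measure (facet v)) ?f)\<^sup>2)"
    unfolding Q by (simp add: ennreal_mult distrib_right mult.assoc)
  finally show ?thesis by (simp add: ennreal_mult[symmetric])
qed

text \<open>Expanding one factor of the square in barycentric coordinates and using duality shows
  that the squared norm of the dual function equals its value at \<open>z\<close>. The point value
  estimate bounds the square of this value by the squared norm, and one factor cancels.\<close>

lemma facet_dual_bound:
  assumes v: "v \<in> C" and z: "z \<in> C" "z \<noteq> v"
    and dual: "\<And>w. w \<in> C - {v} \<Longrightarrow> (LINT y|face_measure (facet v). (p \<bullet> y + q) * lam w y) = (if w = z then 1 else 0)"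
  shows "(l2_norm (face_measure (facet v)) (\<lambda>y. p \<bullet> y + q))\<^sup>2 * measure (face_measure (facet v)) (facet v) \<le> 8 * 2 ^ DIM('a) + 2"
proof -
  interpret hyperplane_face "facet v" "normal v" "offset v" by (rule hyperplane_face_facet[OF v])
  interpret fm: finite_measure "face_measure (facet v)" by (rule finite_face_measure)
  let ?M = "face_measure (facet v)" and ?f = "\<lambda>y. p \<bullet> y + q"
  have fsq: "square_integrable ?M ?f" by (rule square_integrable_face) (intro continuous_intros)
  have lsq: "square_integrable ?M (lam w)" for w by (rule square_integrable_face[OF lam_continuous])
  have "(l2_norm ?M ?f)\<^sup>2 = (LINT y|?M. (\<Sum>w\<in>C - {v}. ?f w * (?f y * lam w y)))"
    unfolding l2_norm_power2
  proof (rule Bochner_Integration.integral_cong[OF refl])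
    fix y assume "y \<in> space ?M"
    then have "y \<in> facet v" by (simp only: space_face_measure)
    then have y: "lam v y = 0" using facet_eq[OF v] by auto
    have "?f y = (\<Sum>w\<in>C. lam w y * ?f w)" by (rule affine_repr)
    also have "\<dots> = (\<Sum>w\<in>C - {v}. lam w y * ?f w)" using y by (simp add: sum.remove[OF fin_C v])
    finally have "(?f y)\<^sup>2 = ?f y * (\<Sum>w\<in>C - {v}. lam w y * ?f w)" by (simp add: power2_eq_square)
    also have "\<dots> = (\<Sum>w\<in>C - {v}. ?f w * (?f y * lam w y))" by (simp add: sum_distrib_left mult_ac)
    finally show "(?f y)\<^sup>2 = (\<Sum>w\<in>C - {v}. ?f w * (?f y * lam w y))" .
  qed
  also have "\<dots> = (\<Sum>w\<in>C - {v}. ?f w * (LINT y|?M. ?f y * lam w y))"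
    using square_integrable_mult[OF fsq lsq] by simp
  also have "\<dots> = (\<Sum>w\<in>C - {v}. if w = z then ?f w else 0)" by (intro sum.cong) (auto simp: dual)
  also have "\<dots> = ?f z" using z by simp
  finally have fz: "(l2_norm ?M ?f)\<^sup>2 = ?f z" .
  let ?Q = "(l2_norm ?M ?f)\<^sup>2"
  have "?Q * ?Q * measure ?M (facet v) \<le> (8 * 2 ^ DIM('a) + 2) * ?Q"
    using facet_point_value[OF v z, of p q] unfolding fz[symmetric] by (simp add: power2_eq_square)
  then have "?Q * (?Q * measure ?M (facet v)) \<le> ?Q * (8 * 2 ^ DIM('a) + 2)" by (simp only: mult_ac)
  then show ?thesis
  proof (cases "?Q = 0")
    case False
    then have "?Q > 0" using zero_le_power2[of "l2_norm ?M ?f"] by linarith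
    with \<open>?Q * (?Q * measure ?M (facet v)) \<le> ?Q * (8 * 2 ^ DIM('a) + 2)\<close> show ?thesis by (simp only: mult_le_cancel_left_pos)
  qed simp
qed

end

section \<open>Removing sets of codimension two\<close>

lemma low_aff_dim_negligible:
  fixes S :: "'a::euclidean_space set"
  assumes "aff_dim S < int DIM('a)"
  shows "negligible S"
proof -
  obtain a b where "a \<noteq> 0" "S \<subseteq> {x. a \<bullet> x = b}"
    using aff_lowdim_subset_hyperplane[OF assms] by blast
  then show ?thesis using negligible_hyperplane[of a b] negligible_subset by blast
qed

lemma open_minus_negligible_nonempty:
  fixes U :: "'a::euclidean_space set"
  assumes "open U" "U \<noteq> {}" "negligible S"
  shows "U - S \<noteq> {}"
proof
  assume "U - S = {}"
  then have "U \<subseteq> S" by auto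
  then have "negligible U" using assms(3) negligible_subset by blast
  then show False using assms open_not_negligible by blast
qed

text \<open>Two points are joined through a third point \<open>z\<close> by two segments. A segment
  from an end point to \<open>z\<close> can hit a flat only if \<open>z\<close> lies in the hull of
  the flat and that end point; these finitely many hulls have dimension at most n - 1, so a generic
  \<open>z\<close> avoids them.\<close>

lemma connected_ball_minus_codim_2:
  fixes \<A> :: "'a::euclidean_space set set"
  assumes fin: "finite \<A>" and dim: "\<And>A. A \<in> \<A> \<Longrightarrow> aff_dim A \<le> int DIM('a) - 2"
  shows "connected (ball p e - (\<Union>A\<in>\<A>. affine hull A))"
proof -
  let ?S = "\<Union>A\<in>\<A>. affine hull A"
  have "\<exists>g. path g \<and> path_image g \<subseteq> ball p e - ?S \<and> pathstart g = x \<and> pathfinish g = y"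
    if x: "x \<in> ball p e - ?S" and y: "y \<in> ball p e - ?S" for x y
  proof -
    let ?N = "\<Union>A\<in>\<A>. affine hull (insert x A) \<union> affine hull (insert y A)"
    have "negligible (affine hull (insert w A))" if "A \<in> \<A>" for w A
    proof (rule low_aff_dim_negligible)
      have "aff_dim (affine hull (insert w A)) \<le> aff_dim A + 1" by (simp add: aff_dim_insert)
      then show "aff_dim (affine hull (insert w A)) < int DIM('a)" using dim[OF that] by simp
    qed
    then have "negligible ?N" using fin by (intro negligible_Union) auto
    moreover have "ball p e \<noteq> {}" using x by blast
    ultimately have "ball p e - ?N \<noteq> {}" by (intro open_minus_negligible_nonempty open_ball)
    then obtain z where z: "z \<in> ball p e" "z \<notin> ?N" by blast
    have seg: "closed_segment w z \<subseteq> ball p e - ?S" if w: "w \<in> ball p e - ?S" "\<And>A. A \<in> \<A> \<Longrightarrow> z \<notin> affine hull (insert w A)" for w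
    proof
      fix q assume q: "q \<in> closed_segment w z"
      then have "q \<in> ball p e" using closed_segment_subset[OF _ z(1) convex_ball, of w] w by auto
      moreover have "q \<notin> affine hull A" if A: "A \<in> \<A>" for A
      proof
        assume qA: "q \<in> affine hull A"
        obtain t where t: "q = (1 - t) *\<^sub>R w + t *\<^sub>R z" using q by (auto simp: closed_segment_def)
        have "t \<noteq> 0" using t qA w A by auto
        then have "z = (1 - 1 / t) *\<^sub>R w + (1 / t) *\<^sub>R q"
          unfolding t by (simp add: algebra_simps)
        moreover have "w \<in> affine hull (insert w A)" by (simp add: hull_inc)
        moreover have "q \<in> affine hull (insert w A)" using qA hull_mono[of A "insert w A" affine] by blast
        ultimately have "z \<in> affine hull (insert w A)"
          using mem_affine[OF affine_affine_hull, of w "insert w A" q "1 - 1 / t" "1 / t"] by simp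
        then show False using w(2)[OF A] by blast
      qed
      ultimately show "q \<in> ball p e - ?S" by blast
    qed
    have sx: "closed_segment x z \<subseteq> ball p e - ?S" by (rule seg[OF x]) (use z in auto)
    have sy: "closed_segment y z \<subseteq> ball p e - ?S" by (rule seg[OF y]) (use z in auto)
    show ?thesis
      using sx sy by (intro exI[of _ "linepath x z +++ linepath z y"]) (auto simp: path_image_join closed_segment_commute)
  qed
  then have "path_connected (ball p e - ?S)" unfolding path_connected_def by blast
  then show ?thesis by (rule path_connected_imp_connected)
qed

text \<open>A separation of the remaining set would extend to all of \<open>U\<close>: every small
  ball minus the flats is connected and thus lies on one side. \<open>B X\<close> is the union of
  the balls on the side \<open>X\<close>; two balls of different sides cannot meet, because their
  intersection would be open and not exhausted by the flats.\<close>

lemma connected_open_minus_codim_2: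
  fixes \<A> :: "'a::euclidean_space set set"
  assumes U: "open U" "connected U" and fin: "finite \<A>"
    and dim: "\<And>A. A \<in> \<A> \<Longrightarrow> aff_dim A \<le> int DIM('a) - 2"
  shows "connected (U - (\<Union>A\<in>\<A>. affine hull A))"
proof (rule connectedI)
  let ?S = "\<Union>A\<in>\<A>. affine hull A"
  have neg: "negligible ?S"
  proof (intro negligible_Union finite_imageI fin)
    fix s assume "s \<in> (hull) affine ` \<A>"
    then obtain A where A: "A \<in> \<A>" "s = affine hull A" by auto
    then show "negligible s" using dim[OF A(1)] by (intro low_aff_dim_negligible) simp
  qed
  fix P Q assume PQ: "open P" "open Q" "P \<inter> (U - ?S) \<noteq> {}" "Q \<inter> (U - ?S) \<noteq> {}" "P \<inter> Q \<inter> (U - ?S) = {}" "U - ?S \<subseteq> P \<union> Q"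
  define B where "B X = {x. \<exists>y e. x \<in> ball y e \<and> ball y e \<subseteq> U \<and> ball y e - ?S \<subseteq> X}" for X :: "'a set"
  have open_B: "open (B X)" for X
  proof -
    have "B X = \<Union>{ball y e | y e. ball y e \<subseteq> U \<and> ball y e - ?S \<subseteq> X}" unfolding B_def by blast
    then show ?thesis by (auto intro!: open_Union)
  qed
  have cover: "U \<subseteq> B P \<union> B Q"
  proof
    fix x assume "x \<in> U"
    then obtain e where e: "e > 0" "ball x e \<subseteq> U" using U(1) open_contains_ball by blast
    have con: "connected (ball x e - ?S)" by (rule connected_ball_minus_codim_2[OF fin dim])
    have "ball x e - ?S \<subseteq> P \<or> ball x e - ?S \<subseteq> Q"
      using connectedD[OF con PQ(1,2)] PQ(5,6) e(2) by blast
    moreover have "x \<in> ball x e" using e by simp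
    ultimately show "x \<in> B P \<union> B Q" using e(2) unfolding B_def by blast
  qed
  have disj: "B P \<inter> B Q \<inter> U = {}"
  proof (rule ccontr)
    assume "B P \<inter> B Q \<inter> U \<noteq> {}"
    then obtain x y1 e1 y2 e2 where x: "x \<in> ball y1 e1 \<inter> ball y2 e2" and b: "ball y1 e1 \<subseteq> U" "ball y1 e1 - ?S \<subseteq> P" "ball y2 e2 - ?S \<subseteq> Q"
      unfolding B_def by blast
    have "ball y1 e1 \<inter> ball y2 e2 - ?S \<noteq> {}"
      using x by (intro open_minus_negligible_nonempty neg) auto
    then show False using b PQ(5) by blast
  qed
  have ne: "B X \<inter> U \<noteq> {}" if X: "open X" "X \<inter> (U - ?S) \<noteq> {}" for X
  proof -
    obtain x where x: "x \<in> X" "x \<in> U" using X(2) by blast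
    then obtain e where "e > 0" "ball x e \<subseteq> X \<inter> U" using U(1) X(1) open_contains_ball[of "X \<inter> U"] by blast
    then have "x \<in> B X" unfolding B_def by (auto intro!: exI[of _ x] exI[of _ e])
    then show ?thesis using x by blast
  qed
  show False
    using connectedD[OF U(2) open_B open_B disj cover] ne[OF PQ(1,3)] ne[OF PQ(2,4)] by blast
qed

section \<open>Geometry of shape-regular meshes\<close>

lemma simplex_verts:
  fixes T :: "'a::euclidean_space set"
  assumes "int DIM('a) simplex T"
  shows "\<not> affine_dependent (verts T)" "card (verts T) = Suc DIM('a)" "T = convex hull (verts T)" "finite (verts T)"
proof -
  obtain C where C: "\<not> affine_dependent C" "int (card C) = int DIM('a) + 1" "T = convex hull C"
    using assms unfolding simplex_def by blast
  have "verts T = C" unfolding verts_def C(3) using extreme_point_of_convex_hull_affine_independent[OF C(1)] by auto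
  then show "\<not> affine_dependent (verts T)" "card (verts T) = Suc DIM('a)" "T = convex hull (verts T)" "finite (verts T)"
    using C aff_independent_finite[OF C(1)] by auto
qed

text \<open>\<open>mesh_N\<close> bounds the number of elements at a vertex, \<open>mesh_K\<close>
  the number of ordered pairs of them and thereby the length of a facet chain, and
  \<open>mesh_M\<close> the ratio of two diameters at a vertex, one factor \<open>\<kappa>\<close>
  for each link of the chain.\<close>

definition mesh_N :: "real \<Rightarrow> nat \<Rightarrow> nat" where "mesh_N \<kappa> n = nat \<lfloor>(2 * \<kappa>) ^ n\<rfloor>"
definition mesh_K :: "real \<Rightarrow> nat \<Rightarrow> nat" where "mesh_K \<kappa> n = mesh_N \<kappa> n * mesh_N \<kappa> n"
definition mesh_M :: "real \<Rightarrow> nat \<Rightarrow> real" where "mesh_M \<kappa> n = \<kappa> ^ mesh_K \<kappa> n"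

locale mesh =
  fixes \<Omega> :: "'a::euclidean_space set" and \<kappa> :: real and \<T> :: "'a set set" and \<phi> :: "'a \<Rightarrow> 'a \<Rightarrow> real"
  assumes dom: "polyhedral_domain \<Omega>" and conf: "conforming_mesh \<Omega> \<T>" and shape: "shape_regular \<kappa> \<T>"
    and sym: "locally_symmetric \<Omega> \<T>" and nodal: "nodal_basis \<T> \<phi>"
begin

abbreviation (input) star :: "'a \<Rightarrow> 'a set set" where "star \<equiv> vertex_elements \<T>"
abbreviation (input) vpatch :: "'a \<Rightarrow> 'a set" where "vpatch \<equiv> vertex_patch \<T>"
abbreviation (input) patch :: "'a set \<Rightarrow> 'a set" where "patch \<equiv> element_patch \<T>"
abbreviation (input) coeff where "coeff \<equiv> clement_coeff \<Omega> \<T> \<phi>"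
abbreviation (input) interp where "interp \<equiv> clement \<Omega> \<T> \<phi>"

lemma finite_mesh: "finite \<T>"
  using conf by (simp add: conforming_mesh_def triangulation_def)

lemma simplex_mesh: "T \<in> \<T> \<Longrightarrow> int DIM('a) simplex T"
  using conf by (simp add: conforming_mesh_def)

lemma face_mesh:
  assumes "T \<in> \<T>" "T' \<in> \<T>"
  shows "(T \<inter> T') face_of T"
proof -
  have "triangulation \<T>" using conf unfolding conforming_mesh_def by (rule conjunct1)
  then have "\<forall>T T'. T \<in> \<T> \<and> T' \<in> \<T> \<longrightarrow> (T \<inter> T') face_of T" unfolding triangulation_def by (elim conjE)
  from this[rule_format, OF conjI[OF assms]] show ?thesis .
qed

lemma Union_mesh: "\<Union>\<T> = closure \<Omega>"
  using conf by (simp add: conforming_mesh_def)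

text \<open>The affine coefficients of \<open>\<phi> z\<close> on \<open>T\<close>, extracted by
  choice. They satisfy the duality of \<open>bary_simplex\<close>, so the global basis functions
  themselves serve as barycentric coordinates.\<close>

definition ga :: "'a set \<Rightarrow> 'a \<Rightarrow> 'a" where
  "ga T z = fst (SOME p. \<forall>x\<in>T. \<phi> z x = fst p \<bullet> x + snd p)"
definition gc :: "'a set \<Rightarrow> 'a \<Rightarrow> real" where
  "gc T z = snd (SOME p. \<forall>x\<in>T. \<phi> z x = fst p \<bullet> x + snd p)"

lemma phi_affine:
  assumes "T \<in> \<T>" "z \<in> mesh_verts \<T>" "x \<in> T"
  shows "\<phi> z x = ga T z \<bullet> x + gc T z"
proof -
  have "affine_fun_on T (\<phi> z)" using nodal assms unfolding nodal_basis_def by auto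
  then have "\<exists>p. \<forall>x\<in>T. \<phi> z x = fst p \<bullet> x + snd p" unfolding affine_fun_on_def by auto
  from bspec[OF someI_ex[OF this] assms(3)] show ?thesis unfolding ga_def gc_def .
qed

lemma verts_mesh: "T \<in> \<T> \<Longrightarrow> z \<in> verts T \<Longrightarrow> z \<in> mesh_verts \<T>"
  by (auto simp: mesh_verts_def)

lemma verts_sub: "z \<in> verts T \<Longrightarrow> z \<in> T"
  by (auto simp: verts_def extreme_point_of_def)

lemma phi_node: "z \<in> mesh_verts \<T> \<Longrightarrow> z' \<in> mesh_verts \<T> \<Longrightarrow> \<phi> z z' = (if z' = z then 1 else 0)"
  using nodal unfolding nodal_basis_def by auto

lemma bary:
  assumes T: "T \<in> \<T>"
  shows "bary_simplex (verts T) (ga T) (gc T)"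
proof
  show "card (verts T) = Suc DIM('a)" "\<not> affine_dependent (verts T)" using simplex_verts[OF simplex_mesh[OF T]] by auto
  fix v v' assume "v \<in> verts T" "v' \<in> verts T"
  then show "ga T v \<bullet> v' + gc T v = (if v' = v then 1 else 0)"
    using phi_affine[OF T verts_mesh[OF T] verts_sub, of v v'] phi_node[OF verts_mesh[OF T] verts_mesh[OF T], of v v'] by simp
qed

lemma T_eq: "T \<in> \<T> \<Longrightarrow> bary_simplex.T (verts T) = T"
  using bary_simplex.T_def[OF bary] simplex_verts(3)[OF simplex_mesh] by metis

lemma lam_phi: "T \<in> \<T> \<Longrightarrow> z \<in> mesh_verts \<T> \<Longrightarrow> x \<in> T \<Longrightarrow> ga T z \<bullet> x + gc T z = \<phi> z x"
  using phi_affine by simp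

lemma elem_facts:
  assumes "T \<in> \<T>"
  shows "compact T" "convex T" "bounded T" "interior T \<noteq> {}" "negligible (T - interior T)" "T \<in> sets borel" "T \<in> sets lebesgue"
    "finite (verts T)" "verts T \<noteq> {}" "bounded (interior T)" "convex (interior T)" "interior T \<in> sets lebesgue"
proof -
  interpret B: bary_simplex "verts T" "ga T" "gc T" by (rule bary[OF assms])
  note [simp] = T_eq[OF assms]
  show "compact T" using B.T_compact by simp
  show c: "convex T" using B.T_convex by simp
  show b: "bounded T" using B.bounded_T by simp
  show "interior T \<noteq> {}" using B.interior_T_nonempty by simp
  show "negligible (T - interior T)" using B.negligible_frontier_T by simp
  show "T \<in> sets borel" using B.T_borel by simp
  then show "T \<in> sets lebesgue" by simp
  show "finite (verts T)" by simp
  show "verts T \<noteq> {}" using B.card_C by auto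
  show "bounded (interior T)" using b bounded_subset interior_subset by blast
  show "convex (interior T)" using c by (rule convex_interior)
  show "interior T \<in> sets lebesgue" by simp
qed

lemma closure_interior_elem: "T \<in> \<T> \<Longrightarrow> closure (interior T) = T"
  using convex_closure_interior[of T] elem_facts[of T] by (auto simp: compact_imp_closed)

lemma diam_pos: "T \<in> \<T> \<Longrightarrow> diameter T > 0"
proof -
  assume T: "T \<in> \<T>"
  interpret B: bary_simplex "verts T" "ga T" "gc T" by (rule bary[OF T])
  obtain z where z: "z \<in> verts T" using elem_facts(9)[OF T] by auto
  obtain w where w: "w \<in> verts T" "w \<noteq> z" using B.other_vertex by blast
  have "dist z w \<le> diameter T" using diameter_bounded_bound[OF elem_facts(3)[OF T]] z w verts_sub by blast
  moreover have "dist z w > 0" using w by simp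
  ultimately show "diameter T > 0" by linarith
qed

lemma inscribed:
  assumes T: "T \<in> \<T>"
  shows "\<kappa> > 0" "\<exists>x. cball x (diameter T / (2 * \<kappa>)) \<subseteq> T"
proof -
  let ?R = "{r. 0 \<le> r \<and> (\<exists>x. cball x r \<subseteq> T)}"
  obtain x where "x \<in> interior T" using elem_facts(4)[OF T] by auto
  then obtain e where e: "e > 0" "cball x e \<subseteq> T" by (auto simp: mem_interior_cball)
  have bdd: "bdd_above ?R"
  proof (rule bdd_aboveI[where M="diameter T"])
    fix r assume "r \<in> ?R"
    then obtain y where r: "r \<ge> 0" "cball y r \<subseteq> T" by auto
    obtain b :: 'a where b: "b \<in> Basis" using nonempty_Basis by blast
    have "y \<in> T" "y + r *\<^sub>R b \<in> T" using r b by (auto intro!: subsetD[OF r(2)] simp: dist_norm)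
    then have "dist y (y + r *\<^sub>R b) \<le> diameter T" using diameter_bounded_bound[OF elem_facts(3)[OF T]] by blast
    then show "r \<le> diameter T" using r b by (simp add: dist_norm)
  qed
  have "e \<le> inradius T" unfolding inradius_def using e bdd by (intro cSup_upper) auto
  \<comment> \<open>Positivity matters: division by zero would make the quotient in
    \<open>shape_regular\<close> zero, and the condition would carry no information.\<close>
  then have in_pos: "inradius T > 0" using e by simp
  have le: "diameter T / inradius T \<le> \<kappa>" using shape T by (auto simp: shape_regular_def)
  have "diameter T / inradius T > 0" using in_pos diam_pos[OF T] by simp
  then show k: "\<kappa> > 0" using le by linarith
  \<comment> \<open>The factor 2 makes the inequality strict, so that some admissible radius, and
    not only their supremum, exceeds the left side.\<close>
  have "diameter T / (2 * \<kappa>) < inradius T"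
  proof -
    have "diameter T \<le> \<kappa> * inradius T" using le in_pos by (simp add: field_simps)
    moreover have "0 < \<kappa> * inradius T" using k in_pos by simp
    ultimately have "diameter T < inradius T * (2 * \<kappa>)" by (simp add: mult_ac)
    then show ?thesis using k by (simp add: pos_divide_less_eq)
  qed
  then obtain r where r: "r \<in> ?R" "diameter T / (2 * \<kappa>) < r"
  proof -
    have "e \<in> ?R" using e by auto
    then have "?R \<noteq> {}" by blast
    then show ?thesis
      using that less_cSup_iff[OF _ bdd, of "diameter T / (2 * \<kappa>)"] \<open>diameter T / (2 * \<kappa>) < inradius T\<close> unfolding inradius_def by blast
  qed
  then obtain y where "cball y r \<subseteq> T" by auto
  then have "cball y (diameter T / (2 * \<kappa>)) \<subseteq> T" using r(2) by (meson less_imp_le order_trans subset_cball)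
  then show "\<exists>x. cball x (diameter T / (2 * \<kappa>)) \<subseteq> T" by blast
qed

lemma grad_bound:
  assumes T: "T \<in> \<T>" and v: "v \<in> verts T"
  shows "diameter T * norm (ga T v) \<le> \<kappa>"
proof -
  interpret B: bary_simplex "verts T" "ga T" "gc T" by (rule bary[OF T])
  obtain x where x: "cball x (diameter T / (2 * \<kappa>)) \<subseteq> T" using inscribed[OF T] by blast
  have k: "\<kappa> > 0" by (rule inscribed(1)[OF T])
  have "2 * (diameter T / (2 * \<kappa>)) * norm (ga T v) \<le> 1"
    by (rule B.grad_le) (use x v k diam_pos[OF T] T_eq[OF T] in auto)
  then show ?thesis using k by (simp add: field_simps)
qed

text \<open>The coordinate of \<open>p\<close> changes by one along the edge, and its slope is at
  most \<open>\<kappa>\<close> over the diameter.\<close>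

lemma edge_bound:
  assumes T: "T \<in> \<T>" and p: "p \<in> verts T" "q \<in> verts T" "p \<noteq> q"
  shows "diameter T \<le> \<kappa> * dist p q"
proof -
  interpret B: bary_simplex "verts T" "ga T" "gc T" by (rule bary[OF T])
  have "1 = ga T p \<bullet> (p - q)" using B.a_diff[OF p(1,1,2)] B.lam_vertex p by simp
  also have "\<dots> \<le> norm (ga T p) * dist p q" using norm_cauchy_schwarz by (simp add: dist_norm)
  finally have "diameter T * 1 \<le> diameter T * (norm (ga T p) * dist p q)"
    using diam_pos[OF T] by (intro mult_left_mono) auto
  also have "\<dots> \<le> \<kappa> * dist p q" using mult_right_mono[OF grad_bound[OF T p(1)], of "dist p q"] by (simp add: mult.assoc)
  finally show ?thesis by simp
qed

lemma kappa_ge_1: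
  assumes T: "T \<in> \<T>"
  shows "\<kappa> \<ge> 1"
proof -
  interpret B: bary_simplex "verts T" "ga T" "gc T" by (rule bary[OF T])
  obtain z where z: "z \<in> verts T" using elem_facts(9)[OF T] by auto
  obtain w where w: "w \<in> verts T" "w \<noteq> z" using B.other_vertex by blast
  have "diameter T \<le> \<kappa> * dist z w" using edge_bound[OF T z w(1)] w by auto
  also have "\<dots> \<le> \<kappa> * diameter T"
    using diameter_bounded_bound[OF elem_facts(3)[OF T]] z w verts_sub inscribed(1)[OF T] by (intro mult_left_mono) auto
  finally show ?thesis using diam_pos[OF T] by simp
qed

text \<open>By conformity the intersection of two elements is a face of both, and the extreme points
  of a face are exactly the extreme points of the element lying in it.\<close>

lemma vertex_in_elem:
  assumes "z \<in> mesh_verts \<T>" "T \<in> \<T>" "z \<in> T"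
  shows "z \<in> verts T"
proof -
  obtain T1 where T1: "T1 \<in> \<T>" "z extreme_point_of T1" using assms(1) by (auto simp: mesh_verts_def verts_def)
  have z1: "z \<in> T1" using T1(2) by (simp add: extreme_point_of_def)
  have f1: "(T1 \<inter> T) face_of T1" by (rule face_mesh[OF T1(1) assms(2)])
  have f: "(T \<inter> T1) face_of T" by (rule face_mesh[OF assms(2) T1(1)])
  have "z extreme_point_of (T1 \<inter> T)" using extreme_point_of_face[OF f1] T1(2) z1 assms(3) by auto
  then have "z extreme_point_of (T \<inter> T1)" by (simp add: Int_commute)
  then show ?thesis using extreme_point_of_face[OF f] by (auto simp: verts_def)
qed

lemma interior_disjoint_elem:
  assumes T: "T \<in> \<T>" "T' \<in> \<T>" "T \<noteq> T'"
  shows "T' \<inter> interior T = {}"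
proof (rule ccontr)
  assume ne: "T' \<inter> interior T \<noteq> {}"
  have "(T \<inter> T') face_of T" by (rule face_mesh[OF T(1,2)])
  then have "T \<inter> T' = T" using face_of_disjoint_interior[of "T \<inter> T'" T] ne interior_subset[of T] by auto
  then have sub: "T \<subseteq> T'" by auto
  have "(T' \<inter> T) face_of T'" by (rule face_mesh[OF T(2,1)])
  moreover have "T' \<inter> T \<inter> interior T' \<noteq> {}"
    using interior_mono[OF sub] elem_facts(4)[OF T(1)] sub interior_subset[of T] by blast
  ultimately have "T' \<inter> T = T'" using face_of_disjoint_interior[of "T' \<inter> T" T'] by auto
  then show False using sub T(3) by auto
qed

lemma vertex_elements_sub: "T \<in> star z \<Longrightarrow> T \<in> \<T>" "T \<in> star z \<Longrightarrow> z \<in> T"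
  by (auto simp: vertex_elements_def)

lemma finite_vertex_elements: "finite (star z)"
  using finite_mesh by (simp add: vertex_elements_def)

lemma vertex_elements_verts: "z \<in> verts T \<Longrightarrow> T \<in> \<T> \<Longrightarrow> T \<in> star z"
  by (auto simp: vertex_elements_def verts_sub)

text \<open>The elements at \<open>z\<close> need not be comparable in size here. Each is contracted
  towards \<open>z\<close> until its diameter is the smallest one, \<open>\<epsilon>\<close>; the
  copies stay in the elements by convexity and contain disjoint balls of radius
  \<open>\<epsilon> / (2 * \<kappa>)\<close> in the ball of radius \<open>\<epsilon>\<close> about
  \<open>z\<close>. Volumes give the count (2 \<kappa>)^n.\<close>

lemma card_vertex_elements:
  assumes z: "z \<in> mesh_verts \<T>"
  shows "card (star z) \<le> mesh_N \<kappa> DIM('a)"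
proof -
  let ?E = "star z" and ?n = "DIM('a)"
  obtain T0 where T0: "T0 \<in> \<T>" "z \<in> verts T0" using z by (auto simp: mesh_verts_def)
  have ne: "?E \<noteq> {}" using vertex_elements_verts[OF T0(2,1)] by auto
  have k: "\<kappa> > 0" by (rule inscribed(1)[OF T0(1)])
  define \<epsilon> where "\<epsilon> = Min (diameter ` ?E)"
  have eps: "\<epsilon> > 0" "\<And>T. T \<in> ?E \<Longrightarrow> \<epsilon> \<le> diameter T"
    unfolding \<epsilon>_def using ne finite_vertex_elements diam_pos vertex_elements_sub by (auto intro!: Min_le)
  let ?r = "\<epsilon> / (2 * \<kappa>)"
  have r: "?r > 0" using eps k by simp
  have "\<exists>p. ball p ?r \<subseteq> interior T \<and> ball p ?r \<subseteq> cball z \<epsilon>" if T: "T \<in> ?E" for T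
  proof -
    have TT: "T \<in> \<T>" "z \<in> T" using vertex_elements_sub[OF T] by auto
    obtain x where x: "cball x (diameter T / (2 * \<kappa>)) \<subseteq> T" using inscribed(2)[OF TT(1)] by blast
    define t where "t = \<epsilon> / diameter T"
    have t: "0 < t" "t \<le> 1" "t * diameter T = \<epsilon>" using eps(1) eps(2)[OF T] diam_pos[OF TT(1)] by (auto simp: t_def)
    define p where "p = (1 - t) *\<^sub>R z + t *\<^sub>R x"
    have y: "y \<in> T \<and> dist z y \<le> \<epsilon>" if y: "y \<in> cball p ?r" for y
    proof -
      \<comment> \<open>The preimage of \<open>y\<close> under the contraction towards
        \<open>z\<close> with ratio \<open>t\<close>.\<close>
      define w where "w = x + (1 / t) *\<^sub>R (y - p)"
      have "norm (y - p) \<le> t * (diameter T / (2 * \<kappa>))" using y t(3) by (simp add: dist_norm norm_minus_commute)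
      then have "norm ((1 / t) *\<^sub>R (y - p)) \<le> diameter T / (2 * \<kappa>)" using t by (simp add: pos_divide_le_eq mult.commute)
      then have wT: "w \<in> T" using x by (auto simp: w_def dist_norm)
      have yw: "y = (1 - t) *\<^sub>R z + t *\<^sub>R w" using t by (simp add: w_def p_def algebra_simps)
      then have "y \<in> T" using elem_facts(2)[OF TT(1)] TT(2) wT t by (simp add: convexD)
      moreover have "z - y = t *\<^sub>R (z - w)" unfolding yw by (simp add: algebra_simps)
      then have "dist z y = t * dist z w" using t by (simp add: dist_norm)
      then have "dist z y \<le> \<epsilon>" using mult_left_mono[OF diameter_bounded_bound[OF elem_facts(3)[OF TT(1)] TT(2) wT], of t] t by simp
      ultimately show ?thesis by blast
    qed
    then have "ball p ?r \<subseteq> T" "ball p ?r \<subseteq> cball z \<epsilon>" by auto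
    then show ?thesis using interior_maximal[of "ball p ?r" T] by auto
  qed
  then obtain p where p: "\<And>T. T \<in> ?E \<Longrightarrow> ball (p T) ?r \<subseteq> interior T" "\<And>T. T \<in> ?E \<Longrightarrow> ball (p T) ?r \<subseteq> cball z \<epsilon>" by metis
  have disj: "disjoint_family_on (\<lambda>T. ball (p T) ?r) ?E"
    unfolding disjoint_family_on_def
  proof (intro ballI impI)
    fix T T' assume "T \<in> ?E" "T' \<in> ?E" "T \<noteq> T'"
    then show "ball (p T) ?r \<inter> ball (p T') ?r = {}"
      using p(1)[of T] p(1)[of T'] interior_disjoint_elem[of T T'] vertex_elements_sub interior_subset[of T'] by blast
  qed
  have "real (card ?E) * (unit_ball_vol (real ?n) * ?r ^ ?n) = (\<Sum>T\<in>?E. measure lborel (ball (p T) ?r))"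
    using r by (simp add: content_ball)
  also have "\<dots> = measure lborel (\<Union>T\<in>?E. ball (p T) ?r)"
  proof -
    have "emeasure lborel (ball q ?r) \<noteq> \<infinity>" for q using emeasure_lborel_ball_finite[of q ?r] by auto
    then show ?thesis using disj by (intro measure_finite_Union[symmetric] finite_vertex_elements) auto
  qed
  also have "\<dots> \<le> measure lborel (cball z \<epsilon>)"
  proof (rule measure_mono_fmeasurable)
    show "(\<Union>T\<in>?E. ball (p T) ?r) \<in> sets lborel" by (simp add: borel_open open_UN)
    show "cball z \<epsilon> \<in> fmeasurable lborel" using emeasure_lborel_cball_finite[of z \<epsilon>] by (simp add: fmeasurable_def)
    show "(\<Union>T\<in>?E. ball (p T) ?r) \<subseteq> cball z \<epsilon>" using p(2) by blast
  qed
  also have "\<dots> = unit_ball_vol (real ?n) * \<epsilon> ^ ?n" using eps(1) by (simp add: content_cball)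
  also have "\<dots> = unit_ball_vol (real ?n) * ((2 * \<kappa>) ^ ?n * ?r ^ ?n)" 
  proof -
    have "2 * \<kappa> * ?r = \<epsilon>" using k by simp
    then show ?thesis by (metis power_mult_distrib)
  qed
  finally have "real (card ?E) * (unit_ball_vol (real ?n) * ?r ^ ?n) \<le> (2 * \<kappa>) ^ ?n * (unit_ball_vol (real ?n) * ?r ^ ?n)"
    by (simp add: mult_ac)
  moreover have "unit_ball_vol (real ?n) * ?r ^ ?n > 0" using r by (intro mult_pos_pos zero_less_power unit_ball_vol_pos) auto
  ultimately have "real (card ?E) \<le> (2 * \<kappa>) ^ ?n" by (simp only: mult_le_cancel_right_pos)
  then show ?thesis unfolding mesh_N_def by (simp add: le_nat_floor)
qed

section \<open>Chains of elements through common facets\<close>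

text \<open>Intersections of elements are faces of both, so dimension n - 1 expresses that a whole
  facet is shared.\<close>

definition adj :: "'a \<Rightarrow> ('a set \<times> 'a set) set" where
  "adj z = {(T1, T2). T1 \<in> star z \<and> T2 \<in> star z \<and> aff_dim (T1 \<inter> T2) = int DIM('a) - 1}"

lemma aff_dim_elem: "T \<in> \<T> \<Longrightarrow> aff_dim T = int DIM('a)"
  using aff_dim_simplex simplex_mesh by blast

lemma facet_verts:
  assumes T: "T \<in> \<T>" and F: "F facet_of T"
  shows "\<exists>v\<in>verts T. F = convex hull (verts T - {v}) \<and> verts F = verts T - {v}"
proof -
  note V = simplex_verts[OF simplex_mesh[OF T]]
  have "F facet_of (convex hull (verts T))" using V(3) F by simp
  then obtain v where v: "v \<in> verts T" "F = convex hull (verts T - {v})"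
    using facet_of_convex_hull_affine_independent[OF V(1)] by auto
  have "\<not> affine_dependent (verts T - {v})" using V(1) affine_dependent_subset[of "verts T - {v}" "verts T"] by auto
  then have "verts F = verts T - {v}"
    unfolding verts_def v(2) using extreme_point_of_convex_hull_affine_independent by blast
  then show ?thesis using v by blast
qed

lemma adj_facets:
  assumes T: "T1 \<in> \<T>" "T2 \<in> \<T>" and d: "aff_dim (T1 \<inter> T2) = int DIM('a) - 1"
  shows "T1 \<noteq> T2" "\<exists>v\<in>verts T1. \<exists>v'\<in>verts T2. T1 \<inter> T2 = convex hull (verts T1 - {v}) \<and> verts T1 - {v} = verts T2 - {v'}"
proof -
  show "T1 \<noteq> T2" using d aff_dim_elem[OF T(1)] by auto
  have ne: "T1 \<inter> T2 \<noteq> {}" using d DIM_positive[where 'a='a] by auto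
  have "(T1 \<inter> T2) facet_of T1" "(T1 \<inter> T2) facet_of T2"
    using face_mesh[OF T] face_mesh[OF T(2,1)] ne d aff_dim_elem T by (auto simp: facet_of_def Int_commute)
  from facet_verts[OF T(1) this(1)] facet_verts[OF T(2) this(2)]
  show "\<exists>v\<in>verts T1. \<exists>v'\<in>verts T2. T1 \<inter> T2 = convex hull (verts T1 - {v}) \<and> verts T1 - {v} = verts T2 - {v'}" by metis
qed

lemma dom_facts: "open \<Omega>" "connected \<Omega>" "\<And>x e. x \<in> frontier \<Omega> \<Longrightarrow> e > 0 \<Longrightarrow> \<exists>U. open U \<and> x \<in> U \<and> U \<subseteq> ball x e \<and> connected (U \<inter> \<Omega>)"
  using dom unfolding polyhedral_domain_def by blast+

lemma mesh_verts_closure: "z \<in> mesh_verts \<T> \<Longrightarrow> z \<in> closure \<Omega>"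
  using Union_mesh verts_sub by (auto simp: mesh_verts_def)

lemma local_connected_neighbourhood:
  assumes z: "z \<in> mesh_verts \<T>" and e: "e > 0"
  shows "\<exists>U. open U \<and> z \<in> U \<and> U \<subseteq> ball z e \<and> connected (U \<inter> \<Omega>)"
proof (cases "z \<in> \<Omega>")
  case True
  then obtain d where d: "d > 0" "ball z d \<subseteq> \<Omega>" using dom_facts(1) open_contains_ball by blast
  have "ball z (min d e) \<inter> \<Omega> = ball z (min d e)" using d by auto
  then show ?thesis using d e by (intro exI[of _ "ball z (min d e)"]) auto
next
  case False
  then have "z \<in> frontier \<Omega>" using mesh_verts_closure[OF z] dom_facts(1) by (simp add: frontier_def interior_open)
  then show ?thesis using dom_facts(3) e by blast
qed

text \<open>An element is the closure of its interior, so near \<open>z\<close> it contains a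
  nonempty open piece of the domain, which a null set cannot exhaust.\<close>

lemma elem_meets:
  assumes "T \<in> \<T>" "z \<in> T" "open U" "z \<in> U" "negligible S"
  shows "T \<inter> (U \<inter> \<Omega> - S) \<noteq> {}"
proof -
  have "z \<in> closure (interior T)" using closure_interior_elem[OF assms(1)] assms(2) by simp
  then have "U \<inter> interior T \<noteq> {}" using assms(3,4) closure_iff_nhds_not_empty by (metis subset_refl inf_commute)
  then obtain y where y: "y \<in> U" "y \<in> interior T" by auto
  then have "y \<in> closure \<Omega>" using Union_mesh assms(1) interior_subset[of T] by blast
  then have "(U \<inter> interior T) \<inter> \<Omega> \<noteq> {}"
    using y assms(3) open_Int_closure_eq_empty[of "U \<inter> interior T" \<Omega>] by auto
  moreover have "open ((U \<inter> interior T) \<inter> \<Omega>)" using assms(3) dom_facts(1) by auto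
  ultimately have "(U \<inter> interior T) \<inter> \<Omega> - S \<noteq> {}" using open_minus_negligible_nonempty assms(5) by blast
  then show ?thesis using interior_subset[of T] by blast
qed

text \<open>Otherwise the elements reachable from \<open>T1\<close> and the remaining elements at
  \<open>z\<close> would give two closed sets covering a connected neighbourhood of \<open>z\<close>
  in the domain. Elements of different classes meet in dimension at most n - 2, so the two sets
  become disjoint after removal of these intersections, which does not disconnect the
  neighbourhood.\<close>

lemma facet_connected:
  assumes z: "z \<in> mesh_verts \<T>" and T: "T1 \<in> star z" "T2 \<in> star z"
  shows "(T1, T2) \<in> (adj z)\<^sup>*"
proof (rule ccontr)
  assume no: "(T1, T2) \<notin> (adj z)\<^sup>*"
  let ?E = "star z"
  define \<A> where "\<A> = {T \<in> ?E. (T1, T) \<in> (adj z)\<^sup>*}"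
  define \<S> where "\<S> = {A \<in> (\<lambda>(T, T'). T \<inter> T') ` (\<T> \<times> \<T>). aff_dim A \<le> int DIM('a) - 2}"
  have finS: "finite \<S>" unfolding \<S>_def using finite_mesh by simp
  have dimS: "aff_dim A \<le> int DIM('a) - 2" if "A \<in> \<S>" for A using that by (auto simp: \<S>_def)
  let ?S = "\<Union>A\<in>\<S>. affine hull A"
  have neg: "negligible ?S"
  proof (intro negligible_Union finite_imageI finS)
    fix s assume "s \<in> (hull) affine ` \<S>"
    then obtain A where A: "A \<in> \<S>" "s = affine hull A" by auto
    then show "negligible s" using dimS[OF A(1)] by (intro low_aff_dim_negligible) simp
  qed
  \<comment> \<open>The neighbourhood is taken so small that it meets only elements containing
    \<open>z\<close>.\<close>
  have "closed (\<Union>(\<T> - ?E))" using finite_mesh elem_facts(1) by (intro closed_Union) (auto intro: compact_imp_closed)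
  moreover have "z \<notin> \<Union>(\<T> - ?E)" by (auto simp: vertex_elements_def)
  ultimately obtain e where e: "e > 0" "ball z e \<subseteq> - \<Union>(\<T> - ?E)"
    by (metis ComplI open_Compl open_contains_ball)
  obtain U where U: "open U" "z \<in> U" "U \<subseteq> ball z e" "connected (U \<inter> \<Omega>)"
    using local_connected_neighbourhood[OF z e(1)] by blast
  let ?W = "U \<inter> \<Omega> - ?S"
  have con: "connected ?W"
    using connected_open_minus_codim_2[OF _ U(4) finS dimS] U(1) dom_facts(1) by auto
  have cov: "?W \<subseteq> \<Union>\<A> \<union> \<Union>(?E - \<A>)"
  proof
    fix x assume x: "x \<in> ?W"
    then have "x \<in> closure \<Omega>" using closure_subset by blast
    then obtain T where T: "T \<in> \<T>" "x \<in> T" using Union_mesh by blast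
    moreover have "x \<notin> \<Union>(\<T> - ?E)" using x U(3) e(2) by blast
    ultimately show "x \<in> \<Union>\<A> \<union> \<Union>(?E - \<A>)" by blast
  qed
  have disj: "\<Union>\<A> \<inter> \<Union>(?E - \<A>) \<inter> ?W = {}"
  proof (rule ccontr)
    assume "\<Union>\<A> \<inter> \<Union>(?E - \<A>) \<inter> ?W \<noteq> {}"
    then obtain x T T' where x: "x \<in> T" "x \<in> T'" "x \<in> ?W" and TT: "T \<in> \<A>" "T' \<in> ?E" "T' \<notin> \<A>" by blast
    have TE: "T \<in> ?E" "(T1, T) \<in> (adj z)\<^sup>*" using TT by (auto simp: \<A>_def)
    have mT: "T \<in> \<T>" "T' \<in> \<T>" using TE TT vertex_elements_sub by auto
    have ne: "T \<noteq> T'" using TT by auto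
    have "aff_dim (T \<inter> T') \<noteq> int DIM('a) - 1"
    proof
      assume "aff_dim (T \<inter> T') = int DIM('a) - 1"
      then have "(T, T') \<in> adj z" using TE TT by (simp add: adj_def)
      then have "(T1, T') \<in> (adj z)\<^sup>*" using TE(2) by (rule_tac rtrancl_into_rtrancl)
      then show False using TT by (simp add: \<A>_def)
    qed
    moreover have "aff_dim (T \<inter> T') < int DIM('a)"
    proof -
      have "T \<inter> T' \<noteq> T" using interior_disjoint_elem[OF mT ne] elem_facts(4)[OF mT(1)] interior_subset[of T] by blast
      then have "aff_dim (T \<inter> T') < aff_dim T" using face_of_aff_dim_lt[OF elem_facts(2)[OF mT(1)] face_mesh[OF mT]] by blast
      then show ?thesis using aff_dim_elem[OF mT(1)] by simp
    qed
    ultimately have "aff_dim (T \<inter> T') \<le> int DIM('a) - 2" by linarith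
    then have "T \<inter> T' \<in> \<S>" unfolding \<S>_def using mT by auto
    moreover have "x \<in> affine hull (T \<inter> T')" using x by (auto intro: hull_inc)
    ultimately show False using x(3) by blast
  qed
  have clA: "closed (\<Union>\<A>)" "closed (\<Union>(?E - \<A>))"
    using finite_vertex_elements[of z] elem_facts(1) vertex_elements_sub
    by (auto intro!: closed_Union compact_imp_closed simp: \<A>_def)
  have "T1 \<in> \<A>" using T(1) by (simp add: \<A>_def)
  then have 1: "\<Union>\<A> \<inter> ?W \<noteq> {}"
    using elem_meets[OF vertex_elements_sub[OF T(1)] U(1,2) neg] by blast
  have "T2 \<in> ?E - \<A>" using T(2) no by (simp add: \<A>_def)
  then have 2: "\<Union>(?E - \<A>) \<inter> ?W \<noteq> {}"
    using elem_meets[OF vertex_elements_sub[OF T(2)] U(1,2) neg] by blast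
  show False
    using con 1 2 disj cov clA unfolding connected_closed by blast
qed

end

context mesh
begin

subsection \<open>Vertex patches\<close>

lemma open_vertex_patch: "open (vpatch z)"
  by (simp add: vertex_patch_def)

lemma interior_sub_patch: "T \<in> star z \<Longrightarrow> interior T \<subseteq> vpatch z"
  unfolding vertex_patch_def by (intro interior_mono) blast

lemma patch_sub: "vpatch z \<subseteq> \<Union>(star z)"
  unfolding vertex_patch_def by (rule interior_subset)

lemma patch_almost_cover: "negligible (\<Union>(star z) - (\<Union>T\<in>star z. interior T))"
proof (rule negligible_subset)
  show "negligible (\<Union>T\<in>star z. T - interior T)"
    using finite_vertex_elements elem_facts(5) vertex_elements_sub(1) by (intro negligible_Union) auto
qed blast

lemma negligible_elem_Int:
  assumes "T \<in> \<T>" "T' \<in> \<T>" "T \<noteq> T'" shows "negligible (T \<inter> T')"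
proof (rule negligible_subset[OF elem_facts(5)[OF assms(1)]])
  show "T \<inter> T' \<subseteq> T - interior T" using interior_disjoint_elem[OF assms] by blast
qed

lemma elem_lmeasurable: "T \<in> \<T> \<Longrightarrow> T \<in> lmeasurable"
  using elem_facts(1) lmeasurable_compact by blast

lemma patch_measure: "vol (vpatch z) = (\<Sum>T\<in>star z. vol T)"
proof -
  let ?E = "star z"
  have "vol (\<Union>?E) = (\<Sum>T\<in>?E. vol T)"
  proof (rule measure_negligible_finite_Union[OF finite_vertex_elements])
    show "\<And>S. S \<in> ?E \<Longrightarrow> S \<in> lmeasurable" using elem_lmeasurable vertex_elements_sub by blast
    show "pairwise (\<lambda>S T. negligible (S \<inter> T)) ?E" using negligible_elem_Int vertex_elements_sub by (auto simp: pairwise_def)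
  qed
  moreover have "vol (vpatch z) = vol (\<Union>?E)"
  proof (rule measure_negligible_symdiff)
    show "\<Union>?E \<in> lmeasurable" using elem_lmeasurable vertex_elements_sub finite_vertex_elements by (intro fmeasurable.finite_Union) auto
    have "sym_diff (\<Union>?E) (vpatch z) \<subseteq> \<Union>?E - (\<Union>T\<in>?E. interior T)"
      using patch_sub interior_sub_patch by blast
    then show "negligible (sym_diff (\<Union>?E) (vpatch z))" using patch_almost_cover negligible_subset by blast
  qed
  ultimately show ?thesis by simp
qed

lemma measure_elem_pos: "T \<in> \<T> \<Longrightarrow> vol T > 0"
proof -
  assume T: "T \<in> \<T>"
  have "0 < vol (interior T)" using elem_facts[OF T] by (intro open_measure_pos) auto
  also have "\<dots> \<le> vol T"
    using elem_lmeasurable[OF T] interior_subset by (intro measure_mono_fmeasurable) auto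
  finally show ?thesis .
qed

text \<open>The form in which local symmetry enters the moment computation: the moments of the
  elements about \<open>z\<close> cancel.\<close>

lemma symmetric_sum:
  assumes z: "z \<in> interior_verts \<Omega> \<T>"
  shows "(\<Sum>T\<in>star z. vol T *\<^sub>R (barycenter T - z)) = 0"
proof -
  let ?E = "star z" and ?m = "vol (vpatch z)"
  obtain T where T: "T \<in> \<T>" "z \<in> verts T" using z by (auto simp: interior_verts_def mesh_verts_def)
  then have "T \<in> ?E" by (simp add: vertex_elements_verts)
  then have ne: "?E \<noteq> {}" by blast
  have "(\<Sum>T\<in>?E. vol T) > 0"
    by (rule sum_pos[OF finite_vertex_elements ne]) (rule measure_elem_pos[OF vertex_elements_sub(1)])
  then have m: "?m > 0" by (simp only: patch_measure)
  define S where "S = (\<Sum>T\<in>?E. vol T *\<^sub>R barycenter T)"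
  have "(1 / ?m) *\<^sub>R S = z"
    unfolding S_def using bspec[OF sym[unfolded locally_symmetric_def] z] .
  then have "?m *\<^sub>R ((1 / ?m) *\<^sub>R S) = ?m *\<^sub>R z" by (rule arg_cong)
  then have "S = ?m *\<^sub>R z" using m by simp
  moreover have "(\<Sum>T\<in>?E. vol T *\<^sub>R (barycenter T - z)) = S - (\<Sum>T\<in>?E. vol T) *\<^sub>R z"
    unfolding S_def by (simp only: scaleR_diff_right sum_subtractf scaleR_sum_left)
  ultimately show ?thesis by (simp only: patch_measure diff_self)
qed

subsection \<open>Comparable element sizes\<close>

text \<open>For n at least 2 a common facet contains a common edge, and an edge is comparable to the
  diameter of each element it belongs to.\<close>

lemma adj_size:
  assumes n: "DIM('a) \<ge> 2" and T: "T1 \<in> \<T>" "T2 \<in> \<T>" "aff_dim (T1 \<inter> T2) = int DIM('a) - 1"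
  shows "diameter T1 \<le> \<kappa> * diameter T2"
proof -
  obtain v v' where v: "v \<in> verts T1" "v' \<in> verts T2" "verts T1 - {v} = verts T2 - {v'}"
    using adj_facets[OF T] by blast
  interpret B: bary_simplex "verts T1" "ga T1" "gc T1" by (rule bary[OF T(1)])
  have "card (verts T1 - {v}) \<ge> 2" using B.card_facet_verts[OF v(1)] n by simp
  then obtain p q where pq: "p \<in> verts T1 - {v}" "q \<in> verts T1 - {v}" "p \<noteq> q"
    by (metis card_le_Suc0_iff_eq finite_Diff B.fin_C not_less_eq_eq numeral_2_eq_2)
  have "diameter T1 \<le> \<kappa> * dist p q" by (rule edge_bound[OF T(1)]) (use pq in auto)
  also have "\<dots> \<le> \<kappa> * diameter T2"
  proof (intro mult_left_mono)
    have "p \<in> T2" "q \<in> T2" using pq v(3) verts_sub by blast+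
    then show "dist p q \<le> diameter T2" using diameter_bounded_bound[OF elem_facts(3)[OF T(2)]] by blast
  qed (use inscribed(1)[OF T(1)] in simp)
  finally show ?thesis .
qed

text \<open>\<open>s\<close> is a signed length whose sign tells on which side of \<open>z\<close>
  the segment lies. Writing the segment as a closed ball gives access to the formulas for volume,
  diameter and interior of balls.\<close>

lemma segment_elem:
  assumes n: "DIM('a) = 1" and e: "Basis = {e}" and T: "T \<in> star z" and z: "z \<in> mesh_verts \<T>"
  shows "\<exists>s. s \<noteq> 0 \<and> T = cball (z + (s/2) *\<^sub>R e) (\<bar>s\<bar> / 2) \<and> barycenter T - z = (s/2) *\<^sub>R e"
proof -
  have TT: "T \<in> \<T>" "z \<in> T" using vertex_elements_sub[OF T] by auto
  interpret B: bary_simplex "verts T" "ga T" "gc T" by (rule bary[OF TT(1)])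
  have zT: "z \<in> verts T" by (rule vertex_in_elem[OF z TT])
  have "card (verts T - {z}) = 1" using B.card_facet_verts[OF zT] n by simp
  then obtain p where p: "verts T - {z} = {p}" by (auto simp: card_1_singleton_iff)
  have V: "verts T = {z, p}" "p \<noteq> z" using p zT by auto
  have rep: "y = (y \<bullet> e) *\<^sub>R e" for y :: 'a
  proof -
    have "(\<Sum>b\<in>{e}. (y \<bullet> b) *\<^sub>R b) = y" using euclidean_representation[of y] unfolding e .
    then show ?thesis by simp
  qed
  have eB: "e \<in> Basis" unfolding e by simp
  have ee: "e \<bullet> e = 1" "norm e = 1" using inner_same_Basis[OF eB] norm_Basis[OF eB] by auto
  define s where "s = (p - z) \<bullet> e"
  have ps: "p = z + s *\<^sub>R e" using rep[of "p - z"] by (simp add: s_def algebra_simps)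
  have s: "s \<noteq> 0" using V(2) ps by auto
  have Th: "T = convex hull {z, p}" using simplex_verts(3)[OF simplex_mesh[OF TT(1)]] V by simp
  have "T = cball (z + (s/2) *\<^sub>R e) (\<bar>s\<bar> / 2)"
  proof
    have "z \<in> cball (z + (s/2) *\<^sub>R e) (\<bar>s\<bar> / 2)" using ee by (simp add: dist_norm)
    moreover have "(z + (s/2) *\<^sub>R e) - p = (- s/2) *\<^sub>R e" unfolding ps by (simp add: algebra_simps flip: scaleR_add_left)
    then have "p \<in> cball (z + (s/2) *\<^sub>R e) (\<bar>s\<bar> / 2)" using ee by (simp only: mem_cball dist_norm norm_scaleR)
    ultimately show "T \<subseteq> cball (z + (s/2) *\<^sub>R e) (\<bar>s\<bar> / 2)" unfolding Th by (intro hull_minimal) auto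
    show "cball (z + (s/2) *\<^sub>R e) (\<bar>s\<bar> / 2) \<subseteq> T"
    proof
      fix y assume y: "y \<in> cball (z + (s/2) *\<^sub>R e) (\<bar>s\<bar> / 2)"
      define t where "t = ((y - z) \<bullet> e) / s"
      have ts: "t * s = (y - z) \<bullet> e" using s by (simp add: t_def)
      have "z + (t * s) *\<^sub>R e = z + (y - z)" unfolding ts by (simp only: rep[of "y - z", symmetric])
      then have yz: "y = z + (t * s) *\<^sub>R e" by simp
      have "(z + (s/2) *\<^sub>R e) - y = ((1/2 - t) * s) *\<^sub>R e" unfolding yz by (simp add: algebra_simps)
      then have "\<bar>1/2 - t\<bar> * \<bar>s\<bar> \<le> 1/2 * \<bar>s\<bar>" using y ee by (simp add: dist_norm abs_mult)
      then have "\<bar>1/2 - t\<bar> \<le> 1/2" by (rule mult_right_le_imp_le) (use s in simp)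
      then have t: "0 \<le> t" "t \<le> 1" unfolding abs_le_iff by linarith+
      have "y = (1 - t) *\<^sub>R z + t *\<^sub>R p" unfolding yz ps by (simp add: algebra_simps)
      then show "y \<in> T" unfolding Th using t by (auto simp: convex_hull_2_alt intro!: exI[of _ t] simp: algebra_simps)
    qed
  qed
  moreover have "barycenter T - z = (s/2) *\<^sub>R e"
    unfolding barycenter_def V(1) using V(2) n by (simp add: ps algebra_simps flip: scaleR_add_left)
  ultimately show ?thesis using s by blast
qed

text \<open>Segments on the same side of \<open>z\<close> would have overlapping interiors, so there
  are two segments on opposite sides and \<open>z\<close> is an interior vertex. Volumes being
  proportional to |s|, local symmetry at \<open>z\<close> becomes |s1| s1 + |s2| s2 = 0.\<close>

lemma size_dim_1:
  assumes n: "DIM('a) = 1" and z: "z \<in> mesh_verts \<T>" and T: "T1 \<in> star z" "T2 \<in> star z"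
  shows "diameter T1 = diameter T2"
proof (cases "T1 = T2")
  case ne: False
  obtain e :: 'a where e: "Basis = {e}" using n by (auto simp: card_1_singleton_iff)
  have eB: "e \<in> Basis" unfolding e by simp
  have ee: "e \<bullet> e = 1" "norm e = 1" using inner_same_Basis[OF eB] norm_Basis[OF eB] by auto
  have rep: "y = (y \<bullet> e) *\<^sub>R e" for y :: 'a
  proof -
    have "(\<Sum>b\<in>{e}. (y \<bullet> b) *\<^sub>R b) = y" using euclidean_representation[of y] unfolding e .
    then show ?thesis by simp
  qed
  have nrm: "norm y = \<bar>y \<bullet> e\<bar>" for y :: 'a using arg_cong[OF rep[of y], of norm] by (simp add: ee)
  obtain s where s: "\<And>T. T \<in> star z \<Longrightarrow> s T \<noteq> 0 \<and> T = cball (z + (s T/2) *\<^sub>R e) (\<bar>s T\<bar> / 2) \<and> barycenter T - z = (s T/2) *\<^sub>R e"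
    using segment_elem[OF n e _ z] by metis
  have half: "\<bar>1/2 - t\<bar> < 1/2 \<longleftrightarrow> 0 < t \<and> t < 1" for t :: real unfolding abs_less_iff by auto
  have int: "y \<in> interior T \<longleftrightarrow> 0 < ((y - z) \<bullet> e) / s T \<and> ((y - z) \<bullet> e) / s T < 1" if T: "T \<in> star z" for T y
  proof -
    let ?t = "((y - z) \<bullet> e) / s T"
    have "interior T = ball (z + (s T/2) *\<^sub>R e) (\<bar>s T\<bar> / 2)" using s[OF T] by (metis interior_cball)
    then have "y \<in> interior T \<longleftrightarrow> \<bar>(z + (s T/2) *\<^sub>R e - y) \<bullet> e\<bar> < \<bar>s T\<bar> / 2" by (simp add: dist_norm nrm)
    also have "(z + (s T/2) *\<^sub>R e - y) \<bullet> e = (1/2 - ?t) * s T" using s[OF T] ee by (simp add: inner_diff_left inner_add_left field_simps)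
    also have "\<bar>(1/2 - ?t) * s T\<bar> < \<bar>s T\<bar> / 2 \<longleftrightarrow> \<bar>1/2 - ?t\<bar> < 1/2"
      using s[OF T] mult_less_cancel_right_pos[of "\<bar>s T\<bar>" "\<bar>1/2 - ?t\<bar>" "1/2"] by (simp add: abs_mult)
    also have "\<dots> \<longleftrightarrow> 0 < ?t \<and> ?t < 1" by (rule half)
    finally show ?thesis .
  qed
  have opp: "s T * s T' < 0" if TT: "T \<in> star z" "T' \<in> star z" "T \<noteq> T'" for T T'
  proof (rule ccontr)
    assume "\<not> s T * s T' < 0"
    then have "s T * s T' > 0" using s[OF TT(1)] s[OF TT(2)] by (metis linorder_neqE_linordered_idom mult_eq_0_iff)
    then have q: "s T / s T' > 0" by (simp add: zero_less_divide_iff zero_less_mult_iff)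
    \<comment> \<open>A coordinate strictly inside both segments: with q = s T / s T' > 0 its
      relative positions are 1 / (2 (1 + q)) and q / (2 (1 + q)).\<close>
    define t where "t = s T / (2 * (1 + s T / s T'))"
    have t1: "t / s T = 1 / (2 * (1 + s T / s T'))" using s[OF TT(1)] by (simp add: t_def)
    have t2: "t / s T' = (s T / s T') / (2 * (1 + s T / s T'))" by (simp add: t_def)
    have "z + t *\<^sub>R e \<in> interior T" unfolding int[OF TT(1)] using q ee by (simp add: t1)
    moreover have "z + t *\<^sub>R e \<in> interior T'"
    proof -
      have "0 < q / (2 * (1 + q)) \<and> q / (2 * (1 + q)) < 1" if "q > 0" for q :: real using that by (simp add: field_simps)
      from this[OF q] have "0 < t / s T' \<and> t / s T' < 1" unfolding t2 .
      moreover have "(z + t *\<^sub>R e - z) \<bullet> e = t" using ee by simp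
      ultimately show ?thesis unfolding int[OF TT(2)] by (simp only:)
    qed
    ultimately show False using interior_disjoint_elem[OF vertex_elements_sub(1)[OF TT(1)] vertex_elements_sub(1)[OF TT(2)] TT(3)] interior_subset[of T'] by blast
  qed
  have E: "star z = {T1, T2}"
  proof (rule ccontr)
    assume "star z \<noteq> {T1, T2}"
    then obtain T3 where T3: "T3 \<in> star z" "T3 \<noteq> T1" "T3 \<noteq> T2" using T by blast
    have "s T1 * s T2 < 0" "s T3 * s T1 < 0" "s T3 * s T2 < 0" using opp T T3 ne by auto
    then show False by (auto simp: mult_less_0_iff)
  qed
  \<comment> \<open>The domain meets the interiors of both segments, so its image under the
    coordinate is connected and contains numbers of both signs, hence 0.\<close>
  have "z \<in> \<Omega>"
  proof -
    have "\<exists>q\<in>\<Omega>. q \<in> interior T" if "T \<in> star z" for T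
    proof -
      have "interior T \<subseteq> closure \<Omega>" using Union_mesh vertex_elements_sub[OF that] interior_subset by blast
      moreover have "interior T \<noteq> {}" using elem_facts(4) vertex_elements_sub[OF that] by blast
      ultimately show ?thesis using open_Int_closure_eq_empty[of "interior T" \<Omega>] by auto
    qed
    then obtain q1 q2 where q: "q1 \<in> \<Omega>" "q1 \<in> interior T1" "q2 \<in> \<Omega>" "q2 \<in> interior T2" using T by blast
    let ?f = "\<lambda>y. (y - z) \<bullet> e"
    have "connected (?f ` \<Omega>)" by (intro connected_continuous_image dom_facts(2) continuous_intros)
    have "?f q1 / s T1 > 0" "?f q2 / s T2 > 0" using q int T by auto
    moreover have "s T1 * s T2 < 0" using opp T ne by auto
    ultimately have "(?f q1 < 0 \<and> 0 < ?f q2) \<or> (?f q2 < 0 \<and> 0 < ?f q1)"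
      by (auto simp: zero_less_divide_iff mult_less_0_iff)
    then have "0 \<in> ?f ` \<Omega>"
      using connectedD_interval[OF \<open>connected (?f ` \<Omega>)\<close>, of "?f q1" "?f q2" 0] connectedD_interval[OF \<open>connected (?f ` \<Omega>)\<close>, of "?f q2" "?f q1" 0] q
      by (auto simp: less_imp_le)
    then obtain y where y: "y \<in> \<Omega>" "(y - z) \<bullet> e = 0" by auto
    have "y - z = ((y - z) \<bullet> e) *\<^sub>R e" by (rule rep)
    also have "\<dots> = 0" unfolding y(2) by simp
    finally show ?thesis using y by simp
  qed
  then have "z \<in> interior_verts \<Omega> \<T>" using z by (simp add: interior_verts_def)
  from symmetric_sum[OF this] have "vol T1 *\<^sub>R (barycenter T1 - z) + vol T2 *\<^sub>R (barycenter T2 - z) = 0"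
    unfolding E using ne by simp
  then have "(vol T1 * (s T1 / 2) + vol T2 * (s T2 / 2)) *\<^sub>R e = 0"
    using s[OF T(1)] s[OF T(2)] by (simp add: algebra_simps)
  then have eq: "vol T1 * s T1 + vol T2 * s T2 = 0" using ee by auto
  have m: "vol T = unit_ball_vol (real DIM('a)) * (\<bar>s T\<bar> / 2)" if "T \<in> star z" for T
  proof -
    have "vol T = vol (cball (z + (s T/2) *\<^sub>R e) (\<bar>s T\<bar> / 2))" using s[OF that] by metis
    then show ?thesis using n by (simp add: content_cball)
  qed
  have d: "diameter T = \<bar>s T\<bar>" if "T \<in> star z" for T
  proof -
    have "diameter T = diameter (cball (z + (s T/2) *\<^sub>R e) (\<bar>s T\<bar> / 2))" using s[OF that] by metis
    then show ?thesis by simp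
  qed
  have "unit_ball_vol (real DIM('a)) / 2 * (\<bar>s T1\<bar> * s T1 + \<bar>s T2\<bar> * s T2) = 0" using eq by (simp add: m T algebra_simps)
  moreover have "unit_ball_vol (real DIM('a)) > 0" by simp
  ultimately have "\<bar>s T1\<bar> * s T1 + \<bar>s T2\<bar> * s T2 = 0" by simp
  then have "\<bar>s T1\<bar> * \<bar>s T1\<bar> = \<bar>s T2\<bar> * \<bar>s T2\<bar>" using opp[OF T ne] by (auto simp: abs_if mult_less_0_iff split: if_splits)
  then have "sqrt (\<bar>s T1\<bar> * \<bar>s T1\<bar>) = sqrt (\<bar>s T2\<bar> * \<bar>s T2\<bar>)" by (rule arg_cong)
  then have "\<bar>s T1\<bar> = \<bar>s T2\<bar>" by (simp only: real_sqrt_abs2 abs_abs)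
  then show ?thesis using d T by simp
qed simp

lemma finite_adj: "finite (adj z)" and card_adj: "z \<in> mesh_verts \<T> \<Longrightarrow> card (adj z) \<le> mesh_K \<kappa> DIM('a)"
proof -
  have sub: "adj z \<subseteq> star z \<times> star z" by (auto simp: adj_def)
  have fin: "finite (star z \<times> star z)" using finite_vertex_elements by simp
  show "finite (adj z)" using finite_subset[OF sub fin] .
  assume z: "z \<in> mesh_verts \<T>"
  have "card (adj z) \<le> card (star z) * card (star z)"
    using card_mono[OF fin sub] by (simp add: card_cartesian_product)
  also have "\<dots> \<le> mesh_K \<kappa> DIM('a)" unfolding mesh_K_def by (intro mult_mono card_vertex_elements[OF z]) auto
  finally show "card (adj z) \<le> mesh_K \<kappa> DIM('a)" .
qed

text \<open>Reachability in a finite relation takes at most as many steps as the relation has pairs,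
  which makes the chain length uniform over all meshes.\<close>

lemma adj_chain:
  assumes z: "z \<in> mesh_verts \<T>" and T: "T1 \<in> star z" "T2 \<in> star z"
  shows "\<exists>k\<le>mesh_K \<kappa> DIM('a). (T1, T2) \<in> adj z ^^ k"
  using facet_connected[OF z T] card_adj[OF z] unfolding rtrancl_finite_eq_relpow[OF finite_adj] by (auto intro: order_trans)

lemma size_comparable:
  assumes z: "z \<in> mesh_verts \<T>" and T: "T1 \<in> star z" "T2 \<in> star z"
  shows "diameter T1 \<le> mesh_M \<kappa> DIM('a) * diameter T2"
proof (cases "DIM('a) = 1")
  case True
  have k: "\<kappa> \<ge> 1" using kappa_ge_1 vertex_elements_sub[OF T(1)] by blast
  have "mesh_M \<kappa> DIM('a) \<ge> 1" unfolding mesh_M_def using k by (rule one_le_power)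
  then show ?thesis using size_dim_1[OF True z T] diam_pos[OF vertex_elements_sub(1)[OF T(2)]] by simp
next
  case False
  then have n: "DIM('a) \<ge> 2" using DIM_positive[where 'a='a] by linarith
  have k: "\<kappa> \<ge> 1" using kappa_ge_1 vertex_elements_sub[OF T(1)] by blast
  have step: "diameter T1 \<le> \<kappa> ^ j * diameter T'" if "(T1, T') \<in> adj z ^^ j" for j T'
    using that
  proof (induction j arbitrary: T')
    case (Suc j)
    then obtain T'' where T'': "(T1, T'') \<in> adj z ^^ j" "(T'', T') \<in> adj z" by auto
    have "diameter T1 \<le> \<kappa> ^ j * diameter T''" by (rule Suc.IH[OF T''(1)])
    also have "diameter T'' \<le> \<kappa> * diameter T'"
      using T''(2) vertex_elements_sub by (intro adj_size[OF n]) (auto simp: adj_def)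
    finally show ?case using k by (simp add: mult_left_mono mult_ac)
  qed simp
  obtain j where j: "j \<le> mesh_K \<kappa> DIM('a)" "(T1, T2) \<in> adj z ^^ j" using adj_chain[OF z T] by blast
  have "diameter T1 \<le> \<kappa> ^ j * diameter T2" by (rule step[OF j(2)])
  also have "\<dots> \<le> mesh_M \<kappa> DIM('a) * diameter T2"
    unfolding mesh_M_def using k j(1) diam_pos[OF vertex_elements_sub(1)[OF T(2)]] by (intro mult_right_mono power_increasing) auto
  finally show ?thesis .
qed

subsection \<open>Balls across facets\<close>

text \<open>The radius is so small that in a ball about the facet centre all coordinates are
  positive except possibly those of the two opposite vertices. A point of the ball outside both
  elements would have both of these negative; its reflection in the centre would then be interior to
  both elements, which is impossible.\<close>

lemma facet_ball:
  assumes T: "T1 \<in> \<T>" "T2 \<in> \<T>" "aff_dim (T1 \<inter> T2) = int DIM('a) - 1" and r: "r > 0"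
    and g: "\<And>w. w \<in> verts T1 \<Longrightarrow> r * norm (ga T1 w) \<le> 1 / real DIM('a)" "\<And>w. w \<in> verts T2 \<Longrightarrow> r * norm (ga T2 w) \<le> 1 / real DIM('a)"
  shows "\<exists>b q1 q2. ball b r \<subseteq> T1 \<union> T2 \<and> ball q1 (r/2) \<subseteq> ball b r \<inter> interior T1 \<and> ball q2 (r/2) \<subseteq> ball b r \<inter> interior T2"
proof -
  obtain v1 v2 where v: "v1 \<in> verts T1" "v2 \<in> verts T2" "verts T1 - {v1} = verts T2 - {v2}" and ne: "T1 \<noteq> T2"
    using adj_facets[OF T] by blast
  interpret A: bary_simplex "verts T1" "ga T1" "gc T1" by (rule bary[OF T(1)])
  interpret B: bary_simplex "verts T2" "ga T2" "gc T2" by (rule bary[OF T(2)])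
  note [simp] = T_eq[OF T(1)] T_eq[OF T(2)]
  define b where "b = A.facet_center v1"
  have b2: "b = B.facet_center v2" unfolding b_def A.facet_center_def B.facet_center_def v(3) ..
  have A0: "A.lam v1 b = 0" and B0: "B.lam v2 b = 0"
    using A.lam_facet_center(1)[OF v(1)] B.lam_facet_center(1)[OF v(2)] b_def b2 by auto
  have Apos: "A.lam w x > 0" if "w \<in> verts T1" "w \<noteq> v1" "x \<in> ball b r" for w x
    using A.lam_near_facet_center[OF v(1) that(1,2) _ g(1)[OF that(1)], of x] that(3) by (simp add: b_def dist_norm norm_minus_commute)
  have Bpos: "B.lam w x > 0" if "w \<in> verts T2" "w \<noteq> v2" "x \<in> ball b r" for w x
    using B.lam_near_facet_center[OF v(2) that(1,2) _ g(2)[OF that(1)], of x] that(3) by (simp add: b2 dist_norm norm_minus_commute)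
  have "ball b r \<subseteq> T1 \<union> T2"
  proof
    fix x assume x: "x \<in> ball b r"
    show "x \<in> T1 \<union> T2"
    proof (rule ccontr)
      assume no: "x \<notin> T1 \<union> T2"
      have "A.lam v1 x < 0"
      proof (rule ccontr)
        assume "\<not> A.lam v1 x < 0"
        then have "\<forall>w\<in>verts T1. 0 \<le> A.lam w x" using Apos[OF _ _ x] by (metis less_imp_le not_less)
        then have "x \<in> A.T" unfolding A.T_eq by blast
        then show False using no by simp
      qed
      moreover have "B.lam v2 x < 0"
      proof (rule ccontr)
        assume "\<not> B.lam v2 x < 0"
        then have "\<forall>w\<in>verts T2. 0 \<le> B.lam w x" using Bpos[OF _ _ x] by (metis less_imp_le not_less)
        then have "x \<in> B.T" unfolding B.T_eq by blast
        then show False using no by simp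
      qed
      moreover define x' where "x' = b + (b - x)"
      have x': "x' \<in> ball b r" using x by (simp add: x'_def dist_norm norm_minus_commute)
      have "A.lam v1 x' = - A.lam v1 x" using A0 by (simp add: x'_def A.lam_def inner_add_right inner_diff_right)
      moreover have "B.lam v2 x' = - B.lam v2 x" using B0 by (simp add: x'_def B.lam_def inner_add_right inner_diff_right)
      ultimately have "\<forall>w\<in>verts T1. 0 < A.lam w x'" "\<forall>w\<in>verts T2. 0 < B.lam w x'"
        using Apos[OF _ _ x'] Bpos[OF _ _ x'] by (metis neg_0_less_iff_less)+
      then have "x' \<in> interior A.T" "x' \<in> interior B.T" unfolding A.interior_T B.interior_T by auto
      then show False using interior_disjoint_elem[OF T(1,2) ne] interior_subset[of T2] by auto
    qed
  qed
  moreover have "ball (b + (r/2) *\<^sub>R A.normal v1) (r/2) \<subseteq> ball b r \<inter> interior T1"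
    using A.inward_half_ball[OF v(1) A0 r Apos] by simp
  moreover have "ball (b + (r/2) *\<^sub>R B.normal v2) (r/2) \<subseteq> ball b r \<inter> interior T2"
    using B.inward_half_ball[OF v(2) B0 r Bpos] by simp
  ultimately show ?thesis by blast
qed

end

text \<open>On the common part \<open>B\<close> the difference of the two constants is the
  difference of the two errors.\<close>

lemma l2_constant_compare:
  fixes u :: "'a::euclidean_space \<Rightarrow> real"
  assumes B: "B \<subseteq> K1" "B \<subseteq> K2" "B \<in> sets lebesgue" and K: "K1 \<in> sets lebesgue" "K2 \<in> sets lebesgue" "bounded K1" "bounded K2"
    and u: "inL2 K1 u" "inL2 K2 u"
  shows "\<bar>c1 - c2\<bar> * sqrt (vol B) \<le> L2 K1 (\<lambda>x. u x - c1) + L2 K2 (\<lambda>x. u x - c2)"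
proof -
  have s1: "inL2 K1 (\<lambda>x. u x - c1)"
    by (intro square_integrable_diff u square_integrable_const finite_measure_bounded_lebesgue_on K)
  have s2: "inL2 K2 (\<lambda>x. u x - c2)"
    by (intro square_integrable_diff u square_integrable_const finite_measure_bounded_lebesgue_on K)
  have b1: "inL2 B (\<lambda>x. u x - c1)" by (rule square_integrable_subset[OF s1 B(1) K(1) B(3)])
  have b2: "inL2 B (\<lambda>x. u x - c2)" by (rule square_integrable_subset[OF s2 B(2) K(2) B(3)])
  have "\<bar>c1 - c2\<bar> * sqrt (vol B) = L2 B (\<lambda>x. (u x - c2) - (u x - c1))"
    using B(3) by (simp add: l2_norm_const measure_restrict_space)
  also have "\<dots> \<le> L2 B (\<lambda>x. u x - c2) + L2 B (\<lambda>x. u x - c1)"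
    by (rule l2_norm_triangle_diff[OF b2 b1])
  also have "\<dots> \<le> L2 K2 (\<lambda>x. u x - c2) + L2 K1 (\<lambda>x. u x - c1)"
    by (intro add_mono l2_norm_subset[OF s2 B(2) K(2) B(3)] l2_norm_subset[OF s1 B(1) K(1) B(3)])
  finally show ?thesis by simp
qed

lemma grad_norm_subset:
  assumes "\<And>b. b \<in> Basis \<Longrightarrow> inL2 S (g b)" "T \<subseteq> S" "S \<in> sets lebesgue" "T \<in> sets lebesgue"
  shows "grad_norm T g \<le> grad_norm S g"
  unfolding grad_norm_def using assms by (intro real_sqrt_le_mono sum_mono power_mono l2_norm_subset) auto

text \<open>Three factors: the number of elements of the patch, the convex Poincare constant for
  sets of diameter at most \<open>2 * mesh_M\<close> times that of \<open>T\<close>, and the cost of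
  replacing the mean of an element by that of \<open>T\<close>. In the last one each of at most
  \<open>mesh_K\<close> links costs 4, and the root compares an element with a ball across a
  facet.\<close>

definition patch_const :: "real \<Rightarrow> nat \<Rightarrow> real" where
  "patch_const \<kappa> n = real ((n + 1) * mesh_N \<kappa> n) * (sqrt (2 ^ n) * (2 * mesh_M \<kappa> n)) *
     (1 + 4 * real (mesh_K \<kappa> n) * sqrt ((2 * \<kappa> * (mesh_M \<kappa> n)\<^sup>2 * real n) ^ n))"

context mesh
begin

subsection \<open>Element patches\<close>

definition patch_elems :: "'a set \<Rightarrow> 'a set set" where
  "patch_elems T = (\<Union>z\<in>verts T. star z)"

lemma open_element_patch: "open (patch T)"
  unfolding element_patch_def by (intro open_UN ballI open_vertex_patch)

lemma patch_elems_mesh: "T' \<in> patch_elems T \<Longrightarrow> T' \<in> \<T>"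
  by (auto simp: patch_elems_def vertex_elements_def)

lemma patch_elems_interior: "T' \<in> patch_elems T \<Longrightarrow> interior T' \<subseteq> patch T"
  unfolding patch_elems_def element_patch_def using interior_sub_patch by blast

lemma finite_patch_elems: "finite (patch_elems T)"
  using finite_mesh patch_elems_mesh by (meson finite_subset subsetI)

lemma card_patch_elems:
  assumes T: "T \<in> \<T>"
  shows "card (patch_elems T) \<le> (DIM('a) + 1) * mesh_N \<kappa> DIM('a)"
proof -
  have "card (patch_elems T) \<le> (\<Sum>z\<in>verts T. card (star z))"
    unfolding patch_elems_def by (rule card_UN_le) (rule elem_facts(8)[OF T])
  also have "\<dots> \<le> (\<Sum>z\<in>verts T. mesh_N \<kappa> DIM('a))"
    by (intro sum_mono card_vertex_elements verts_mesh[OF T])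
  also have "\<dots> = (DIM('a) + 1) * mesh_N \<kappa> DIM('a)" using simplex_verts(2)[OF simplex_mesh[OF T]] by simp
  finally show ?thesis .
qed

lemma self_patch_elem: "T \<in> \<T> \<Longrightarrow> T \<in> patch_elems T"
  unfolding patch_elems_def using elem_facts(9) vertex_elements_verts by blast

lemma patch_elem_size:
  assumes T: "T \<in> \<T>" and T': "T' \<in> patch_elems T"
  shows "diameter T' \<le> mesh_M \<kappa> DIM('a) * diameter T" "diameter T \<le> mesh_M \<kappa> DIM('a) * diameter T'"
proof -
  obtain z where z: "z \<in> verts T" "T' \<in> star z" using T' by (auto simp: patch_elems_def)
  have "T \<in> star z" by (rule vertex_elements_verts[OF z(1) T])
  then show "diameter T' \<le> mesh_M \<kappa> DIM('a) * diameter T" "diameter T \<le> mesh_M \<kappa> DIM('a) * diameter T'"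
    using size_comparable[OF verts_mesh[OF T z(1)]] z(2) by auto
qed

lemma element_patch_sub: "patch T \<subseteq> \<Union>(patch_elems T)"
  unfolding element_patch_def patch_elems_def using patch_sub by blast

lemma bounded_element_patch: "bounded (patch T)"
  using bounded_Union[OF finite_patch_elems] elem_facts(3) patch_elems_mesh element_patch_sub bounded_subset by metis

lemma element_patch_lebesgue [simp]: "patch T \<in> sets lebesgue"
  using open_element_patch by simp

lemma element_patch_cover: "negligible (patch T - (\<Union>T'\<in>patch_elems T. interior T'))"
proof (rule negligible_subset)
  show "negligible (\<Union>T'\<in>patch_elems T. T' - interior T')"
    using finite_patch_elems elem_facts(5) patch_elems_mesh by (intro negligible_Union) auto
  show "patch T - (\<Union>T'\<in>patch_elems T. interior T') \<subseteq> (\<Union>T'\<in>patch_elems T. T' - interior T')"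
    using element_patch_sub by blast
qed

lemma element_patch_nonempty: "T \<in> \<T> \<Longrightarrow> patch T \<noteq> {}"
  using patch_elems_interior[OF self_patch_elem] elem_facts(4) by blast

lemma mesh_M_ge_1: "T \<in> \<T> \<Longrightarrow> mesh_M \<kappa> DIM('a) \<ge> 1"
  unfolding mesh_M_def by (rule one_le_power[OF kappa_ge_1])

text \<open>Each point reaches a vertex of \<open>T\<close> within one element, and the two vertices
  are joined within \<open>T\<close>: three diameters, each at most \<open>mesh_M\<close> times that
  of \<open>T\<close>.\<close>

lemma element_patch_dist:
  assumes T: "T \<in> \<T>" and xy: "x \<in> patch T" "y \<in> patch T"
  shows "dist x y \<le> 3 * mesh_M \<kappa> DIM('a) * diameter T"
proof -
  let ?M = "mesh_M \<kappa> DIM('a)"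
  have "\<exists>z\<in>verts T. dist x z \<le> ?M * diameter T" if x: "x \<in> patch T" for x
  proof -
    obtain T' where T': "T' \<in> patch_elems T" "x \<in> T'" using element_patch_sub x by blast
    obtain z where z: "z \<in> verts T" "T' \<in> star z" using T'(1) by (auto simp: patch_elems_def)
    have "dist x z \<le> diameter T'"
      using diameter_bounded_bound[OF elem_facts(3)[OF patch_elems_mesh[OF T'(1)]] T'(2) vertex_elements_sub(2)[OF z(2)]] .
    then show ?thesis using patch_elem_size(1)[OF T T'(1)] z(1) by force
  qed
  then obtain z1 z2 where z: "z1 \<in> verts T" "dist x z1 \<le> ?M * diameter T" "z2 \<in> verts T" "dist y z2 \<le> ?M * diameter T" using xy by blast
  have "dist z1 z2 \<le> diameter T" using diameter_bounded_bound[OF elem_facts(3)[OF T]] z verts_sub by blast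
  also have "\<dots> \<le> ?M * diameter T" using mesh_M_ge_1[OF T] diam_pos[OF T] by simp
  finally have "dist z1 z2 \<le> ?M * diameter T" .
  then show ?thesis using z dist_triangle[of x y z1] dist_triangle[of z1 y z2] by (simp add: dist_commute)
qed

lemma elem_measure_le: "T \<in> \<T> \<Longrightarrow> vol T \<le> unit_ball_vol (real DIM('a)) * diameter T ^ DIM('a)"
proof -
  assume T: "T \<in> \<T>"
  obtain z where z: "z \<in> verts T" using elem_facts(9)[OF T] by auto
  have "T \<subseteq> cball z (diameter T)" using diameter_bounded_bound[OF elem_facts(3)[OF T] verts_sub[OF z]] by auto
  then have "vol T \<le> vol (cball z (diameter T))"
    using elem_facts(7)[OF T] by (intro measure_mono_fmeasurable) auto
  then show ?thesis using diam_pos[OF T] by (simp add: content_cball)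
qed

lemma elem_measure_ge: "T \<in> \<T> \<Longrightarrow> unit_ball_vol (real DIM('a)) * (diameter T / (2 * \<kappa>)) ^ DIM('a) \<le> vol (interior T)"
proof -
  assume T: "T \<in> \<T>"
  obtain x where "cball x (diameter T / (2 * \<kappa>)) \<subseteq> T" using inscribed(2)[OF T] by blast
  then have "ball x (diameter T / (2 * \<kappa>)) \<subseteq> interior T" using ball_subset_cball by (intro interior_maximal) auto
  then have "vol (ball x (diameter T / (2 * \<kappa>))) \<le> vol (interior T)"
    using lmeasurable_open[OF elem_facts(10)[OF T]] by (intro measure_mono_fmeasurable) auto
  then show ?thesis using diam_pos[OF T] inscribed(1)[OF T] by (simp add: content_ball)
qed

lemma l2_norm_patch_le:
  assumes f: "inL2 (patch T) f"
  shows "L2 (patch T) f \<le> (\<Sum>T'\<in>patch_elems T. L2 (interior T') f)"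
proof -
  let ?D = "patch T"
  have sq: "inL2 (interior T') f" if "T' \<in> patch_elems T" for T'
    by (rule square_integrable_subset[OF f patch_elems_interior[OF that]]) auto
  have fm: "(\<lambda>x. indicator (interior T') x * ennreal ((f x)\<^sup>2)) \<in> borel_measurable lebesgue" if "T' \<in> patch_elems T" for T'
  proof -
    have "f \<in> borel_measurable (lebesgue_on (interior T'))" using sq[OF that] by (simp add: square_integrable_def)
    then have "(\<lambda>x. if x \<in> interior T' then f x else 0) \<in> borel_measurable lebesgue" by (simp add: borel_measurable_if)
    then have "(\<lambda>x. ennreal ((if x \<in> interior T' then f x else 0)\<^sup>2)) \<in> borel_measurable lebesgue" by measurable
    moreover have "(\<lambda>x. ennreal ((if x \<in> interior T' then f x else 0)\<^sup>2)) = (\<lambda>x. indicator (interior T') x * ennreal ((f x)\<^sup>2))"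
      by (auto simp: fun_eq_iff indicator_def)
    ultimately show ?thesis by simp
  qed
  have "ennreal ((L2 ?D f)\<^sup>2) = (\<integral>\<^sup>+x. indicator ?D x * ennreal ((f x)\<^sup>2) \<partial>lebesgue)"
    using l2_norm_nn_integral[OF f] by (simp add: nn_integral_completion)
  also have "\<dots> \<le> (\<integral>\<^sup>+x. (\<Sum>T'\<in>patch_elems T. indicator (interior T') x * ennreal ((f x)\<^sup>2)) \<partial>lebesgue)"
  proof (rule nn_integral_mono_AE)
    have "AE x in lebesgue. x \<notin> ?D - (\<Union>T'\<in>patch_elems T. interior T')"
      using element_patch_cover by (simp only: negligible_iff_null_sets AE_not_in)
    then show "AE x in lebesgue. indicator ?D x * ennreal ((f x)\<^sup>2) \<le> (\<Sum>T'\<in>patch_elems T. indicator (interior T') x * ennreal ((f x)\<^sup>2))"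
    proof eventually_elim
      case (elim x)
      show ?case
      proof (cases "x \<in> ?D")
        case True
        then obtain T' where T': "T' \<in> patch_elems T" "x \<in> interior T'" using elim by blast
        have "indicator ?D x * ennreal ((f x)\<^sup>2) = indicator (interior T') x * ennreal ((f x)\<^sup>2)" using True T' by simp
        also have "\<dots> \<le> (\<Sum>T'\<in>patch_elems T. indicator (interior T') x * ennreal ((f x)\<^sup>2))"
          by (rule member_le_sum[OF T'(1)]) (use finite_patch_elems in auto)
        finally show ?thesis .
      qed simp
    qed
  qed
  also have "\<dots> = (\<Sum>T'\<in>patch_elems T. \<integral>\<^sup>+x. indicator (interior T') x * ennreal ((f x)\<^sup>2) \<partial>lebesgue)"
    by (rule nn_integral_sum) (rule fm)
  also have "\<dots> = (\<Sum>T'\<in>patch_elems T. ennreal ((L2 (interior T') f)\<^sup>2))"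
    by (rule sum.cong[OF refl]) (simp add: l2_norm_nn_integral[OF sq] nn_integral_completion)
  also have "\<dots> = ennreal (\<Sum>T'\<in>patch_elems T. (L2 (interior T') f)\<^sup>2)" by (simp add: sum_ennreal)
  finally have "(L2 ?D f)\<^sup>2 \<le> (\<Sum>T'\<in>patch_elems T. (L2 (interior T') f)\<^sup>2)"
    by (subst (asm) ennreal_le_iff) (auto intro: sum_nonneg)
  then have "sqrt ((L2 ?D f)\<^sup>2) \<le> sqrt (\<Sum>T'\<in>patch_elems T. (L2 (interior T') f)\<^sup>2)"
    by (rule real_sqrt_le_mono)
  then have "L2 ?D f \<le> L2_set (\<lambda>T'. L2 (interior T') f) (patch_elems T)"
    by (simp add: L2_set_def)
  also have "\<dots> \<le> (\<Sum>T'\<in>patch_elems T. L2 (interior T') f)" by (rule L2_set_le_sum) simp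
  finally show ?thesis .
qed

theorem patch_Poincare:
  assumes T: "T \<in> \<T>" and u: "inL2 (patch T) u"
    and g: "\<And>b. b \<in> Basis \<Longrightarrow> has_weak_partial (patch T) b u (g b)"
      "\<And>b. b \<in> Basis \<Longrightarrow> inL2 (patch T) (g b)"
  shows "\<exists>c. L2 (patch T) (\<lambda>x. u x - c) \<le> patch_const \<kappa> DIM('a) * diameter T * grad_norm (patch T) g"
proof -
  let ?D = "patch T" and ?M = "mesh_M \<kappa> DIM('a)" and ?h = "diameter T" and ?n = "real DIM('a)"
    and ?G = "grad_norm (patch T) g" and ?\<omega> = "unit_ball_vol (real DIM('a))"
  define E where "E = sqrt (2 ^ DIM('a)) * (2 * ?M * ?h) * ?G"
  \<comment> \<open>Gradients on an element of the patch are at most \<kappa> M / h, so this radius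
    satisfies the condition of \<open>facet_ball\<close> for all of them simultaneously;
    \<open>\<beta>\<close> is the volume of a ball of radius \<open>r / 2\<close>.\<close>
  define r where "r = ?h / (\<kappa> * ?M * ?n)"
  define \<beta> where "\<beta> = ?\<omega> * (r / 2) ^ DIM('a)"
  have M: "?M \<ge> 1" by (rule mesh_M_ge_1[OF T])
  have k: "\<kappa> \<ge> 1" by (rule kappa_ge_1[OF T])
  have h: "?h > 0" by (rule diam_pos[OF T])
  have n: "?n \<ge> 1" using DIM_positive[where 'a='a] by linarith
  have G: "?G \<ge> 0" by (rule grad_norm_nonneg)
  have E: "E \<ge> 0" unfolding E_def using M h G by (intro mult_nonneg_nonneg) auto
  have r: "r > 0" unfolding r_def using h k M n by (intro divide_pos_pos mult_pos_pos) auto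
  have \<beta>: "\<beta> > 0" unfolding \<beta>_def using r by (intro mult_pos_pos zero_less_power) auto
  have r_le: "r \<le> ?h"
  proof -
    have "1 \<le> \<kappa> * ?M * ?n" using k M n by (intro mult_ge1_I) auto
    then show ?thesis unfolding r_def using h by (simp add: divide_le_eq mult_le_cancel_left1)
  qed
  have loc: "L2 K (\<lambda>x. u x - avg K u) \<le> E"
    if K: "open K" "convex K" "bounded K" "K \<noteq> {}" "K \<subseteq> ?D" "diameter K \<le> 2 * ?M * ?h" for K
  proof -
    have Kl: "K \<in> sets lebesgue" using K by simp
    have "L2 K (\<lambda>x. u x - avg K u) \<le> sqrt (2 ^ DIM('a)) * diameter K * grad_norm K g"
    proof (rule Poincare_convex[OF K(1-4)])
      show "inL2 K u" by (rule square_integrable_subset[OF u K(5) _ Kl]) simp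
      show "has_weak_partial K b u (g b)" if "b \<in> Basis" for b
        by (rule has_weak_partial_subset[OF g(1)[OF that] open_element_patch K(1,5)])
      show "inL2 K (g b)" if "b \<in> Basis" for b
        by (rule square_integrable_subset[OF g(2)[OF that] K(5) _ Kl]) simp
    qed
    also have "\<dots> \<le> E" unfolding E_def
    proof (intro mult_mono K(6))
      show "grad_norm K g \<le> ?G" by (rule grad_norm_subset[OF g(2) K(5) _ Kl]) simp_all
    qed (use M h G K(3) in \<open>auto intro!: diameter_ge_0 grad_norm_nonneg mult_nonneg_nonneg\<close>)
    finally show ?thesis .
  qed
  let ?a = "\<lambda>T'. avg (interior T') u"
  have elem: "L2 (interior T') (\<lambda>x. u x - ?a T') \<le> E" if T': "T' \<in> patch_elems T" for T'
  proof (rule loc)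
    have "diameter (interior T') \<le> diameter T'"
      using diameter_subset[OF interior_subset elem_facts(3)[OF patch_elems_mesh[OF T']]] .
    also have "\<dots> \<le> ?M * ?h" by (rule patch_elem_size(1)[OF T T'])
    also have "\<dots> \<le> 2 * ?M * ?h" using M h by simp
    finally show "diameter (interior T') \<le> 2 * ?M * ?h" .
  qed (use elem_facts[OF patch_elems_mesh[OF T']] patch_elems_interior[OF T'] in auto)
  have usub: "inL2 K u" if "open K" "K \<subseteq> ?D" for K
    by (rule square_integrable_subset[OF u that(2)]) (use that in auto)
  have radius: "r * norm (ga T' w) \<le> 1 / ?n" if T': "T' \<in> patch_elems T" and w: "w \<in> verts T'" for T' w
  proof -
    have T'm: "T' \<in> \<T>" by (rule patch_elems_mesh[OF T'])
    have "?h * norm (ga T' w) \<le> ?M * diameter T' * norm (ga T' w)"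
      by (intro mult_right_mono patch_elem_size(2)[OF T T']) simp
    also have "\<dots> \<le> ?M * \<kappa>" using mult_left_mono[OF grad_bound[OF T'm w], of ?M] M by (simp add: mult.assoc)
    finally have "?h * norm (ga T' w) / (\<kappa> * ?M * ?n) \<le> ?M * \<kappa> / (\<kappa> * ?M * ?n)"
      using k M n by (intro divide_right_mono) auto
    also have "\<dots> = 1 / ?n" using k M by simp
    finally show ?thesis by (simp add: r_def)
  qed
  have adjacent: "\<bar>?a T1 - ?a T2\<bar> * sqrt \<beta> \<le> 4 * E" if z: "z \<in> verts T" and a: "(T1, T2) \<in> adj z" for z T1 T2
  proof -
    have VE: "T1 \<in> star z" "T2 \<in> star z" and ad: "aff_dim (T1 \<inter> T2) = int DIM('a) - 1" using a by (auto simp: adj_def)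
    have P: "T1 \<in> patch_elems T" "T2 \<in> patch_elems T" using VE z by (auto simp: patch_elems_def)
    obtain b q1 q2 where b: "ball b r \<subseteq> T1 \<union> T2" "ball q1 (r/2) \<subseteq> ball b r \<inter> interior T1" "ball q2 (r/2) \<subseteq> ball b r \<inter> interior T2"
      using facet_ball[OF patch_elems_mesh[OF P(1)] patch_elems_mesh[OF P(2)] ad r radius[OF P(1)] radius[OF P(2)]] by blast
    \<comment> \<open>Being open and covered by two elements at \<open>z\<close>, the ball belongs
      to the vertex patch, so the convex Poincare inequality may be applied on it.\<close>
    have "ball b r \<subseteq> interior (\<Union>(star z))" using b(1) VE by (intro interior_maximal) auto
    then have bD: "ball b r \<subseteq> ?D" using z unfolding element_patch_def vertex_patch_def by blast
    have Bl: "L2 (ball b r) (\<lambda>x. u x - avg (ball b r) u) \<le> E"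
    proof (rule loc)
      have "1 * ?h \<le> ?M * ?h" using M h by (intro mult_right_mono) auto
      then have "r \<le> ?M * ?h" using r_le by linarith
      then show "diameter (ball b r) \<le> 2 * ?M * ?h" using r by simp
    qed (use bD r in auto)
    have m: "vol (ball q (r/2)) = \<beta>" for q :: 'a using r by (simp add: content_ball \<beta>_def)
    \<comment> \<open>An element and the ball across its facet share a ball of volume
      \<open>\<beta>\<close>. Each of the two comparisons costs \<open>2 * E\<close>, the whole link
      \<open>4 * E\<close>.\<close>
    have c1: "\<bar>?a T1 - avg (ball b r) u\<bar> * sqrt \<beta> \<le> E + E"
    proof -
      have "\<bar>?a T1 - avg (ball b r) u\<bar> * sqrt (vol (ball q1 (r/2))) \<le> L2 (interior T1) (\<lambda>x. u x - ?a T1) + L2 (ball b r) (\<lambda>x. u x - avg (ball b r) u)"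
        by (rule l2_constant_compare) (use b bD P usub patch_elems_interior elem_facts(10)[OF patch_elems_mesh] in auto)
      then show ?thesis using elem[OF P(1)] Bl by (simp add: m)
    qed
    have c2: "\<bar>?a T2 - avg (ball b r) u\<bar> * sqrt \<beta> \<le> E + E"
    proof -
      have "\<bar>?a T2 - avg (ball b r) u\<bar> * sqrt (vol (ball q2 (r/2))) \<le> L2 (interior T2) (\<lambda>x. u x - ?a T2) + L2 (ball b r) (\<lambda>x. u x - avg (ball b r) u)"
        by (rule l2_constant_compare) (use b bD P usub patch_elems_interior elem_facts(10)[OF patch_elems_mesh] in auto)
      then show ?thesis using elem[OF P(2)] Bl by (simp add: m)
    qed
    have "\<bar>?a T1 - ?a T2\<bar> * sqrt \<beta> \<le> (\<bar>?a T1 - avg (ball b r) u\<bar> + \<bar>?a T2 - avg (ball b r) u\<bar>) * sqrt \<beta>"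
      using \<beta> by (intro mult_right_mono) auto
    also have "\<dots> \<le> 4 * E" using c1 c2 by (simp add: distrib_right)
    finally show ?thesis .
  qed
  have chain: "\<bar>?a T1 - ?a T2\<bar> * sqrt \<beta> \<le> real j * (4 * E)" if z: "z \<in> verts T" and j: "(T1, T2) \<in> adj z ^^ j" for z j T1 T2
    using j
  proof (induction j arbitrary: T2)
    case (Suc j)
    then obtain T3 where T3: "(T1, T3) \<in> adj z ^^ j" "(T3, T2) \<in> adj z" by auto
    have "\<bar>?a T1 - ?a T2\<bar> * sqrt \<beta> \<le> (\<bar>?a T1 - ?a T3\<bar> + \<bar>?a T3 - ?a T2\<bar>) * sqrt \<beta>"
      using \<beta> by (intro mult_right_mono) auto
    also have "\<dots> \<le> real j * (4 * E) + 4 * E" using Suc.IH[OF T3(1)] adjacent[OF z T3(2)] by (simp add: distrib_right)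
    finally show ?case by (simp add: algebra_simps)
  qed simp
  define R where "R = sqrt ((2 * \<kappa> * ?M\<^sup>2 * ?n) ^ DIM('a))"
  have R: "R \<ge> 0" using k by (simp add: R_def)
  define Kc where "Kc = real (mesh_K \<kappa> DIM('a))"
  have each: "L2 (interior T') (\<lambda>x. u x - ?a T) \<le> E * (1 + 4 * Kc * R)" if T': "T' \<in> patch_elems T" for T'
  proof -
    have T'm: "T' \<in> \<T>" by (rule patch_elems_mesh[OF T'])
    note F = elem_facts[OF T'm]
    obtain z where z: "z \<in> verts T" "T' \<in> star z" using T' by (auto simp: patch_elems_def)
    obtain j where j: "j \<le> mesh_K \<kappa> DIM('a)" "(T, T') \<in> adj z ^^ j"
      using adj_chain[OF verts_mesh[OF T z(1)] vertex_elements_verts[OF z(1) T] z(2)] by blast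
    have "\<bar>?a T - ?a T'\<bar> * sqrt \<beta> \<le> real j * (4 * E)" by (rule chain[OF z(1) j(2)])
    also have "\<dots> \<le> Kc * (4 * E)" using j(1) E by (intro mult_right_mono) (auto simp: Kc_def)
    finally have d: "\<bar>?a T - ?a T'\<bar> * sqrt \<beta> \<le> 4 * Kc * E" by simp
    \<comment> \<open>The constant \<open>R\<close> is chosen for this: M h equals
      \<open>2 * \<kappa> * M^2 * n\<close> times \<open>r / 2\<close>, so the n-th power of that
      factor compares the volumes.\<close>
    have meas: "vol (interior T') \<le> R\<^sup>2 * \<beta>"
    proof -
      have "vol (interior T') \<le> vol T'"
        using elem_lmeasurable[OF T'm] interior_subset by (intro measure_mono_fmeasurable) auto
      also have "\<dots> \<le> ?\<omega> * diameter T' ^ DIM('a)" by (rule elem_measure_le[OF T'm])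
      also have "\<dots> \<le> ?\<omega> * (?M * ?h) ^ DIM('a)"
        using patch_elem_size(1)[OF T T'] diam_pos[OF T'm] by (intro mult_left_mono power_mono) auto
      also have "?M * ?h = (2 * \<kappa> * ?M\<^sup>2 * ?n) * (r / 2)" using k M n by (simp add: r_def power2_eq_square)
      also have "?\<omega> * ((2 * \<kappa> * ?M\<^sup>2 * ?n) * (r / 2)) ^ DIM('a) = R\<^sup>2 * \<beta>"
      proof -
        have "R\<^sup>2 = (2 * \<kappa> * ?M\<^sup>2 * ?n) ^ DIM('a)" using k by (simp add: R_def)
        then show ?thesis by (simp only: \<beta>_def power_mult_distrib mult_ac)
      qed
      finally show ?thesis .
    qed
    have fin: "finite_measure (lebesgue_on (interior T'))" by (rule finite_measure_bounded_lebesgue_on[OF F(10,12)])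
    have us: "inL2 (interior T') u" by (rule usub[OF open_interior patch_elems_interior[OF T']])
    have "L2 (interior T') (\<lambda>x. u x - ?a T) = L2 (interior T') (\<lambda>x. (u x - ?a T') + (?a T' - ?a T))" by simp
    also have "\<dots> \<le> L2 (interior T') (\<lambda>x. u x - ?a T') + L2 (interior T') (\<lambda>x. ?a T' - ?a T)"
      by (intro l2_norm_triangle square_integrable_diff us square_integrable_const fin)
    also have "L2 (interior T') (\<lambda>x. ?a T' - ?a T) = \<bar>?a T - ?a T'\<bar> * sqrt (vol (interior T'))"
      by (simp add: l2_norm_const measure_restrict_space abs_minus_commute)
    also have "\<dots> \<le> \<bar>?a T - ?a T'\<bar> * (R * sqrt \<beta>)"
    proof -
      have "sqrt (vol (interior T')) \<le> sqrt (R\<^sup>2 * \<beta>)" using meas by (rule real_sqrt_le_mono)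
      then show ?thesis using R by (intro mult_left_mono) (auto simp: real_sqrt_mult)
    qed
    also have "\<dots> \<le> R * (4 * Kc * E)" using mult_left_mono[OF d R] by (simp add: mult_ac)
    finally show ?thesis using elem[OF T'] by (simp add: algebra_simps)
  qed
  have "L2 ?D (\<lambda>x. u x - ?a T) \<le> (\<Sum>T'\<in>patch_elems T. L2 (interior T') (\<lambda>x. u x - ?a T))"
    by (intro l2_norm_patch_le square_integrable_diff u square_integrable_const finite_measure_bounded_lebesgue_on bounded_element_patch element_patch_lebesgue)
  also have "\<dots> \<le> (\<Sum>T'\<in>patch_elems T. E * (1 + 4 * Kc * R))" by (intro sum_mono each)
  also have "\<dots> = real (card (patch_elems T)) * (E * (1 + 4 * Kc * R))" by simp
  also have "\<dots> \<le> real ((DIM('a) + 1) * mesh_N \<kappa> DIM('a)) * (E * (1 + 4 * Kc * R))"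
  proof (rule mult_right_mono)
    show "real (card (patch_elems T)) \<le> real ((DIM('a) + 1) * mesh_N \<kappa> DIM('a))" using card_patch_elems[OF T] by (rule of_nat_mono)
    show "0 \<le> E * (1 + 4 * Kc * R)" using E R by (intro mult_nonneg_nonneg add_nonneg_nonneg) (auto simp: Kc_def)
  qed
  also have "\<dots> = patch_const \<kappa> DIM('a) * ?h * ?G" by (simp add: patch_const_def E_def Kc_def R_def mult_ac)
  finally show ?thesis by blast
qed

end

subsection \<open>Affine functions and oscillation\<close>

lemma affine_frechet_derivative: "fderiv (\<lambda>x. p \<bullet> x + q) x b = p \<bullet> b"
  for p :: "'a::euclidean_space" and q :: real
proof -
  have "((\<lambda>x. p \<bullet> x + q) has_derivative (\<lambda>h. p \<bullet> h)) (at x)" by (auto intro!: derivative_eq_intros)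
  from frechet_derivative_at[OF this] show ?thesis by (metis (no_types))
qed

lemma Ck_1_affine: "Ck 1 (\<lambda>x. p \<bullet> x + q)" for p :: "'a::euclidean_space" and q :: real
proof -
  have "(\<lambda>x. p \<bullet> x + q) differentiable (at x)" for x
    using differentiableI[of "\<lambda>x. p \<bullet> x + q" "\<lambda>h. p \<bullet> h" "at x"] by (auto intro!: derivative_eq_intros)
  then show ?thesis unfolding Ck_1_iff affine_frechet_derivative by simp
qed

lemma continuous_affine: "continuous_on S (\<lambda>x. p \<bullet> x + q)" for p :: "'a::euclidean_space" and q :: real
  by (intro continuous_intros)

lemma has_weak_partial_affine:
  fixes p :: "'a::euclidean_space" and q :: real
  assumes "open D"
  shows "has_weak_partial D b (\<lambda>x. p \<bullet> x + q) (\<lambda>x. p \<bullet> b)"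
  using Ck_1_has_weak_partial[OF Ck_1_affine assms, of b p q] unfolding affine_frechet_derivative .

lemma has_weak_partial_cong:
  assumes u: "has_weak_partial D b u g" and eq: "\<And>x. x \<in> D \<Longrightarrow> u' x = u x" and D: "D \<in> sets lebesgue"
  shows "has_weak_partial D b u' g"
proof -
  have "integrable (lebesgue_on K) u' \<longleftrightarrow> integrable (lebesgue_on K) u" if "compact K" "K \<subseteq> D" for K
    by (rule Bochner_Integration.integrable_cong[OF refl]) (use that eq in auto)
  moreover have "(LINT x|lebesgue_on D. u' x * f x) = (LINT x|lebesgue_on D. u x * f x)" for f
    by (rule Bochner_Integration.integral_cong[OF refl]) (use eq in auto)
  ultimately show ?thesis using u unfolding has_weak_partial_def locally_integrable_def by (simp cong: conj_cong imp_cong)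
qed

lemma gagliardo_measurable:
  fixes u :: "'a::euclidean_space \<Rightarrow> real"
  assumes u: "u \<in> borel_measurable (lebesgue_on D)"
  shows "gagliardo s u \<in> borel_measurable (lebesgue_on D \<Otimes>\<^sub>M lebesgue_on D)"
proof -
  note [measurable] = u
  have [measurable]: "(\<lambda>x. x) \<in> lebesgue_on D \<rightarrow>\<^sub>M (borel :: 'a measure)"
    by (rule measurable_restrict_space1) (auto simp: measurable_completion)
  have "(\<lambda>p. (u (fst p) - u (snd p))\<^sup>2 / norm (fst p - snd p) powr (real DIM('a) + 2 * s)) \<in> borel_measurable (lebesgue_on D \<Otimes>\<^sub>M lebesgue_on D)"
    by measurable
  then show ?thesis by (simp add: gagliardo_def case_prod_beta')
qed

text \<open>\<open>weak_partial\<close> is one representative, membership in \<open>H1s\<close>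
  supplies another; the seminorm has to be moved between them. In the double integral equality a.e.
  is needed in both variables at once.\<close>

lemma Hs_seminorm_cong_AE:
  fixes g :: "'a::euclidean_space \<Rightarrow> real"
  assumes D: "open D" "bounded D" and s: "0 \<le> s" "s \<le> 1" and g: "g \<in> Hs s D"
    and g': "g' \<in> borel_measurable (lebesgue_on D)" "AE x in lebesgue_on D. g x = g' x"
  shows "Hs_seminorm s D g' = Hs_seminorm s D g"
proof -
  let ?M = "lebesgue_on D"
  have sq: "square_integrable ?M g" using g by (simp add: Hs_def)
  have gm: "g \<in> borel_measurable ?M" using sq by (simp add: square_integrable_def)
  consider "s = 0" | "0 < s" "s < 1" | "s = 1" using s by linarith
  then show ?thesis
  proof cases
    case 1
    then show ?thesis using l2_norm_cong_AE[OF gm g'] by (simp add: Hs_seminorm_def)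
  next
    case 2
    interpret F: finite_measure ?M by (rule finite_measure_bounded_lebesgue_on) (use D in auto)
    interpret P: pair_sigma_finite ?M ?M by unfold_locales
    note [measurable] = gm g'(1)
    have "AE p in ?M \<Otimes>\<^sub>M ?M. g (fst p) = g' (fst p) \<and> g (snd p) = g' (snd p)"
    proof (rule P.AE_pair_measure)
      show "{p \<in> space (?M \<Otimes>\<^sub>M ?M). g (fst p) = g' (fst p) \<and> g (snd p) = g' (snd p)} \<in> sets (?M \<Otimes>\<^sub>M ?M)" by measurable
      show "AE x in ?M. AE y in ?M. g (fst (x, y)) = g' (fst (x, y)) \<and> g (snd (x, y)) = g' (snd (x, y))"
        using g'(2)
      proof eventually_elim
        case (elim x)
        show ?case using g'(2) by eventually_elim (use elim in simp)
      qed
    qed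
    then have "AE p in ?M \<Otimes>\<^sub>M ?M. gagliardo s g' p = gagliardo s g p"
      by eventually_elim (simp add: gagliardo_def case_prod_beta')
    then have "(LINT p|(?M \<Otimes>\<^sub>M ?M). gagliardo s g' p) = (LINT p|(?M \<Otimes>\<^sub>M ?M). gagliardo s g p)"
      by (intro integral_cong_AE gagliardo_measurable gm g'(1))
    then show ?thesis using 2 by (simp add: Hs_seminorm_def)
  next
    case 3
    have "\<forall>b\<in>Basis. \<exists>h. has_weak_partial D b g h" using g 3 by (auto simp: Hs_def)
    then obtain h where h: "\<And>b. b \<in> Basis \<Longrightarrow> has_weak_partial D b g (h b)" by metis
    have h': "has_weak_partial D b g' (h b)" if "b \<in> Basis" for b
    proof (rule has_weak_partial_cong_AE[OF h[OF that] D(1) g'])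
      show "h b \<in> borel_measurable ?M"
        by (rule locally_integrable_measurable[OF D(1)]) (use h[OF that] in \<open>simp add: has_weak_partial_def\<close>)
    qed simp
    show ?thesis using 3 by (simp add: Hs_seminorm_def h1_seminorm_eq[OF D(1) h] h1_seminorm_eq[OF D(1) h'])
  qed
qed

text \<open>The variance is at most the squared distance to the constant \<open>g x\<close>, for
  every x in \<open>D\<close>. On \<open>D\<close> the distance of two points is at most
  \<open>d\<close>, so the squared difference is at most the Gagliardo integrand times
  \<open>d powr (n + 2 s)\<close>; integration over x gives the factor \<open>vol D\<close>.\<close>

lemma gagliardo_average:
  fixes g :: "'a::euclidean_space \<Rightarrow> real"
  assumes D: "open D" "bounded D" "D \<noteq> {}" and s: "0 < s" "s < 1" and g: "g \<in> Hs s D"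
    and d: "\<And>x y. x \<in> D \<Longrightarrow> y \<in> D \<Longrightarrow> dist x y \<le> d"
  shows "vol D * (L2 D (\<lambda>x. g x - avg D g))\<^sup>2 \<le> d powr (real DIM('a) + 2 * s) * (Hs_seminorm s D g)\<^sup>2"
proof -
  let ?M = "lebesgue_on D" and ?\<alpha> = "real DIM('a) + 2 * s"
  have Dl: "D \<in> sets lebesgue" using D by simp
  interpret F: finite_measure ?M by (rule finite_measure_bounded_lebesgue_on[OF D(2) Dl])
  have sq: "square_integrable ?M g" and gi: "integrable (?M \<Otimes>\<^sub>M ?M) (gagliardo s g)" using g s by (auto simp: Hs_def)
  have gag0: "gagliardo s g p \<ge> 0" for p by (simp add: gagliardo_def case_prod_beta')
  define L where "L = (l2_norm ?M (\<lambda>x. g x - avg D g))\<^sup>2"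
  have pt: "(g y - g x)\<^sup>2 \<le> d powr ?\<alpha> * gagliardo s g (x, y)" if "x \<in> D" "y \<in> D" for x y
  \<comment> \<open>On the diagonal the kernel is zero through division by zero, and so is the
    difference.\<close>
  proof (cases "x = y")
    case False
    have "norm (x - y) powr ?\<alpha> \<le> d powr ?\<alpha>" using d[OF that] s by (intro powr_mono2) (auto simp: dist_norm)
    then have "(g x - g y)\<^sup>2 * (norm (x - y) powr ?\<alpha>) \<le> (g x - g y)\<^sup>2 * d powr ?\<alpha>" by (rule mult_left_mono) simp
    then show ?thesis using False by (simp add: gagliardo_def le_divide_eq power2_commute[of "g y"] mult_ac)
  qed (simp add: gagliardo_def)
  have row: "ennreal L \<le> (\<integral>\<^sup>+y. ennreal (d powr ?\<alpha> * gagliardo s g (x, y)) \<partial>?M)" if x: "x \<in> D" for x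
  proof -
    have sqx: "square_integrable ?M (\<lambda>y. g y - g x)" by (intro square_integrable_diff sq square_integrable_const F.finite_measure_axioms)
    have "L \<le> (l2_norm ?M (\<lambda>y. g y - g x))\<^sup>2"
      unfolding L_def by (intro power_mono l2_norm_avg_le[OF D(2) Dl sq] open_measure_pos D) simp
    also have "\<dots> = (LINT y|?M. (g y - g x)\<^sup>2)" by (rule l2_norm_power2)
    finally have "ennreal L \<le> ennreal (LINT y|?M. (g y - g x)\<^sup>2)" by (rule ennreal_leI)
    also have "\<dots> = (\<integral>\<^sup>+y. ennreal ((g y - g x)\<^sup>2) \<partial>?M)"
      using sqx by (intro nn_integral_eq_integral[symmetric]) (auto simp: square_integrable_def)
    also have "\<dots> \<le> (\<integral>\<^sup>+y. ennreal (d powr ?\<alpha> * gagliardo s g (x, y)) \<partial>?M)"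
      using pt[OF x] by (intro nn_integral_mono ennreal_leI) simp
    finally show ?thesis .
  qed
  have meas: "(\<lambda>p. ennreal (d powr ?\<alpha> * gagliardo s g p)) \<in> borel_measurable (?M \<Otimes>\<^sub>M ?M)"
    using borel_measurable_integrable[OF gi] by measurable
  have "ennreal (vol D * L) = ennreal L * emeasure ?M (space ?M)"
    unfolding F.emeasure_eq_measure using Dl by (simp add: measure_restrict_space ennreal_mult'[symmetric] mult.commute L_def)
  also have "\<dots> = (\<integral>\<^sup>+x. ennreal L \<partial>?M)" by simp
  also have "\<dots> \<le> (\<integral>\<^sup>+x. \<integral>\<^sup>+y. ennreal (d powr ?\<alpha> * gagliardo s g (x, y)) \<partial>?M \<partial>?M)"
    using row by (intro nn_integral_mono) simp
  also have "\<dots> = (\<integral>\<^sup>+p. ennreal (d powr ?\<alpha> * gagliardo s g p) \<partial>(?M \<Otimes>\<^sub>M ?M))" by (rule F.nn_integral_fst[OF meas])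
  also have "\<dots> = ennreal (LINT p|(?M \<Otimes>\<^sub>M ?M). d powr ?\<alpha> * gagliardo s g p)"
    using gi gag0 by (intro nn_integral_eq_integral) auto
  also have "(LINT p|(?M \<Otimes>\<^sub>M ?M). d powr ?\<alpha> * gagliardo s g p) = d powr ?\<alpha> * (LINT p|(?M \<Otimes>\<^sub>M ?M). gagliardo s g p)" by simp
  also have "(LINT p|(?M \<Otimes>\<^sub>M ?M). gagliardo s g p) = (Hs_seminorm s D g)\<^sup>2"
    using s gag0 by (simp add: Hs_seminorm_def integral_nonneg_AE)
  finally show ?thesis unfolding L_def by (subst (asm) ennreal_le_iff) auto
qed

text \<open>The summands cover s = 0, s = 1 and 0 < s < 1 in this order; their sum is uniform in s.
  Under the root, \<open>(3 * mesh_M \<kappa> n) ^ (n + 2)\<close> bounds the power n + 2 s of the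
  relative patch diameter, and the rest comes from the lower bound for the volume of
  \<open>T\<close>; the n-th powers of the mesh size cancel.\<close>

definition osc_const :: "real \<Rightarrow> nat \<Rightarrow> real" where
  "osc_const \<kappa> n = 1 + patch_const \<kappa> n + sqrt ((3 * mesh_M \<kappa> n) ^ (n + 2) * (2 * \<kappa>) ^ n / unit_ball_vol (real n))"

context mesh
begin

lemma patch_const_nonneg: "T \<in> \<T> \<Longrightarrow> patch_const \<kappa> DIM('a) \<ge> 0"
  unfolding patch_const_def using mesh_M_ge_1[of T] kappa_ge_1[of T]
  by (intro mult_nonneg_nonneg add_nonneg_nonneg real_sqrt_ge_zero zero_le_power) auto

lemma Hs_seminorm_nonneg: "Hs_seminorm s D g \<ge> 0"
  unfolding Hs_seminorm_def h1_seminorm_def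
  by (auto intro!: integral_nonneg_AE sum_nonneg simp: gagliardo_def case_prod_beta')

lemma patch_oscillation:
  assumes T: "T \<in> \<T>" and s: "0 \<le> s" "s \<le> 1" and g: "g \<in> Hs s (patch T)"
  shows "\<exists>c. L2 (patch T) (\<lambda>x. g x - c) \<le> osc_const \<kappa> DIM('a) * diameter T powr s * Hs_seminorm s (patch T) g"
proof -
  let ?D = "patch T" and ?h = "diameter T" and ?M = "mesh_M \<kappa> DIM('a)" and ?n = "DIM('a)" and ?\<omega> = "unit_ball_vol (real DIM('a))"
  define R where "R = sqrt ((3 * ?M) ^ (?n + 2) * (2 * \<kappa>) ^ ?n / ?\<omega>)"
  define H where "H = Hs_seminorm s ?D g"
  have h: "?h > 0" and k: "\<kappa> \<ge> 1" and M: "?M \<ge> 1" by (rule diam_pos[OF T] kappa_ge_1[OF T] mesh_M_ge_1[OF T])+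
  have \<omega>: "?\<omega> > 0" by simp
  have pc: "patch_const \<kappa> ?n \<ge> 0" by (rule patch_const_nonneg[OF T])
  have R: "R \<ge> 0" unfolding R_def using k M \<omega> by (intro real_sqrt_ge_zero divide_nonneg_nonneg mult_nonneg_nonneg zero_le_power) auto
  have H: "H \<ge> 0" unfolding H_def by (rule Hs_seminorm_nonneg)
  have hs: "0 \<le> ?h powr s * H" using H by simp
  have sq: "inL2 ?D g" using g by (simp add: Hs_def)
  have osc: "osc_const \<kappa> ?n = 1 + patch_const \<kappa> ?n + R" by (simp add: osc_const_def R_def)
  have fin: "x \<le> osc_const \<kappa> ?n * ?h powr s * H" if "x \<le> K * (?h powr s * H)" "K \<le> osc_const \<kappa> ?n" for x K
    using that mult_right_mono[OF that(2) hs] by (simp add: mult.assoc)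
  consider "s = 0" | "0 < s" "s < 1" | "s = 1" using s by linarith
  then have "\<exists>c. L2 ?D (\<lambda>x. g x - c) \<le> osc_const \<kappa> ?n * ?h powr s * H"
  proof cases
    case 1
    have "L2 ?D (\<lambda>x. g x - 0) \<le> 1 * (?h powr s * H)" using 1 h by (simp add: H_def Hs_seminorm_def)
    from fin[OF this] show ?thesis using pc R osc by (intro exI[of _ 0]) simp
  next
    case 3
    have "\<forall>b\<in>Basis. \<exists>g'. has_weak_partial ?D b g g' \<and> inL2 ?D g'" using g 3 by (simp add: Hs_def)
    then obtain g' where g': "\<And>b. b \<in> Basis \<Longrightarrow> has_weak_partial ?D b g (g' b)" "\<And>b. b \<in> Basis \<Longrightarrow> inL2 ?D (g' b)" by metis
    obtain c where c: "L2 ?D (\<lambda>x. g x - c) \<le> patch_const \<kappa> ?n * ?h * grad_norm ?D g'"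
      using patch_Poincare[OF T sq g'] by blast
    have "grad_norm ?D g' = H" using 3 by (simp add: H_def Hs_seminorm_def h1_seminorm_eq[OF open_element_patch g'(1)] grad_norm_def)
    then have "L2 ?D (\<lambda>x. g x - c) \<le> patch_const \<kappa> ?n * (?h powr s * H)" using c 3 h by (simp add: mult.assoc)
    from fin[OF this] show ?thesis using R osc by (intro exI[of _ c]) simp
  next
    case 2
    define L where "L = L2 ?D (\<lambda>x. g x - avg ?D g)"
    have L: "L \<ge> 0" by (simp add: L_def)
    define m where "m = ?\<omega> * (?h / (2 * \<kappa>)) ^ ?n"
    have m: "m > 0" unfolding m_def using h k \<omega> by (intro mult_pos_pos zero_less_power divide_pos_pos) auto
    have "m \<le> vol (interior T)" unfolding m_def by (rule elem_measure_ge[OF T])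
    also have "\<dots> \<le> vol ?D"
      using patch_elems_interior[OF self_patch_elem[OF T]] lmeasurable_open[OF bounded_element_patch open_element_patch]
      by (intro measure_mono_fmeasurable) auto
    finally have mD: "m \<le> vol ?D" .
    have "m * L\<^sup>2 \<le> vol ?D * L\<^sup>2" using mD by (rule mult_right_mono) simp
    also have "\<dots> \<le> (3 * ?M * ?h) powr (real ?n + 2 * s) * H\<^sup>2"
      unfolding L_def H_def by (rule gagliardo_average[OF open_element_patch bounded_element_patch element_patch_nonempty[OF T] 2 g element_patch_dist[OF T]])
    also have "(3 * ?M * ?h) powr (real ?n + 2 * s) = (3 * ?M) powr (real ?n + 2 * s) * (?h ^ ?n * (?h powr s)\<^sup>2)"
    proof -
      have "(3 * ?M * ?h) powr (real ?n + 2 * s) = (3 * ?M) powr (real ?n + 2 * s) * ?h powr (real ?n + 2 * s)"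
        using M h by (simp add: powr_mult)
      also have "?h powr (real ?n + 2 * s) = ?h ^ ?n * (?h powr s)\<^sup>2"
        unfolding mult_2[of s] powr_add power2_eq_square powr_realpow[OF h] by (rule refl)
      finally show ?thesis .
    qed
    also have "\<dots> * H\<^sup>2 \<le> (3 * ?M) ^ (?n + 2) * (?h ^ ?n * (?h powr s)\<^sup>2) * H\<^sup>2"
    proof (intro mult_right_mono)
      have "(3 * ?M) powr (real ?n + 2 * s) \<le> (3 * ?M) powr (real (?n + 2))" using M 2 by (intro powr_mono) auto
      also have "\<dots> = (3 * ?M) ^ (?n + 2)" using M by (intro powr_realpow) auto
      finally show "(3 * ?M) powr (real ?n + 2 * s) \<le> (3 * ?M) ^ (?n + 2)" .
    qed (use h in auto)
    also have "\<dots> = m * (R * (?h powr s * H))\<^sup>2"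
    proof -
      have "R\<^sup>2 = (3 * ?M) ^ (?n + 2) * (2 * \<kappa>) ^ ?n / ?\<omega>"
        unfolding R_def using k M \<omega> by (intro real_sqrt_pow2 divide_nonneg_nonneg mult_nonneg_nonneg zero_le_power) auto
      moreover have "x * y * (u * v / x) = u * (y * v)" if "x > 0" for x y u v :: real using that by simp
      ultimately have "m * R\<^sup>2 = (3 * ?M) ^ (?n + 2) * ((?h / (2 * \<kappa>)) ^ ?n * (2 * \<kappa>) ^ ?n)" using \<omega> by (simp only: m_def)
      also have "(?h / (2 * \<kappa>)) ^ ?n * (2 * \<kappa>) ^ ?n = ?h ^ ?n" unfolding power_mult_distrib[symmetric] using k by simp
      finally have mR: "m * R\<^sup>2 = (3 * ?M) ^ (?n + 2) * ?h ^ ?n" .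
      have "m * (R * (?h powr s * H))\<^sup>2 = (m * R\<^sup>2) * (?h powr s)\<^sup>2 * H\<^sup>2" by (simp only: power_mult_distrib mult_ac)
      then show ?thesis unfolding mR by (simp only: mult.assoc)
    qed
    finally have "L\<^sup>2 \<le> (R * (?h powr s * H))\<^sup>2" using m by simp
    then have "L \<le> R * (?h powr s * H)" using mult_nonneg_nonneg[OF R hs] by (rule power2_le_imp_le)
    from fin[OF this] show ?thesis using pc osc unfolding L_def by (intro exI[of _ "avg ?D g"]) simp
  qed
  then show ?thesis by (simp only: H_def)
qed

text \<open>The bound is kept in two stages because the gradient defect serves twice: it is the
  gradient error, and through the Poincare inequality for \<open>w\<close> minus its linear part it
  also bounds the error in the mean square.\<close>

lemma patch_affine_approximation:
  assumes T: "T \<in> \<T>" and s: "0 \<le> s" "s \<le> 1" and w: "w \<in> H1s s (patch T)"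
  shows "\<exists>p q g. (\<forall>b\<in>Basis. has_weak_partial (patch T) b w (g b) \<and> inL2 (patch T) (g b)) \<and>
    L2 (patch T) (\<lambda>x. w x - (p \<bullet> x + q)) \<le> patch_const \<kappa> DIM('a) * diameter T * grad_norm (patch T) (\<lambda>b x. g b x - p \<bullet> b) \<and>
    grad_norm (patch T) (\<lambda>b x. g b x - p \<bullet> b) \<le> osc_const \<kappa> DIM('a) * diameter T powr s * H1s_seminorm s (patch T) w"
proof -
  let ?D = "patch T" and ?h = "diameter T"
  have wsq: "inL2 ?D w" using w by (simp add: H1s_def)
  have fin: "finite_measure (lebesgue_on ?D)" by (rule finite_measure_bounded_lebesgue_on[OF bounded_element_patch element_patch_lebesgue])
  have "\<forall>b\<in>Basis. \<exists>g. has_weak_partial ?D b w g \<and> g \<in> Hs s ?D" using w by (simp add: H1s_def)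
  then obtain g where g: "\<And>b. b \<in> Basis \<Longrightarrow> has_weak_partial ?D b w (g b)" "\<And>b. b \<in> Basis \<Longrightarrow> g b \<in> Hs s ?D" by metis
  have gsq: "inL2 ?D (g b)" if "b \<in> Basis" for b using g(2)[OF that] by (simp add: Hs_def)
  have "\<forall>b\<in>Basis. \<exists>c. L2 ?D (\<lambda>x. g b x - c) \<le> osc_const \<kappa> DIM('a) * ?h powr s * Hs_seminorm s ?D (g b)"
    using patch_oscillation[OF T s g(2)] by blast
  then obtain c where c: "\<And>b. b \<in> Basis \<Longrightarrow> L2 ?D (\<lambda>x. g b x - c b) \<le> osc_const \<kappa> DIM('a) * ?h powr s * Hs_seminorm s ?D (g b)" by metis
  define p where "p = (\<Sum>b\<in>Basis. c b *\<^sub>R b)"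
  have pb: "p \<bullet> b = c b" if "b \<in> Basis" for b unfolding p_def using that by simp
  let ?B = "grad_norm ?D (\<lambda>b x. g b x - p \<bullet> b)"
  have "?B \<le> sqrt (\<Sum>b\<in>Basis. (osc_const \<kappa> DIM('a) * ?h powr s * Hs_seminorm s ?D (g b))\<^sup>2)"
    unfolding grad_norm_def by (intro real_sqrt_le_mono sum_mono power_mono) (auto simp: pb c)
  also have "\<dots> = sqrt ((osc_const \<kappa> DIM('a) * ?h powr s)\<^sup>2 * (\<Sum>b\<in>Basis. (Hs_seminorm s ?D (g b))\<^sup>2))"
    by (simp add: power_mult_distrib sum_distrib_left)
  also have "\<dots> = osc_const \<kappa> DIM('a) * ?h powr s * sqrt (\<Sum>b\<in>Basis. (Hs_seminorm s ?D (g b))\<^sup>2)"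
  proof -
    have "osc_const \<kappa> DIM('a) \<ge> 0" unfolding osc_const_def using patch_const_nonneg[OF T] mesh_M_ge_1[OF T] kappa_ge_1[OF T]
      by (intro add_nonneg_nonneg real_sqrt_ge_zero divide_nonneg_nonneg mult_nonneg_nonneg zero_le_power) auto
    then show ?thesis by (simp add: real_sqrt_mult abs_mult)
  qed
  also have "sqrt (\<Sum>b\<in>Basis. (Hs_seminorm s ?D (g b))\<^sup>2) = H1s_seminorm s ?D w"
  proof -
    have "Hs_seminorm s ?D (weak_partial ?D b w) = Hs_seminorm s ?D (g b)" if b: "b \<in> Basis" for b
    proof (rule Hs_seminorm_cong_AE[OF open_element_patch bounded_element_patch s g(2)[OF b]])
      have "locally_integrable ?D (weak_partial ?D b w)" using weak_partial_works[OF g(1)[OF b]] by (simp add: has_weak_partial_def)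
      then show "weak_partial ?D b w \<in> borel_measurable (lebesgue_on ?D)" by (rule locally_integrable_measurable[OF open_element_patch])
      show "AE x in lebesgue_on ?D. g b x = weak_partial ?D b w x"
        using weak_partial_AE[OF open_element_patch g(1)[OF b]] by eventually_elim simp
    qed
    then show ?thesis by (simp add: H1s_seminorm_def)
  qed
  finally have B: "?B \<le> osc_const \<kappa> DIM('a) * ?h powr s * H1s_seminorm s ?D w" .
  have "\<exists>q. L2 ?D (\<lambda>x. (w x - (p \<bullet> x + 0)) - q) \<le> patch_const \<kappa> DIM('a) * ?h * ?B"
  proof (rule patch_Poincare[OF T])
    show "inL2 ?D (\<lambda>x. w x - (p \<bullet> x + 0))"
      by (intro square_integrable_diff wsq continuous_square_integrable continuous_affine bounded_element_patch element_patch_lebesgue)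
    show "has_weak_partial ?D b (\<lambda>x. w x - (p \<bullet> x + 0)) (\<lambda>x. g b x - p \<bullet> b)" if "b \<in> Basis" for b
      by (rule has_weak_partial_diff[OF g(1)[OF that] has_weak_partial_affine[OF open_element_patch] open_element_patch])
    show "inL2 ?D (\<lambda>x. g b x - p \<bullet> b)" if "b \<in> Basis" for b
      by (intro square_integrable_diff gsq[OF that] square_integrable_const fin)
  qed
  then obtain q where "L2 ?D (\<lambda>x. w x - (p \<bullet> x + q)) \<le> patch_const \<kappa> DIM('a) * ?h * ?B"
    by (auto simp: algebra_simps)
  then show ?thesis using g(1) gsq B by blast
qed

end

context mesh
begin

subsection \<open>Nodal values at interior vertices\<close>

lemma phi_outside:
  assumes T: "T \<in> \<T>" and z: "z \<in> mesh_verts \<T>" "z \<notin> verts T" and x: "x \<in> T"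
  shows "\<phi> z x = 0"
proof -
  interpret B: bary_simplex "verts T" "ga T" "gc T" by (rule bary[OF T])
  have "ga T z \<bullet> v + gc T z = 0" if v: "v \<in> verts T" for v
    using lam_phi[OF T z(1) verts_sub[OF v]] phi_node[OF z(1) verts_mesh[OF T v]] z(2) v by auto
  then show ?thesis using B.affine_repr[of "ga T z" x "gc T z"] lam_phi[OF T z(1) x] by simp
qed

lemma phi_bounds:
  assumes T: "T \<in> \<T>" and z: "z \<in> mesh_verts \<T>" and x: "x \<in> T"
  shows "\<bar>\<phi> z x\<bar> \<le> 1"
proof (cases "z \<in> verts T")
  case True
  interpret B: bary_simplex "verts T" "ga T" "gc T" by (rule bary[OF T])
  have xT: "x \<in> B.T" using x T_eq[OF T] by simp
  have "B.lam z x = \<phi> z x" using lam_phi[OF T z x] by (simp add: B.lam_def)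
  moreover have "0 \<le> B.lam z x" using xT True unfolding B.T_eq by blast
  ultimately show ?thesis using B.lam_le_1[OF xT True] by simp
qed (simp add: phi_outside[OF T z _ x])

text \<open>On each of the finitely many closed elements the basis function is affine, and the local
  continuous pieces are glued.\<close>

lemma phi_continuous: "z \<in> mesh_verts \<T> \<Longrightarrow> continuous_on (\<Union>(star z)) (\<phi> z)"
proof -
  assume z: "z \<in> mesh_verts \<T>"
  have "continuous_on T (\<phi> z)" if T: "T \<in> star z" for T
  proof (rule continuous_on_eq[OF continuous_affine])
    show "ga T z \<bullet> x + gc T z = \<phi> z x" if "x \<in> T" for x by (rule lam_phi[OF vertex_elements_sub(1)[OF T] z that])
  qed
  then have "continuous_on (\<Union>T\<in>star z. T) (\<phi> z)"
    by (intro continuous_on_closed_Union finite_vertex_elements)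
      (auto intro: compact_imp_closed elem_facts(1) vertex_elements_sub)
  then show ?thesis by simp
qed

lemma patch_integral:
  fixes f :: "'a \<Rightarrow> real"
  assumes f: "continuous_on (\<Union>(star z)) f"
  shows "(LINT x|lebesgue_on (vpatch z). f x) = (\<Sum>T\<in>star z. LINT x|lebesgue_on T. f x)"
proof -
  let ?E = "star z" and ?V = "vpatch z"
  have V: "?V \<in> sets lebesgue" using open_vertex_patch by simp
  have int: "integrable lebesgue (\<lambda>x. indicator T x * f x)" if T: "T \<in> ?E" for T
  proof -
    have "continuous_on T f" by (rule continuous_on_subset[OF f]) (use T in blast)
    then have "integrable lborel (\<lambda>x. indicator T x *\<^sub>R f x)"
      by (intro borel_integrable_compact elem_facts(1) vertex_elements_sub(1)[OF T])
    then show ?thesis by (simp add: integrable_completion)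
  qed
  have "f \<in> borel_measurable (lebesgue_on ?V)"
    by (rule continuous_imp_measurable_on_sets_lebesgue[OF continuous_on_subset[OF f patch_sub] V])
  then have "(\<lambda>x. if x \<in> ?V then f x else 0) \<in> borel_measurable lebesgue" using V by (simp add: borel_measurable_if)
  moreover have "(\<lambda>x. if x \<in> ?V then f x else 0) = (\<lambda>x. indicator ?V x * f x)" by (auto simp: fun_eq_iff indicator_def)
  ultimately have m: "(\<lambda>x. indicator ?V x * f x) \<in> borel_measurable lebesgue" by simp
  have "AE x in lebesgue. x \<notin> \<Union>?E - (\<Union>T\<in>?E. interior T)"
    using patch_almost_cover by (simp only: negligible_iff_null_sets AE_not_in)
  then have ae: "AE x in lebesgue. indicator ?V x * f x = (\<Sum>T\<in>?E. indicator T x * f x)"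
  proof eventually_elim
    case (elim x)
    show ?case
    proof (cases "x \<in> \<Union>?E")
      case True
      then obtain T where T: "T \<in> ?E" "x \<in> interior T" using elim by blast
      have "(\<Sum>T'\<in>?E. indicator T' x * f x) = (\<Sum>T'\<in>?E. if T' = T then f x else 0)"
      proof (rule sum.cong[OF refl])
        fix T' assume T': "T' \<in> ?E"
        show "indicator T' x * f x = (if T' = T then f x else 0)"
          using interior_disjoint_elem[OF vertex_elements_sub(1)[OF T(1)] vertex_elements_sub(1)[OF T']] T(2) interior_subset[of T]
          by (auto simp: indicator_def)
      qed
      also have "\<dots> = f x" using T(1) finite_vertex_elements by simp
      finally show ?thesis using T interior_sub_patch[OF T(1)] by (auto simp: indicator_def)
    next
      case False
      then have "x \<notin> ?V" using patch_sub by blast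
      moreover have "\<And>T. T \<in> ?E \<Longrightarrow> x \<notin> T" using False by blast
      ultimately show ?thesis by (simp add: indicator_def)
    qed
  qed
  have "(LINT x|lebesgue_on ?V. f x) = (LINT x|lebesgue. (\<Sum>T\<in>?E. indicator T x * f x))"
    unfolding lebesgue_on_integral_eq[OF V]
    by (rule integral_cong_AE[OF m _ ae]) (intro borel_measurable_sum borel_measurable_integrable int)
  also have "\<dots> = (\<Sum>T\<in>?E. (LINT x|lebesgue. indicator T x * f x))" by (rule Bochner_Integration.integral_sum[OF int])
  also have "\<dots> = (\<Sum>T\<in>?E. (LINT x|lebesgue_on T. f x))"
    by (rule sum.cong[OF refl]) (simp add: lebesgue_on_integral_eq elem_facts(7) vertex_elements_sub(1))
  finally show ?thesis .
qed

lemma elem_integral: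
  fixes f f' :: "'a \<Rightarrow> real"
  assumes T: "T \<in> \<T>" and f: "continuous_on UNIV f" "\<And>x. x \<in> T \<Longrightarrow> f' x = f x"
  shows "(LINT x|lebesgue_on T. f' x) = (LINT x|lborel. indicator T x * f x)"
proof -
  have [measurable]: "f \<in> borel_measurable borel" by (rule borel_measurable_continuous_onI[OF f(1)])
  have [measurable]: "T \<in> sets borel" by (rule elem_facts(6)[OF T])
  have "(LINT x|lebesgue_on T. f' x) = (LINT x|lebesgue_on T. f x)"
    by (rule Bochner_Integration.integral_cong[OF refl]) (use f in simp)
  also have "\<dots> = (LINT x|lebesgue. indicator T x * f x)" by (rule lebesgue_on_integral_eq[OF elem_facts(7)[OF T]])
  also have "\<dots> = (LINT x|lborel. indicator T x * f x)" by (rule integral_completion) measurable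
  finally show ?thesis .
qed

text \<open>Summing \<open>mom_lam_affine\<close> over the elements at \<open>z\<close> gives the
  value at \<open>z\<close> times the total weight, plus the slope applied to the sum of |T| times
  (barycenter minus z), divided by n + 2. Local symmetry makes that sum vanish, so the weighted mean
  reproduces affine functions.\<close>

lemma patch_weight:
  assumes z: "z \<in> interior_verts \<Omega> \<T>"
  shows "(LINT x|lebesgue_on (vpatch z). \<phi> z x) = vol (vpatch z) / (real DIM('a) + 1)"
    "(LINT x|lebesgue_on (vpatch z). (p \<bullet> x + q) * \<phi> z x) = (p \<bullet> z + q) * (vol (vpatch z) / (real DIM('a) + 1))"
proof -
  let ?E = "star z" and ?n = "real DIM('a)"
  have zm: "z \<in> mesh_verts \<T>" using z by (simp add: interior_verts_def)
  have zT: "z \<in> verts T" if "T \<in> ?E" for T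
    using vertex_in_elem[OF zm vertex_elements_sub(1)[OF that] vertex_elements_sub(2)[OF that]] .
  have c: "continuous_on (\<Union>?E) (\<phi> z)" by (rule phi_continuous[OF zm])
  have one: "(LINT x|lebesgue_on T. \<phi> z x) = vol T / (?n + 1)" if T: "T \<in> ?E" for T
  proof -
    note TT = vertex_elements_sub(1)[OF T]
    interpret B: bary_simplex "verts T" "ga T" "gc T" by (rule bary[OF TT])
    have "(LINT x|lebesgue_on T. \<phi> z x) = (LINT x|lborel. indicator T x * B.lam z x)"
      by (rule elem_integral[OF TT B.lam_continuous]) (simp add: B.lam_def lam_phi[OF TT zm])
    also have "\<dots> = B.mom (B.lam z)" by (simp add: B.mom_def T_eq[OF TT])
    also have "\<dots> = vol T / (?n + 1)" using B.mom_lam[OF zT[OF T]] by (simp add: T_eq[OF TT])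
    finally show ?thesis .
  qed
  have two: "(LINT x|lebesgue_on T. (p \<bullet> x + q) * \<phi> z x)
      = (p \<bullet> z + q) * (vol T / (?n + 1)) + (p \<bullet> (vol T *\<^sub>R (barycenter T - z))) / (?n + 2)" if T: "T \<in> ?E" for T
  proof -
    note TT = vertex_elements_sub(1)[OF T]
    interpret B: bary_simplex "verts T" "ga T" "gc T" by (rule bary[OF TT])
    have cont: "continuous_on UNIV (\<lambda>x. (p \<bullet> x + q) * B.lam z x)" by (intro continuous_intros B.lam_continuous)
    have "(LINT x|lebesgue_on T. (p \<bullet> x + q) * \<phi> z x) = (LINT x|lborel. indicator T x * ((p \<bullet> x + q) * B.lam z x))"
      by (rule elem_integral[OF TT cont]) (simp add: B.lam_def lam_phi[OF TT zm])
    also have "\<dots> = B.mom (\<lambda>x. (p \<bullet> x + q) * B.lam z x)" by (simp add: B.mom_def T_eq[OF TT])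
    also have "\<dots> = vol T / ((?n + 1) * (?n + 2)) * ((p \<bullet> z + q) + (\<Sum>v\<in>verts T. p \<bullet> v + q))"
      using B.mom_lam_affine[OF zT[OF T], of p q] by (simp add: T_eq[OF TT])
    \<comment> \<open>The vertex values sum to n + 1 times the value at the barycenter, here split
      into the value at \<open>z\<close> and a deviation.\<close>
    also have "(\<Sum>v\<in>verts T. p \<bullet> v + q) = (?n + 1) * (p \<bullet> z + q) + (?n + 1) * (p \<bullet> (barycenter T - z))"
    proof -
      have "(?n + 1) *\<^sub>R barycenter T = (\<Sum>v\<in>verts T. v)" by (simp add: barycenter_def)
      then have "(?n + 1) * (p \<bullet> barycenter T) = (\<Sum>v\<in>verts T. p \<bullet> v)" by (simp only: inner_scaleR_right[symmetric] inner_sum_right[symmetric])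
      then show ?thesis using B.card_C by (simp add: sum.distrib inner_diff_right algebra_simps)
    qed
    also have "vol T / ((?n + 1) * (?n + 2)) * ((p \<bullet> z + q) + ((?n + 1) * (p \<bullet> z + q) + (?n + 1) * (p \<bullet> (barycenter T - z))))
      = (p \<bullet> z + q) * (vol T / (?n + 1)) + (p \<bullet> (vol T *\<^sub>R (barycenter T - z))) / (?n + 2)"
    proof -
      have "m / ((n + 1) * (n + 2)) * (P + ((n + 1) * P + (n + 1) * Q)) = P * (m / (n + 1)) + (m * Q) / (n + 2)"
        if "n + 1 \<noteq> 0" "n + 2 \<noteq> 0" for m n P Q :: real
      proof -
        have "m / ((n + 1) * (n + 2)) * (P + ((n + 1) * P + (n + 1) * Q)) = (m * P * (n + 2) + m * Q * (n + 1)) / ((n + 1) * (n + 2))"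
          by (simp add: algebra_simps)
        also have "\<dots> = P * (m / (n + 1)) + (m * Q) / (n + 2)" using that by (simp add: add_divide_distrib mult_ac)
        finally show ?thesis .
      qed
      from this[of ?n] show ?thesis by simp
    qed
    finally show ?thesis .
  qed
  have "(LINT x|lebesgue_on (vpatch z). \<phi> z x) = (\<Sum>T\<in>?E. vol T / (?n + 1))"
    unfolding patch_integral[OF c] by (rule sum.cong[OF refl one])
  then show "(LINT x|lebesgue_on (vpatch z). \<phi> z x) = vol (vpatch z) / (?n + 1)"
    by (simp only: patch_measure sum_divide_distrib)
  have c2: "continuous_on (\<Union>?E) (\<lambda>x. (p \<bullet> x + q) * \<phi> z x)" by (intro continuous_intros c)
  have "(LINT x|lebesgue_on (vpatch z). (p \<bullet> x + q) * \<phi> z x)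
      = (\<Sum>T\<in>?E. (p \<bullet> z + q) * (vol T / (?n + 1)) + (p \<bullet> (vol T *\<^sub>R (barycenter T - z))) / (?n + 2))"
    unfolding patch_integral[OF c2] by (rule sum.cong[OF refl two])
  also have "\<dots> = (p \<bullet> z + q) * (vol (vpatch z) / (?n + 1)) + (p \<bullet> (\<Sum>T\<in>?E. vol T *\<^sub>R (barycenter T - z))) / (?n + 2)"
    by (simp only: sum.distrib sum_distrib_left sum_divide_distrib patch_measure inner_sum_right)
  finally show "(LINT x|lebesgue_on (vpatch z). (p \<bullet> x + q) * \<phi> z x) = (p \<bullet> z + q) * (vol (vpatch z) / (?n + 1))"
    unfolding symmetric_sum[OF z] by simp
qed

text \<open>The denominator is |V| / (n + 1) and the norm of the basis function at most the root of
  |V|, where V is the vertex patch. Since \<open>T\<close> is one of its elements, the volumes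
  cancel and n + 1 remains.\<close>

lemma interior_coeff:
  assumes T: "T \<in> \<T>" "z \<in> verts T" and z: "z \<in> interior_verts \<Omega> \<T>"
    and w: "inL2 (patch T) w"
  shows "\<bar>coeff \<sigma> \<theta> w z - (p \<bullet> z + q)\<bar> * sqrt (vol T)
    \<le> (real DIM('a) + 1) * L2 (patch T) (\<lambda>x. w x - (p \<bullet> x + q))"
proof -
  let ?V = "vpatch z" and ?D = "patch T" and ?n = "real DIM('a)"
  let ?A = "L2 ?D (\<lambda>x. w x - (p \<bullet> x + q))" and ?m = "vol ?V"
  have zm: "z \<in> mesh_verts \<T>" by (rule verts_mesh[OF T])
  have V: "?V \<in> sets lebesgue" "?V \<subseteq> ?D" using open_vertex_patch T(2) by (auto simp: element_patch_def)
  have Vb: "bounded ?V" using bounded_subset[OF bounded_element_patch V(2)] .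
  have fin: "finite_measure (lebesgue_on ?V)" by (rule finite_measure_bounded_lebesgue_on[OF Vb V(1)])
  have TV: "T \<in> star z" by (rule vertex_elements_verts[OF T(2,1)])
  have "0 < vol T" by (rule measure_elem_pos[OF T(1)])
  moreover have mT: "vol T \<le> ?m"
    unfolding patch_measure by (rule member_le_sum[OF TV]) (use finite_vertex_elements in auto)
  ultimately have m: "?m > 0" by linarith
  have \<phi>m: "\<phi> z \<in> borel_measurable (lebesgue_on ?V)"
    by (rule continuous_imp_measurable_on_sets_lebesgue[OF continuous_on_subset[OF phi_continuous[OF zm] patch_sub] V(1)])
  have \<phi>1: "\<bar>\<phi> z x\<bar> \<le> 1" if "x \<in> space (lebesgue_on ?V)" for x
  proof -
    have "x \<in> ?V" using that by simp
    then obtain T' where "T' \<in> star z" "x \<in> T'" using patch_sub by blast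
    then show ?thesis using phi_bounds[OF vertex_elements_sub(1) zm] by blast
  qed
  have \<phi>s: "inL2 ?V (\<phi> z)" by (rule square_integrable_bounded[OF fin \<phi>m \<phi>1])
  have \<phi>n: "L2 ?V (\<phi> z) \<le> sqrt ?m"
    using l2_norm_bounded[OF fin \<phi>m \<phi>1] V(1) by (simp add: measure_restrict_space)
  have ws: "inL2 ?V w" by (rule square_integrable_subset[OF w V(2) element_patch_lebesgue V(1)])
  have Ps: "inL2 ?V (\<lambda>x. p \<bullet> x + q)" by (rule continuous_square_integrable[OF continuous_affine Vb V(1)])
  have ds: "inL2 ?D (\<lambda>x. w x - (p \<bullet> x + q))"
    by (intro square_integrable_diff w continuous_square_integrable continuous_affine bounded_element_patch element_patch_lebesgue)
  let ?I = "LINT x|lebesgue_on ?V. (w x - (p \<bullet> x + q)) * \<phi> z x"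
  have "?I = (LINT x|lebesgue_on ?V. w x * \<phi> z x) - (LINT x|lebesgue_on ?V. (p \<bullet> x + q) * \<phi> z x)"
    unfolding left_diff_distrib by (intro Bochner_Integration.integral_diff square_integrable_mult ws Ps \<phi>s)
  then have I: "(LINT x|lebesgue_on ?V. w x * \<phi> z x) = ?I + (p \<bullet> z + q) * (?m / (?n + 1))" using patch_weight(2)[OF z] by simp
  have "coeff \<sigma> \<theta> w z = (?I + (p \<bullet> z + q) * (?m / (?n + 1))) / (?m / (?n + 1))"
    using z unfolding clement_coeff_def patch_weight(1)[OF z] I by simp
  also have "\<dots> = ?I / (?m / (?n + 1)) + (p \<bullet> z + q)"
  proof -
    have "(i + P * x) / x = i / x + P" if "x \<noteq> 0" for i P x :: real using that by (simp add: add_divide_distrib)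
    then show ?thesis by this (use m in simp)
  qed
  finally have eq: "\<bar>coeff \<sigma> \<theta> w z - (p \<bullet> z + q)\<bar> = \<bar>?I\<bar> * ((?n + 1) / ?m)" using m by (simp add: abs_mult)
  have "\<bar>?I\<bar> \<le> L2 ?V (\<lambda>x. w x - (p \<bullet> x + q)) * L2 ?V (\<phi> z)"
    by (intro l2_Cauchy_Schwarz square_integrable_diff ws Ps \<phi>s)
  also have "\<dots> \<le> ?A * sqrt ?m" by (intro mult_mono l2_norm_subset[OF ds V(2) element_patch_lebesgue V(1)] \<phi>n) auto
  finally have "\<bar>?I\<bar> * ((?n + 1) / ?m) * sqrt (vol T) \<le> ?A * sqrt ?m * ((?n + 1) / ?m) * sqrt ?m"
    using m mT by (intro mult_mono real_sqrt_le_mono) auto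
  also have "\<dots> = ?A * ((?n + 1) / ?m) * (sqrt ?m * sqrt ?m)" by (simp only: mult_ac)
  also have "\<dots> = (?n + 1) * ?A" using m by simp
  finally show ?thesis unfolding eq .
qed

subsection \<open>Nodal values at boundary vertices\<close>

lemma finite_mesh_verts: "finite (mesh_verts \<T>)"
  unfolding mesh_verts_def using finite_mesh elem_facts(8) by blast

lemma scott_zhang_node:
  assumes z: "z \<in> mesh_verts \<T>"
  shows "scott_zhang \<T> \<phi> \<sigma> \<theta> w z = (LINT y|face_measure (\<sigma> z). \<theta> z y * face_trace \<T> (\<sigma> z) w y)"
proof -
  have "scott_zhang \<T> \<phi> \<sigma> \<theta> w z = (\<Sum>z'\<in>mesh_verts \<T>. if z' = z then (LINT y|face_measure (\<sigma> z). \<theta> z y * face_trace \<T> (\<sigma> z) w y) else 0)"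
    unfolding scott_zhang_def by (rule sum.cong[OF refl]) (auto simp: phi_node[OF _ z])
  then show ?thesis using z finite_mesh_verts by simp
qed

text \<open>With N the norm of the dual function, \<open>mF\<close> the area of the face and
  \<open>At\<close> the trace constant, three quantities are independent of the mesh size:
  \<open>N\<^sup>2 * mF\<close>, \<open>At\<^sup>2 * r\<close>, and the volume of \<open>T\<close>
  divided by \<open>r * mF\<close>. Their product is the claim.\<close>

lemma boundary_coeff:
  assumes SZ: "scott_zhang_data \<Omega> \<T> \<phi> \<sigma> \<theta>" and T: "T \<in> \<T>" "z \<in> verts T" and z: "z \<notin> interior_verts \<Omega> \<T>"
    and w: "inL2 (patch T) w"
    and g: "\<And>b. b \<in> Basis \<Longrightarrow> has_weak_partial (patch T) b w (g b)"
      "\<And>b. b \<in> Basis \<Longrightarrow> inL2 (patch T) (g b)"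
  shows "\<bar>coeff \<sigma> \<theta> w z - (p \<bullet> z + q)\<bar> * sqrt (vol T)
    \<le> sqrt (4 * (8 * 2 ^ DIM('a) + 2) * real DIM('a) * (mesh_M \<kappa> DIM('a))\<^sup>2 * (mesh_M \<kappa> DIM('a) * \<kappa> * real DIM('a)) ^ DIM('a)) *
      (L2 (patch T) (\<lambda>x. w x - (p \<bullet> x + q)) + diameter T * grad_norm (patch T) (\<lambda>b x. g b x - p \<bullet> b))"
proof -
  let ?D = "patch T" and ?n = "real DIM('a)" and ?M = "mesh_M \<kappa> DIM('a)" and ?\<omega> = "unit_ball_vol (real DIM('a))"
  define A where "A = L2 ?D (\<lambda>x. w x - (p \<bullet> x + q))"
  define G where "G = grad_norm ?D (\<lambda>b x. g b x - p \<bullet> b)"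
  define K where "K = (8 * 2 ^ DIM('a) + 2 :: real)"
  have zm: "z \<in> mesh_verts \<T>" by (rule verts_mesh[OF T])
  have SZz: "\<exists>T\<in>\<T>. \<sigma> z facet_of T" "z \<in> \<sigma> z" "affine_fun_on (\<sigma> z) (\<theta> z)"
    "\<And>z'. z' \<in> verts (\<sigma> z) \<Longrightarrow> (LINT x|face_measure (\<sigma> z). \<theta> z x * \<phi> z' x) = (if z' = z then 1 else 0)"
    using SZ zm unfolding scott_zhang_data_def by blast+
  \<comment> \<open>Literally the element chosen in \<open>face_trace\<close>. It contains
    \<open>z\<close> but may differ from \<open>T\<close>; it belongs to the patch of
    \<open>T\<close>, so the estimate stays local.\<close>
  define T' where "T' = (SOME T. T \<in> \<T> \<and> \<sigma> z facet_of T)"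
  have T': "T' \<in> \<T>" "\<sigma> z facet_of T'" using someI_ex[of "\<lambda>T. T \<in> \<T> \<and> \<sigma> z facet_of T"] SZz(1) unfolding T'_def by blast+
  have zT': "z \<in> T'" using facet_of_imp_subset[OF T'(2)] SZz(2) by blast
  have zV': "z \<in> verts T'" by (rule vertex_in_elem[OF zm T'(1) zT'])
  have pe: "T' \<in> patch_elems T" using T(2) vertex_elements_verts[OF zV' T'(1)] by (auto simp: patch_elems_def)
  interpret B: bary_simplex "verts T'" "ga T'" "gc T'" by (rule bary[OF T'(1)])
  obtain v where v: "v \<in> verts T'" "\<sigma> z = convex hull (verts T' - {v})" "verts (\<sigma> z) = verts T' - {v}" using facet_verts[OF T'] by blast
  have F: "\<sigma> z = B.facet v" by (simp add: B.facet_def v(2))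
  have zv: "z \<noteq> v" using SZz(2) B.lam_vertex[OF v(1) v(1)] unfolding F B.facet_eq[OF v(1)] by auto
  interpret H: hyperplane_face "B.facet v" "B.normal v" "B.offset v" by (rule B.hyperplane_face_facet[OF v(1)])
  let ?F = "face_measure (B.facet v)"
  obtain a c where th: "\<And>x. x \<in> B.facet v \<Longrightarrow> \<theta> z x = a \<bullet> x + c" using SZz(3) unfolding affine_fun_on_def F by blast
  have lam_F: "\<phi> u x = B.lam u x" if "u \<in> verts T'" "x \<in> B.facet v" for u x
    using lam_phi[OF T'(1) verts_mesh[OF T'(1) that(1)], of x] that(2) T_eq[OF T'(1)] unfolding B.facet_eq[OF v(1)] B.lam_def by simp
  have dual: "(LINT y|?F. (a \<bullet> y + c) * B.lam u y) = (if u = z then 1 else 0)" if u: "u \<in> verts T' - {v}" for u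
  proof -
    have "(LINT y|?F. (a \<bullet> y + c) * B.lam u y) = (LINT y|?F. \<theta> z y * \<phi> u y)"
      by (rule Bochner_Integration.integral_cong[OF refl]) (use u in \<open>simp add: th lam_F\<close>)
    moreover have "u \<in> verts (\<sigma> z)" using u v(3) by simp
    note SZz(4)[OF this]
    ultimately show ?thesis unfolding F by simp
  qed
  define N where "N = l2_norm ?F (\<lambda>y. a \<bullet> y + c)"
  define mF where "mF = measure ?F (B.facet v)"
  have N: "N\<^sup>2 * mF \<le> K" unfolding N_def mF_def K_def by (rule B.facet_dual_bound[OF v(1) zV' zv dual])
  have ths: "square_integrable ?F (\<lambda>y. a \<bullet> y + c)" by (rule H.square_integrable_face[OF continuous_affine])
  have exact: "(LINT y|?F. (a \<bullet> y + c) * (p \<bullet> y + q)) = p \<bullet> z + q"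
  proof -
    have "(LINT y|?F. (a \<bullet> y + c) * (p \<bullet> y + q)) = (LINT y|?F. (\<Sum>u\<in>verts T' - {v}. (p \<bullet> u + q) * ((a \<bullet> y + c) * B.lam u y)))"
    proof (rule Bochner_Integration.integral_cong[OF refl])
      fix y assume "y \<in> space ?F"
      then have "y \<in> B.facet v" by simp
      then have y: "B.lam v y = 0" unfolding B.facet_eq[OF v(1)] by simp
      have "p \<bullet> y + q = (\<Sum>u\<in>verts T' - {v}. B.lam u y * (p \<bullet> u + q))"
        using B.affine_repr[of p y q] sum.remove[OF B.fin_C v(1), of "\<lambda>u. B.lam u y * (p \<bullet> u + q)"] y by simp
      then show "(a \<bullet> y + c) * (p \<bullet> y + q) = (\<Sum>u\<in>verts T' - {v}. (p \<bullet> u + q) * ((a \<bullet> y + c) * B.lam u y))"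
        by (simp add: sum_distrib_left mult_ac)
    qed
    also have "\<dots> = (\<Sum>u\<in>verts T' - {v}. (LINT y|?F. (p \<bullet> u + q) * ((a \<bullet> y + c) * B.lam u y)))"
      by (intro Bochner_Integration.integral_sum integrable_mult_right square_integrable_mult ths H.square_integrable_face B.lam_continuous)
    also have "\<dots> = (\<Sum>u\<in>verts T' - {v}. if u = z then p \<bullet> z + q else 0)"
      by (rule sum.cong[OF refl]) (simp add: dual)
    also have "\<dots> = p \<bullet> z + q" using zV' zv by simp
    finally show ?thesis .
  qed
  define t where "t = face_trace \<T> (\<sigma> z) w"
  define At where "At = sqrt (2 * ?n\<^sup>2 * norm (ga T' v))"
  have At: "At \<ge> 0" by (simp add: At_def)
  note E = elem_facts[OF T'(1)]
  have iD: "interior T' \<subseteq> ?D" by (rule patch_elems_interior[OF pe])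
  have tr: "l2_norm ?F u \<le> At * L2 (interior T') u + At * diameter T' * grad_norm (interior T') (\<lambda>b x. fderiv u x b)"
    if "Ck 1 u" for u
    using B.facet_trace_C1[OF v(1) that] unfolding At_def T_eq[OF T'(1)] .
  have ws: "inL2 (interior T') w" by (rule square_integrable_subset[OF w iD element_patch_lebesgue E(12)])
  have gw: "has_weak_partial (interior T') b w (g b)" if "b \<in> Basis" for b
    by (rule has_weak_partial_subset[OF g(1)[OF that] open_element_patch open_interior iD])
  have gs: "inL2 (interior T') (g b)" if "b \<in> Basis" for b
    by (rule square_integrable_subset[OF g(2)[OF that] iD element_patch_lebesgue E(12)])
  have h': "diameter T' > 0" by (rule diam_pos[OF T'(1)])
  have Bt: "At * diameter T' \<ge> 0" using At h' by simp
  have "\<exists>t. is_face_trace T' (B.facet v) w t"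
    by (rule H.face_trace_exists[OF E(2) E(3) E(4) tr At Bt ws gw gs])
  then have "is_face_trace T' (B.facet v) w (SOME t. is_face_trace T' (B.facet v) w t)" by (rule someI_ex)
  moreover have "t = (SOME t. is_face_trace T' (\<sigma> z) w t)" unfolding t_def face_trace_def T'_def by (rule refl)
  ultimately have t: "is_face_trace T' (B.facet v) w t" unfolding F by simp
  have ts: "square_integrable ?F t" using t by (simp add: is_face_trace_def)
  have k: "\<kappa> \<ge> 1" and M: "?M \<ge> 1" and h: "diameter T > 0" by (rule kappa_ge_1[OF T(1)] mesh_M_ge_1[OF T(1)] diam_pos[OF T(1)])+
  have n: "?n \<ge> 1" using DIM_positive[where 'a='a] by linarith
  have A0: "A \<ge> 0" and G0: "G \<ge> 0" unfolding A_def G_def by (simp, rule grad_norm_nonneg)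
  define S where "S = A + diameter T * G"
  have S0: "S \<ge> 0" unfolding S_def using A0 G0 h by simp
  have fD: "finite_measure (lebesgue_on ?D)" by (rule finite_measure_bounded_lebesgue_on[OF bounded_element_patch element_patch_lebesgue])
  have "l2_norm ?F (\<lambda>x. t x - (p \<bullet> x + q)) \<le> At * L2 (interior T') (\<lambda>x. w x - (p \<bullet> x + q))
      + At * diameter T' * grad_norm (interior T') (\<lambda>b x. g b x - p \<bullet> b)"
    using H.face_trace_bound[OF E(2) E(3) E(4) tr At Bt ws gw gs t Ck_1_affine[of p q]] unfolding affine_frechet_derivative .
  also have "\<dots> \<le> At * A + At * diameter T' * G"
  proof (intro add_mono mult_left_mono)
    show "L2 (interior T') (\<lambda>x. w x - (p \<bullet> x + q)) \<le> A" unfolding A_def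
      by (intro l2_norm_subset[OF _ iD] square_integrable_diff w continuous_square_integrable continuous_affine bounded_element_patch element_patch_lebesgue E(12))
    show "grad_norm (interior T') (\<lambda>b x. g b x - p \<bullet> b) \<le> G" unfolding G_def
      by (intro grad_norm_subset[OF _ iD] square_integrable_diff g(2) square_integrable_const fD element_patch_lebesgue E(12))
  qed (use At Bt in auto)
  also have "\<dots> \<le> At * (?M * S)"
  proof -
    have "diameter T' * G \<le> ?M * diameter T * G" by (intro mult_right_mono patch_elem_size(1)[OF T(1) pe] G0)
    moreover have "1 * A \<le> ?M * A" by (rule mult_right_mono[OF M A0])
    ultimately have "A + diameter T' * G \<le> ?M * S" by (simp add: S_def algebra_simps)
    from mult_left_mono[OF this At] show ?thesis by (simp add: algebra_simps)
  qed
  finally have tb: "l2_norm ?F (\<lambda>x. t x - (p \<bullet> x + q)) \<le> At * (?M * S)" .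
  have Ps: "square_integrable ?F (\<lambda>x. p \<bullet> x + q)" by (rule H.square_integrable_face[OF continuous_affine])
  define X where "X = \<bar>coeff \<sigma> \<theta> w z - (p \<bullet> z + q)\<bar>"
  have "coeff \<sigma> \<theta> w z = (LINT y|?F. \<theta> z y * t y)"
    using z by (simp add: clement_coeff_def scott_zhang_node[OF zm] t_def F)
  also have "\<dots> = (LINT y|?F. (a \<bullet> y + c) * t y)"
    by (rule Bochner_Integration.integral_cong[OF refl]) (simp add: th)
  finally have "coeff \<sigma> \<theta> w z - (p \<bullet> z + q) = (LINT y|?F. (a \<bullet> y + c) * (t y - (p \<bullet> y + q)))"
    unfolding right_diff_distrib exact[symmetric] by (subst Bochner_Integration.integral_diff) (auto intro: square_integrable_mult ths ts Ps)
  then have "X \<le> N * l2_norm ?F (\<lambda>x. t x - (p \<bullet> x + q))"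
    unfolding X_def N_def using l2_Cauchy_Schwarz[OF ths square_integrable_diff[OF ts Ps]] by simp
  also have "\<dots> \<le> N * (At * (?M * S))" by (rule mult_left_mono[OF tb]) (simp add: N_def)
  finally have X: "X \<le> N * (At * (?M * S))" .
  \<comment> \<open>This length replaces the diameter of \<open>T'\<close>: a ball of this radius
    about the facet centre bounds the face area from below, and the slope of the opposite coordinate
    is at most \<open>1 / (n * r)\<close>.\<close>
  define r where "r = diameter T' / (\<kappa> * ?n)"
  have r: "r > 0" unfolding r_def using h' k n by (intro divide_pos_pos mult_pos_pos) auto
  have rr: "diameter T' = \<kappa> * ?n * r" unfolding r_def using k n by simp
  have rad: "r * norm (ga T' u) \<le> 1 / ?n" if "u \<in> verts T'" for u
  proof -
    have "\<kappa> * (?n * (r * norm (ga T' u))) \<le> \<kappa> * 1" using grad_bound[OF T'(1) that] unfolding rr by (simp add: mult_ac)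
    then have "?n * (r * norm (ga T' u)) \<le> 1" by (rule mult_left_le_imp_le) (use k in simp)
    then show ?thesis using n by (simp add: le_divide_eq mult.commute)
  qed
  have "?\<omega> * r ^ DIM('a) \<le> 2 * r * mF"
    using B.facet_measure_ge[OF v(1) r rad] r by (simp add: content_ball mF_def)
  then have mr: "vol T \<le> 2 * r * mF * (?M * \<kappa> * ?n) ^ DIM('a)"
  proof -
    assume m: "?\<omega> * r ^ DIM('a) \<le> 2 * r * mF"
    have "vol T \<le> ?\<omega> * diameter T ^ DIM('a)" by (rule elem_measure_le[OF T(1)])
    also have "\<dots> \<le> ?\<omega> * (?M * diameter T') ^ DIM('a)"
      using patch_elem_size(2)[OF T(1) pe] h by (intro mult_left_mono power_mono) auto
    also have "\<dots> = ?\<omega> * r ^ DIM('a) * (?M * \<kappa> * ?n) ^ DIM('a)" unfolding rr by (simp only: power_mult_distrib mult_ac)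
    also have "\<dots> \<le> 2 * r * mF * (?M * \<kappa> * ?n) ^ DIM('a)" using m M k by (intro mult_right_mono) auto
    finally show ?thesis .
  qed
  have X0: "X \<ge> 0" by (simp add: X_def)
  have "X\<^sup>2 * vol T \<le> (N * (At * (?M * S)))\<^sup>2 * (2 * r * mF * (?M * \<kappa> * ?n) ^ DIM('a))"
    using X X0 mr by (intro mult_mono power_mono) auto
  also have "\<dots> = (N\<^sup>2 * mF) * (At\<^sup>2 * r) * (2 * (?M\<^sup>2 * S\<^sup>2 * (?M * \<kappa> * ?n) ^ DIM('a)))" by (simp only: power_mult_distrib mult_ac)
  also have "\<dots> \<le> K * (2 * ?n) * (2 * (?M\<^sup>2 * S\<^sup>2 * (?M * \<kappa> * ?n) ^ DIM('a)))"
  proof (rule mult_right_mono, rule mult_mono[OF N])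
    have "At\<^sup>2 * r = 2 * ?n\<^sup>2 * (r * norm (ga T' v))" by (simp add: At_def mult_ac)
    also have "\<dots> \<le> 2 * ?n\<^sup>2 * (1 / ?n)" by (intro mult_left_mono rad[OF v(1)]) simp
    also have "\<dots> = 2 * ?n" using n by (simp add: power2_eq_square)
    finally show "At\<^sup>2 * r \<le> 2 * ?n" .
  qed (use r k M in \<open>auto simp: K_def\<close>)
  also have "\<dots> = (4 * K * ?n * ?M\<^sup>2 * (?M * \<kappa> * ?n) ^ DIM('a)) * S\<^sup>2" by simp
  finally have "sqrt (X\<^sup>2 * vol T) \<le> sqrt ((4 * K * ?n * ?M\<^sup>2 * (?M * \<kappa> * ?n) ^ DIM('a)) * S\<^sup>2)" by (rule real_sqrt_le_mono)
  then have "X * sqrt (vol T) \<le> sqrt (4 * K * ?n * ?M\<^sup>2 * (?M * \<kappa> * ?n) ^ DIM('a)) * S"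
    using X0 S0 by (simp only: real_sqrt_mult[of "X\<^sup>2"] real_sqrt_mult[of _ "S\<^sup>2"] real_sqrt_abs abs_of_nonneg)
  then show ?thesis unfolding X_def K_def S_def A_def G_def .
qed

end

subsection \<open>The interpolation estimate\<close>

lemma grad_norm_const:
  assumes "K \<in> sets lebesgue"
  shows "grad_norm K (\<lambda>b x. S \<bullet> b) = norm S * sqrt (vol K)"
proof -
  have "(\<Sum>b\<in>Basis. (L2 K (\<lambda>x. S \<bullet> b))\<^sup>2) = (\<Sum>b\<in>Basis. (S \<bullet> b)\<^sup>2) * vol K"
    using assms by (simp add: l2_norm_const measure_restrict_space power_mult_distrib sum_distrib_right)
  also have "(\<Sum>b\<in>Basis. (S \<bullet> b)\<^sup>2) = (norm S)\<^sup>2"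
    unfolding power2_norm_eq_inner euclidean_inner[of S S] by (simp add: power2_eq_square)
  finally show ?thesis by (simp add: grad_norm_def real_sqrt_mult)
qed

text \<open>The leading 1 stands for \<open>w\<close> minus its affine approximant. The nodal part
  enters with weight 1 in the mean square and \<open>\<kappa>\<close> in the gradient, for n + 1
  vertices with the interior and the boundary nodal bounds added. The last line is the affine
  approximation on the patch.\<close>

definition clement_const :: "real \<Rightarrow> nat \<Rightarrow> real" where
  "clement_const \<kappa> n = (1 + (1 + \<kappa>) * (real n + 1) * ((real n + 1) +
      sqrt (4 * (8 * 2 ^ n + 2) * real n * (mesh_M \<kappa> n)\<^sup>2 * (mesh_M \<kappa> n * \<kappa> * real n) ^ n))) *
     ((1 + patch_const \<kappa> n) * osc_const \<kappa> n)"

context mesh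
begin

text \<open>An element and its interior differ by a null set. If the square is not integrable on
  \<open>T\<close>, the left side is zero by the convention for integrals, and the inequality is
  immediate.\<close>

lemma l2_norm_elem_le:
  assumes T: "T \<in> \<T>"
  shows "L2 T f \<le> L2 (interior T) f"
proof (cases "integrable (lebesgue_on T) (\<lambda>x. (f x)\<^sup>2)")
  case True
  note E = elem_facts[OF T]
  have i: "integrable (lebesgue_on (interior T)) (\<lambda>x. (f x)\<^sup>2)"
    by (rule lebesgue_on_integrable_subset[OF True interior_subset E(7) E(12)])
  have "AE x in lebesgue. x \<notin> T - interior T" using E(5) by (simp only: negligible_iff_null_sets AE_not_in)
  then have "AE x in lebesgue. indicator T x * (f x)\<^sup>2 = indicator (interior T) x * (f x)\<^sup>2"
    by eventually_elim (use interior_subset[of T] in \<open>auto simp: indicator_def\<close>)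
  then have "(LINT x|lebesgue_on T. (f x)\<^sup>2) = (LINT x|lebesgue_on (interior T). (f x)\<^sup>2)"
    unfolding lebesgue_on_integral_eq[OF E(7)] lebesgue_on_integral_eq[OF E(12)]
    using True i E by (intro integral_cong_AE borel_measurable_integrable) (simp_all add: lebesgue_on_integrable_iff)
  then show ?thesis by (simp add: l2_norm_def)
next
  case False
  then show ?thesis unfolding l2_norm_def[of "lebesgue_on T"] by (simp add: not_integrable_integral_eq)
qed

lemma mesh_verts_split: "interior_verts \<Omega> \<T> \<union> boundary_verts \<Omega> \<T> = mesh_verts \<T>"
  using mesh_verts_closure dom_facts(1) by (auto simp: interior_verts_def boundary_verts_def frontier_def interior_open)

lemma clement_local:
  assumes T: "T \<in> \<T>" and x: "x \<in> T"
  shows "interp \<sigma> \<theta> w x = (\<Sum>z\<in>verts T. coeff \<sigma> \<theta> w z * (ga T z \<bullet> x + gc T z))"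
proof -
  have "interp \<sigma> \<theta> w x = (\<Sum>z\<in>verts T. coeff \<sigma> \<theta> w z * \<phi> z x)"
    unfolding clement_def mesh_verts_split
    by (rule sum.mono_neutral_right[OF finite_mesh_verts]) (use verts_mesh[OF T] phi_outside[OF T _ _ x] in auto)
  also have "\<dots> = (\<Sum>z\<in>verts T. coeff \<sigma> \<theta> w z * (ga T z \<bullet> x + gc T z))"
    by (rule sum.cong[OF refl]) (simp add: lam_phi[OF T verts_mesh[OF T] x])
  finally show ?thesis .
qed

theorem clement_estimate:
  assumes SZ: "scott_zhang_data \<Omega> \<T> \<phi> \<sigma> \<theta>" and T: "T \<in> \<T>" and s: "0 \<le> s" "s \<le> 1" and w: "w \<in> H1s s (patch T)"
  shows "L2 T (\<lambda>x. w x - interp \<sigma> \<theta> w x)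
      + diameter T * h1_seminorm (interior T) (\<lambda>x. w x - interp \<sigma> \<theta> w x)
    \<le> clement_const \<kappa> DIM('a) * diameter T powr (1 + s) * H1s_seminorm s (patch T) w"
proof -
  let ?D = "patch T" and ?h = "diameter T" and ?n = "real DIM('a)" and ?M = "mesh_M \<kappa> DIM('a)" and ?I = "interior T"
  let ?LI = "lebesgue_on (interior T)"
  note E = elem_facts[OF T]
  interpret B: bary_simplex "verts T" "ga T" "gc T" by (rule bary[OF T])
  have h: "?h > 0" and k: "\<kappa> \<ge> 1" by (rule diam_pos[OF T] kappa_ge_1[OF T])+
  have wsq: "inL2 ?D w" using w by (simp add: H1s_def)
  obtain p q g where g: "\<And>b. b \<in> Basis \<Longrightarrow> has_weak_partial ?D b w (g b)" "\<And>b. b \<in> Basis \<Longrightarrow> inL2 ?D (g b)"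
    and A: "L2 ?D (\<lambda>x. w x - (p \<bullet> x + q)) \<le> patch_const \<kappa> DIM('a) * ?h * grad_norm ?D (\<lambda>b x. g b x - p \<bullet> b)"
    and G: "grad_norm ?D (\<lambda>b x. g b x - p \<bullet> b) \<le> osc_const \<kappa> DIM('a) * ?h powr s * H1s_seminorm s ?D w"
    using patch_affine_approximation[OF T s w] by blast
  define A where "A = L2 ?D (\<lambda>x. w x - (p \<bullet> x + q))"
  define G where "G = grad_norm ?D (\<lambda>b x. g b x - p \<bullet> b)"
  define m where "m = sqrt (vol T)"
  define c where "c z = coeff \<sigma> \<theta> w z - (p \<bullet> z + q)" for z
  define C2 where "C2 = sqrt (4 * (8 * 2 ^ DIM('a) + 2) * ?n * ?M\<^sup>2 * (?M * \<kappa> * ?n) ^ DIM('a))"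
  have A0: "A \<ge> 0" and G0: "G \<ge> 0" unfolding A_def G_def by (simp, rule grad_norm_nonneg)
  have C20: "C2 \<ge> 0" unfolding C2_def using k mesh_M_ge_1[OF T] by (intro real_sqrt_ge_zero mult_nonneg_nonneg zero_le_power) auto
  have c: "\<bar>c z\<bar> * m \<le> (?n + 1 + C2) * (A + ?h * G)" if z: "z \<in> verts T" for z
  proof (cases "z \<in> interior_verts \<Omega> \<T>")
    case True
    have "\<bar>c z\<bar> * m \<le> (?n + 1) * A" unfolding c_def m_def A_def by (rule interior_coeff[OF T z True wsq])
    also have "\<dots> \<le> (?n + 1 + C2) * (A + ?h * G)" using A0 G0 h C20 by (intro mult_mono) auto
    finally show ?thesis .
  next
    case False
    have "\<bar>c z\<bar> * m \<le> C2 * (A + ?h * G)" unfolding c_def m_def A_def G_def C2_def by (rule boundary_coeff[OF SZ T z False wsq g])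
    also have "\<dots> \<le> (?n + 1 + C2) * (A + ?h * G)" using A0 G0 h by (intro mult_right_mono) auto
    finally show ?thesis .
  qed
  define Z where "Z = (\<Sum>z\<in>verts T. \<bar>c z\<bar> * m)"
  have Z: "Z \<le> (?n + 1) * ((?n + 1 + C2) * (A + ?h * G))"
  proof -
    have "Z \<le> (\<Sum>z\<in>verts T. (?n + 1 + C2) * (A + ?h * G))" unfolding Z_def by (rule sum_mono[OF c])
    then show ?thesis using B.card_C by (simp add: add.commute)
  qed
  \<comment> \<open>On \<open>T\<close> the nodal part is affine with gradient \<open>S\<close> and
    constant term \<open>k0\<close>, so its gradient norm is \<open>norm S\<close> times the root of
    the volume.\<close>
  define S where "S = (\<Sum>z\<in>verts T. c z *\<^sub>R ga T z)"
  define k0 where "k0 = (\<Sum>z\<in>verts T. c z * gc T z)"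
  have Sk: "(\<Sum>z\<in>verts T. c z * B.lam z x) = S \<bullet> x + k0" for x
    by (simp add: S_def k0_def B.lam_def inner_sum_left distrib_left sum.distrib)
  have eq: "w x - interp \<sigma> \<theta> w x = (w x - (p \<bullet> x + q)) - (\<Sum>z\<in>verts T. c z * B.lam z x)" if "x \<in> T" for x
  proof -
    have "(\<Sum>z\<in>verts T. c z * B.lam z x) = interp \<sigma> \<theta> w x - (\<Sum>z\<in>verts T. B.lam z x * (p \<bullet> z + q))"
      unfolding clement_local[OF T that] unfolding c_def B.lam_def left_diff_distrib sum_subtractf by (simp add: mult.commute)
    then show ?thesis using B.affine_repr[of p x q] by simp
  qed
  have ID: "?I \<subseteq> ?D" by (rule patch_elems_interior[OF self_patch_elem[OF T]])
  have fin: "finite_measure ?LI" by (rule finite_measure_bounded_lebesgue_on[OF E(10) E(12)])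
  have finD: "finite_measure (lebesgue_on ?D)" by (rule finite_measure_bounded_lebesgue_on[OF bounded_element_patch element_patch_lebesgue])
  have wD: "inL2 ?D (\<lambda>x. w x - (p \<bullet> x + q))"
    by (intro square_integrable_diff wsq continuous_square_integrable continuous_affine bounded_element_patch element_patch_lebesgue)
  have gD: "inL2 ?D (\<lambda>x. g b x - p \<bullet> b)" if "b \<in> Basis" for b
    by (intro square_integrable_diff g(2) that square_integrable_const finD)
  have mI: "sqrt (vol ?I) \<le> m"
    unfolding m_def using elem_lmeasurable[OF T] interior_subset E(12) by (intro real_sqrt_le_mono measure_mono_fmeasurable) auto
  have lam_s: "square_integrable ?LI (B.lam z)" for z by (rule continuous_square_integrable[OF B.lam_continuous E(10) E(12)])
  have lam_n: "l2_norm ?LI (B.lam z) \<le> m" if z: "z \<in> verts T" for z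
  proof -
    have "l2_norm ?LI (B.lam z) \<le> 1 * sqrt (measure ?LI (space ?LI))"
    proof (rule l2_norm_bounded[OF fin])
      show "B.lam z \<in> borel_measurable ?LI" using lam_s by (simp add: square_integrable_def)
      fix x assume "x \<in> space ?LI"
      then have x: "x \<in> B.T" using interior_subset[of T] T_eq[OF T] by auto
      then have "0 \<le> B.lam z x" using z unfolding B.T_eq by blast
      then show "\<bar>B.lam z x\<bar> \<le> 1" using B.lam_le_1[OF x z] by simp
    qed
    also have "\<dots> = sqrt (vol ?I)" using E(12) by (simp add: measure_restrict_space)
    finally show ?thesis using mI by linarith
  qed
  have lower: "L2 T (\<lambda>x. w x - interp \<sigma> \<theta> w x) \<le> A + Z"
  proof -
    have "L2 T (\<lambda>x. w x - interp \<sigma> \<theta> w x) \<le> l2_norm ?LI (\<lambda>x. w x - interp \<sigma> \<theta> w x)"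
      by (rule l2_norm_elem_le[OF T])
    also have "\<dots> = l2_norm ?LI (\<lambda>x. (w x - (p \<bullet> x + q)) - (\<Sum>z\<in>verts T. c z * B.lam z x))"
    proof -
      have "(LINT x|?LI. (w x - interp \<sigma> \<theta> w x)\<^sup>2) = (LINT x|?LI. ((w x - (p \<bullet> x + q)) - (\<Sum>z\<in>verts T. c z * B.lam z x))\<^sup>2)"
      proof (rule Bochner_Integration.integral_cong[OF refl])
        fix x assume "x \<in> space ?LI"
        then have "x \<in> T" using interior_subset[of T] by auto
        then show "(w x - interp \<sigma> \<theta> w x)\<^sup>2 = ((w x - (p \<bullet> x + q)) - (\<Sum>z\<in>verts T. c z * B.lam z x))\<^sup>2" by (simp only: eq)
      qed
      then show ?thesis by (simp only: l2_norm_def)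
    qed
    also have "\<dots> \<le> l2_norm ?LI (\<lambda>x. w x - (p \<bullet> x + q)) + l2_norm ?LI (\<lambda>x. \<Sum>z\<in>verts T. c z * B.lam z x)"
      by (intro l2_norm_triangle_diff square_integrable_subset[OF wD ID element_patch_lebesgue E(12)] square_integrable_sum square_integrable_cmult lam_s)
    also have "\<dots> \<le> A + Z"
    proof (rule add_mono)
      show "l2_norm ?LI (\<lambda>x. w x - (p \<bullet> x + q)) \<le> A" unfolding A_def by (rule l2_norm_subset[OF wD ID element_patch_lebesgue E(12)])
      have "l2_norm ?LI (\<lambda>x. \<Sum>z\<in>verts T. c z * B.lam z x) \<le> (\<Sum>z\<in>verts T. l2_norm ?LI (\<lambda>x. c z * B.lam z x))"
        by (intro l2_norm_triangle_sum E(8) square_integrable_cmult lam_s)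
      also have "\<dots> \<le> Z" unfolding Z_def l2_norm_cmult by (intro sum_mono mult_left_mono lam_n) auto
      finally show "l2_norm ?LI (\<lambda>x. \<Sum>z\<in>verts T. c z * B.lam z x) \<le> Z" .
    qed
    finally show ?thesis .
  qed
  have "?h * h1_seminorm ?I (\<lambda>x. w x - interp \<sigma> \<theta> w x) \<le> ?h * G + \<kappa> * Z"
  proof -
    have wp: "has_weak_partial ?I b (\<lambda>x. w x - interp \<sigma> \<theta> w x) (\<lambda>x. (g b x - p \<bullet> b) + (- S) \<bullet> b)" if b: "b \<in> Basis" for b
    proof (rule has_weak_partial_cong[OF _ _ E(12)])
      have "has_weak_partial ?I b (\<lambda>x. (w x - (p \<bullet> x + q)) - (S \<bullet> x + k0)) (\<lambda>x. (g b x - p \<bullet> b) - S \<bullet> b)"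
        by (intro has_weak_partial_diff has_weak_partial_affine open_interior has_weak_partial_subset[OF g(1)[OF b] open_element_patch open_interior ID])
      then show "has_weak_partial ?I b (\<lambda>x. (w x - (p \<bullet> x + q)) - (S \<bullet> x + k0)) (\<lambda>x. (g b x - p \<bullet> b) + (- S) \<bullet> b)" by simp
      show "w x - interp \<sigma> \<theta> w x = (w x - (p \<bullet> x + q)) - (S \<bullet> x + k0)" if "x \<in> ?I" for x
        using eq[of x] that interior_subset[of T] by (auto simp only: Sk)
    qed
    have "h1_seminorm ?I (\<lambda>x. w x - interp \<sigma> \<theta> w x) = grad_norm ?I (\<lambda>b x. (g b x - p \<bullet> b) + (- S) \<bullet> b)"
      unfolding grad_norm_def by (rule h1_seminorm_eq[OF open_interior wp])
    also have "\<dots> \<le> grad_norm ?I (\<lambda>b x. g b x - p \<bullet> b) + grad_norm ?I (\<lambda>b x. (- S) \<bullet> b)"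
      by (intro grad_norm_triangle square_integrable_subset[OF gD ID element_patch_lebesgue E(12)] square_integrable_const fin)
    also have "\<dots> \<le> G + norm S * m"
    proof (rule add_mono)
      show "grad_norm ?I (\<lambda>b x. g b x - p \<bullet> b) \<le> G" unfolding G_def by (rule grad_norm_subset[OF gD ID element_patch_lebesgue E(12)])
      show "grad_norm ?I (\<lambda>b x. (- S) \<bullet> b) \<le> norm S * m"
        unfolding grad_norm_const[OF E(12)] norm_minus_cancel by (intro mult_left_mono mI) simp
    qed
    finally have "?h * h1_seminorm ?I (\<lambda>x. w x - interp \<sigma> \<theta> w x) \<le> ?h * (G + norm S * m)"
      using h by (intro mult_left_mono) auto
    also have "\<dots> = ?h * G + ?h * norm S * m" by (simp add: distrib_left)
    \<comment> \<open>The gradient of a basis function is at most \<open>\<kappa>\<close> over the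
      diameter, which cancels the weight of the gradient term.\<close>
    also have "?h * norm S * m \<le> \<kappa> * Z"
    proof -
      have m0: "m \<ge> 0" by (simp add: m_def)
      have "norm S \<le> (\<Sum>z\<in>verts T. \<bar>c z\<bar> * norm (ga T z))" unfolding S_def by (rule sum_norm_le) simp
      then have "?h * norm S * m \<le> ?h * (\<Sum>z\<in>verts T. \<bar>c z\<bar> * norm (ga T z)) * m" using h m0 by (intro mult_right_mono mult_left_mono) auto
      also have "\<dots> = (\<Sum>z\<in>verts T. (\<bar>c z\<bar> * m) * (?h * norm (ga T z)))" by (simp add: sum_distrib_left sum_distrib_right mult_ac)
      also have "\<dots> \<le> (\<Sum>z\<in>verts T. (\<bar>c z\<bar> * m) * \<kappa>)" using m0 by (intro sum_mono mult_left_mono grad_bound[OF T]) auto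
      also have "\<dots> = \<kappa> * Z" by (simp add: Z_def sum_distrib_left mult_ac)
      finally show ?thesis .
    qed
    finally show ?thesis by simp
  qed
  with lower have "L2 T (\<lambda>x. w x - interp \<sigma> \<theta> w x) + ?h * h1_seminorm ?I (\<lambda>x. w x - interp \<sigma> \<theta> w x)
      \<le> (A + ?h * G) + (1 + \<kappa>) * Z" by (simp add: distrib_right)
  also have "\<dots> \<le> (A + ?h * G) + (1 + \<kappa>) * ((?n + 1) * ((?n + 1 + C2) * (A + ?h * G)))"
    using Z k by (intro add_left_mono mult_left_mono) auto
  also have "\<dots> = (1 + (1 + \<kappa>) * (?n + 1) * (?n + 1 + C2)) * (A + ?h * G)" by (simp add: distrib_right mult.assoc)
  also have "\<dots> \<le> (1 + (1 + \<kappa>) * (?n + 1) * (?n + 1 + C2)) * ((1 + patch_const \<kappa> DIM('a)) * osc_const \<kappa> DIM('a) * (?h powr (1 + s) * H1s_seminorm s ?D w))"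
  proof (rule mult_left_mono)
    have pc: "patch_const \<kappa> DIM('a) \<ge> 0" by (rule patch_const_nonneg[OF T])
    have "A + ?h * G \<le> (1 + patch_const \<kappa> DIM('a)) * ?h * G" using A unfolding A_def[symmetric] G_def[symmetric] by (simp add: algebra_simps)
    also have "\<dots> \<le> (1 + patch_const \<kappa> DIM('a)) * ?h * (osc_const \<kappa> DIM('a) * ?h powr s * H1s_seminorm s ?D w)"
      using G pc h unfolding G_def[symmetric] by (intro mult_left_mono) auto
    also have "\<dots> = (1 + patch_const \<kappa> DIM('a)) * osc_const \<kappa> DIM('a) * (?h powr (1 + s) * H1s_seminorm s ?D w)"
      using h by (simp add: powr_add mult_ac)
    finally show "A + ?h * G \<le> (1 + patch_const \<kappa> DIM('a)) * osc_const \<kappa> DIM('a) * (?h powr (1 + s) * H1s_seminorm s ?D w)" .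
    show "0 \<le> 1 + (1 + \<kappa>) * (?n + 1) * (?n + 1 + C2)" using k C20 by (intro add_nonneg_nonneg mult_nonneg_nonneg) auto
  qed
  also have "\<dots> = clement_const \<kappa> DIM('a) * ?h powr (1 + s) * H1s_seminorm s ?D w" by (simp only: clement_const_def C2_def mult.assoc)
  finally show ?thesis .
qed

end

theorem lemma4p3:
  fixes \<Omega> :: "(real ^ 'n) set" and \<kappa> :: real
  assumes "CARD('n) \<in> {1, 2, 3}"
    and "polyhedral_domain \<Omega>"
  shows "\<exists>c::real. \<forall>\<T> \<phi> \<sigma> \<theta>.
    conforming_mesh \<Omega> \<T> \<and> shape_regular \<kappa> \<T> \<and> locally_symmetric \<Omega> \<T> \<and>
    nodal_basis \<T> \<phi> \<and> scott_zhang_data \<Omega> \<T> \<phi> \<sigma> \<theta> \<longrightarrow>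
    (\<forall>T\<in>\<T>. \<forall>s\<in>{0..1}. \<forall>w\<in>H1s s (element_patch \<T> T).
       l2_norm (lebesgue_on T) (\<lambda>x. w x - clement \<Omega> \<T> \<phi> \<sigma> \<theta> w x)
         + diameter T * h1_seminorm (interior T) (\<lambda>x. w x - clement \<Omega> \<T> \<phi> \<sigma> \<theta> w x)
       \<le> c * diameter T powr (1 + s) * H1s_seminorm s (element_patch \<T> T) w)"
\<comment> \<open>The witness is built from \<open>\<kappa>\<close> and the dimension alone, so one
  constant serves all meshes, elements, exponents and functions.\<close>
proof (intro exI[of _ "clement_const \<kappa> DIM(real ^ 'n)"] allI impI ballI)
  fix \<T> \<phi> \<sigma> \<theta> T s w
  assume M: "conforming_mesh \<Omega> \<T> \<and> shape_regular \<kappa> \<T> \<and> locally_symmetric \<Omega> \<T> \<and> nodal_basis \<T> \<phi> \<and> scott_zhang_data \<Omega> \<T> \<phi> \<sigma> \<theta>"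
    and T: "T \<in> \<T>" and s: "s \<in> {0..1::real}" and w: "w \<in> H1s s (element_patch \<T> T)"
  interpret mesh \<Omega> \<kappa> \<T> \<phi> by unfold_locales (use M assms(2) in auto)
  show "l2_norm (lebesgue_on T) (\<lambda>x. w x - clement \<Omega> \<T> \<phi> \<sigma> \<theta> w x)
         + diameter T * h1_seminorm (interior T) (\<lambda>x. w x - clement \<Omega> \<T> \<phi> \<sigma> \<theta> w x)
       \<le> clement_const \<kappa> DIM(real ^ 'n) * diameter T powr (1 + s) * H1s_seminorm s (element_patch \<T> T) w"
    using M s by (intro clement_estimate[OF _ T _ _ w]) auto
qed

end
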